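(* Let $\Omega\subset\mathbb{R}^n$ be an open set. A function $u$ is $(s,p)$-harmonic in $\Omega$ if and only if $u$ is a continuous weak solution in $\Omega$.
   Context: Standing assumptions: $n\ge1$ is an integer, $s\in(0,1)$, $p\in(1,\infty)$, $\Lambda\ge1$, and $K:\mathbb{R}^n\times\mathbb{R}^n\to[0,\infty)$ is a measurable symmetric kernel ($K(x,y)=K(y,x)$) with $\Lambda^{-1}\le K(x,y)|x-y|^{n+sp}\le\Lambda$ for a.e. $x,y\in\mathbb{R}^n$. Functions are measurable; $D\Subset\Omega$ means that $\overline D$ is a compact subset of $\Omega$; $u_\pm:=\max\{\pm u,0\}$. $W^{s,p}(U)$ consists of $v\in L^p(U)$ with $\int_U\int_U\frac{|v(x)-v(y)|^p}{|x-y|^{n+sp}}\,dx\,dy<\infty$; $v\in W^{s,p}_{\rm loc}(\Omega)$ means $v\in W^{s,p}(D)$ for every open $D\Subset\Omega$. The tail space is $L^{p-1}_{sp}(\mathbb{R}^n):=\{f\in L^{p-1}_{\rm loc}(\mathbb{R}^n):\int_{\mathbb{R}^n}|f(x)|^{p-1}(1+|x|)^{-n-sp}\,dx<\infty\}$. A weak supersolution in an open set $\Omega$ is a function $u$ on $\mathbb{R}^n$ with $u\in W^{s,p}_{\rm loc}(\Omega)$, $u_-\in L^{p-1}_{sp}(\mathbb{R}^n)$, and $$\int_{\mathbb{R}^n}\int_{\mathbb{R}^n}|u(x)-u(y)|^{p-2}(u(x)-u(y))(\eta(x)-\eta(y))K(x,y)\,dx\,dy\ge0$$ for every nonnegative $\eta\in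 C_0^\infty(\Omega)$. $u$ is a weak subsolution if $-u$ is a weak supersolution, and a weak solution if it is both. A continuous weak solution in $\Omega$ is a weak solution in $\Omega$ that is continuous and finite-valued in $\Omega$. "$v\in C(\overline D)$ is a weak solution in $D$" means that $v$, defined on $\mathbb{R}^n$, is a weak solution in $D$ whose restriction to $\overline D$ is continuous (and finite). A function $u:\mathbb{R}^n\to[-\infty,\infty]$ is $(s,p)$-superharmonic in an open set $\Omega$ if: (a) $u<+\infty$ almost everywhere in $\Omega$ and $u>-\infty$ everywhere in $\Omega$; (b) $u$ is lower semicontinuous in $\Omega$; (c) if $D\Subset\Omega$ is open and $v\in C(\overline D)$ is a weak solution in $D$ such that $v_+\in L^\infty(\mathbb{R}^n)$ and $u\ge v$ on $\partial D$ and almost everywhere on $\mathbb{R}^n\setminus D$, then $u\ge v$ in $D$; (d) $u_-\in L^{p-1}_{sp}(\mathbb{R}^n)$. $u$ is $(s,p)$-harmonic in $\Omega$ if both $u$ and $-u$ are $(s,p)$-superharmonic in $\Omega$. *)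

theory Defs
  imports "HOL-Analysis.Analysis"
begin

text \<open>
  \<open>\<real>\<^sup>n\<close> is an arbitrary type of class \<^class>\<open>euclidean_space\<close> with \<open>n = DIM('a) \<ge> 1\<close>.
  Functions on it take values in \<open>[-\<infinity>, \<infinity>]\<close>, and "measurable" and "almost everywhere"
  refer to Lebesgue measure, on \<open>\<real>\<^sup>n\<close> and on \<open>\<real>\<^sup>n \<times> \<real>\<^sup>n\<close> alike.
\<close>

definition compactly_contained :: "'a::euclidean_space set \<Rightarrow> 'a set \<Rightarrow> bool"
    (infix \<open>\<Subset>\<close> 50)
  where "D \<Subset> \<Omega> \<longleftrightarrow> compact (closure D) \<and> closure D \<subseteq> \<Omega>"

definition pos_part :: "('a \<Rightarrow> ereal) \<Rightarrow> 'a \<Rightarrow> ereal"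
  where "pos_part u x = max (u x) 0"

definition neg_part :: "('a \<Rightarrow> ereal) \<Rightarrow> 'a \<Rightarrow> ereal"
  where "neg_part u x = max (- u x) 0"

text \<open>\<open>|t|\<^sup>r\<close> for exponents \<open>r > 0\<close>, with \<open>|\<plusminus>\<infinity>|\<^sup>r = \<infinity>\<close>.\<close>
definition abs_pow :: "ereal \<Rightarrow> real \<Rightarrow> ennreal"
  where "abs_pow t r = (if \<bar>t\<bar> = \<infinity> then \<infinity> else ennreal (\<bar>real_of_ereal t\<bar> powr r))"

definition tail_space :: "real \<Rightarrow> real \<Rightarrow> ('a::euclidean_space \<Rightarrow> ereal) set"
  where "tail_space s p = {f.
    f \<in> borel_measurable lebesgue \<and>
    (\<forall>C. compact C \<longrightarrow> (\<integral>\<^sup>+x\<in>C. abs_pow (f x) (p - 1) \<partial>lebesgue) < \<infinity>) \<and>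
    (\<integral>\<^sup>+x. abs_pow (f x) (p - 1) *
        ennreal ((1 + norm x) powr (- real DIM('a) - s * p)) \<partial>lebesgue) < \<infinity>}"

text \<open>The quotient in the Gagliardo seminorm has the value \<open>0\<close> on the (null) diagonal.\<close>
definition frac_sobolev ::
    "real \<Rightarrow> real \<Rightarrow> 'a::euclidean_space set \<Rightarrow> ('a \<Rightarrow> ereal) set"
  where "frac_sobolev s p U = {v.
    v \<in> borel_measurable (lebesgue_on U) \<and>
    (\<integral>\<^sup>+x\<in>U. abs_pow (v x) p \<partial>lebesgue) < \<infinity> \<and>
    (\<integral>\<^sup>+(x, y)\<in>U \<times> U. abs_pow (v x - v y) p /
        ennreal (norm (x - y) powr (real DIM('a) + s * p)) \<partial>lebesgue) < \<infinity>}"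

definition frac_sobolev_loc ::
    "real \<Rightarrow> real \<Rightarrow> 'a::euclidean_space set \<Rightarrow> ('a \<Rightarrow> ereal) set"
  where "frac_sobolev_loc s p \<Omega> =
    {v. \<forall>D. open D \<longrightarrow> D \<Subset> \<Omega> \<longrightarrow> v \<in> frac_sobolev s p D}"

definition admissible_kernel ::
    "real \<Rightarrow> real \<Rightarrow> real \<Rightarrow> ('a::euclidean_space \<Rightarrow> 'a \<Rightarrow> real) \<Rightarrow> bool"
  where "admissible_kernel s p \<Lambda> K \<longleftrightarrow>
    (\<lambda>(x, y). K x y) \<in> borel_measurable lebesgue \<and>
    (\<forall>x y. 0 \<le> K x y) \<and>
    (\<forall>x y. K x y = K y x) \<and>
    (AE (x, y) in lebesgue.
        1 / \<Lambda> \<le> K x y * norm (x - y) powr (real DIM('a) + s * p) \<and>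
        K x y * norm (x - y) powr (real DIM('a) + s * p) \<le> \<Lambda>)"

fun C_k :: "nat \<Rightarrow> ('a::euclidean_space \<Rightarrow> real) \<Rightarrow> bool"
  where
    "C_k 0 f \<longleftrightarrow> continuous_on UNIV f"
  | "C_k (Suc k) f \<longleftrightarrow> (\<forall>x. f differentiable (at x)) \<and>
       (\<forall>b\<in>Basis. C_k k (\<lambda>x. frechet_derivative f (at x) b))"

definition test_functions :: "'a::euclidean_space set \<Rightarrow> ('a \<Rightarrow> real) set"
  where "test_functions \<Omega> = {\<eta>. (\<forall>k. C_k k \<eta>) \<and> {x. \<eta> x \<noteq> 0} \<Subset> \<Omega>}"

text \<open>\<open>|t|\<^sup>p\<^sup>-\<^sup>2 t\<close>, extended by \<open>\<plusminus>\<infinity> \<mapsto> \<plusminus>\<infinity>\<close>.\<close>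
definition signed_pow :: "real \<Rightarrow> ereal \<Rightarrow> ereal"
  where "signed_pow p t =
    (if \<bar>t\<bar> = \<infinity> then t
     else ereal (\<bar>real_of_ereal t\<bar> powr (p - 2) * real_of_ereal t))"

text \<open>
  The integral of an extended real function exists in \<open>(-\<infinity>, \<infinity>]\<close> and is nonnegative.
  (The Bochner integral is not suitable here: it is \<open>0\<close> for non-integrable functions.)
\<close>
definition integral_nonneg :: "'a measure \<Rightarrow> ('a \<Rightarrow> ereal) \<Rightarrow> bool"
  where "integral_nonneg M F \<longleftrightarrow>
    F \<in> borel_measurable M \<and>
    (\<integral>\<^sup>+z. e2ennreal (- F z) \<partial>M) < \<infinity> \<and>
    (\<integral>\<^sup>+z. e2ennreal (- F z) \<partial>M) \<le> (\<integral>\<^sup>+z. e2ennreal (F z) \<partial>M)"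

text \<open>
  For \<open>u\<close> finite almost everywhere in \<open>\<Omega>\<close>, the value of \<open>u x - u y\<close> at two points where
  it has the form \<open>\<infinity> - \<infinity>\<close> is irrelevant: almost everywhere there
  \<open>\<eta> x = \<eta> y = 0\<close>, and \<open>\<plusminus>\<infinity> * 0 = 0\<close> in \<^typ>\<open>ereal\<close>.
\<close>
definition weak_supersolution ::
    "real \<Rightarrow> real \<Rightarrow> ('a::euclidean_space \<Rightarrow> 'a \<Rightarrow> real) \<Rightarrow> 'a set \<Rightarrow> ('a \<Rightarrow> ereal) \<Rightarrow> bool"
  where "weak_supersolution s p K \<Omega> u \<longleftrightarrow>
    u \<in> borel_measurable lebesgue \<and>
    u \<in> frac_sobolev_loc s p \<Omega> \<and>
    neg_part u \<in> tail_space s p \<and>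
    (\<forall>\<eta>\<in>test_functions \<Omega>. (\<forall>x. 0 \<le> \<eta> x) \<longrightarrow>
      integral_nonneg lebesgue
        (\<lambda>(x, y). signed_pow p (u x - u y) * ereal ((\<eta> x - \<eta> y) * K x y)))"

definition weak_subsolution ::
    "real \<Rightarrow> real \<Rightarrow> ('a::euclidean_space \<Rightarrow> 'a \<Rightarrow> real) \<Rightarrow> 'a set \<Rightarrow> ('a \<Rightarrow> ereal) \<Rightarrow> bool"
  where "weak_subsolution s p K \<Omega> u \<longleftrightarrow> weak_supersolution s p K \<Omega> (\<lambda>x. - u x)"

definition weak_solution ::
    "real \<Rightarrow> real \<Rightarrow> ('a::euclidean_space \<Rightarrow> 'a \<Rightarrow> real) \<Rightarrow> 'a set \<Rightarrow> ('a \<Rightarrow> ereal) \<Rightarrow> bool"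
  where "weak_solution s p K \<Omega> u \<longleftrightarrow>
    weak_supersolution s p K \<Omega> u \<and> weak_subsolution s p K \<Omega> u"

definition finite_continuous_on :: "'a::topological_space set \<Rightarrow> ('a \<Rightarrow> ereal) \<Rightarrow> bool"
  where "finite_continuous_on S u \<longleftrightarrow> continuous_on S u \<and> (\<forall>x\<in>S. \<bar>u x\<bar> \<noteq> \<infinity>)"

definition continuous_weak_solution ::
    "real \<Rightarrow> real \<Rightarrow> ('a::euclidean_space \<Rightarrow> 'a \<Rightarrow> real) \<Rightarrow> 'a set \<Rightarrow> ('a \<Rightarrow> ereal) \<Rightarrow> bool"
  where "continuous_weak_solution s p K \<Omega> u \<longleftrightarrow>
    weak_solution s p K \<Omega> u \<and> finite_continuous_on \<Omega> u"

definition lower_semicontinuous_on :: "'a::topological_space set \<Rightarrow> ('a \<Rightarrow> ereal) \<Rightarrow> bool"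
  where "lower_semicontinuous_on S u \<longleftrightarrow> (\<forall>x\<in>S. u x \<le> Liminf (at x within S) u)"

definition superharmonic ::
    "real \<Rightarrow> real \<Rightarrow> ('a::euclidean_space \<Rightarrow> 'a \<Rightarrow> real) \<Rightarrow> 'a set \<Rightarrow> ('a \<Rightarrow> ereal) \<Rightarrow> bool"
  where "superharmonic s p K \<Omega> u \<longleftrightarrow>
    u \<in> borel_measurable lebesgue \<and>
    (AE x in lebesgue. x \<in> \<Omega> \<longrightarrow> u x < \<infinity>) \<and>
    (\<forall>x\<in>\<Omega>. - \<infinity> < u x) \<and>
    lower_semicontinuous_on \<Omega> u \<and>
    (\<forall>D v. open D \<longrightarrow> D \<Subset> \<Omega> \<longrightarrow>
      weak_solution s p K D v \<longrightarrow>
      finite_continuous_on (closure D) v \<longrightarrow>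
      (\<exists>M::real. AE x in lebesgue. pos_part v x \<le> ereal M) \<longrightarrow>
      (\<forall>x\<in>frontier D. v x \<le> u x) \<longrightarrow>
      (AE x in lebesgue. x \<notin> D \<longrightarrow> v x \<le> u x) \<longrightarrow>
      (\<forall>x\<in>D. v x \<le> u x)) \<and>
    neg_part u \<in> tail_space s p"

definition harmonic ::
    "real \<Rightarrow> real \<Rightarrow> ('a::euclidean_space \<Rightarrow> 'a \<Rightarrow> real) \<Rightarrow> 'a set \<Rightarrow> ('a \<Rightarrow> ereal) \<Rightarrow> bool"
  where "harmonic s p K \<Omega> u \<longleftrightarrow>
    superharmonic s p K \<Omega> u \<and> superharmonic s p K \<Omega> (\<lambda>x. - u x)"

end

theory Submission
  imports Defs
begin

text \<open>
  After replacing functions and kernel by Borel representatives, both sides of the equivalence are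
  statements about the form \<open>\<integral> \<phi>(u(x) - u(y)) (\<eta>(x) - \<eta>(y)) K(x, y)\<close> with \<open>\<phi>(t) = |t|\<^sup>p\<^sup>-\<^sup>2 t\<close>.

  A continuous weak solution \<open>u\<close> is superharmonic by comparison: if \<open>v\<close> is a solution in \<open>D\<close> that
  exceeds \<open>u\<close> somewhere in \<open>D\<close> and lies below \<open>u\<close> outside, then \<open>(v - u - \<epsilon>)\<^sub>+\<close> is compactly supported
  in \<open>D\<close>, and its mollifications are admissible in both inequalities; strict monotonicity of \<open>\<phi>\<close> gives
  a contradiction.

  Conversely, a harmonic \<open>u\<close> is continuous, and it suffices that it is a supersolution. On a
  neighbourhood \<open>N\<close> of an open set \<open>D\<close> with the exterior ball property choose a Lipschitz function
  \<open>g\<close> within \<open>\<delta>\<close> below \<open>u\<close>, continue it by a truncation of \<open>u\<close>, and minimize the energy among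
  the functions that lie above \<open>g\<close> and agree with it outside \<open>D\<close>. De Giorgi's oscillation lemma,
  applied in the interior and at the boundary, makes the minimizer \<open>V\<close> continuous. Where \<open>V > g\<close> it is
  a weak solution, so the comparison property (c) gives \<open>g \<le> V \<le> u\<close>; as \<open>V\<close> satisfies the
  inequality for nonnegative test functions, so does the limit \<open>u\<close>, the energies being
  bounded locally by the Caccioppoli inequality.
\<close>

section \<open>Power inequalities\<close>

text \<open>Harmonicity carries no energy bound, so \<open>u\<close> cannot be tested directly; a
  Lipschitz obstacle has finite energy on bounded sets. Comparison admits only functions bounded
  above, so outside the neighbourhood \<open>u\<close> is cut off at a level that is sent to
  infinity in the end, and only functions continuous up to the boundary, hence the exterior balls.
  Far away only the power \<open>p - 1\<close> of a function is integrable and its full energy may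
  be infinite; therefore all far interactions are estimated with powers \<open>p - 1\<close>, and
  minimization uses energy differences. The Caccioppoli inequality keeps the interaction between
  points above and points below a level, and this term drives the whole iteration, with no
  logarithmic estimate. In both limit passages (mollified test functions, approximating minimizers)
  the energies stay bounded but strong convergence is unknown; Young's inequality with a small
  parameter and Fatou's lemma suffice, because only a one-sided inequality has to survive.\<close>

definition phi :: "real \<Rightarrow> real \<Rightarrow> real"
  where "phi p t = \<bar>t\<bar> powr (p - 2) * t"

lemma phi_0 [simp]: "phi p 0 = 0"
  by (simp add: phi_def)

lemma phi_minus [simp]: "phi p (- t) = - phi p t"
  by (simp add: phi_def)

lemma phi_nonneg_eq: "0 \<le> t \<Longrightarrow> phi p t = t powr (p - 1)"
  using powr_mult_base[of t "p - 2"] by (cases "t = 0") (auto simp: phi_def algebra_simps)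

lemma abs_phi: "\<bar>phi p t\<bar> = \<bar>t\<bar> powr (p - 1)"
  using phi_nonneg_eq[of "\<bar>t\<bar>" p] by (simp add: phi_def abs_mult)

lemma phi_strict_mono:
  assumes "1 < p" "a < b"
  shows "phi p a < phi p b"
proof -
  have *: "phi p a < phi p b" if "0 \<le> a" "a < b" for a b
    using that assms(1) by (simp add: phi_nonneg_eq powr_less_mono2)
  have pos: "0 < phi p t" if "0 < t" for t
    using *[of 0 t] that by simp
  consider "0 \<le> a" | "b \<le> 0" | "a < 0" "0 < b"
    using assms(2) by linarith
  then show ?thesis
  proof cases
    case 1 then show ?thesis using * assms by blast
  next
    case 2 then show ?thesis using *[of "- b" "- a"] assms by simp
  next
    case 3 then show ?thesis using pos[of b] pos[of "- a"] by simp
  qed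
qed

lemma phi_mono: "1 < p \<Longrightarrow> a \<le> b \<Longrightarrow> phi p a \<le> phi p b"
  using phi_strict_mono[of p a b] by (cases "a = b") auto

lemma borel_measurable_phi [measurable]: "phi p \<in> borel_measurable borel"
  unfolding phi_def by measurable

text \<open>For \<open>p < 2\<close> the factor \<open>\<bar>t\<bar> powr (p - 2)\<close> is
  singular at 0; splitting into positive and negative part leaves only the positive exponent
  \<open>p - 1\<close>.\<close>

lemma continuous_phi:
  assumes "1 < p"
  shows "continuous_on UNIV (phi p)"
proof -
  have "phi p = (\<lambda>t. (max t 0) powr (p - 1) - (max (- t) 0) powr (p - 1))"
  proof
    fix t :: real
    show "phi p t = (max t 0) powr (p - 1) - (max (- t) 0) powr (p - 1)"
      using phi_nonneg_eq[of t p] phi_nonneg_eq[of "- t" p] assms by (cases "0 \<le> t") (auto simp: max_def)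
  qed
  moreover have "continuous_on UNIV (\<lambda>t::real. (max t 0) powr (p - 1) - (max (- t) 0) powr (p - 1))"
    using assms by (intro continuous_intros continuous_on_powr') auto
  ultimately show ?thesis by metis
qed

lemma powr_add_le:
  fixes a b q :: real
  assumes "0 \<le> a" "0 \<le> b" "0 < q"
  shows "(a + b) powr q \<le> 2 powr q * (a powr q + b powr q)"
proof -
  have "(a + b) powr q \<le> (2 * max a b) powr q"
    using assms by (intro powr_mono2) auto
  also have "\<dots> = 2 powr q * (max a b) powr q"
    using assms by (simp add: powr_mult)
  also have "\<dots> \<le> 2 powr q * (a powr q + b powr q)"
    by (intro mult_left_mono) (auto simp: max_def)
  finally show ?thesis .
qed

lemma abs_diff_powr_le:
  fixes a b q :: real
  assumes "0 < q"
  shows "\<bar>a - b\<bar> powr q \<le> 2 powr q * (\<bar>a\<bar> powr q + \<bar>b\<bar> powr q)"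
proof -
  have "\<bar>a - b\<bar> powr q \<le> (\<bar>a\<bar> + \<bar>b\<bar>) powr q"
    using assms by (intro powr_mono2) auto
  also have "\<dots> \<le> 2 powr q * (\<bar>a\<bar> powr q + \<bar>b\<bar> powr q)"
    using assms by (intro powr_add_le) auto
  finally show ?thesis .
qed

text \<open>Split by whether \<open>B \<le> \<epsilon> * A\<close>: in either case one of the two
  terms on the right alone dominates. Sharp constants are not sought, only a free
  \<open>\<epsilon>\<close>.\<close>

lemma young_powr:
  fixes A B \<epsilon> p :: real
  assumes "0 \<le> A" "0 \<le> B" "0 < \<epsilon>" "1 < p"
  shows "A powr (p - 1) * B \<le> \<epsilon> * A powr p + \<epsilon> powr (1 - p) * B powr p"
proof -
  have split: "x powr (p - 1) * x = x powr p" if "0 \<le> x" for x :: real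
    using powr_mult_base[of x "p - 1"] that by (cases "x = 0") (auto simp: mult.commute)
  show ?thesis
  proof (cases "B \<le> \<epsilon> * A")
    case True
    then have "A powr (p - 1) * B \<le> A powr (p - 1) * (\<epsilon> * A)"
      by (intro mult_left_mono) auto
    also have "\<dots> = \<epsilon> * A powr p"
      using split[of A] assms by (simp add: algebra_simps)
    finally show ?thesis by (simp add: add_increasing2)
  next
    case False
    then have "A \<le> B / \<epsilon>" using assms by (simp add: field_simps)
    then have "A powr (p - 1) * B \<le> (B / \<epsilon>) powr (p - 1) * B"
      using assms by (intro mult_right_mono powr_mono2) auto
    also have "\<dots> = \<epsilon> powr (1 - p) * (B powr (p - 1) * B)"
      using assms powr_minus[of \<epsilon> "p - 1"] by (simp add: powr_divide field_simps)
    also have "\<dots> = \<epsilon> powr (1 - p) * B powr p"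
      using split[of B] assms by simp
    finally show ?thesis using assms by (simp add: add_increasing)
  qed
qed

lemma powr_pm1_mult: "0 \<le> x \<Longrightarrow> x powr (p - 1) * x = x powr p" for x p :: real
  using powr_mult_base[of x "p - 1"] by (cases "x = 0") (auto simp: mult.commute)

text \<open>In the Caccioppoli inequality \<open>t\<close> is the increment of \<open>v - l\<close>,
  \<open>e\<close> that of the level function \<open>l\<close>, and \<open>\<tau>\<close> that of
  the truncation. A shift \<open>e\<close> of at most half of \<open>\<bar>t\<bar>\<close> costs a
  factor; a larger one bounds \<open>t\<close>, \<open>\<tau>\<close> and \<open>t + e\<close> by
  \<open>3 * \<bar>e\<bar>\<close>, so that every term is of the order of the error.\<close>

lemma phi_shift_lower:
  fixes t \<tau> e p :: real
  assumes "1 < p" "0 \<le> t * \<tau>" "\<bar>\<tau>\<bar> \<le> \<bar>t\<bar>"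
  shows "2 powr (1 - p) * (\<bar>t\<bar> powr (p - 1) * \<bar>\<tau>\<bar>) - 4 * 3 powr p * \<bar>e\<bar> powr p \<le> phi p (t + e) * \<tau>"
proof -
  have *: "2 powr (1 - p) * (t powr (p - 1) * \<tau>) - 4 * 3 powr p * \<bar>e\<bar> powr p \<le> phi p (t + e) * \<tau>"
    if "0 \<le> \<tau>" "\<tau> \<le> t" for t \<tau> e
  proof (cases "2 * \<bar>e\<bar> \<le> t")
    case True
    then have le: "t / 2 \<le> t + e" by (simp add: abs_if split: if_splits)
    have "2 powr (1 - p) * t powr (p - 1) = (t / 2) powr (p - 1)"
      using that powr_minus[of 2 "p - 1"] by (simp add: powr_divide field_simps)
    also have "\<dots> \<le> phi p (t + e)"
      using le that assms by (subst phi_nonneg_eq) (auto intro!: powr_mono2)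
    finally have "2 powr (1 - p) * t powr (p - 1) * \<tau> \<le> phi p (t + e) * \<tau>"
      using that by (intro mult_right_mono)
    then show ?thesis
      using powr_ge_zero[of "\<bar>e\<bar>" p] by (simp add: mult.assoc) (smt (verit) mult_nonneg_nonneg powr_ge_zero)
  next
    case False
    have a: "\<bar>phi p (t + e) * \<tau>\<bar> \<le> 2 * 3 powr p * \<bar>e\<bar> powr p"
    proof -
      have "\<bar>phi p (t + e) * \<tau>\<bar> = \<bar>t + e\<bar> powr (p - 1) * \<tau>"
        using that by (simp add: abs_mult abs_phi)
      also have "\<dots> \<le> (3 * \<bar>e\<bar>) powr (p - 1) * (3 * \<bar>e\<bar>)"
        using False that assms by (intro mult_mono powr_mono2) auto
      also have "\<dots> = 3 powr p * \<bar>e\<bar> powr p"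
        by (subst powr_pm1_mult) (auto simp: powr_mult)
      finally show ?thesis using powr_ge_zero[of "3 * \<bar>e\<bar>" p] by (simp add: powr_mult)
    qed
    have "2 powr (1 - p) * (t powr (p - 1) * \<tau>) \<le> 1 * ((3 * \<bar>e\<bar>) powr (p - 1) * (3 * \<bar>e\<bar>))"
      using False that assms powr_mono[of "1 - p" 0 2] by (intro mult_mono powr_mono2) auto
    also have "\<dots> = 3 powr p * \<bar>e\<bar> powr p"
      by (simp only: mult_1) (subst powr_pm1_mult, auto simp: powr_mult)
    finally have "2 powr (1 - p) * (t powr (p - 1) * \<tau>) \<le> 3 powr p * \<bar>e\<bar> powr p" .
    moreover have "0 \<le> 3 powr p * \<bar>e\<bar> powr p" by simp
    moreover have "\<bar>t\<bar> = t" "\<bar>\<tau>\<bar> = \<tau>" using that by auto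
    ultimately show ?thesis using a by linarith
  qed
  show ?thesis
  proof (cases "0 \<le> \<tau> \<and> 0 \<le> t")
    case True
    then show ?thesis using *[of \<tau> t e] assms by simp
  next
    case False
    then have "\<tau> \<le> 0" "t \<le> 0"
      using assms(2,3) by (auto simp: zero_le_mult_iff abs_if split: if_splits)
    then show ?thesis using *[of "- \<tau>" "- t" "- e"] assms phi_minus[of p "t + e"] by simp
  qed
qed

text \<open>At 0 the difference quotient is bounded by \<open>\<bar>h\<bar> powr (p - 1)\<close>,
  which tends to 0 for all \<open>p > 1\<close>.\<close>

lemma abs_powr_has_derivative:
  assumes "1 < p"
  shows "((\<lambda>x. \<bar>x\<bar> powr p) has_real_derivative (p * phi p a)) (at a)"
proof -
  consider "0 < a" | "a < 0" | "a = 0" by linarith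
  then show ?thesis
  proof cases
    case 1
    have "((\<lambda>x. x powr p) has_real_derivative (p * phi p a)) (at a)"
      using 1 by (auto intro!: derivative_eq_intros simp: phi_nonneg_eq)
    then show ?thesis
      by (rule DERIV_cong_ev[THEN iffD1, rotated -1])
         (use 1 in \<open>auto simp: eventually_nhds intro!: exI[of _ "{0<..}"]\<close>)
  next
    case 2
    have "((\<lambda>x. (- x) powr p) has_real_derivative (p * phi p a)) (at a)"
    proof -
      have "phi p a = - ((- a) powr (p - 1))"
        using 2 phi_nonneg_eq[of "- a" p] by simp
      then show ?thesis
        using 2 by (auto intro!: derivative_eq_intros)
    qed
    then show ?thesis
      by (rule DERIV_cong_ev[THEN iffD1, rotated -1])
         (use 2 in \<open>auto simp: eventually_nhds intro!: exI[of _ "{..<0}"]\<close>)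
  next
    case 3
    have "((\<lambda>h. \<bar>h\<bar> powr (p - 1)) \<longlongrightarrow> 0) (at 0)"
      using assms by (intro tendsto_eq_intros) (auto simp: )
    moreover have "\<forall>\<^sub>F h in at 0. \<bar>\<bar>h\<bar> powr p / h\<bar> \<le> \<bar>h\<bar> powr (p - 1)"
      by (auto simp: eventually_at_filter powr_diff)
    ultimately have "((\<lambda>h. \<bar>h\<bar> powr p / h) \<longlongrightarrow> 0) (at 0)"
      by (intro Lim_null_comparison[of "\<lambda>h. \<bar>h\<bar> powr p / h" "\<lambda>h. \<bar>h\<bar> powr (p - 1)"]) simp_all
    then show ?thesis using 3 by (simp add: DERIV_def)
  qed
qed

text \<open>By the mean value theorem. A bounded change of a difference thus costs only the power
  \<open>p - 1\<close> of a possibly unbounded value, and that power is what the tail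
  controls.\<close>

lemma abs_powr_diff_le:
  fixes a b p :: real
  assumes "1 < p"
  shows "\<bar>\<bar>a\<bar> powr p - \<bar>b\<bar> powr p\<bar> \<le> p * (max \<bar>a\<bar> \<bar>b\<bar>) powr (p - 1) * \<bar>\<bar>a\<bar> - \<bar>b\<bar>\<bar>"
proof -
  have *: "y powr p - x powr p \<le> p * y powr (p - 1) * (y - x)" if "0 \<le> x" and xy: "x < y" for x y
  proof -
    obtain z where z: "x < z" "z < y" "\<bar>y\<bar> powr p - \<bar>x\<bar> powr p = (y - x) * (p * phi p z)"
      using MVT2[OF xy, of "\<lambda>x. \<bar>x\<bar> powr p" "\<lambda>x. p * phi p x", OF abs_powr_has_derivative[OF assms]] by blast
    have "phi p z \<le> y powr (p - 1)"
      using z that assms by (subst phi_nonneg_eq) (auto intro!: powr_mono2)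
    then have "(y - x) * (p * phi p z) \<le> (y - x) * (p * y powr (p - 1))"
      using that assms by (intro mult_left_mono) auto
    then show ?thesis using z that by (simp add: algebra_simps)
  qed
  show ?thesis
  proof (cases "\<bar>b\<bar> \<le> \<bar>a\<bar>")
    case True
    then have "\<bar>b\<bar> powr p \<le> \<bar>a\<bar> powr p" using assms by (intro powr_mono2) auto
    then show ?thesis using True *[of "\<bar>b\<bar>" "\<bar>a\<bar>"] by (cases "\<bar>b\<bar> = \<bar>a\<bar>") (auto simp: max_def)
  next
    case False
    then have "\<bar>a\<bar> powr p \<le> \<bar>b\<bar> powr p" using assms by (intro powr_mono2) auto
    then show ?thesis using False *[of "\<bar>a\<bar>" "\<bar>b\<bar>"] by (auto simp: max_def)
  qed
qed

lemma convex_abs_powr: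
  assumes "1 < p"
  shows "convex_on UNIV (\<lambda>x::real. \<bar>x\<bar> powr p)"
proof (rule convex_on_realI[where f' = "\<lambda>x. p * phi p x"])
  show "connected (UNIV :: real set)" by simp
  show "((\<lambda>x. \<bar>x\<bar> powr p) has_real_derivative p * phi p x) (at x)" for x
    by (rule abs_powr_has_derivative[OF assms])
  show "p * phi p x \<le> p * phi p y" if "x \<le> y" for x y
    using that assms phi_mono by simp
qed

text \<open>Majorization: \<open>P + d\<close> and \<open>P + d'\<close> lie between \<open>P\<close> and \<open>P + d + d'\<close> and have the same sum.\<close>
lemma abs_powr_submodular:
  fixes a a' b b' p :: real
  assumes "1 < p"
  shows "\<bar>min a a' - min b b'\<bar> powr p + \<bar>max a a' - max b b'\<bar> powr p
         \<le> \<bar>a - b\<bar> powr p + \<bar>a' - b'\<bar> powr p"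
proof -
  define f where "f = (\<lambda>x::real. \<bar>x\<bar> powr p)"
  have cvx: "convex_on UNIV f" unfolding f_def by (rule convex_abs_powr[OF assms])
  have maj: "f (P + d) + f (P + d') \<le> f P + f (P + d + d')" if "0 \<le> d" "0 \<le> d'" for P d d'
  proof (cases "d + d' = 0")
    case True
    then show ?thesis using that by (simp add: add_nonneg_eq_0_iff)
  next
    case False
    define t where "t = d / (d + d')"
    have t: "0 \<le> t" "t \<le> 1" "t * (d + d') = d" using that False by (auto simp: t_def divide_simps)
    have "f ((1 - t) * P + t * (P + d + d')) \<le> (1 - t) * f P + t * f (P + d + d')"
      "f ((1 - (1 - t)) * P + (1 - t) * (P + d + d')) \<le> (1 - (1 - t)) * f P + (1 - t) * f (P + d + d')"
      using convex_onD[OF cvx, of t P "P + d + d'"] convex_onD[OF cvx, of "1 - t" P "P + d + d'"] t by auto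
    moreover have "(1 - t) * P + t * (P + d + d') = P + d"
      "(1 - (1 - t)) * P + (1 - t) * (P + d + d') = P + d'"
      using t(3) by (simp_all add: algebra_simps)
    ultimately show ?thesis by (simp add: algebra_simps)
  qed
  \<comment> \<open>For equally ordered pairs minimum and maximum just return the two given pairs.
    In the crossed cases \<open>maj\<close> applies with \<open>P = a - b\<close> or
    \<open>P = a' - b'\<close>.\<close>
  consider "(a \<le> a' \<and> b \<le> b') \<or> (a' \<le> a \<and> b' \<le> b)" | "a \<le> a'" "b' \<le> b" | "a' \<le> a" "b \<le> b'"
    by linarith
  then show ?thesis
  proof cases
    case 1 then show ?thesis by (auto simp: min_def max_def)
  next
    case 2
    then show ?thesis using maj[of "b - b'" "a' - a" "a - b"]
      by (simp add: min_absorb1 min_absorb2 max_absorb1 max_absorb2 f_def algebra_simps)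
  next
    case 3
    then show ?thesis using maj[of "a - a'" "b' - b" "a' - b'"]
      by (simp add: min_absorb1 min_absorb2 max_absorb1 max_absorb2 f_def algebra_simps)
  qed
qed

section \<open>The kernel integral over dyadic shells\<close>

lemma dyadic_scale:
  fixes q :: real
  assumes "1 \<le> q"
  obtains j :: nat where "2 ^ j \<le> q" "q < 2 * 2 ^ j"
proof -
  define P where "P = (\<lambda>j::nat. q < 2 ^ j)"
  obtain n where "P n" using real_arch_pow[of 2 q] by (auto simp: P_def)
  then have L: "P (LEAST j. P j)" by (rule LeastI)
  have "(LEAST j. P j) \<noteq> 0"
    using L assms by (intro notI) (simp add: P_def)
  then obtain j where j: "(LEAST j. P j) = Suc j" by (cases "LEAST j. P j") auto
  have "\<not> P j" using not_less_Least[of j P] j by simp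
  with L show thesis
    unfolding j by (intro that[of j]) (auto simp: P_def)
qed

lemma powr_two_power: "(2 ^ j) powr c = (2 powr c) ^ j" for c :: real
  by (simp add: powr_realpow[symmetric] powr_powr mult.commute)

text \<open>A substitute for polar coordinates: each point has a dyadic scale at which
  \<open>f\<close> is at most \<open>h j\<close>, and the shell of that scale is enlarged to a ball,
  whose measure is known. As the resulting series is geometric, the enlargement costs only a
  constant.\<close>

lemma nn_integral_geometric_majorant:
  fixes f :: "'a::euclidean_space \<Rightarrow> ennreal" and c \<theta> :: real
  assumes f: "\<And>y. f y \<noteq> 0 \<Longrightarrow> \<exists>j. f y \<le> indicator (ball x (\<rho> j)) y * ennreal (h j)"
    and h: "\<And>j. 0 \<le> h j" "\<And>j. 0 \<le> \<rho> j"
    and bound: "\<And>j::nat. unit_ball_vol (real DIM('a)) * \<rho> j ^ DIM('a) * h j = c * \<theta> ^ j"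
    and \<theta>: "0 \<le> \<theta>" "\<theta> < 1" and c: "0 \<le> c"
  shows "(\<integral>\<^sup>+y. f y \<partial>lborel) \<le> ennreal (c / (1 - \<theta>))"
proof -
  define g where "g j y = indicator (ball x (\<rho> j)) y * ennreal (h j)" for j :: nat and y
  have "f y \<le> (\<Sum>j. g j y)" for y
  proof (cases "f y = 0")
    case False
    then obtain j where "f y \<le> g j y" using f by (auto simp: g_def)
    also have "\<dots> \<le> (\<Sum>j. g j y)"
      using sum_le_suminf[of "\<lambda>j. g j y" "{j}"] by simp
    finally show ?thesis .
  qed simp
  then have "(\<integral>\<^sup>+y. f y \<partial>lborel) \<le> (\<integral>\<^sup>+y. (\<Sum>j. g j y) \<partial>lborel)"
    by (intro nn_integral_mono)
  also have "\<dots> = (\<Sum>j. \<integral>\<^sup>+y. g j y \<partial>lborel)"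
    
  proof (intro nn_integral_suminf)
    fix j
    have [measurable]: "ball x (\<rho> j) \<in> sets borel" by (rule borel_open) simp
    show "g j \<in> borel_measurable lborel" unfolding g_def by measurable
  qed
  also have "\<dots> = (\<Sum>j. ennreal (c * \<theta> ^ j))"
  proof (intro suminf_cong)
    fix j
    have "(\<integral>\<^sup>+y. g j y \<partial>lborel) = emeasure lborel (ball x (\<rho> j)) * ennreal (h j)"
      unfolding g_def by (subst nn_integral_multc) (auto intro!: borel_measurable_indicator simp: borel_open)
    also have "\<dots> = ennreal (unit_ball_vol (real DIM('a)) * \<rho> j ^ DIM('a) * h j)"
      using h by (simp add: emeasure_ball ennreal_mult)
    finally show "(\<integral>\<^sup>+y. g j y \<partial>lborel) = ennreal (c * \<theta> ^ j)"
      by (simp add: bound)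
  qed
  also have "\<dots> = ennreal (c / (1 - \<theta>))"
    using \<theta> c sums_mult[OF geometric_sums[of \<theta>], of c] by (intro suminf_ennreal_eq) auto
  finally show ?thesis .
qed

text \<open>The shell between the radii \<open>2 ^ j * r\<close> and \<open>2 * (2 ^ j * r)\<close>
  contributes a multiple of \<open>(2 ^ j * r) powr - a\<close>, so the ratio of the series is
  \<open>2 powr - a\<close>.\<close>

lemma far_kernel_integral:
  fixes a :: real
  assumes "0 < a"
  obtains C where "0 \<le> C"
    "\<And>(x::'a::euclidean_space) r. 0 < r \<Longrightarrow>
       (\<integral>\<^sup>+y. indicator (- ball x r) y * ennreal (norm (x - y) powr - (real DIM('a) + a)) \<partial>lborel)
       \<le> ennreal (C * r powr - a)"
proof
  define n where "n = real DIM('a)"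
  define C where "C = unit_ball_vol n * 2 ^ DIM('a) / (1 - 2 powr - a)"
  have \<theta>: "2 powr - a < 1" using assms powr_less_mono[of "- a" 0 2] by simp
  show "0 \<le> C" using \<theta> by (auto simp: C_def n_def)
  fix x :: 'a and r :: real assume r: "0 < r"
  have "(\<integral>\<^sup>+y. indicator (- ball x r) y * ennreal (norm (x - y) powr - (real DIM('a) + a)) \<partial>lborel)
     \<le> ennreal (unit_ball_vol n * 2 ^ DIM('a) * r powr - a / (1 - 2 powr - a))"
  proof (rule nn_integral_geometric_majorant[where x = x and \<rho> = "\<lambda>j. 2 * (2 ^ j * r)"
        and h = "\<lambda>j. (2 ^ j * r) powr - (n + a)"])
    fix y assume "indicator (- ball x r) y * ennreal (norm (x - y) powr - (real DIM('a) + a)) \<noteq> 0"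
    then have y: "r \<le> norm (x - y)" by (auto simp: indicator_def dist_norm split: if_splits)
    then obtain j where j: "2 ^ j \<le> norm (x - y) / r" "norm (x - y) / r < 2 * 2 ^ j"
      using dyadic_scale[of "norm (x - y) / r"] r by auto
    then have j: "2 ^ j * r \<le> norm (x - y)" "norm (x - y) < 2 * (2 ^ j * r)"
      using r by (auto simp: field_simps)
    then have "norm (x - y) powr - (n + a) \<le> (2 ^ j * r) powr - (n + a)"
      using r assms by (intro powr_mono2') (auto simp: n_def)
    then show "\<exists>j. indicator (- ball x r) y * ennreal (norm (x - y) powr - (real DIM('a) + a))
        \<le> indicator (ball x (2 * (2 ^ j * r))) y * ennreal ((2 ^ j * r) powr - (n + a))"
      using y j by (intro exI[of _ j]) (auto simp: indicator_def dist_norm n_def intro!: ennreal_leI)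
  next
    fix j :: nat
    have "(2 ^ j * r) powr - (n + a) = (2 ^ j * r) powr - n * (2 ^ j * r) powr - a"
      by (simp add: powr_add[symmetric])
    moreover have "(2 ^ j * r) powr - n = 1 / (2 ^ j * r) ^ DIM('a)"
      using r by (simp add: n_def powr_minus powr_realpow divide_inverse)
    moreover have "(2 ^ j * r) powr - a = r powr - a * (2 powr - a) ^ j"
      using r by (simp add: powr_mult powr_realpow[symmetric] powr_powr mult.commute)
    ultimately show "unit_ball_vol (real DIM('a)) * (2 * (2 ^ j * r)) ^ DIM('a) * (2 ^ j * r) powr - (n + a)
      = unit_ball_vol n * 2 ^ DIM('a) * r powr - a * (2 powr - a) ^ j"
      using r by (simp add: power_mult_distrib n_def)
  qed (use r \<theta> in \<open>auto simp: n_def\<close>)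
  also have "\<dots> = ennreal (C * r powr - a)" by (simp add: C_def)
  finally show "(\<integral>\<^sup>+y. indicator (- ball x r) y * ennreal (norm (x - y) powr - (real DIM('a) + a)) \<partial>lborel)
     \<le> ennreal (C * r powr - a)" .
qed

text \<open>The shells shrink towards \<open>x\<close> and contribute multiples of
  \<open>(r / 2 ^ j) powr b\<close>. With \<open>b = p - s * p\<close> this is the integrability of
  \<open>norm (x - y) powr p\<close> against the kernel near the diagonal.\<close>

lemma near_kernel_integral:
  fixes b :: real
  assumes "0 < b"
  obtains C where "0 \<le> C"
    "\<And>(x::'a::euclidean_space) r. 0 < r \<Longrightarrow>
       (\<integral>\<^sup>+y. indicator (ball x r) y * ennreal (norm (x - y) powr (b - real DIM('a))) \<partial>lborel)
       \<le> ennreal (C * r powr b)"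
proof
  define n where "n = real DIM('a)"
  define C where "C = unit_ball_vol n * 4 ^ DIM('a) / (1 - 2 powr - b)"
  have \<theta>: "2 powr - b < 1" using assms powr_less_mono[of "- b" 0 2] by simp
  show "0 \<le> C" using \<theta> by (auto simp: C_def n_def)
  fix x :: 'a and r :: real assume r: "0 < r"
  have "(\<integral>\<^sup>+y. indicator (ball x r) y * ennreal (norm (x - y) powr (b - real DIM('a))) \<partial>lborel)
     \<le> ennreal (unit_ball_vol n * 4 ^ DIM('a) * r powr b / (1 - 2 powr - b))"
  proof (rule nn_integral_geometric_majorant[where x = x and \<rho> = "\<lambda>j. 2 * (r / 2 ^ j)"
        and h = "\<lambda>j. (r / 2 ^ j) powr b * (r / 2 ^ j / 2) powr - n"])
    fix y assume "indicator (ball x r) y * ennreal (norm (x - y) powr (b - real DIM('a))) \<noteq> 0"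
    then have y: "norm (x - y) < r" "x \<noteq> y" by (auto simp: indicator_def dist_norm split: if_splits)
    then obtain j where j: "2 ^ j \<le> r / norm (x - y)" "r / norm (x - y) < 2 * 2 ^ j"
      using dyadic_scale[of "r / norm (x - y)"] r by auto
    then have j: "norm (x - y) \<le> r / 2 ^ j" "r / 2 ^ j / 2 < norm (x - y)"
      using y by (auto simp: field_simps)
    \<comment> \<open>The sign of \<open>b - n\<close> is open, so the factor with exponent
      \<open>b\<close> is bounded at the outer radius of the shell and the one with exponent
      \<open>- n\<close> at the inner radius.\<close>
    have "norm (x - y) powr (b - n) = norm (x - y) powr b * norm (x - y) powr - n"
      by (simp add: powr_add[symmetric])
    also have "\<dots> \<le> (r / 2 ^ j) powr b * (r / 2 ^ j / 2) powr - n"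
      using r assms j by (intro mult_mono powr_mono2 powr_mono2') (auto simp: n_def)
    finally show "\<exists>j. indicator (ball x r) y * ennreal (norm (x - y) powr (b - real DIM('a)))
        \<le> indicator (ball x (2 * (r / 2 ^ j))) y * ennreal ((r / 2 ^ j) powr b * (r / 2 ^ j / 2) powr - n)"
      using y j r by (intro exI[of _ j]) (auto simp: indicator_def dist_norm n_def intro!: ennreal_leI)
  next
    fix j :: nat
    have "(r / 2 ^ j / 2) powr - n = 1 / (r / 2 ^ j / 2) ^ DIM('a)"
    proof -
      have "x powr - n = 1 / x ^ DIM('a)" if "0 < x" for x :: real
        using that by (simp add: n_def powr_minus powr_realpow divide_inverse)
      then show ?thesis using r by simp
    qed
    moreover have "(r / 2 ^ j) powr b = r powr b * (2 powr - b) ^ j"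
    proof -
      have "(r / 2 ^ j) powr b = r powr b * (2 ^ j) powr - b"
        using r by (simp add: powr_divide powr_minus field_simps)
      then show ?thesis by (simp only: powr_two_power)
    qed
    moreover have "(2 * (r / 2 ^ j)) ^ DIM('a) = 4 ^ DIM('a) * (r / 2 ^ j / 2) ^ DIM('a)"
    proof -
      have "2 * (r / 2 ^ j) = 4 * (r / 2 ^ j / 2)" by simp
      then show ?thesis by (simp only: power_mult_distrib)
    qed
    ultimately show "unit_ball_vol (real DIM('a)) * (2 * (r / 2 ^ j)) ^ DIM('a)
        * ((r / 2 ^ j) powr b * (r / 2 ^ j / 2) powr - n)
      = unit_ball_vol n * 4 ^ DIM('a) * r powr b * (2 powr - b) ^ j"
      using r by (simp add: n_def)
  qed (use r \<theta> in \<open>auto simp: n_def\<close>)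
  also have "\<dots> = ennreal (C * r powr b)" by (simp add: C_def)
  finally show "(\<integral>\<^sup>+y. indicator (ball x r) y * ennreal (norm (x - y) powr (b - real DIM('a))) \<partial>lborel)
     \<le> ennreal (C * r powr b)" .
qed

lemma fst_snd_borel [measurable]:
  "fst \<in> borel_measurable (borel :: ('a::second_countable_topology \<times> 'b::second_countable_topology) measure)"
  "snd \<in> borel_measurable (borel :: ('a \<times> 'b) measure)"
  by (intro borel_measurable_continuous_onI continuous_intros)+

lemma nn_integral_lborel_Pair:
  fixes f :: "'a::euclidean_space \<times> 'a \<Rightarrow> ennreal"
  assumes f: "f \<in> borel_measurable borel"
  shows "(\<integral>\<^sup>+z. f z \<partial>lborel) = (\<integral>\<^sup>+x. \<integral>\<^sup>+y. f (x, y) \<partial>lborel \<partial>lborel)"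
  using lborel.nn_integral_fst[of f lborel] f by (simp add: lborel_prod)

lemma nn_integral_lborel_swap:
  fixes f :: "'a::euclidean_space \<times> 'a \<Rightarrow> ennreal"
  assumes f [measurable]: "f \<in> borel_measurable borel"
  shows "(\<integral>\<^sup>+z. f (snd z, fst z) \<partial>lborel) = (\<integral>\<^sup>+z. f z \<partial>lborel)"
proof -
  have "(\<lambda>z::'a \<times> 'a. (snd z, fst z)) \<in> borel_measurable borel"
    by (intro borel_measurable_continuous_onI continuous_intros)
  then have "(\<lambda>z. f (snd z, fst z)) \<in> borel_measurable borel" using f by (rule measurable_compose)
  then have "(\<integral>\<^sup>+z. f (snd z, fst z) \<partial>lborel) = (\<integral>\<^sup>+x. \<integral>\<^sup>+y. f (y, x) \<partial>lborel \<partial>lborel)"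
    by (subst nn_integral_lborel_Pair) auto
  also have "\<dots> = (\<integral>\<^sup>+z. f z \<partial>lborel)"
    using lborel_pair.Fubini'[of "\<lambda>x y. f (x, y)"] f
    by (subst nn_integral_lborel_Pair) (auto simp: lborel_prod)
  finally show ?thesis .
qed

lemma AE_lborel_fst_snd:
  fixes P :: "'a::euclidean_space \<Rightarrow> bool"
  assumes "AE x in lborel. P x"
  shows "AE z in lborel. P (fst z) \<and> P (snd z)"
proof -
  obtain N where N: "N \<in> null_sets lborel" "{x. \<not> P x} \<subseteq> N"
    using assms by (auto elim!: AE_E simp: null_sets_def)
  have [measurable]: "N \<in> sets borel" using N by auto
  have z: "emeasure lborel N = 0" using N by auto
  have "(\<integral>\<^sup>+z. indicator N (fst z) \<partial>(lborel::('a \<times> 'a) measure)) = (\<integral>\<^sup>+x. \<integral>\<^sup>+y. indicator N x \<partial>(lborel::'a measure) \<partial>lborel)"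
    by (subst nn_integral_lborel_Pair) auto
  also have "\<dots> = 0"
    using N(1) by (subst nn_integral_0_iff_AE) (auto intro: AE_mp[OF AE_not_in[OF N(1)]] simp: indicator_def)
  finally have 1: "AE z in (lborel::('a \<times> 'a) measure). fst z \<notin> N"
    by (subst (asm) nn_integral_0_iff_AE) (auto simp: indicator_def)
  have "(\<integral>\<^sup>+z. indicator N (snd z) \<partial>(lborel::('a \<times> 'a) measure)) = (\<integral>\<^sup>+x. \<integral>\<^sup>+y. indicator N y \<partial>lborel \<partial>(lborel::'a measure))"
    by (subst nn_integral_lborel_Pair) auto
  also have "\<dots> = 0" using z by (simp add: nn_integral_indicator)
  finally have 2: "AE z in (lborel::('a \<times> 'a) measure). snd z \<notin> N"
    by (subst (asm) nn_integral_0_iff_AE) (auto simp: indicator_def)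
  from 1 2 show ?thesis by eventually_elim (use N(2) in auto)
qed

text \<open>The bounds are required at every pair. On the diagonal both are 0, because
  \<open>0 powr q = 0\<close> for every \<open>q\<close>, so \<open>k\<close> vanishes there and is
  positive only off it.\<close>

locale nonlocal_kernel =
  fixes s p \<Lambda> :: real and k :: "'a::euclidean_space \<times> 'a \<Rightarrow> real"
  assumes s: "0 < s" "s < 1" and p: "1 < p" and \<Lambda>: "1 \<le> \<Lambda>"
    and k_borel [measurable]: "k \<in> borel_measurable borel"
    and k_sym: "k (x, y) = k (y, x)"
    and k_lower: "norm (x - y) powr - (real DIM('a) + s * p) / \<Lambda> \<le> k (x, y)"
    and k_upper: "k (x, y) \<le> \<Lambda> * norm (x - y) powr - (real DIM('a) + s * p)"
begin

definition \<nu> :: "('a \<times> 'a) measure"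
  where "\<nu> = density lborel (\<lambda>z. ennreal (k z))"

definition weight :: "'a \<Rightarrow> real"
  where "weight y = (1 + norm y) powr - (real DIM('a) + s * p)"

lemma sp_pos: "0 < s * p" "0 < real DIM('a) + s * p" "0 < p - s * p"
proof -
  show "0 < s * p" using s p by simp
  then show "0 < real DIM('a) + s * p" by simp
  have "s * p < 1 * p" using s p by (intro mult_strict_right_mono) auto
  then show "0 < p - s * p" by simp
qed

lemma k_nonneg: "0 \<le> k z"
proof -
  have "0 \<le> norm (fst z - snd z) powr - (real DIM('a) + s * p) / \<Lambda>" using \<Lambda> by simp
  then show ?thesis using k_lower[of "fst z" "snd z"] by simp
qed

lemma k_pos: "x \<noteq> y \<Longrightarrow> 0 < k (x, y)"
proof -
  assume "x \<noteq> y"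
  then have "0 < norm (x - y) powr - (real DIM('a) + s * p) / \<Lambda>" using \<Lambda> by simp
  then show ?thesis using k_lower[of x y] by simp
qed

lemma space_\<nu> [simp]: "space \<nu> = UNIV" and sets_\<nu> [measurable_cong]: "sets \<nu> = sets borel"
  by (simp_all add: \<nu>_def)

lemma borel_measurable_\<nu>: "f \<in> borel_measurable \<nu> \<longleftrightarrow> f \<in> borel_measurable borel"
  by (simp add: measurable_def sets_\<nu>)

lemma AE_\<nu>I: "AE z in lborel. P z \<Longrightarrow> AE z in \<nu>. P z"
  unfolding \<nu>_def by (subst AE_density) auto

lemma AE_\<nu>_pair:
  assumes "AE x in lborel. P x"
  shows "AE z in \<nu>. P (fst z) \<and> P (snd z)"
  by (intro AE_\<nu>I AE_lborel_fst_snd assms)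

lemma nn_integral_\<nu>:
  assumes [measurable]: "f \<in> borel_measurable borel"
  shows "(\<integral>\<^sup>+z. f z \<partial>\<nu>) = (\<integral>\<^sup>+x. \<integral>\<^sup>+y. f (x, y) * ennreal (k (x, y)) \<partial>lborel \<partial>lborel)"
proof -
  have "(\<integral>\<^sup>+z. f z \<partial>\<nu>) = (\<integral>\<^sup>+z. ennreal (k z) * f z \<partial>lborel)"
    unfolding \<nu>_def by (subst nn_integral_density) auto
  also have "\<dots> = (\<integral>\<^sup>+x. \<integral>\<^sup>+y. f (x, y) * ennreal (k (x, y)) \<partial>lborel \<partial>lborel)"
    by (subst nn_integral_lborel_Pair) (auto simp: mult.commute)
  finally show ?thesis .
qed

lemma nn_integral_\<nu>_swap:
  assumes [measurable]: "f \<in> borel_measurable borel"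
  shows "(\<integral>\<^sup>+z. f (snd z, fst z) \<partial>\<nu>) = (\<integral>\<^sup>+z. f z \<partial>\<nu>)"
proof -
  have [measurable]: "(\<lambda>z::'a \<times> 'a. (snd z, fst z)) \<in> borel_measurable borel"
    by (intro borel_measurable_continuous_onI continuous_intros)
  have "(\<integral>\<^sup>+z. f (snd z, fst z) \<partial>\<nu>) = (\<integral>\<^sup>+z. ennreal (k (snd z, fst z)) * f (snd z, fst z) \<partial>lborel)"
    unfolding \<nu>_def using k_sym by (subst nn_integral_density) auto
  also have "\<dots> = (\<integral>\<^sup>+z. ennreal (k z) * f z \<partial>lborel)"
    by (rule nn_integral_lborel_swap) measurable
  also have "\<dots> = (\<integral>\<^sup>+z. f z \<partial>\<nu>)"
    unfolding \<nu>_def by (subst nn_integral_density) auto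
  finally show ?thesis .
qed

lemma weight_borel [measurable]: "weight \<in> borel_measurable borel"
  unfolding weight_def by measurable

lemma weight_pos: "0 < weight y"
  unfolding weight_def by (simp add: add_pos_nonneg less_imp_neq[symmetric])

lemma weight_finite: "(\<integral>\<^sup>+y. ennreal (weight y) \<partial>lborel) < \<infinity>"
proof -
  obtain C where C: "0 \<le> C" "\<And>(x::'a) r. 0 < r \<Longrightarrow>
       (\<integral>\<^sup>+y. indicator (- ball x r) y * ennreal (norm (x - y) powr - (real DIM('a) + s * p)) \<partial>lborel)
       \<le> ennreal (C * r powr - (s * p))"
    by (rule far_kernel_integral[where 'a='a, OF sp_pos(1)]) (rule that; assumption)
  have [measurable]: "ball 0 1 \<in> sets (borel :: 'a measure)" "- ball 0 1 \<in> sets (borel :: 'a measure)" by auto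
  have "ennreal (weight y) \<le> indicator (ball 0 1) y + indicator (- ball 0 1) y * ennreal (norm (0 - y) powr - (real DIM('a) + s * p))" for y
  proof (cases "y \<in> ball 0 1")
    case True
    have "weight y \<le> 1" unfolding weight_def
      using powr_mono2'[of "- (real DIM('a) + s * p)" 1 "1 + norm y"] sp_pos by simp
    with True show ?thesis by (simp add: ennreal_le_1)
  next
    case False
    then have "0 < norm y" by auto
    then have "weight y \<le> norm y powr - (real DIM('a) + s * p)"
      unfolding weight_def using sp_pos by (intro powr_mono2') auto
    with False show ?thesis by (simp add: ennreal_leI)
  qed
  then have "(\<integral>\<^sup>+y. ennreal (weight y) \<partial>lborel) \<le>
    (\<integral>\<^sup>+y. indicator (ball (0::'a) 1) y + indicator (- ball (0::'a) 1) y * ennreal (norm (0 - y) powr - (real DIM('a) + s * p)) \<partial>lborel)"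
    by (intro nn_integral_mono)
  also have "\<dots> = emeasure lborel (ball (0::'a) 1) +
      (\<integral>\<^sup>+y. indicator (- ball (0::'a) 1) y * ennreal (norm (0 - y) powr - (real DIM('a) + s * p)) \<partial>lborel)"
    by (subst nn_integral_add) auto
  also have "\<dots> \<le> emeasure lborel (ball (0::'a) 1) + ennreal (C * 1 powr - (s * p))"
    by (intro add_left_mono C) auto
  also have "\<dots> < \<infinity>" by (simp add: emeasure_ball)
  finally show ?thesis .
qed

text \<open>Away from base points in a bounded set the kernel is dominated by the weight, so a
  single tail condition centred at 0 serves all of them.\<close>

lemma kernel_le_weight:
  assumes "0 < d"
  obtains C where "0 \<le> C" "\<And>x y. norm x \<le> b \<Longrightarrow> d \<le> dist x y \<Longrightarrow> k (x, y) \<le> C * weight y"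
proof
  \<comment> \<open>With \<open>d \<le> dist x y\<close> the constant
    \<open>1 + \<bar>b\<bar>\<close> is at most \<open>(1 + \<bar>b\<bar>) / d\<close> times the
    distance; the added 1 pays for the distance itself. Hence \<open>1 + norm y\<close> is at most
    \<open>A * norm (x - y)\<close>.\<close>
  define A where "A = (1 + \<bar>b\<bar>) / d + 1"
  define C where "C = \<Lambda> * A powr (real DIM('a) + s * p)"
  show "0 \<le> C" using \<Lambda> by (simp add: C_def)
  have A: "0 < A" using assms by (auto simp: A_def intro!: add_nonneg_pos)
  fix x y :: 'a assume x: "norm x \<le> b" and y: "d \<le> dist x y"
  have "1 + norm y \<le> 1 + norm x + norm (x - y)"
    using norm_triangle_ineq[of x "y - x"] by (simp add: norm_minus_commute)
  also have "\<dots> \<le> (1 + \<bar>b\<bar>) / d * d + norm (x - y)" using x assms by simp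
  also have "\<dots> \<le> (1 + \<bar>b\<bar>) / d * norm (x - y) + norm (x - y)"
    using y assms by (intro add_right_mono mult_left_mono) (auto simp: dist_norm)
  finally have le: "(1 + norm y) / A \<le> norm (x - y)"
    using A by (simp add: A_def field_simps)
  have pos: "0 < 1 + norm y" by (simp add: add_pos_nonneg)
  have "k (x, y) \<le> \<Lambda> * norm (x - y) powr - (real DIM('a) + s * p)" by (rule k_upper)
  also have "\<dots> \<le> \<Lambda> * ((1 + norm y) / A) powr - (real DIM('a) + s * p)"
    using le A pos \<Lambda> sp_pos by (intro mult_left_mono powr_mono2') auto
  also have "\<dots> = C * weight y"
  proof -
    have "((1 + norm y) / A) powr - q = A powr q * (1 + norm y) powr - q" for q
      using A pos by (simp add: powr_divide powr_minus field_simps)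
    then show ?thesis by (simp only: C_def weight_def mult.assoc)
  qed
  finally show "k (x, y) \<le> C * weight y" .
qed

text \<open>Both signs of \<open>f\<close> are included. Local integrability of the power
  \<open>p - 1\<close> is contained in this, since \<open>weight\<close> is bounded below on compact
  sets.\<close>

definition tail_finite :: "('a \<Rightarrow> real) \<Rightarrow> bool"
  where "tail_finite f \<longleftrightarrow> (\<integral>\<^sup>+y. ennreal (\<bar>f y\<bar> powr (p - 1) * weight y) \<partial>lborel) < \<infinity>"

lemma far_integral_le:
  assumes [measurable]: "S \<in> sets borel" "N \<in> sets borel" "F \<in> borel_measurable borel"
    and d: "0 < d" "\<And>x y. x \<in> S \<Longrightarrow> y \<notin> N \<Longrightarrow> d \<le> dist x y"
    and C: "\<And>x y. x \<in> S \<Longrightarrow> d \<le> dist x y \<Longrightarrow> k (x, y) \<le> C * weight y" "0 \<le> C"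
  shows "(\<integral>\<^sup>+z. indicator (S \<times> - N) z * F (snd z) \<partial>\<nu>)
    \<le> emeasure lborel S * (ennreal C * (\<integral>\<^sup>+y. F y * ennreal (weight y) \<partial>lborel))"
proof -
  have [measurable]: "S \<times> - N \<in> sets borel" by (simp add: borel_Times)
  have "(\<integral>\<^sup>+z. indicator (S \<times> - N) z * F (snd z) \<partial>\<nu>)
    = (\<integral>\<^sup>+x. \<integral>\<^sup>+y. indicator (S \<times> - N) (x, y) * F y * ennreal (k (x, y)) \<partial>lborel \<partial>lborel)"
    by (subst nn_integral_\<nu>) auto
  also have "\<dots> \<le> (\<integral>\<^sup>+x. \<integral>\<^sup>+y. indicator S x * (ennreal C * (F y * ennreal (weight y))) \<partial>lborel \<partial>lborel)"
  proof (intro nn_integral_mono)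
    fix x y
    show "indicator (S \<times> - N) (x, y) * F y * ennreal (k (x, y)) \<le> indicator S x * (ennreal C * (F y * ennreal (weight y)))"
    proof (cases "x \<in> S \<and> y \<notin> N")
      case True
      then have "ennreal (k (x, y)) \<le> ennreal C * ennreal (weight y)"
        using C(1)[of x y] d(2)[of x y] C(2) weight_pos[of y] by (simp add: ennreal_mult[symmetric] ennreal_leI)
      then have "F y * ennreal (k (x, y)) \<le> F y * (ennreal C * ennreal (weight y))" by (rule mult_left_mono) simp
      with True show ?thesis by (simp add: ac_simps)
    qed auto
  qed
  also have "\<dots> = emeasure lborel S * (ennreal C * (\<integral>\<^sup>+y. F y * ennreal (weight y) \<partial>lborel))"
  proof -
    have "(\<integral>\<^sup>+y. indicator S x * (ennreal C * (F y * ennreal (weight y))) \<partial>lborel)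
      = indicator S x * (ennreal C * (\<integral>\<^sup>+y. F y * ennreal (weight y) \<partial>lborel))" for x
      by (subst nn_integral_cmult, measurable)+
    then show ?thesis by (simp only:) (subst nn_integral_multc, auto)
  qed
  finally show ?thesis .
qed

text \<open>The kernel takes \<open>s * p\<close> from the exponent \<open>p\<close>, and
  \<open>p - s * p > 0\<close> remains. The measure of the first factor stays explicit, because in
  the Caccioppoli inequality that factor is the superlevel set.\<close>

lemma near_integral_le:
  obtains C where "0 \<le> C"
    "\<And>E B r. \<lbrakk>E \<in> sets borel; B \<in> sets borel; 0 < r; \<forall>x\<in>E. \<forall>y\<in>B. dist x y < r\<rbrakk> \<Longrightarrow>
      (\<integral>\<^sup>+z. indicator (E \<times> B) z * ennreal (norm (fst z - snd z) powr p) \<partial>\<nu>)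
        \<le> ennreal (C * r powr (p - s * p)) * emeasure lborel E"
proof -
  obtain C where C: "0 \<le> C" "\<And>(x::'a) r. 0 < r \<Longrightarrow>
       (\<integral>\<^sup>+y. indicator (ball x r) y * ennreal (norm (x - y) powr (p - s * p - real DIM('a))) \<partial>lborel)
       \<le> ennreal (C * r powr (p - s * p))"
    by (rule near_kernel_integral[where 'a='a, OF sp_pos(3)]) (rule that; assumption)
  show thesis
  proof (rule that[of "\<Lambda> * C"])
  show "0 \<le> \<Lambda> * C" using C \<Lambda> by simp
  fix E B :: "'a set" and r :: real
  assume [measurable]: "E \<in> sets borel" "B \<in> sets borel" and r: "0 < r"
    and dist: "\<forall>x\<in>E. \<forall>y\<in>B. dist x y < r"
  have [measurable]: "E \<times> B \<in> sets borel" by (simp add: borel_Times)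
  have "(\<integral>\<^sup>+z. indicator (E \<times> B) z * ennreal (norm (fst z - snd z) powr p) \<partial>\<nu>)
    = (\<integral>\<^sup>+x. \<integral>\<^sup>+y. indicator (E \<times> B) (x, y) * ennreal (norm (x - y) powr p) * ennreal (k (x, y)) \<partial>lborel \<partial>lborel)"
    by (subst nn_integral_\<nu>) auto
  also have "\<dots> \<le> (\<integral>\<^sup>+x. \<integral>\<^sup>+y. (indicator E x * ennreal \<Lambda>) * (indicator (ball x r) y * ennreal (norm (x - y) powr (p - s * p - real DIM('a)))) \<partial>lborel \<partial>lborel)"
  proof (intro nn_integral_mono)
    fix x y
    show "indicator (E \<times> B) (x, y) * ennreal (norm (x - y) powr p) * ennreal (k (x, y))
      \<le> (indicator E x * ennreal \<Lambda>) * (indicator (ball x r) y * ennreal (norm (x - y) powr (p - s * p - real DIM('a))))"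
    proof (cases "x \<in> E \<and> y \<in> B")
      case True
      have "norm (x - y) powr p * k (x, y) \<le> \<Lambda> * norm (x - y) powr (p - s * p - real DIM('a))"
      proof -
        have "norm (x - y) powr p * k (x, y) \<le> norm (x - y) powr p * (\<Lambda> * norm (x - y) powr - (real DIM('a) + s * p))"
          by (intro mult_left_mono k_upper) auto
        also have "\<dots> = \<Lambda> * (norm (x - y) powr p * norm (x - y) powr - (real DIM('a) + s * p))" by simp
        also have "\<dots> = \<Lambda> * norm (x - y) powr (p - s * p - real DIM('a))"
          by (subst powr_add[symmetric]) (simp add: algebra_simps)
        finally show ?thesis .
      qed
      then show ?thesis using True \<Lambda> k_nonneg dist
        by (simp add: ennreal_mult[symmetric] ennreal_leI)
    qed auto
  qed
  also have "\<dots> = (\<integral>\<^sup>+x. (indicator E x * ennreal \<Lambda>) * (\<integral>\<^sup>+y. (indicator (ball x r) y * ennreal (norm (x - y) powr (p - s * p - real DIM('a)))) \<partial>lborel) \<partial>lborel)"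
  proof (intro nn_integral_cong nn_integral_cmult)
    fix x :: 'a
    have [measurable]: "ball x r \<in> sets borel" by (rule borel_open) simp
    show "(\<lambda>y. indicator (ball x r) y * ennreal (norm (x - y) powr (p - s * p - real DIM('a)))) \<in> borel_measurable lborel"
      by measurable
  qed
  also have "\<dots> \<le> (\<integral>\<^sup>+x. (indicator E x * ennreal \<Lambda>) * ennreal (C * r powr (p - s * p)) \<partial>lborel)"
    using r by (intro nn_integral_mono mult_left_mono C) auto
  also have "\<dots> = emeasure lborel E * ennreal \<Lambda> * ennreal (C * r powr (p - s * p))"
    by (simp add: nn_integral_multc)
  also have "\<dots> = ennreal (\<Lambda> * C * r powr (p - s * p)) * emeasure lborel E"
    using \<Lambda> C by (simp add: ennreal_mult ac_simps)
  finally show "(\<integral>\<^sup>+z. indicator (E \<times> B) z * ennreal (norm (fst z - snd z) powr p) \<partial>\<nu>)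
        \<le> ennreal (\<Lambda> * C * r powr (p - s * p)) * emeasure lborel E" .
  qed
qed

lemma near_integral_finite:
  assumes "B \<in> sets borel" and "bounded B"
  shows "(\<integral>\<^sup>+z. indicator (B \<times> B) z * ennreal (norm (fst z - snd z) powr p) \<partial>\<nu>) < \<infinity>"
proof -
  obtain b where b: "0 < b" "\<And>x. x \<in> B \<Longrightarrow> norm x < b"
    using assms(2) by (meson bounded_pos_less)
  have dist: "\<forall>x\<in>B. \<forall>y\<in>B. dist x y < 2 * b"
  proof (intro ballI)
    fix x y assume "x \<in> B" "y \<in> B"
    then show "dist x y < 2 * b"
      using b(2)[of x] b(2)[of y] norm_triangle_ineq4[of x y] by (simp add: dist_norm)
  qed
  obtain C where C: "0 \<le> C"
    "\<And>E B r. \<lbrakk>E \<in> sets borel; B \<in> sets borel; 0 < r; \<forall>x\<in>E. \<forall>y\<in>B. dist x y < r\<rbrakk> \<Longrightarrow>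
      (\<integral>\<^sup>+z. indicator (E \<times> B) z * ennreal (norm (fst z - snd z) powr p) \<partial>\<nu>)
        \<le> ennreal (C * r powr (p - s * p)) * emeasure lborel E"
    by (rule near_integral_le) (rule that; assumption)
  have "(\<integral>\<^sup>+z. indicator (B \<times> B) z * ennreal (norm (fst z - snd z) powr p) \<partial>\<nu>)
    \<le> ennreal (C * (2 * b) powr (p - s * p)) * emeasure lborel B"
    using b by (intro C(2) assms dist) auto
  also have "\<dots> < \<infinity>"
    using emeasure_bounded_finite[OF assms(2)] by (simp add: ennreal_mult_less_top)
  finally show ?thesis .
qed

end

section \<open>Energies and the Caccioppoli inequality\<close>

lemma ennreal_integral_le_nn_integral:
  assumes "integrable M f"
  shows "ennreal (\<integral>x. f x \<partial>M) \<le> (\<integral>\<^sup>+x. ennreal (f x) \<partial>M)"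
proof -
  have fin: "(\<integral>\<^sup>+x. ennreal (f x) \<partial>M) < \<infinity>"
    using assms by (simp add: real_integrable_def less_top)
  have "(\<integral>x. f x \<partial>M) \<le> enn2real (\<integral>\<^sup>+x. ennreal (f x) \<partial>M)"
    using assms by (simp add: real_lebesgue_integral_def)
  then have "ennreal (\<integral>x. f x \<partial>M) \<le> ennreal (enn2real (\<integral>\<^sup>+x. ennreal (f x) \<partial>M))"
    by (rule ennreal_leI)
  also have "\<dots> = (\<integral>\<^sup>+x. ennreal (f x) \<partial>M)" using fin by simp
  finally show ?thesis .
qed

text \<open>A one-sided Vitali convergence theorem: by Fatou's lemma, uniform integrability is only
  needed up to an arbitrarily small multiple of a sequence bounded in \<open>L\<^sup>1\<close>.\<close>
lemma limit_integral_nonneg: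
  fixes F :: "nat \<Rightarrow> 'b \<Rightarrow> real"
  assumes F: "\<And>i. integrable M (F i)" "\<And>i. 0 \<le> (\<integral>x. F i x \<partial>M)"
    and f: "integrable M f" and lim: "AE x in M. (\<lambda>i. F i x) \<longlonglongrightarrow> f x"
    and B: "\<And>i. integrable M (B i)" "\<And>i x. 0 \<le> B i x" "\<And>i. (\<integral>x. B i x \<partial>M) \<le> W"
    and G: "\<And>\<epsilon>. 0 < \<epsilon> \<Longrightarrow> integrable M (G \<epsilon>)" "\<And>\<epsilon> i. 0 < \<epsilon> \<Longrightarrow> AE x in M. F i x \<le> G \<epsilon> x + \<epsilon> * B i x"
  shows "0 \<le> (\<integral>x. f x \<partial>M)"
proof -
  have "- (\<epsilon> * W) \<le> (\<integral>x. f x \<partial>M)" if e: "0 < \<epsilon>" for \<epsilon>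
  proof -
    note [measurable] = borel_measurable_integrable[OF F(1)] borel_measurable_integrable[OF f]
      borel_measurable_integrable[OF B(1)] borel_measurable_integrable[OF G(1)[OF e]]
    \<comment> \<open>Nonnegative almost everywhere, so Fatou's lemma applies. The term
      \<open>\<epsilon> * B i x\<close> is dropped in the lower limit, where it only helps, and
      costs \<open>\<epsilon> * W\<close> in the integrals.\<close>
    define X where "X i x = G \<epsilon> x + \<epsilon> * B i x - F i x" for i x
    have [measurable]: "X i \<in> borel_measurable M" for i unfolding X_def by measurable
    have intX: "integrable M (X i)" for i
      unfolding X_def by (intro Bochner_Integration.integrable_diff Bochner_Integration.integrable_add
          integrable_mult_right F B G e)
    have X_nn: "AE x in M. 0 \<le> X i x" for i
      using G(2)[OF e, of i] by eventually_elim (simp add: X_def)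
    have ub: "(\<integral>x. X i x \<partial>M) \<le> (\<integral>x. G \<epsilon> x \<partial>M) + \<epsilon> * W" for i
    proof -
      have "(\<integral>x. X i x \<partial>M) = (\<integral>x. G \<epsilon> x \<partial>M) + \<epsilon> * (\<integral>x. B i x \<partial>M) - (\<integral>x. F i x \<partial>M)"
        unfolding X_def using F(1) B(1) G(1)[OF e] by simp
      also have "\<dots> \<le> (\<integral>x. G \<epsilon> x \<partial>M) + \<epsilon> * W - 0"
        using e B(3)[of i] F(2)[of i] by (intro diff_mono add_left_mono mult_left_mono) auto
      finally show ?thesis by simp
    qed
    have "AE x in M. ennreal (G \<epsilon> x - f x) \<le> liminf (\<lambda>i. ennreal (X i x))"
    proof -
      from lim show ?thesis
      proof eventually_elim
        fix x assume l: "(\<lambda>i. F i x) \<longlonglongrightarrow> f x"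
        have "ennreal (G \<epsilon> x - f x) = liminf (\<lambda>i. ennreal (G \<epsilon> x - F i x))"
          by (intro lim_imp_Liminf[symmetric] tendsto_ennrealI tendsto_intros l) simp
        also have "\<dots> \<le> liminf (\<lambda>i. ennreal (X i x))"
          using e B(2) by (intro Liminf_mono always_eventually allI ennreal_leI) (simp add: X_def)
        finally show "ennreal (G \<epsilon> x - f x) \<le> liminf (\<lambda>i. ennreal (X i x))" .
      qed
    qed
    then have "(\<integral>\<^sup>+x. ennreal (G \<epsilon> x - f x) \<partial>M) \<le> (\<integral>\<^sup>+x. liminf (\<lambda>i. ennreal (X i x)) \<partial>M)"
      by (rule nn_integral_mono_AE)
    also have "\<dots> \<le> liminf (\<lambda>i. \<integral>\<^sup>+x. ennreal (X i x) \<partial>M)"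
      by (rule nn_integral_liminf) measurable
    also have "\<dots> \<le> liminf (\<lambda>i::nat. ennreal ((\<integral>x. G \<epsilon> x \<partial>M) + \<epsilon> * W))"
    proof (intro Liminf_mono always_eventually allI)
      fix i
      show "(\<integral>\<^sup>+x. ennreal (X i x) \<partial>M) \<le> ennreal ((\<integral>x. G \<epsilon> x \<partial>M) + \<epsilon> * W)"
        using nn_integral_eq_integral[OF intX X_nn, of i] ub[of i] by (simp add: ennreal_leI)
    qed
    also have "\<dots> = ennreal ((\<integral>x. G \<epsilon> x \<partial>M) + \<epsilon> * W)" by (simp add: Liminf_const)
    finally have le: "ennreal (\<integral>x. G \<epsilon> x - f x \<partial>M) \<le> ennreal ((\<integral>x. G \<epsilon> x \<partial>M) + \<epsilon> * W)"
      using ennreal_integral_le_nn_integral[OF Bochner_Integration.integrable_diff[OF G(1)[OF e] f]]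
      by (rule order_trans[rotated])
    have "0 \<le> (\<integral>x. X 0 x \<partial>M)" using X_nn by (rule integral_nonneg_AE)
    then have "0 \<le> (\<integral>x. G \<epsilon> x \<partial>M) + \<epsilon> * W" using ub[of 0] by linarith
    with le have "(\<integral>x. G \<epsilon> x - f x \<partial>M) \<le> (\<integral>x. G \<epsilon> x \<partial>M) + \<epsilon> * W"
      by (simp add: ennreal_le_iff)
    then show ?thesis using f G(1)[OF e] by simp
  qed
  note * = this
  show ?thesis
  proof (rule ccontr)
    assume neg: "\<not> 0 \<le> (\<integral>x. f x \<partial>M)"
    have "0 \<le> (\<integral>x. B 0 x \<partial>M)" by (rule Bochner_Integration.integral_nonneg) (rule B(2))
    then have W: "0 \<le> W" using B(3)[of 0] by linarith
    \<comment> \<open>Makes \<open>\<epsilon> * W\<close> at most half the size of the supposed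
      negative value; the 1 covers \<open>W = 0\<close>.\<close>
    define \<epsilon> where "\<epsilon> = - (\<integral>x. f x \<partial>M) / (2 * (W + 1))"
    have "0 < \<epsilon>" using neg W by (simp add: \<epsilon>_def divide_neg_pos)
    moreover have "\<epsilon> * W \<le> - (\<integral>x. f x \<partial>M) / 2"
    proof -
      have "\<epsilon> * W \<le> \<epsilon> * (W + 1)" using \<open>0 < \<epsilon>\<close> by simp
      also have "\<dots> = - (\<integral>x. f x \<partial>M) / 2" using W by (simp add: \<epsilon>_def field_simps)
      finally show ?thesis .
    qed
    ultimately show False using *[of \<epsilon>] neg by simp
  qed
qed

lemma nn_integral_le_of_integral_nonpos:
  fixes f P R :: "'b \<Rightarrow> real"
  assumes f: "integrable M f" "(\<integral>x. f x \<partial>M) \<le> 0"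
    and [measurable]: "P \<in> borel_measurable M" "R \<in> borel_measurable M"
    and nn: "\<And>x. 0 \<le> P x" "\<And>x. 0 \<le> R x" and le: "AE x in M. P x \<le> f x + R x"
  shows "(\<integral>\<^sup>+x. ennreal (P x) \<partial>M) \<le> (\<integral>\<^sup>+x. ennreal (R x) \<partial>M)"
proof (cases "(\<integral>\<^sup>+x. ennreal (R x) \<partial>M) < \<infinity>")
  case True
  then have R: "integrable M R"
    using nn by (intro integrableI_nonneg) auto
  have "AE x in M. norm (P x) \<le> norm (f x + R x)"
    using le
  proof eventually_elim
    fix x assume "P x \<le> f x + R x"
    then show "norm (P x) \<le> norm (f x + R x)" using nn(1)[of x] by simp
  qed
  then have P: "integrable M P"
    by (intro Bochner_Integration.integrable_bound[OF Bochner_Integration.integrable_add[OF f(1) R]]) auto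
  have "(\<integral>x. P x \<partial>M) \<le> (\<integral>x. f x + R x \<partial>M)"
    using P R f le by (intro integral_mono_AE) auto
  also have "\<dots> \<le> (\<integral>x. R x \<partial>M)" using R f by simp
  finally show ?thesis
    using P R nn by (simp add: nn_integral_eq_integral ennreal_leI)
qed (simp add: less_top[symmetric])

context nonlocal_kernel
begin

definition energy :: "'a set \<Rightarrow> ('a \<Rightarrow> real) \<Rightarrow> ennreal"
  where "energy N f = (\<integral>\<^sup>+z. indicator (N \<times> N) z * ennreal (\<bar>f (fst z) - f (snd z)\<bar> powr p) \<partial>\<nu>)"

definition form :: "('a \<Rightarrow> real) \<Rightarrow> ('a \<Rightarrow> real) \<Rightarrow> 'a \<times> 'a \<Rightarrow> real"
  where "form f h z = phi p (f (fst z) - f (snd z)) * (h (fst z) - h (snd z))"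

text \<open>The positive distance is what lets the weight dominate the kernel on
  \<open>S \<times> - N\<close>.\<close>

definition separated :: "'a set \<Rightarrow> 'a set \<Rightarrow> bool"
  where "separated S N \<longleftrightarrow> S \<in> sets borel \<and> N \<in> sets borel \<and> bounded N \<and> S \<subseteq> N \<and>
    (\<exists>d>0. \<forall>x\<in>S. \<forall>y. y \<notin> N \<longrightarrow> d \<le> dist x y)"

text \<open>Majorant of a form whose test function vanishes off \<open>S\<close>, on pairs of a
  point of \<open>S\<close> and a point outside \<open>N\<close>; \<open>b\<close> stands for a
  bound of \<open>f\<close> on \<open>N\<close>. Outer values occur only with the power
  \<open>p - 1\<close>, so a finite tail makes it integrable.\<close>

definition far :: "'a set \<Rightarrow> 'a set \<Rightarrow> real \<Rightarrow> ('a \<Rightarrow> real) \<Rightarrow> 'a \<times> 'a \<Rightarrow> real"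
  where "far S N b f z =
    indicator (S \<times> - N) z * (b powr (p - 1) + \<bar>f (snd z)\<bar> powr (p - 1)) +
    indicator ((- N) \<times> S) z * (b powr (p - 1) + \<bar>f (fst z)\<bar> powr (p - 1))"

lemma form_borel [measurable]:
  assumes [measurable]: "f \<in> borel_measurable borel" "h \<in> borel_measurable borel"
  shows "form f h \<in> borel_measurable borel"
  unfolding form_def by measurable

lemma Times_borel [measurable]: "A \<in> sets borel \<Longrightarrow> B \<in> sets borel \<Longrightarrow> A \<times> B \<in> sets (borel :: ('a \<times> 'a) measure)"
  by (simp add: borel_Times)

lemma far_borel [measurable]:
  assumes [measurable]: "S \<in> sets borel" "N \<in> sets borel" "f \<in> borel_measurable borel"
  shows "far S N b f \<in> borel_measurable borel"
  unfolding far_def by measurable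

lemma far_nonneg: "0 \<le> far S N b f z"
  unfolding far_def by (intro add_nonneg_nonneg mult_nonneg_nonneg) auto

lemma far_integrable:
  assumes sep: "separated S N" and [measurable]: "f \<in> borel_measurable borel" and tail: "tail_finite f"
  shows "integrable \<nu> (far S N b f)"
proof -
  have [measurable]: "S \<in> sets borel" "N \<in> sets borel" and SN: "bounded N" "S \<subseteq> N"
    using sep by (auto simp: separated_def)
  obtain d where d: "0 < d" "\<forall>x\<in>S. \<forall>y. y \<notin> N \<longrightarrow> d \<le> dist x y" using sep by (auto simp: separated_def)
  obtain r where r: "\<forall>x\<in>S. norm x \<le> r" using SN bounded_subset by (metis bounded_iff)
  obtain C where C: "0 \<le> C" "\<And>x y. norm x \<le> r \<Longrightarrow> d \<le> dist x y \<Longrightarrow> k (x, y) \<le> C * weight y"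
    using kernel_le_weight[OF d(1)] by blast
  define F where "F y = ennreal (b powr (p - 1) + \<bar>f y\<bar> powr (p - 1))" for y
  have [measurable]: "F \<in> borel_measurable borel" unfolding F_def by measurable
  have "(\<integral>\<^sup>+y. F y * ennreal (weight y) \<partial>lborel)
      = (\<integral>\<^sup>+y. ennreal (b powr (p - 1)) * ennreal (weight y) + ennreal (\<bar>f y\<bar> powr (p - 1) * weight y) \<partial>lborel)"
    using weight_pos by (intro nn_integral_cong) (simp add: F_def distrib_right less_imp_le ennreal_mult)
  also have "\<dots> = ennreal (b powr (p - 1)) * (\<integral>\<^sup>+y. ennreal (weight y) \<partial>lborel)
      + (\<integral>\<^sup>+y. ennreal (\<bar>f y\<bar> powr (p - 1) * weight y) \<partial>lborel)"
    by (subst nn_integral_add) (auto simp: nn_integral_cmult)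
  also have "\<dots> < \<infinity>"
    using weight_finite tail by (simp add: tail_finite_def ennreal_mult_less_top)
  finally have Fw: "(\<integral>\<^sup>+y. F y * ennreal (weight y) \<partial>lborel) < \<infinity>" .
  have 1: "(\<integral>\<^sup>+z. indicator (S \<times> - N) z * F (snd z) \<partial>\<nu>) < \<infinity>"
  proof -
    have "(\<integral>\<^sup>+z. indicator (S \<times> - N) z * F (snd z) \<partial>\<nu>)
      \<le> emeasure lborel S * (ennreal C * (\<integral>\<^sup>+y. F y * ennreal (weight y) \<partial>lborel))"
      using d r C by (intro far_integral_le[of S N F d C]) auto
    also have "\<dots> < \<infinity>"
      using Fw emeasure_bounded_finite[OF bounded_subset[OF SN]] by (simp add: ennreal_mult_less_top)
    finally show ?thesis .
  qed
  have 2: "(\<integral>\<^sup>+z. indicator ((- N) \<times> S) z * F (fst z) \<partial>\<nu>) < \<infinity>"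
  proof -
    have "(\<integral>\<^sup>+z. indicator ((- N) \<times> S) z * F (fst z) \<partial>\<nu>)
      = (\<integral>\<^sup>+z. indicator (S \<times> - N) (snd z, fst z) * F (snd (snd z, fst z)) \<partial>\<nu>)"
      by (intro nn_integral_cong) (auto simp: indicator_def mem_Times_iff)
    also have "\<dots> = (\<integral>\<^sup>+z. indicator (S \<times> - N) z * F (snd z) \<partial>\<nu>)"
      by (rule nn_integral_\<nu>_swap) measurable
    finally show ?thesis using 1 by simp
  qed
  have "(\<integral>\<^sup>+z. ennreal (far S N b f z) \<partial>\<nu>)
     = (\<integral>\<^sup>+z. indicator (S \<times> - N) z * F (snd z) + indicator ((- N) \<times> S) z * F (fst z) \<partial>\<nu>)"
    by (intro nn_integral_cong) (auto simp: far_def F_def indicator_def)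
  also have "\<dots> = (\<integral>\<^sup>+z. indicator (S \<times> - N) z * F (snd z) \<partial>\<nu>) + (\<integral>\<^sup>+z. indicator ((- N) \<times> S) z * F (fst z) \<partial>\<nu>)"
    by (subst nn_integral_add) (auto simp: borel_measurable_\<nu>)
  also have "\<dots> < \<infinity>" using 1 2 by simp
  finally show ?thesis
    by (intro integrableI_nonneg) (auto simp: far_nonneg borel_measurable_\<nu>)
qed

text \<open>A pair contributes only if one of its points lies in \<open>S\<close>. If the other one
  is outside \<open>N\<close>, the increment of \<open>h\<close> is a single value of
  \<open>h\<close>, hence at most \<open>c\<close>.\<close>

lemma form_le_far:
  assumes "S \<subseteq> N" "\<And>x. x \<notin> S \<Longrightarrow> h x = 0" "\<And>x. \<bar>h x\<bar> \<le> c" "\<And>x. x \<in> N \<Longrightarrow> \<bar>f x\<bar> \<le> b"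
  shows "\<bar>form f h z\<bar> \<le> indicator (N \<times> N) z * (\<bar>f (fst z) - f (snd z)\<bar> powr (p - 1) * \<bar>h (fst z) - h (snd z)\<bar>)
    + 2 powr (p - 1) * c * far S N b f z"
proof -
  obtain x y where z: "z = (x, y)" by (cases z)
  have c: "0 \<le> c" using assms(3)[of undefined] by linarith
  have bound: "\<bar>f x - f y\<bar> powr (p - 1) * \<bar>h x\<bar> \<le> 2 powr (p - 1) * c * (b powr (p - 1) + \<bar>f y\<bar> powr (p - 1))"
    if "x \<in> N" for x y
  proof -
    have "\<bar>f x - f y\<bar> powr (p - 1) \<le> 2 powr (p - 1) * (\<bar>f x\<bar> powr (p - 1) + \<bar>f y\<bar> powr (p - 1))"
      using p by (intro abs_diff_powr_le) auto
    also have "\<dots> \<le> 2 powr (p - 1) * (b powr (p - 1) + \<bar>f y\<bar> powr (p - 1))"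
      using p assms(4)[OF that] by (intro mult_left_mono add_right_mono powr_mono2) auto
    finally have "\<bar>f x - f y\<bar> powr (p - 1) * \<bar>h x\<bar> \<le> (2 powr (p - 1) * (b powr (p - 1) + \<bar>f y\<bar> powr (p - 1))) * c"
      using assms(3)[of x] c by (intro mult_mono) auto
    then show ?thesis by (simp add: ac_simps)
  qed
  have eq: "\<bar>form f h z\<bar> = \<bar>f x - f y\<bar> powr (p - 1) * \<bar>h x - h y\<bar>"
    by (simp add: form_def z abs_mult abs_phi)
  have far_nn: "0 \<le> 2 powr (p - 1) * c * far S N b f z" using c far_nonneg by simp
  consider "x \<in> N" "y \<in> N" | "x \<in> S" "y \<notin> N" | "x \<notin> N" "y \<in> S" | "x \<notin> S" "y \<notin> S"
    using assms(1) by blast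
  then show ?thesis
  proof cases
    case 1
    then show ?thesis using far_nn unfolding eq by (simp add: z)
  next
    case 2
    then have "h y = 0" using assms(1,2) by blast
    then show ?thesis using 2 bound[of x y] assms(1) unfolding eq by (auto simp: z far_def)
  next
    case 3
    then have "h x = 0" using assms(1,2) by blast
    then show ?thesis using 3 bound[of y x] assms(1) unfolding eq by (auto simp: z far_def abs_minus_commute)
  next
    case 4
    then have "h x = 0" "h y = 0" using assms(2) by auto
    then show ?thesis using far_nn unfolding eq by (auto simp: indicator_def)
  qed
qed

lemma near_integrable:
  assumes [measurable]: "N \<in> sets borel" "f \<in> borel_measurable borel" and "energy N f < \<infinity>"
  shows "integrable \<nu> (\<lambda>z. indicator (N \<times> N) z * \<bar>f (fst z) - f (snd z)\<bar> powr p)"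
proof (intro integrableI_nonneg)
  have "(\<integral>\<^sup>+z. ennreal (indicator (N \<times> N) z * \<bar>f (fst z) - f (snd z)\<bar> powr p) \<partial>\<nu>) = energy N f"
    unfolding energy_def by (intro nn_integral_cong) (auto simp: indicator_def)
  then show "(\<integral>\<^sup>+z. ennreal (indicator (N \<times> N) z * \<bar>f (fst z) - f (snd z)\<bar> powr p) \<partial>\<nu>) < \<infinity>"
    using assms(3) by simp
qed (auto simp: borel_measurable_\<nu>)

text \<open>Young's inequality with parameter 1 splits the near part into the energies of
  \<open>f\<close> and \<open>h\<close>; the far part is covered by \<open>far\<close>.\<close>

lemma form_integrable:
  assumes sep: "separated S N" and [measurable]: "f \<in> borel_measurable borel" "h \<in> borel_measurable borel"
    and "tail_finite f" and "\<And>x. x \<notin> S \<Longrightarrow> h x = 0" "\<And>x. \<bar>h x\<bar> \<le> c" "\<And>x. x \<in> N \<Longrightarrow> \<bar>f x\<bar> \<le> b"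
    and "energy N f < \<infinity>" "energy N h < \<infinity>"
  shows "integrable \<nu> (form f h)"
proof -
  have [measurable]: "S \<in> sets borel" "N \<in> sets borel" and SN: "S \<subseteq> N"
    using sep by (auto simp: separated_def)
  define g where "g z = indicator (N \<times> N) z * \<bar>f (fst z) - f (snd z)\<bar> powr p
     + indicator (N \<times> N) z * \<bar>h (fst z) - h (snd z)\<bar> powr p + 2 powr (p - 1) * c * far S N b f z" for z
  have "integrable \<nu> g" unfolding g_def
    by (intro Bochner_Integration.integrable_add near_integrable integrable_mult_right far_integrable assms) auto
  moreover have "\<bar>form f h z\<bar> \<le> g z" for z
  proof -
    have "\<bar>f (fst z) - f (snd z)\<bar> powr (p - 1) * \<bar>h (fst z) - h (snd z)\<bar>
        \<le> \<bar>f (fst z) - f (snd z)\<bar> powr p + \<bar>h (fst z) - h (snd z)\<bar> powr p"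
      using young_powr[of "\<bar>f (fst z) - f (snd z)\<bar>" "\<bar>h (fst z) - h (snd z)\<bar>" 1 p] p by simp
    then have "indicator (N \<times> N) z * (\<bar>f (fst z) - f (snd z)\<bar> powr (p - 1) * \<bar>h (fst z) - h (snd z)\<bar>)
      \<le> indicator (N \<times> N) z * (\<bar>f (fst z) - f (snd z)\<bar> powr p + \<bar>h (fst z) - h (snd z)\<bar> powr p)"
      by (intro mult_left_mono) auto
    with form_le_far[where S = S and N = N and h = h and f = f and z = z, OF SN assms(5,6,7)] show ?thesis
      unfolding g_def distrib_left by linarith
  qed
  ultimately show ?thesis
    by (intro Bochner_Integration.integrable_bound[of \<nu> g "form f h"])
      (auto simp: borel_measurable_\<nu> intro!: AE_I2 intro: order_trans[OF _ abs_ge_self])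
qed

text \<open>Tests with the excess of \<open>v\<close> over \<open>l\<close>. The left side is not
  reduced to increments of \<open>h\<close>: if \<open>v\<close> is above \<open>l\<close> at one
  point and far below at the other, the factor with exponent \<open>p - 1\<close> records the whole
  gap. The slope of \<open>l\<close> enters as the perturbation in
  \<open>phi_shift_lower\<close>.\<close>

lemma caccioppoli:
  fixes v l :: "'a \<Rightarrow> real"
  assumes [measurable]: "v \<in> borel_measurable borel" "l \<in> borel_measurable borel" "B \<in> sets borel"
    and h: "h = (\<lambda>x. if x \<in> B then max 0 (v x - l x) else 0)"
    and E: "E = {x \<in> B. l x < v x}"
    and L: "0 \<le> L" "\<forall>x\<in>B. \<forall>y\<in>B. \<bar>l x - l y\<bar> \<le> L * norm (x - y)"
    and int: "integrable \<nu> (form v h)" "(\<integral>z. form v h z \<partial>\<nu>) \<le> 0"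
  shows "(\<integral>\<^sup>+z. indicator (B \<times> B) z * ennreal (\<bar>(v (fst z) - l (fst z)) - (v (snd z) - l (snd z))\<bar> powr (p - 1)
            * \<bar>h (fst z) - h (snd z)\<bar>) \<partial>\<nu>)
    \<le> ennreal (2 powr p) * (ennreal (4 * 3 powr p * L powr p) *
          (\<integral>\<^sup>+z. indicator (E \<times> B) z * ennreal (norm (fst z - snd z) powr p) \<partial>\<nu>)
        + (\<integral>\<^sup>+z. indicator (E \<times> - B) z * ennreal ((max 0 (v (snd z) - v (fst z))) powr (p - 1) * h (fst z)) \<partial>\<nu>))"
proof -
  define T where "T z = \<bar>(v (fst z) - l (fst z)) - (v (snd z) - l (snd z))\<bar> powr (p - 1) * \<bar>h (fst z) - h (snd z)\<bar>" for z
  \<comment> \<open>\<open>r1\<close> pays for the slope of \<open>l\<close>, \<open>r2\<close> for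
    points outside \<open>B\<close> where \<open>v\<close> is larger than at the tested point. Both
    are written for one order of the pair; adding the copy under \<open>sw\<close> makes up for this
    and doubles the integral.\<close>
  define r1 where "r1 z = 4 * 3 powr p * L powr p * (indicator (E \<times> B) z * norm (fst z - snd z) powr p)" for z
  define r2 where "r2 z = indicator (E \<times> - B) z * ((max 0 (v (snd z) - v (fst z))) powr (p - 1) * h (fst z))" for z
  define sw where "sw z = (snd z, fst z)" for z :: "'a \<times> 'a"
  have [measurable]: "sw \<in> borel_measurable borel"
    unfolding sw_def by (intro borel_measurable_continuous_onI continuous_intros)
  have [measurable]: "h \<in> borel_measurable borel" unfolding h by measurable
  have [measurable]: "E \<in> sets borel" unfolding E by measurable
  have [measurable]: "r1 \<in> borel_measurable borel" "r2 \<in> borel_measurable borel" "T \<in> borel_measurable borel"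
    unfolding r1_def r2_def T_def by measurable
  have h_nn: "0 \<le> h x" for x by (simp add: h)
  have r_nn: "0 \<le> r1 z" "0 \<le> r2 z" for z using h_nn by (auto simp: r1_def r2_def)
  have T_nn: "0 \<le> T z" for z by (auto simp: T_def)
  define P where "P z = 2 powr (1 - p) * (indicator (B \<times> B) z * T z)" for z
  define R where "R z = (r1 z + r1 (sw z)) + (r2 z + r2 (sw z))" for z
  have h_out: "h x = 0" if "x \<notin> E" for x using that by (auto simp: h E)
  have EB: "E \<subseteq> B" by (auto simp: E)
  have off: "- r2 (x, y) \<le> phi p (v x - v y) * h x" if "x \<in> E" "y \<notin> B" for x y
  proof -
    have "- ((max 0 (v y - v x)) powr (p - 1)) \<le> phi p (v x - v y)"
    proof (cases "v y \<le> v x")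
      case True
      then show ?thesis using p by (simp add: phi_nonneg_eq max_def)
    next
      case False
      then have "phi p (v x - v y) = - ((v y - v x) powr (p - 1))"
        using phi_minus[of p "v y - v x"] by (simp add: phi_nonneg_eq)
      then show ?thesis using False by (simp add: max_def)
    qed
    then have "- ((max 0 (v y - v x)) powr (p - 1)) * h x \<le> phi p (v x - v y) * h x"
      using h_nn by (rule mult_right_mono)
    then show ?thesis using that by (simp add: r2_def)
  qed
  have "P z \<le> form v h z + R z" for z
  proof -
    obtain x y where z: "z = (x, y)" by (cases z)
    have rs: "0 \<le> r1 (x, y)" "0 \<le> r1 (y, x)" "0 \<le> r2 (x, y)" "0 \<le> r2 (y, x)" using r_nn by auto
    \<comment> \<open>Pairs in \<open>B\<close> with neither point in \<open>E\<close> belong to the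
      last case, as \<open>h\<close> vanishes at both. Hence the slope error is integrated over
      \<open>E \<times> B\<close> only and is controlled by the measure of \<open>E\<close>.\<close>
    consider "x \<in> B" "y \<in> B" "x \<in> E \<or> y \<in> E" | "x \<in> E" "y \<notin> B" | "x \<notin> B" "y \<in> E" | "x \<notin> E" "y \<notin> E"
      using EB by blast
    then show ?thesis
    proof cases
      case 1
      define t where "t = (v x - l x) - (v y - l y)"
      define e where "e = l x - l y"
      have te: "v x - v y = t + e" by (simp add: t_def e_def)
      have sgn: "0 \<le> t * (h x - h y)" "\<bar>h x - h y\<bar> \<le> \<bar>t\<bar>"
        using 1 by (auto simp: h t_def max_def zero_le_mult_iff)
      have low: "2 powr (1 - p) * (\<bar>t\<bar> powr (p - 1) * \<bar>h x - h y\<bar>) - 4 * 3 powr p * \<bar>e\<bar> powr p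
          \<le> phi p (t + e) * (h x - h y)"
        by (rule phi_shift_lower[OF p sgn])
      have "\<bar>e\<bar> powr p \<le> (L * norm (x - y)) powr p"
        using L 1 p by (intro powr_mono2) (auto simp: e_def)
      also have "\<dots> = L powr p * norm (x - y) powr p" using L by (simp add: powr_mult)
      finally have "4 * 3 powr p * \<bar>e\<bar> powr p \<le> 4 * 3 powr p * (L powr p * norm (x - y) powr p)"
        by (intro mult_left_mono) auto
      also have "\<dots> \<le> r1 (x, y) + r1 (y, x)"
        using 1 rs by (auto simp: r1_def norm_minus_commute)
      finally show ?thesis
        using low rs 1 by (simp add: P_def R_def T_def z form_def sw_def te t_def[symmetric])
    next
      case 2
      then have "h y = 0" using h_out EB by blast
      then show ?thesis using off[OF 2] rs 2 by (simp add: P_def R_def form_def z sw_def)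
    next
      case 3
      then have "h x = 0" using h_out EB by blast
      moreover have "phi p (v x - v y) = - phi p (v y - v x)"
        using phi_minus[of p "v y - v x"] by simp
      ultimately show ?thesis using off[OF 3(2,1)] rs 3 by (simp add: P_def R_def form_def z sw_def)
    next
      case 4
      then have "h x = 0" "h y = 0" using h_out by auto
      then show ?thesis using rs by (simp add: P_def R_def form_def z sw_def T_def)
    qed
  qed
  then have "(\<integral>\<^sup>+z. ennreal (P z) \<partial>\<nu>) \<le> (\<integral>\<^sup>+z. ennreal (R z) \<partial>\<nu>)"
    using r_nn T_nn
    by (intro nn_integral_le_of_integral_nonpos[OF int])
       (auto simp: P_def R_def borel_measurable_\<nu>)
  also have "(\<integral>\<^sup>+z. ennreal (R z) \<partial>\<nu>) = ((\<integral>\<^sup>+z. ennreal (r1 z) \<partial>\<nu>) + (\<integral>\<^sup>+z. ennreal (r1 (sw z)) \<partial>\<nu>))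
     + ((\<integral>\<^sup>+z. ennreal (r2 z) \<partial>\<nu>) + (\<integral>\<^sup>+z. ennreal (r2 (sw z)) \<partial>\<nu>))"
    unfolding R_def using r_nn by (simp add: nn_integral_add borel_measurable_\<nu>)
  also have "(\<integral>\<^sup>+z. ennreal (r1 (sw z)) \<partial>\<nu>) = (\<integral>\<^sup>+z. ennreal (r1 z) \<partial>\<nu>)"
    unfolding sw_def by (rule nn_integral_\<nu>_swap[of "\<lambda>z. ennreal (r1 z)"]) measurable
  also have "(\<integral>\<^sup>+z. ennreal (r2 (sw z)) \<partial>\<nu>) = (\<integral>\<^sup>+z. ennreal (r2 z) \<partial>\<nu>)"
    unfolding sw_def by (rule nn_integral_\<nu>_swap[of "\<lambda>z. ennreal (r2 z)"]) measurable
  finally have main: "(\<integral>\<^sup>+z. ennreal (P z) \<partial>\<nu>) \<le> 2 * ((\<integral>\<^sup>+z. ennreal (r1 z) \<partial>\<nu>) + (\<integral>\<^sup>+z. ennreal (r2 z) \<partial>\<nu>))"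
    by (simp add: mult_2 algebra_simps)
  have "(\<integral>\<^sup>+z. ennreal (r1 z) \<partial>\<nu>) = ennreal (4 * 3 powr p * L powr p) *
          (\<integral>\<^sup>+z. indicator (E \<times> B) z * ennreal (norm (fst z - snd z) powr p) \<partial>\<nu>)"
    unfolding r1_def
    by (subst nn_integral_cmult[symmetric])
       (auto simp: borel_measurable_\<nu> indicator_def ennreal_mult[symmetric] intro!: nn_integral_cong)
  note eq1 = this
  have eq2: "(\<integral>\<^sup>+z. ennreal (r2 z) \<partial>\<nu>) =
      (\<integral>\<^sup>+z. indicator (E \<times> - B) z * ennreal ((max 0 (v (snd z) - v (fst z))) powr (p - 1) * h (fst z)) \<partial>\<nu>)"
    unfolding r2_def by (intro nn_integral_cong) (auto simp: indicator_def)
  have eqT: "(\<integral>\<^sup>+z. indicator (B \<times> B) z * ennreal (T z) \<partial>\<nu>) = ennreal (2 powr (p - 1)) * (\<integral>\<^sup>+z. ennreal (P z) \<partial>\<nu>)"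
  proof -
    have "2 powr (p - 1) * P z = indicator (B \<times> B) z * T z" for z
    proof -
      have "2 powr (p - 1) * 2 powr (1 - p) = (1::real)" by (simp add: powr_add[symmetric])
      then show ?thesis by (simp add: P_def)
    qed
    then have "indicator (B \<times> B) z * ennreal (T z) = ennreal (2 powr (p - 1)) * ennreal (P z)" for z
      using T_nn[of z] by (auto simp: ennreal_mult[symmetric] P_def indicator_def)
    then show ?thesis
      by (simp only:) (subst nn_integral_cmult, auto simp: borel_measurable_\<nu> P_def)
  qed
  have two: "ennreal (2 powr (p - 1)) * (2 * X) = ennreal (2 powr p) * X" for X :: ennreal
  proof -
    have "ennreal (2 powr (p - 1)) * 2 = ennreal (2 powr (p - 1) * 2)" by (simp add: ennreal_mult)
    also have "\<dots> = ennreal (2 powr p)" by (simp add: powr_diff)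
    finally show ?thesis by (simp add: mult.assoc[symmetric])
  qed
  have le: "ennreal (2 powr (p - 1)) * (\<integral>\<^sup>+z. ennreal (P z) \<partial>\<nu>) \<le>
     ennreal (2 powr (p - 1)) * (2 * ((\<integral>\<^sup>+z. ennreal (r1 z) \<partial>\<nu>) + (\<integral>\<^sup>+z. ennreal (r2 z) \<partial>\<nu>)))"
    using main by (rule mult_left_mono) simp
  have "(\<integral>\<^sup>+z. indicator (B \<times> B) z * ennreal (T z) \<partial>\<nu>)
      \<le> ennreal (2 powr p) * ((\<integral>\<^sup>+z. ennreal (r1 z) \<partial>\<nu>) + (\<integral>\<^sup>+z. ennreal (r2 z) \<partial>\<nu>))"
    unfolding eqT using le by (simp only: two)
  then show ?thesis unfolding eq1 eq2 T_def .
qed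

end

section \<open>De Giorgi's oscillation lemma\<close>

text \<open>A geometric bound \<open>\<epsilon> * \<theta> ^ i\<close> reproduces itself under the
  recursion, because the superlinear power outweighs the growth \<open>b ^ i\<close>. The cap
  \<open>\<epsilon>1\<close> reflects that the recursion is available only for small values.\<close>

lemma superlinear_recursion_tendsto_0:
  fixes C b \<beta> \<epsilon>1 :: real
  assumes "0 < C" "1 < b" "0 < \<beta>" "0 < \<epsilon>1"
  obtains \<epsilon> where "0 < \<epsilon>" "\<epsilon> \<le> \<epsilon>1"
    "\<forall>\<alpha>::nat \<Rightarrow> real. (\<forall>i. 0 \<le> \<alpha> i) \<longrightarrow> \<alpha> 0 \<le> \<epsilon> \<longrightarrow>
       (\<forall>i. \<alpha> i \<le> \<epsilon>1 \<longrightarrow> \<alpha> (Suc i) \<le> C * b ^ i * \<alpha> i powr (1 + \<beta>)) \<longrightarrow> \<alpha> \<longlonglongrightarrow> 0"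
proof
  \<comment> \<open>Chosen so that \<open>b * \<theta> powr \<beta> = 1\<close>, which cancels the
    growth; \<open>\<epsilon>\<close> then makes the remaining factor
    \<open>C * \<epsilon> powr \<beta>\<close> at most \<open>\<theta>\<close>.\<close>
  define \<theta> where "\<theta> = b powr (- 1 / \<beta>)"
  define \<epsilon> where "\<epsilon> = min \<epsilon>1 ((\<theta> / C) powr (1 / \<beta>))"
  have \<theta>: "0 < \<theta>" "\<theta> < 1" "b * \<theta> powr \<beta> = 1"
  proof -
    show "0 < \<theta>" "\<theta> < 1"
      using assms powr_less_mono[of "- 1 / \<beta>" 0 b] by (auto simp: \<theta>_def)
    have "\<theta> powr \<beta> = b powr - 1" using assms by (simp add: \<theta>_def powr_powr)
    then show "b * \<theta> powr \<beta> = 1" using assms by (simp add: powr_minus_divide)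
  qed
  show e: "0 < \<epsilon>" "\<epsilon> \<le> \<epsilon>1" using assms \<theta> by (auto simp: \<epsilon>_def)
  have e\<beta>: "C * \<epsilon> powr \<beta> \<le> \<theta>"
  proof -
    have "\<epsilon> powr \<beta> \<le> ((\<theta> / C) powr (1 / \<beta>)) powr \<beta>"
      using e assms by (intro powr_mono2) (auto simp: \<epsilon>_def)
    also have "\<dots> = \<theta> / C" using assms \<theta> by (simp add: powr_powr)
    finally show ?thesis using assms by (simp add: field_simps)
  qed
  show "\<forall>\<alpha>::nat \<Rightarrow> real. (\<forall>i. 0 \<le> \<alpha> i) \<longrightarrow> \<alpha> 0 \<le> \<epsilon> \<longrightarrow>
       (\<forall>i. \<alpha> i \<le> \<epsilon>1 \<longrightarrow> \<alpha> (Suc i) \<le> C * b ^ i * \<alpha> i powr (1 + \<beta>)) \<longrightarrow> \<alpha> \<longlonglongrightarrow> 0"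
  proof (intro allI impI)
    fix \<alpha> :: "nat \<Rightarrow> real"
    assume nn: "\<forall>i. 0 \<le> \<alpha> i" and 0: "\<alpha> 0 \<le> \<epsilon>"
      and rec: "\<forall>i. \<alpha> i \<le> \<epsilon>1 \<longrightarrow> \<alpha> (Suc i) \<le> C * b ^ i * \<alpha> i powr (1 + \<beta>)"
    have bound: "\<alpha> i \<le> \<epsilon> * \<theta> ^ i" for i
    proof (induction i)
      case 0 then show ?case using \<open>\<alpha> 0 \<le> \<epsilon>\<close> by simp
    next
      case (Suc i)
      have "\<epsilon> * \<theta> ^ i \<le> \<epsilon> * 1" using e \<theta> by (intro mult_left_mono power_le_one) auto
      then have "\<alpha> i \<le> \<epsilon>1" using Suc e by linarith
      then have "\<alpha> (Suc i) \<le> C * b ^ i * \<alpha> i powr (1 + \<beta>)" using rec by blast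
      also have "\<dots> \<le> C * b ^ i * (\<epsilon> * \<theta> ^ i) powr (1 + \<beta>)"
        using Suc nn assms by (intro mult_left_mono powr_mono2) auto
      also have "(\<epsilon> * \<theta> ^ i) powr (1 + \<beta>) = (\<epsilon> * \<theta> ^ i) * (\<epsilon> powr \<beta> * (\<theta> powr \<beta>) ^ i)"
      proof -
        have "(\<epsilon> * \<theta> ^ i) powr (1 + \<beta>) = (\<epsilon> * \<theta> ^ i) * (\<epsilon> * \<theta> ^ i) powr \<beta>"
          using e \<theta> by (simp add: powr_add)
        moreover have "(\<epsilon> * \<theta> ^ i) powr \<beta> = \<epsilon> powr \<beta> * (\<theta> powr \<beta>) ^ i"
          using e \<theta> by (simp add: powr_mult powr_powr powr_realpow[symmetric] mult.commute)
        ultimately show ?thesis by simp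
      qed
      also have "C * b ^ i * ((\<epsilon> * \<theta> ^ i) * (\<epsilon> powr \<beta> * (\<theta> powr \<beta>) ^ i))
          = (C * \<epsilon> powr \<beta>) * (b * \<theta> powr \<beta>) ^ i * (\<epsilon> * \<theta> ^ i)"
        by (simp add: power_mult_distrib)
      also have "\<dots> \<le> \<theta> * (\<epsilon> * \<theta> ^ i)"
        using e\<beta> \<theta> e by (simp only: \<theta>(3) power_one mult_1_right) (intro mult_right_mono, auto)
      finally show ?case by (simp add: ac_simps)
    qed
    have lim: "(\<lambda>i. \<epsilon> * \<theta> ^ i) \<longlonglongrightarrow> 0"
      using \<theta> by (intro tendsto_mult_right_zero LIMSEQ_realpow_zero) auto
    show "\<alpha> \<longlonglongrightarrow> 0"
      by (rule tendsto_sandwich[OF _ _ tendsto_const lim]) (use nn bound in auto)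
  qed
qed

text \<open>0 within \<open>R / 4\<close>, 1 beyond \<open>R / 2\<close>, slope
  \<open>4 / R\<close>. It is added to the level instead of being multiplied into the test function:
  a raised level localizes the truncation by itself.\<close>

definition ramp :: "'a::euclidean_space \<Rightarrow> real \<Rightarrow> 'a \<Rightarrow> real"
  where "ramp z R x = min 1 (max 0 (4 * norm (x - z) / R - 1))"

lemma ramp_borel [measurable]: "ramp z R \<in> borel_measurable borel"
  unfolding ramp_def by measurable

lemma ramp_bounds: "0 \<le> ramp z R x" "ramp z R x \<le> 1"
  by (auto simp: ramp_def)

lemma ramp_eq_1: "0 < R \<Longrightarrow> R / 2 \<le> norm (x - z) \<Longrightarrow> ramp z R x = 1"
  by (simp add: ramp_def field_simps)

lemma ramp_eq_0: "0 < R \<Longrightarrow> norm (x - z) \<le> R / 4 \<Longrightarrow> ramp z R x = 0"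
  by (simp add: ramp_def field_simps)

lemma ramp_lipschitz:
  assumes "0 < R"
  shows "\<bar>ramp z R x - ramp z R y\<bar> \<le> 4 / R * norm (x - y)"
proof -
  have "\<bar>ramp z R x - ramp z R y\<bar> \<le> \<bar>(4 * norm (x - z) / R - 1) - (4 * norm (y - z) / R - 1)\<bar>"
    by (simp add: ramp_def min_def max_def)
  also have "(4 * norm (x - z) / R - 1) - (4 * norm (y - z) / R - 1) = 4 / R * (norm (x - z) - norm (y - z))"
    by (simp add: algebra_simps)
  also have "\<bar>\<dots>\<bar> = 4 / R * \<bar>norm (x - z) - norm (y - z)\<bar>"
    using assms by (simp only: abs_mult) simp
  also have "\<dots> \<le> 4 / R * norm (x - y)"
    using assms norm_triangle_ineq3[of "x - z" "y - z"] by (intro mult_left_mono) auto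
  finally show ?thesis .
qed

context nonlocal_kernel
begin

definition level :: "'a \<Rightarrow> real \<Rightarrow> real \<Rightarrow> real \<Rightarrow> 'a \<Rightarrow> real"
  where "level z R \<sigma> \<kappa> x = \<kappa> + \<sigma> * ramp z R x"

definition excess :: "('a \<Rightarrow> real) \<Rightarrow> 'a \<Rightarrow> real \<Rightarrow> real \<Rightarrow> real \<Rightarrow> 'a \<Rightarrow> real"
  where "excess v z R \<sigma> \<kappa> = (\<lambda>x. if x \<in> ball z R then max 0 (v x - level z R \<sigma> \<kappa> x) else 0)"

definition superlevel :: "('a \<Rightarrow> real) \<Rightarrow> 'a \<Rightarrow> real \<Rightarrow> real \<Rightarrow> real \<Rightarrow> 'a set"
  where "superlevel v z R \<sigma> \<kappa> = {x \<in> ball z R. level z R \<sigma> \<kappa> x < v x}"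

text \<open>What a subsolution satisfies when tested with the excess. Integrability is part of it,
  because a non-integrable function has the integral 0.\<close>

definition excess_test :: "('a \<Rightarrow> real) \<Rightarrow> 'a \<Rightarrow> real \<Rightarrow> real \<Rightarrow> real \<Rightarrow> bool"
  where "excess_test v z R \<sigma> \<kappa> \<longleftrightarrow>
    integrable \<nu> (form v (excess v z R \<sigma> \<kappa>)) \<and> (\<integral>w. form v (excess v z R \<sigma> \<kappa>) w \<partial>\<nu>) \<le> 0"

lemma level_borel [measurable]: "level z R \<sigma> \<kappa> \<in> borel_measurable borel"
  unfolding level_def by measurable

lemma ball_borel [measurable]: "ball z R \<in> sets borel" for z :: 'a
  by (rule borel_open) simp

lemma excess_borel [measurable]:
  assumes [measurable]: "v \<in> borel_measurable borel"
  shows "excess v z R \<sigma> \<kappa> \<in> borel_measurable borel"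
  unfolding excess_def by measurable

lemma superlevel_borel [measurable]:
  assumes [measurable]: "v \<in> borel_measurable borel"
  shows "superlevel v z R \<sigma> \<kappa> \<in> sets borel"
  unfolding superlevel_def by measurable

lemma excess_nonneg: "0 \<le> excess v z R \<sigma> \<kappa> x"
  by (simp add: excess_def)

text \<open>Beyond \<open>R / 2\<close> the level is at least \<open>M\<close>, so there is
  essentially no excess. A point with excess lies above \<open>M - \<sigma>\<close>, hence an
  outside value exceeds it by at most \<open>max 0 (v y - M) + \<sigma>\<close>; the tail hypothesis
  then makes the far error of the same size as the slope error.\<close>

lemma excess_estimate:
  obtains C where "0 < C"
    "\<forall>v z R \<sigma> \<kappa> M. v \<in> borel_measurable borel \<longrightarrow> 0 < R \<longrightarrow> 0 < \<sigma> \<longrightarrow>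
      (AE x in lborel. x \<in> ball z R \<longrightarrow> v x \<le> M) \<longrightarrow>
      (\<integral>\<^sup>+y. indicator (- ball z R) y * ennreal ((max 0 (v y - M)) powr (p - 1) *
          norm (y - z) powr - (real DIM('a) + s * p)) \<partial>lborel) \<le> ennreal (R powr - (s * p) * \<sigma> powr (p - 1)) \<longrightarrow>
      M - \<sigma> \<le> \<kappa> \<longrightarrow> \<kappa> \<le> M \<longrightarrow> excess_test v z R \<sigma> \<kappa> \<longrightarrow>
      (\<integral>\<^sup>+w. indicator (superlevel v z R \<sigma> \<kappa> \<times> (ball z R - superlevel v z R \<sigma> \<kappa>)) w *
         ennreal ((excess v z R \<sigma> \<kappa> (fst w) + (level z R \<sigma> \<kappa> (snd w) - v (snd w))) powr (p - 1) *
            excess v z R \<sigma> \<kappa> (fst w)) \<partial>\<nu>)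
      \<le> ennreal (C * \<sigma> powr p * R powr - (s * p)) * emeasure lborel (superlevel v z R \<sigma> \<kappa>)"
proof -
  define K where "K = real DIM('a) + s * p"
  have K: "0 < K" using sp_pos by (simp add: K_def)
  obtain Cn where Cn: "0 \<le> Cn"
    "\<And>E B r. \<lbrakk>E \<in> sets borel; B \<in> sets borel; 0 < r; \<forall>x\<in>E. \<forall>y\<in>B. dist x y < r\<rbrakk> \<Longrightarrow>
      (\<integral>\<^sup>+z. indicator (E \<times> B) z * ennreal (norm (fst z - snd z) powr p) \<partial>\<nu>)
        \<le> ennreal (Cn * r powr (p - s * p)) * emeasure lborel E"
    by (rule near_integral_le) (rule that; assumption)
  obtain Cf where Cf: "0 \<le> Cf" "\<And>(x::'a) r. 0 < r \<Longrightarrow>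
       (\<integral>\<^sup>+y. indicator (- ball x r) y * ennreal (norm (x - y) powr - (real DIM('a) + s * p)) \<partial>lborel)
       \<le> ennreal (Cf * r powr - (s * p))"
    by (rule far_kernel_integral[where 'a='a, OF sp_pos(1)]) (rule that; assumption)
  \<comment> \<open>In \<open>D1\<close>, \<open>4 * 3 powr p\<close> comes from
    \<open>phi_shift_lower\<close>, \<open>4 powr p\<close> from the slope of the ramp, and
    \<open>2 powr (p - s * p)\<close> from the diameter of the ball. In \<open>D2\<close>,
    \<open>2 powr (p - 1)\<close> splits a sum, \<open>2 powr K\<close> compares the distances of
    \<open>y\<close> from \<open>x\<close> and from \<open>z\<close>, and \<open>1 + Cf\<close> adds
    the tail and the contribution of \<open>\<sigma>\<close>.\<close>
  define D1 where "D1 = 4 * 3 powr p * 4 powr p * (Cn * 2 powr (p - s * p))"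
  define D2 where "D2 = 2 powr (p - 1) * \<Lambda> * 2 powr K * (1 + Cf)"
  define C where "C = 2 powr p * (D1 + D2)"
  have D: "0 \<le> D1" "0 < D2"
    using Cn(1) Cf(1) \<Lambda> by (auto simp: D1_def D2_def intro!: mult_pos_pos add_pos_nonneg)
  show thesis
  proof (rule that[of C])
    show "0 < C" using D by (simp add: C_def)
    show "\<forall>v z R \<sigma> \<kappa> M. v \<in> borel_measurable borel \<longrightarrow> 0 < R \<longrightarrow> 0 < \<sigma> \<longrightarrow>
      (AE x in lborel. x \<in> ball z R \<longrightarrow> v x \<le> M) \<longrightarrow>
      (\<integral>\<^sup>+y. indicator (- ball z R) y * ennreal ((max 0 (v y - M)) powr (p - 1) *
          norm (y - z) powr - (real DIM('a) + s * p)) \<partial>lborel) \<le> ennreal (R powr - (s * p) * \<sigma> powr (p - 1)) \<longrightarrow>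
      M - \<sigma> \<le> \<kappa> \<longrightarrow> \<kappa> \<le> M \<longrightarrow> excess_test v z R \<sigma> \<kappa> \<longrightarrow>
      (\<integral>\<^sup>+w. indicator (superlevel v z R \<sigma> \<kappa> \<times> (ball z R - superlevel v z R \<sigma> \<kappa>)) w *
         ennreal ((excess v z R \<sigma> \<kappa> (fst w) + (level z R \<sigma> \<kappa> (snd w) - v (snd w))) powr (p - 1) *
            excess v z R \<sigma> \<kappa> (fst w)) \<partial>\<nu>)
      \<le> ennreal (C * \<sigma> powr p * R powr - (s * p)) * emeasure lborel (superlevel v z R \<sigma> \<kappa>)"
    proof (intro allI impI)
      fix v :: "'a \<Rightarrow> real" and z :: 'a and R \<sigma> \<kappa> M :: real
      assume v [measurable]: "v \<in> borel_measurable borel" and R: "0 < R" and \<sigma>: "0 < \<sigma>"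
        and M: "AE x in lborel. x \<in> ball z R \<longrightarrow> v x \<le> M"
        and tail: "(\<integral>\<^sup>+y. indicator (- ball z R) y * ennreal ((max 0 (v y - M)) powr (p - 1) *
          norm (y - z) powr - (real DIM('a) + s * p)) \<partial>lborel) \<le> ennreal (R powr - (s * p) * \<sigma> powr (p - 1))"
        and \<kappa>: "M - \<sigma> \<le> \<kappa>" "\<kappa> \<le> M" and test: "excess_test v z R \<sigma> \<kappa>"
      define B where "B = ball z R"
      define l where "l = level z R \<sigma> \<kappa>"
      define h where "h = excess v z R \<sigma> \<kappa>"
      define E where "E = superlevel v z R \<sigma> \<kappa>"
      have [measurable]: "B \<in> sets borel" "l \<in> borel_measurable borel" "h \<in> borel_measurable borel" "E \<in> sets borel"
        by (simp_all add: B_def l_def h_def E_def)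
      have lip: "\<bar>l x - l y\<bar> \<le> (4 * \<sigma> / R) * norm (x - y)" for x y
      proof -
        have "\<bar>l x - l y\<bar> = \<sigma> * \<bar>ramp z R x - ramp z R y\<bar>"
          using \<sigma> by (simp add: l_def level_def right_diff_distrib[symmetric] abs_mult)
        also have "\<dots> \<le> \<sigma> * (4 / R * norm (x - y))"
          using \<sigma> ramp_lipschitz[OF R] by (intro mult_left_mono) auto
        finally show ?thesis by (simp add: ac_simps)
      qed
      have near: "ennreal (4 * 3 powr p * (4 * \<sigma> / R) powr p) *
          (\<integral>\<^sup>+w. indicator (E \<times> B) w * ennreal (norm (fst w - snd w) powr p) \<partial>\<nu>)
          \<le> ennreal (D1 * \<sigma> powr p * R powr - (s * p)) * emeasure lborel E"
      proof -
        have "dist x y < 2 * R" if "x \<in> E" "y \<in> B" for x y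
          using that dist_triangle2[of x y z] by (auto simp: E_def superlevel_def B_def dist_commute)
        then have "(\<integral>\<^sup>+w. indicator (E \<times> B) w * ennreal (norm (fst w - snd w) powr p) \<partial>\<nu>)
          \<le> ennreal (Cn * (2 * R) powr (p - s * p)) * emeasure lborel E"
          using R by (intro Cn(2)) auto
        then have "ennreal (4 * 3 powr p * (4 * \<sigma> / R) powr p) *
          (\<integral>\<^sup>+w. indicator (E \<times> B) w * ennreal (norm (fst w - snd w) powr p) \<partial>\<nu>)
          \<le> ennreal (4 * 3 powr p * (4 * \<sigma> / R) powr p) * (ennreal (Cn * (2 * R) powr (p - s * p)) * emeasure lborel E)"
          by (intro mult_left_mono) auto
        also have "\<dots> = ennreal ((4 * 3 powr p * (4 * \<sigma> / R) powr p) * (Cn * (2 * R) powr (p - s * p))) * emeasure lborel E"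
          using Cn(1) by (simp add: ennreal_mult mult.assoc)
        also have "(4 * 3 powr p * (4 * \<sigma> / R) powr p) * (Cn * (2 * R) powr (p - s * p)) = D1 * \<sigma> powr p * R powr - (s * p)"
        proof -
          have "(4 * \<sigma> / R) powr p = 4 powr p * \<sigma> powr p * R powr - p"
            using R \<sigma> by (simp add: powr_divide powr_mult powr_minus field_simps)
          moreover have "(2 * R) powr (p - s * p) = 2 powr (p - s * p) * (R powr p * R powr - (s * p))"
            using R by (simp add: powr_mult powr_add[symmetric])
          moreover have "R powr - p * R powr p = 1" using R by (simp add: powr_add[symmetric])
          ultimately show ?thesis by (simp add: D1_def)
        qed
        finally show ?thesis .
      qed
      have farE: "(\<integral>\<^sup>+w. indicator (E \<times> - B) w * ennreal ((max 0 (v (snd w) - v (fst w))) powr (p - 1) * h (fst w)) \<partial>\<nu>)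
          \<le> ennreal (D2 * \<sigma> powr p * R powr - (s * p)) * emeasure lborel E"
      proof -
        define F where "F y = ennreal ((max 0 (v y - M)) powr (p - 1) * norm (y - z) powr - K)
            + ennreal (\<sigma> powr (p - 1) * norm (z - y) powr - K)" for y
        define c where "c = 2 powr (p - 1) * \<sigma> * \<Lambda> * 2 powr K"
        have c: "0 \<le> c" using \<sigma> \<Lambda> by (simp add: c_def)
        have [measurable]: "F \<in> borel_measurable borel" unfolding F_def by measurable
        have k_le: "k (x, y) \<le> \<Lambda> * 2 powr K * norm (y - z) powr - K" if "norm (x - z) < R / 2" "y \<notin> B" for x y
        proof -
          have yz: "R \<le> norm (y - z)" using that by (simp add: B_def dist_norm norm_minus_commute)
          have "norm (y - z) \<le> norm (x - y) + norm (x - z)"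
            using norm_triangle_ineq4[of "x - z" "x - y"] by (simp add: add.commute)
          then have le: "norm (y - z) / 2 \<le> norm (x - y)" using yz that by linarith
          have "k (x, y) \<le> \<Lambda> * norm (x - y) powr - K" using k_upper[of x y] by (simp add: K_def)
          also have "\<dots> \<le> \<Lambda> * (norm (y - z) / 2) powr - K"
            using le yz R K \<Lambda> by (intro mult_left_mono powr_mono2') auto
          also have "(norm (y - z) / 2) powr - K = 2 powr K * norm (y - z) powr - K"
            using yz R by (simp add: powr_divide powr_minus field_simps)
          finally show ?thesis by simp
        qed
        have pt: "AE w in \<nu>. fst w \<in> E \<longrightarrow> v (fst w) \<le> M"
          using AE_\<nu>_pair[OF M] by eventually_elim (auto simp: E_def superlevel_def)
        have "(\<integral>\<^sup>+w. indicator (E \<times> - B) w * ennreal ((max 0 (v (snd w) - v (fst w))) powr (p - 1) * h (fst w)) \<partial>\<nu>)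
          \<le> (\<integral>\<^sup>+w. indicator ({x \<in> E. norm (x - z) < R / 2} \<times> - B) w *
              ennreal (2 powr (p - 1) * \<sigma> * ((max 0 (v (snd w) - M)) powr (p - 1) + \<sigma> powr (p - 1))) \<partial>\<nu>)"
        proof (rule nn_integral_mono_AE, use pt in eventually_elim)
          fix w :: "'a \<times> 'a" assume le: "fst w \<in> E \<longrightarrow> v (fst w) \<le> M"
          obtain x y where w: "w = (x, y)" by (cases w)
          show "indicator (E \<times> - B) w * ennreal ((max 0 (v (snd w) - v (fst w))) powr (p - 1) * h (fst w))
            \<le> indicator ({x \<in> E. norm (x - z) < R / 2} \<times> - B) w *
              ennreal (2 powr (p - 1) * \<sigma> * ((max 0 (v (snd w) - M)) powr (p - 1) + \<sigma> powr (p - 1)))"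
          proof (cases "x \<in> E \<and> y \<notin> B")
            case True
            then have vM: "v x \<le> M" and lx: "l x < v x" and xB: "x \<in> ball z R"
              using le w by (auto simp: E_def superlevel_def l_def)
            have "\<kappa> \<le> l x" using \<sigma> ramp_bounds(1)[of z R x] by (simp add: l_def level_def)
            have half: "norm (x - z) < R / 2"
            proof (rule ccontr)
              assume "\<not> norm (x - z) < R / 2"
              then have "l x = \<kappa> + \<sigma>" using ramp_eq_1[OF R, of x z] by (simp add: l_def level_def)
              then show False using lx vM \<kappa> by linarith
            qed
            have h: "h x \<le> \<sigma>" "0 \<le> h x"
              using xB lx vM \<kappa> \<open>\<kappa> \<le> l x\<close> by (auto simp: h_def excess_def l_def)
            have "max 0 (v y - v x) \<le> max 0 (v y - M) + \<sigma>"
              using \<open>\<kappa> \<le> l x\<close> lx \<kappa> \<sigma> by auto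
            then have "(max 0 (v y - v x)) powr (p - 1) \<le> (max 0 (v y - M) + \<sigma>) powr (p - 1)"
              using p by (intro powr_mono2) auto
            also have "\<dots> \<le> 2 powr (p - 1) * ((max 0 (v y - M)) powr (p - 1) + \<sigma> powr (p - 1))"
              using p \<sigma> by (intro powr_add_le) auto
            finally have "(max 0 (v y - v x)) powr (p - 1) * h x
              \<le> 2 powr (p - 1) * ((max 0 (v y - M)) powr (p - 1) + \<sigma> powr (p - 1)) * \<sigma>"
              using h \<sigma> by (intro mult_mono) auto
            then show ?thesis using True half by (simp add: w ac_simps ennreal_leI)
          qed (auto simp: w)
        qed
        also have "\<dots> = (\<integral>\<^sup>+x. \<integral>\<^sup>+y. indicator ({x \<in> E. norm (x - z) < R / 2} \<times> - B) (x, y) *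
              ennreal (2 powr (p - 1) * \<sigma> * ((max 0 (v y - M)) powr (p - 1) + \<sigma> powr (p - 1))) * ennreal (k (x, y)) \<partial>lborel \<partial>lborel)"
          by (subst nn_integral_\<nu>) auto
        also have "\<dots> \<le> (\<integral>\<^sup>+x. \<integral>\<^sup>+y. indicator E x * (ennreal c * (indicator (- B) y * F y)) \<partial>lborel \<partial>lborel)"
        proof (intro nn_integral_mono)
          fix x y
          show "indicator ({x \<in> E. norm (x - z) < R / 2} \<times> - B) (x, y) *
              ennreal (2 powr (p - 1) * \<sigma> * ((max 0 (v y - M)) powr (p - 1) + \<sigma> powr (p - 1))) * ennreal (k (x, y))
            \<le> indicator E x * (ennreal c * (indicator (- B) y * F y))"
          proof (cases "x \<in> E \<and> norm (x - z) < R / 2 \<and> y \<notin> B")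
            case True
            have "2 powr (p - 1) * \<sigma> * ((max 0 (v y - M)) powr (p - 1) + \<sigma> powr (p - 1)) * k (x, y)
              \<le> 2 powr (p - 1) * \<sigma> * ((max 0 (v y - M)) powr (p - 1) + \<sigma> powr (p - 1)) * (\<Lambda> * 2 powr K * norm (y - z) powr - K)"
              using True k_le \<sigma> by (intro mult_left_mono mult_nonneg_nonneg add_nonneg_nonneg) auto
            also have "\<dots> = c * ((max 0 (v y - M)) powr (p - 1) * norm (y - z) powr - K + \<sigma> powr (p - 1) * norm (z - y) powr - K)"
              by (simp add: c_def norm_minus_commute algebra_simps)
            finally show ?thesis using True c \<sigma> k_nonneg
              by (simp add: F_def ennreal_mult[symmetric] ennreal_plus[symmetric] ennreal_leI del: ennreal_plus)
          qed auto
        qed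
        also have "\<dots> = emeasure lborel E * (ennreal c * (\<integral>\<^sup>+y. indicator (- B) y * F y \<partial>lborel))"
        proof -
          have "(\<integral>\<^sup>+y. indicator E x * (ennreal c * (indicator (- B) y * F y)) \<partial>lborel)
            = indicator E x * (ennreal c * (\<integral>\<^sup>+y. indicator (- B) y * F y \<partial>lborel))" for x
            by (subst nn_integral_cmult, measurable)+
          then show ?thesis by (simp only:) (subst nn_integral_multc, auto)
        qed
        also have "(\<integral>\<^sup>+y. indicator (- B) y * F y \<partial>lborel) =
            (\<integral>\<^sup>+y. indicator (- B) y * ennreal ((max 0 (v y - M)) powr (p - 1) * norm (y - z) powr - K) \<partial>lborel)
           + ennreal (\<sigma> powr (p - 1)) * (\<integral>\<^sup>+y. indicator (- B) y * ennreal (norm (z - y) powr - K) \<partial>lborel)"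
          by (subst nn_integral_cmult[symmetric], measurable, subst nn_integral_add[symmetric], measurable)
             (auto intro!: nn_integral_cong simp: F_def indicator_def ennreal_mult)
        also have "\<dots> \<le> ennreal (R powr - (s * p) * \<sigma> powr (p - 1)) + ennreal (\<sigma> powr (p - 1)) * ennreal (Cf * R powr - (s * p))"
          using tail Cf(2)[OF R, of z] unfolding B_def K_def by (intro add_mono mult_left_mono) auto
        also have "\<dots> = ennreal ((1 + Cf) * \<sigma> powr (p - 1) * R powr - (s * p))"
          using Cf(1) by (simp add: ennreal_mult[symmetric] ennreal_plus[symmetric] algebra_simps del: ennreal_plus)
        finally have "(\<integral>\<^sup>+w. indicator (E \<times> - B) w * ennreal ((max 0 (v (snd w) - v (fst w))) powr (p - 1) * h (fst w)) \<partial>\<nu>)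
          \<le> emeasure lborel E * (ennreal c * ennreal ((1 + Cf) * \<sigma> powr (p - 1) * R powr - (s * p)))"
          by (simp add: mult_left_mono)
        also have "ennreal c * ennreal ((1 + Cf) * \<sigma> powr (p - 1) * R powr - (s * p)) = ennreal (D2 * \<sigma> powr p * R powr - (s * p))"
        proof -
          have "c * ((1 + Cf) * \<sigma> powr (p - 1) * R powr - (s * p)) = D2 * (\<sigma> powr (p - 1) * \<sigma>) * R powr - (s * p)"
            by (simp add: c_def D2_def)
          also have "\<sigma> powr (p - 1) * \<sigma> = \<sigma> powr p" using \<sigma> by (simp add: powr_pm1_mult)
          finally show ?thesis by (simp only: ennreal_mult'[OF c, symmetric])
        qed
        finally show ?thesis by (simp add: mult.commute)
      qed
      have cacc: "(\<integral>\<^sup>+w. indicator (B \<times> B) w * ennreal (\<bar>(v (fst w) - l (fst w)) - (v (snd w) - l (snd w))\<bar> powr (p - 1)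
            * \<bar>h (fst w) - h (snd w)\<bar>) \<partial>\<nu>)
        \<le> ennreal (2 powr p) * (ennreal (4 * 3 powr p * (4 * \<sigma> / R) powr p) *
          (\<integral>\<^sup>+w. indicator (E \<times> B) w * ennreal (norm (fst w - snd w) powr p) \<partial>\<nu>)
        + (\<integral>\<^sup>+w. indicator (E \<times> - B) w * ennreal ((max 0 (v (snd w) - v (fst w))) powr (p - 1) * h (fst w)) \<partial>\<nu>))"
        using test lip R \<sigma>
        by (intro caccioppoli) (auto simp: excess_test_def h_def excess_def E_def superlevel_def B_def l_def)
      have "(\<integral>\<^sup>+w. indicator (E \<times> (B - E)) w * ennreal ((h (fst w) + (l (snd w) - v (snd w))) powr (p - 1) * h (fst w)) \<partial>\<nu>)
        \<le> (\<integral>\<^sup>+w. indicator (B \<times> B) w * ennreal (\<bar>(v (fst w) - l (fst w)) - (v (snd w) - l (snd w))\<bar> powr (p - 1)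
            * \<bar>h (fst w) - h (snd w)\<bar>) \<partial>\<nu>)"
      proof (intro nn_integral_mono)
        fix w :: "'a \<times> 'a"
        obtain x y where w: "w = (x, y)" by (cases w)
        show "indicator (E \<times> (B - E)) w * ennreal ((h (fst w) + (l (snd w) - v (snd w))) powr (p - 1) * h (fst w))
          \<le> indicator (B \<times> B) w * ennreal (\<bar>(v (fst w) - l (fst w)) - (v (snd w) - l (snd w))\<bar> powr (p - 1)
            * \<bar>h (fst w) - h (snd w)\<bar>)"
        \<comment> \<open>Only pairs with one point above and one below the level are kept: there
          the increment of \<open>v - l\<close> is the excess at \<open>x\<close> plus the gap at
          \<open>y\<close>.\<close>
        proof (cases "x \<in> E \<and> y \<in> B - E")
          case True
          then have xB: "x \<in> B" and "h x = v x - l x" "0 < v x - l x" "h y = 0" "v y \<le> l y"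
            by (auto simp: E_def superlevel_def h_def excess_def B_def l_def)
          then have "\<bar>(v x - l x) - (v y - l y)\<bar> = h x + (l y - v y)" "\<bar>h x - h y\<bar> = h x" by simp_all
          then show ?thesis using True xB unfolding w fst_conv snd_conv by (simp only:) simp
        qed (auto simp: w)
      qed
      also note cacc
      also have "ennreal (2 powr p) * (ennreal (4 * 3 powr p * (4 * \<sigma> / R) powr p) *
          (\<integral>\<^sup>+w. indicator (E \<times> B) w * ennreal (norm (fst w - snd w) powr p) \<partial>\<nu>)
        + (\<integral>\<^sup>+w. indicator (E \<times> - B) w * ennreal ((max 0 (v (snd w) - v (fst w))) powr (p - 1) * h (fst w)) \<partial>\<nu>))
        \<le> ennreal (2 powr p) * (ennreal (D1 * \<sigma> powr p * R powr - (s * p)) * emeasure lborel E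
            + ennreal (D2 * \<sigma> powr p * R powr - (s * p)) * emeasure lborel E)"
        by (intro mult_left_mono add_mono near farE) simp
      also have "\<dots> = ennreal (C * \<sigma> powr p * R powr - (s * p)) * emeasure lborel E"
      proof -
        have "C * \<sigma> powr p * R powr - (s * p) = 2 powr p * (D1 * \<sigma> powr p * R powr - (s * p) + D2 * \<sigma> powr p * R powr - (s * p))"
          by (simp add: C_def algebra_simps)
        then show ?thesis using D
          by (simp add: ennreal_mult ennreal_plus distrib_right distrib_left mult.assoc)
      qed
      finally show "(\<integral>\<^sup>+w. indicator (superlevel v z R \<sigma> \<kappa> \<times> (ball z R - superlevel v z R \<sigma> \<kappa>)) w *
         ennreal ((excess v z R \<sigma> \<kappa> (fst w) + (level z R \<sigma> \<kappa> (snd w) - v (snd w))) powr (p - 1) *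
            excess v z R \<sigma> \<kappa> (fst w)) \<partial>\<nu>)
      \<le> ennreal (C * \<sigma> powr p * R powr - (s * p)) * emeasure lborel (superlevel v z R \<sigma> \<kappa>)"
        by (simp add: E_def B_def h_def l_def)
    qed
  qed
qed

text \<open>Each point of \<open>A\<close> sees, within distance \<open>\<rho>\<close>, a set of
  measure at least \<open>a\<close> on the other side of the level, and at such distances the kernel
  has a lower bound. \<open>Q\<close> may depend on the point, as the iteration requires.\<close>

lemma excess_integral_lower:
  fixes Q :: "'a \<Rightarrow> 'a set"
  assumes [measurable]: "v \<in> borel_measurable borel" "A \<in> sets borel" "E \<in> sets borel" "B \<in> sets borel"
      "F \<in> borel_measurable borel"
    and A: "A \<subseteq> E" and Q: "\<And>x. x \<in> A \<Longrightarrow> Q x \<in> sets borel \<and> Q x \<subseteq> B - E \<and> ennreal a \<le> emeasure lborel (Q x)"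
    and F: "\<And>x y. x \<in> A \<Longrightarrow> y \<in> Q x \<Longrightarrow> norm (x - y) \<le> \<rho> \<and> m \<le> F (x, y)"
    and pos: "0 < \<rho>" "0 \<le> m" "0 \<le> a"
  shows "ennreal (m * a * (\<rho> powr - (real DIM('a) + s * p) / \<Lambda>)) * emeasure lborel A
    \<le> (\<integral>\<^sup>+w. indicator (E \<times> (B - E)) w * ennreal (F w) \<partial>\<nu>)"
proof -
  define c where "c = \<rho> powr - (real DIM('a) + s * p) / \<Lambda>"
  have c: "0 \<le> c" using \<Lambda> by (simp add: c_def)
  have "ennreal (m * a * c) * emeasure lborel A = (\<integral>\<^sup>+x. ennreal (m * a * c) * indicator A x \<partial>lborel)"
    by (simp add: nn_integral_cmult_indicator)
  also have "\<dots> \<le> (\<integral>\<^sup>+x. \<integral>\<^sup>+y. (indicator (E \<times> (B - E)) (x, y) * ennreal (F (x, y))) * ennreal (k (x, y)) \<partial>lborel \<partial>lborel)"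
  proof (intro nn_integral_mono)
    fix x :: 'a
    show "ennreal (m * a * c) * indicator A x
      \<le> (\<integral>\<^sup>+y. (indicator (E \<times> (B - E)) (x, y) * ennreal (F (x, y))) * ennreal (k (x, y)) \<partial>lborel)"
    proof (cases "x \<in> A")
      case True
      note q = Q[OF True]
      have [measurable]: "Q x \<in> sets borel" using q by simp
      have "ennreal (m * a * c) = ennreal (m * c) * ennreal a"
        using pos c by (simp add: ennreal_mult[symmetric] ac_simps)
      also have "\<dots> \<le> ennreal (m * c) * emeasure lborel (Q x)"
        using q by (intro mult_left_mono) auto
      also have "\<dots> = (\<integral>\<^sup>+y. ennreal (m * c) * indicator (Q x) y \<partial>lborel)"
        by (simp add: nn_integral_cmult_indicator)
      also have "\<dots> \<le> (\<integral>\<^sup>+y. (indicator (E \<times> (B - E)) (x, y) * ennreal (F (x, y))) * ennreal (k (x, y)) \<partial>lborel)"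
      proof (intro nn_integral_mono)
        fix y
        show "ennreal (m * c) * indicator (Q x) y
            \<le> (indicator (E \<times> (B - E)) (x, y) * ennreal (F (x, y))) * ennreal (k (x, y))"
        proof (cases "y \<in> Q x")
          case True
          then have xy: "x \<in> E" "y \<in> B - E" "norm (x - y) \<le> \<rho>" "m \<le> F (x, y)"
            using q A F \<open>x \<in> A\<close> by blast+
          \<comment> \<open>One point lies in \<open>E\<close> and the other does not; off the
            diagonal the negative power decreases with the distance.\<close>
          then have ne: "x \<noteq> y" by auto
          have "\<rho> powr - (real DIM('a) + s * p) \<le> norm (x - y) powr - (real DIM('a) + s * p)"
            using xy ne sp_pos by (intro powr_mono2') auto
          then have "c \<le> norm (x - y) powr - (real DIM('a) + s * p) / \<Lambda>"
            unfolding c_def using \<Lambda> by (intro divide_right_mono) auto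
          also have "\<dots> \<le> k (x, y)" by (rule k_lower)
          finally have "m * c \<le> F (x, y) * k (x, y)"
            using xy c pos by (intro mult_mono) auto
          then show ?thesis using True xy pos k_nonneg by (simp add: ennreal_mult[symmetric] ennreal_leI)
        qed simp
      qed
      finally show ?thesis using True by simp
    qed simp
  qed
  also have "\<dots> = (\<integral>\<^sup>+w. indicator (E \<times> (B - E)) w * ennreal (F w) \<partial>\<nu>)"
    by (subst nn_integral_\<nu>) auto
  finally show ?thesis unfolding c_def .
qed

text \<open>The pairs of points at which \<open>v\<close> lies above and below the
  level control the measure of the superlevel set twice: if \<open>v\<close> is far below \<open>M\<close> on a large set,
  then the superlevel set is small; and a small superlevel set leaves room around each of its
  points, which takes the place of the Sobolev inequality in the iteration over the levels.\<close>
lemma oscillation_decrease: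
  fixes c0 :: real
  assumes c0: "0 < c0"
  obtains H where "1 < H"
    "\<forall>v z R \<sigma> M. v \<in> borel_measurable borel \<longrightarrow> 0 < R \<longrightarrow> 0 < \<sigma> \<longrightarrow>
      (AE x in lborel. x \<in> ball z R \<longrightarrow> v x \<le> M) \<longrightarrow>
      (\<integral>\<^sup>+y. indicator (- ball z R) y * ennreal ((max 0 (v y - M)) powr (p - 1) *
          norm (y - z) powr - (real DIM('a) + s * p)) \<partial>lborel) \<le> ennreal (R powr - (s * p) * \<sigma> powr (p - 1)) \<longrightarrow>
      c0 * R ^ DIM('a) \<le> measure lborel {x \<in> ball z (R / 2). v x \<le> M - H * \<sigma>} \<longrightarrow>
      (\<forall>\<kappa>\<in>{M - \<sigma>..M}. excess_test v z R \<sigma> \<kappa>) \<longrightarrow>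
      (AE x in lborel. x \<in> ball z (R / 4) \<longrightarrow> v x \<le> M - \<sigma> / 4)"
proof -
  define n where "n = real DIM('a)"
  define \<omega> where "\<omega> = unit_ball_vol n"
  define K where "K = n + s * p"
  define \<beta> where "\<beta> = s * p / n"
  have n: "0 < n" "1 \<le> n" by (auto simp: n_def Suc_leI)
  have \<omega>: "0 < \<omega>" using n by (simp add: \<omega>_def)
  have K: "0 < K" using sp_pos by (simp add: K_def n_def)
  have \<beta>: "0 < \<beta>" "K / n = 1 + \<beta>" using sp_pos n by (auto simp: \<beta>_def K_def add_divide_distrib)
  obtain C1 where C1: "0 < C1" and est:
    "\<forall>v z R \<sigma> \<kappa> M. v \<in> borel_measurable borel \<longrightarrow> 0 < R \<longrightarrow> 0 < \<sigma> \<longrightarrow>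
      (AE x in lborel. x \<in> ball z R \<longrightarrow> v x \<le> M) \<longrightarrow>
      (\<integral>\<^sup>+y. indicator (- ball z R) y * ennreal ((max 0 (v y - M)) powr (p - 1) *
          norm (y - z) powr - (real DIM('a) + s * p)) \<partial>lborel) \<le> ennreal (R powr - (s * p) * \<sigma> powr (p - 1)) \<longrightarrow>
      M - \<sigma> \<le> \<kappa> \<longrightarrow> \<kappa> \<le> M \<longrightarrow> excess_test v z R \<sigma> \<kappa> \<longrightarrow>
      (\<integral>\<^sup>+w. indicator (superlevel v z R \<sigma> \<kappa> \<times> (ball z R - superlevel v z R \<sigma> \<kappa>)) w *
         ennreal ((excess v z R \<sigma> \<kappa> (fst w) + (level z R \<sigma> \<kappa> (snd w) - v (snd w))) powr (p - 1) *
            excess v z R \<sigma> \<kappa> (fst w)) \<partial>\<nu>)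
      \<le> ennreal (C1 * \<sigma> powr p * R powr - (s * p)) * emeasure lborel (superlevel v z R \<sigma> \<kappa>)"
    by (rule excess_estimate) (rule that; assumption)
  define C where "C = \<Lambda> * C1 * (2 / \<omega>) powr (1 + \<beta>) * 8 powr p"
  have C: "0 < C" using \<Lambda> C1 \<omega> by (simp add: C_def)
  \<comment> \<open>Half the measure of a ball of radius \<open>R / 2\<close>, relative to
    \<open>R ^ DIM('a)\<close>. As long as the superlevel set is below this, a ball of twice its
    measure has radius at most \<open>R / 2\<close>.\<close>
  define \<epsilon>1 where "\<epsilon>1 = \<omega> / 2 / 2 ^ DIM('a)"
  have \<epsilon>1: "0 < \<epsilon>1" using \<omega> by (simp add: \<epsilon>1_def)
  have b: "(1::real) < 2 powr p" using p powr_less_mono[of 0 p 2] by simp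
  obtain \<epsilon> where \<epsilon>: "0 < \<epsilon>" "\<epsilon> \<le> \<epsilon>1"
    "\<forall>\<alpha>::nat \<Rightarrow> real. (\<forall>i. 0 \<le> \<alpha> i) \<longrightarrow> \<alpha> 0 \<le> \<epsilon> \<longrightarrow>
       (\<forall>i. \<alpha> i \<le> \<epsilon>1 \<longrightarrow> \<alpha> (Suc i) \<le> C * (2 powr p) ^ i * \<alpha> i powr (1 + \<beta>)) \<longrightarrow> \<alpha> \<longlonglongrightarrow> 0"
    by (rule superlinear_recursion_tendsto_0[OF C b \<beta>(1) \<epsilon>1]) (rule that; assumption)
  define C2 where "C2 = 2 * \<Lambda> * C1 * \<omega> / c0"
  have C2: "0 < C2" using \<Lambda> C1 \<omega> c0 by (simp add: C2_def)
  \<comment> \<open>\<open>(H - 1) powr (p - 1) = C2 / \<epsilon>\<close> is what the first use of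
    the estimate, at level \<open>M - \<sigma>\<close>, needs to start the recursion below its
    threshold \<open>\<epsilon>\<close>; \<open>C2\<close> collects the constants of that
    use.\<close>
  define H where "H = 1 + (C2 / \<epsilon>) powr (1 / (p - 1))"
  have H: "1 < H" "(H - 1) powr (p - 1) = C2 / \<epsilon>"
    using C2 \<epsilon> p by (auto simp: H_def powr_powr)
  show thesis
  proof (rule that[OF H(1)], intro allI impI)
    fix v :: "'a \<Rightarrow> real" and z :: 'a and R \<sigma> M :: real
    assume v [measurable]: "v \<in> borel_measurable borel" and R: "0 < R" and \<sigma>: "0 < \<sigma>"
      and M: "AE x in lborel. x \<in> ball z R \<longrightarrow> v x \<le> M"
      and tail: "(\<integral>\<^sup>+y. indicator (- ball z R) y * ennreal ((max 0 (v y - M)) powr (p - 1) *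
          norm (y - z) powr - (real DIM('a) + s * p)) \<partial>lborel) \<le> ennreal (R powr - (s * p) * \<sigma> powr (p - 1))"
      and dens: "c0 * R ^ DIM('a) \<le> measure lborel {x \<in> ball z (R / 2). v x \<le> M - H * \<sigma>}"
      and test: "\<forall>\<kappa>\<in>{M - \<sigma>..M}. excess_test v z R \<sigma> \<kappa>"
    define E where "E \<kappa> = superlevel v z R \<sigma> \<kappa>" for \<kappa>
    define A where "A \<kappa> = {x \<in> E \<kappa>. norm (x - z) < R / 2}" for \<kappa>
    define T where "T \<kappa> w = (excess v z R \<sigma> \<kappa> (fst w) + (level z R \<sigma> \<kappa> (snd w) - v (snd w))) powr (p - 1) *
            excess v z R \<sigma> \<kappa> (fst w)" for \<kappa> w
    have [measurable]: "E \<kappa> \<in> sets borel" for \<kappa> by (simp add: E_def)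
    have [measurable]: "A \<kappa> \<in> sets borel" for \<kappa> unfolding A_def by measurable
    have [measurable]: "T \<kappa> \<in> borel_measurable borel" for \<kappa> unfolding T_def by measurable
    have Rn: "R ^ DIM('a) = R powr n" using R by (simp add: n_def powr_realpow)
    have main: "(\<integral>\<^sup>+w. indicator (E \<kappa> \<times> (ball z R - E \<kappa>)) w * ennreal (T \<kappa> w) \<partial>\<nu>)
      \<le> ennreal (C1 * \<sigma> powr p * R powr - (s * p)) * emeasure lborel (E \<kappa>)" if "M - \<sigma> \<le> \<kappa>" "\<kappa> \<le> M" for \<kappa>
      unfolding E_def T_def using est v R \<sigma> M tail that test by auto
    have Esub: "E \<kappa> \<subseteq> ball z R" for \<kappa> by (auto simp: E_def superlevel_def)
    have Emono: "E \<kappa>' \<subseteq> E \<kappa>" if "\<kappa> \<le> \<kappa>'" for \<kappa> \<kappa>' using that by (auto simp: E_def superlevel_def level_def)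
    have Efin: "emeasure lborel (E \<kappa>) = ennreal (measure lborel (E \<kappa>))" for \<kappa>
      using emeasure_bounded_finite[OF bounded_subset[OF bounded_ball Esub[of \<kappa>]]]
      by (intro emeasure_eq_ennreal_measure) auto
    \<comment> \<open>Beyond \<open>R / 2\<close> the level is \<open>\<kappa> + \<sigma>\<close>,
      which is at least \<open>M\<close>; up to null sets the superlevel sets therefore lie in the
      half ball.\<close>
    have EA: "emeasure lborel (E \<kappa>) = emeasure lborel (A \<kappa>)" if "M - \<sigma> \<le> \<kappa>" for \<kappa>
    proof (rule emeasure_eq_AE)
      show "AE x in lborel. x \<in> E \<kappa> \<longleftrightarrow> x \<in> A \<kappa>"
        using M
      proof eventually_elim
        fix x assume le: "x \<in> ball z R \<longrightarrow> v x \<le> M"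
        have "norm (x - z) < R / 2" if "x \<in> E \<kappa>"
        proof (rule ccontr)
          assume "\<not> norm (x - z) < R / 2"
          then have "ramp z R x = 1" by (intro ramp_eq_1 R) simp
          then show False using that le \<open>M - \<sigma> \<le> \<kappa>\<close> by (auto simp: E_def superlevel_def level_def)
        qed
        then show "x \<in> E \<kappa> \<longleftrightarrow> x \<in> A \<kappa>" by (auto simp: A_def)
      qed
    qed auto
    have lev: "\<kappa> \<le> level z R \<sigma> \<kappa> x" for \<kappa> x
      using \<sigma> ramp_bounds(1)[of z R x] by (simp add: level_def)
    have exc: "\<kappa>' - \<kappa> \<le> excess v z R \<sigma> \<kappa> x" if "x \<in> E \<kappa>'" for x \<kappa> \<kappa>'
      using that by (auto simp: E_def superlevel_def excess_def level_def)
    have below: "v y \<le> level z R \<sigma> \<kappa> y" if "y \<in> ball z R - E \<kappa>" for y \<kappa>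
      using that by (auto simp: E_def superlevel_def)
    have R_cancel: "R powr - (s * p) * R powr K = R powr n"
      using R by (simp add: powr_add[symmetric] K_def)
    define a where "a \<kappa> = measure lborel (E \<kappa>) / R ^ DIM('a)" for \<kappa>
    have a_nn: "0 \<le> a \<kappa>" for \<kappa> using R by (simp add: a_def)
    have aE: "measure lborel (E \<kappa>) = a \<kappa> * R powr n" for \<kappa>
      using R Rn by (simp add: a_def)
    \<comment> \<open>First use of the estimate. Points of \<open>Q\<close> lie at least
      \<open>(H - 1) * \<sigma>\<close> below the level with \<open>\<kappa> = M - \<sigma>\<close>,
      points above the level with \<open>M - \<sigma> / 2\<close> have excess at least
      \<open>\<sigma> / 2\<close> over it, and all such pairs interact at distance at most
      \<open>R\<close>.\<close>
    have small: "a (M - \<sigma> / 2) \<le> \<epsilon>"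
    proof -
      define Q where "Q = {x \<in> ball z (R / 2). v x \<le> M - H * \<sigma>}"
      have [measurable]: "Q \<in> sets borel" unfolding Q_def by measurable
      have Qfin: "emeasure lborel Q = ennreal (measure lborel Q)"
      proof (intro emeasure_eq_ennreal_measure)
        have "Q \<subseteq> ball z (R / 2)" by (auto simp: Q_def)
        then have "emeasure lborel Q < \<infinity>"
          by (intro emeasure_bounded_finite bounded_subset[OF bounded_ball])
        then show "emeasure lborel Q \<noteq> top" by simp
      qed
      have le: "ennreal ((((H - 1) * \<sigma>) powr (p - 1) * (\<sigma> / 2)) * (c0 * R powr n) * (R powr - (real DIM('a) + s * p) / \<Lambda>))
           * emeasure lborel (A (M - \<sigma> / 2))
        \<le> (\<integral>\<^sup>+w. indicator (E (M - \<sigma>) \<times> (ball z R - E (M - \<sigma>))) w * ennreal (T (M - \<sigma>) w) \<partial>\<nu>)"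
      proof (rule excess_integral_lower[where Q = "\<lambda>_. Q" and v = v])
        show "A (M - \<sigma> / 2) \<subseteq> E (M - \<sigma>)" using Emono[of "M - \<sigma>" "M - \<sigma> / 2"] \<sigma> by (auto simp: A_def)
        have Qlow: "v y \<le> M - \<sigma> - (H - 1) * \<sigma>" if "y \<in> Q" for y
          using that by (auto simp: Q_def algebra_simps)
        have QE: "Q \<subseteq> ball z R - E (M - \<sigma>)"
        proof
          fix y assume y: "y \<in> Q"
          have "0 \<le> (H - 1) * \<sigma>" using H \<sigma> by simp
          then have "v y \<le> level z R \<sigma> (M - \<sigma>) y" using Qlow[OF y] lev[of "M - \<sigma>" y] by linarith
          then show "y \<in> ball z R - E (M - \<sigma>)" using y R by (auto simp: Q_def E_def superlevel_def)
        qed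
        show "Q \<in> sets borel \<and> Q \<subseteq> ball z R - E (M - \<sigma>) \<and> ennreal (c0 * R powr n) \<le> emeasure lborel Q" for x :: 'a
          using QE dens Rn unfolding Qfin by (auto simp: Q_def intro: ennreal_leI)
        fix x y assume x: "x \<in> A (M - \<sigma> / 2)" and y: "y \<in> Q"
        have "norm (x - y) \<le> norm (x - z) + norm (y - z)"
          using norm_triangle_ineq4[of "x - z" "y - z"] by simp
        also have "\<dots> \<le> R" using x y by (auto simp: A_def Q_def dist_norm norm_minus_commute)
        finally have "norm (x - y) \<le> R" .
        moreover have "((H - 1) * \<sigma>) powr (p - 1) * (\<sigma> / 2) \<le> T (M - \<sigma>) (x, y)"
        proof -
          have "\<sigma> / 2 \<le> excess v z R \<sigma> (M - \<sigma>) x" using exc[of x "M - \<sigma> / 2" "M - \<sigma>"] x by (simp add: A_def)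
          moreover have "(H - 1) * \<sigma> \<le> level z R \<sigma> (M - \<sigma>) y - v y" using Qlow[OF y] lev[of "M - \<sigma>" y] by linarith
          ultimately show ?thesis unfolding T_def using \<sigma> p H
            by (intro mult_mono powr_mono2) auto
        qed
        ultimately show "norm (x - y) \<le> R \<and> ((H - 1) * \<sigma>) powr (p - 1) * (\<sigma> / 2) \<le> T (M - \<sigma>) (x, y)" by simp
      qed (use R \<sigma> c0 H in auto)
      also have "\<dots> \<le> ennreal (C1 * \<sigma> powr p * R powr - (s * p)) * emeasure lborel (E (M - \<sigma>))"
        using \<sigma> by (intro main) auto
      also have "\<dots> \<le> ennreal (C1 * \<sigma> powr p * R powr - (s * p)) * ennreal (\<omega> * R powr n)"
        using emeasure_mono[OF Esub, of "lborel" "M - \<sigma>"] R Rn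
        by (intro mult_left_mono) (auto simp: emeasure_ball \<omega>_def n_def)
      finally have "ennreal ((((H - 1) * \<sigma>) powr (p - 1) * (\<sigma> / 2)) * (c0 * R powr n) * (R powr - K / \<Lambda>))
           * ennreal (a (M - \<sigma> / 2) * R powr n)
        \<le> ennreal (C1 * \<sigma> powr p * R powr - (s * p)) * ennreal (\<omega> * R powr n)"
        using EA[of "M - \<sigma> / 2"] Efin[of "M - \<sigma> / 2"] aE \<sigma> by (simp add: K_def n_def)
      then have "((((H - 1) * \<sigma>) powr (p - 1) * (\<sigma> / 2)) * (c0 * R powr n) * (R powr - K / \<Lambda>)) * (a (M - \<sigma> / 2) * R powr n)
        \<le> (C1 * \<sigma> powr p * R powr - (s * p)) * (\<omega> * R powr n)"
        using C1 \<omega> c0 \<sigma> R \<Lambda> a_nn by (simp add: ennreal_mult[symmetric] ennreal_le_iff)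
      moreover have "((((H - 1) * \<sigma>) powr (p - 1) * (\<sigma> / 2)) * (c0 * R powr n) * (R powr - K / \<Lambda>)) * (a (M - \<sigma> / 2) * R powr n)
        = (C2 / \<epsilon> * c0 / (2 * \<Lambda>) * a (M - \<sigma> / 2)) * (\<sigma> powr p * R powr - (s * p) * R powr n)"
      proof -
        have "((H - 1) * \<sigma>) powr (p - 1) * (\<sigma> / 2) = C2 / \<epsilon> * (\<sigma> powr (p - 1) * \<sigma>) / 2"
          using H \<sigma> by (simp add: powr_mult)
        also have "\<sigma> powr (p - 1) * \<sigma> = \<sigma> powr p" using \<sigma> by (simp add: powr_pm1_mult)
        finally have 1: "((H - 1) * \<sigma>) powr (p - 1) * (\<sigma> / 2) = C2 / \<epsilon> * \<sigma> powr p / 2" .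
        have 2: "R powr n * R powr - K = R powr - (s * p)"
          using R by (simp add: powr_add[symmetric] K_def)
        have "((((H - 1) * \<sigma>) powr (p - 1) * (\<sigma> / 2)) * (c0 * R powr n) * (R powr - K / \<Lambda>)) * (a (M - \<sigma> / 2) * R powr n)
          = (C2 / \<epsilon> * \<sigma> powr p / 2) * c0 / \<Lambda> * (R powr n * R powr - K) * (a (M - \<sigma> / 2) * R powr n)"
          unfolding 1 by simp
        then show ?thesis unfolding 2 by (simp add: ac_simps)
      qed
      moreover have "(C1 * \<sigma> powr p * R powr - (s * p)) * (\<omega> * R powr n) = (C1 * \<omega>) * (\<sigma> powr p * R powr - (s * p) * R powr n)"
        by simp
      ultimately have "(C2 / \<epsilon> * c0 / (2 * \<Lambda>) * a (M - \<sigma> / 2)) * (\<sigma> powr p * R powr - (s * p) * R powr n)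
          \<le> (C1 * \<omega>) * (\<sigma> powr p * R powr - (s * p) * R powr n)"
        by (simp only:)
      moreover have "0 < \<sigma> powr p * R powr - (s * p) * R powr n" using \<sigma> R by simp
      ultimately have "C2 / \<epsilon> * c0 / (2 * \<Lambda>) * a (M - \<sigma> / 2) \<le> C1 * \<omega>"
        by (rule mult_right_le_imp_le)
      then show ?thesis using C1 \<omega> c0 \<Lambda> \<epsilon> by (simp add: C2_def field_simps)
    qed
    \<comment> \<open>Second use. A ball of radius \<open>\<rho>\<close> has twice the measure of
      the superlevel set, so at least half of it lies below the level. Up to powers of
      \<open>R\<close>, the kernel at distance \<open>\<rho>\<close> is of order
      \<open>a \<kappa> powr - (1 + \<beta>)\<close>, and this produces the superlinear
      power.\<close>
    have step: "a \<kappa>' \<le> \<Lambda> * C1 * (2 / \<omega>) powr (1 + \<beta>) * (\<sigma> / (\<kappa>' - \<kappa>)) powr p * a \<kappa> powr (1 + \<beta>)"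
      if \<kappa>: "M - \<sigma> \<le> \<kappa>" "\<kappa> < \<kappa>'" "\<kappa>' \<le> M" and le: "a \<kappa> \<le> \<epsilon>1" for \<kappa> \<kappa>'
    proof (cases "a \<kappa> = 0")
      \<comment> \<open>Here \<open>\<rho>\<close> would be 0; monotonicity of the superlevel sets
        suffices.\<close>
      case True
      have "measure lborel (E \<kappa>') \<le> measure lborel (E \<kappa>)"
        using Emono[of \<kappa> \<kappa>'] \<kappa> Efin by (intro measure_mono_fmeasurable) (auto simp: fmeasurable_def)
      then have "a \<kappa>' \<le> a \<kappa>" using R by (auto simp: a_def intro!: divide_right_mono)
      then show ?thesis using True a_nn[of \<kappa>'] by simp
    next
      case False
      then have apos: "0 < a \<kappa>" using a_nn[of \<kappa>] by simp
      define d where "d = \<kappa>' - \<kappa>"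
      have d: "0 < d" using \<kappa> by (simp add: d_def)
      define \<rho> where "\<rho> = (2 * a \<kappa> / \<omega>) powr (1 / n) * R"
      have \<rho>: "0 < \<rho>" using apos \<omega> R by (simp add: \<rho>_def)
      have \<rho>n: "\<omega> * \<rho> ^ DIM('a) = 2 * (a \<kappa> * R powr n)"
      proof -
        have "\<rho> ^ DIM('a) = \<rho> powr n" using \<rho> by (simp add: n_def powr_realpow)
        also have "\<dots> = (2 * a \<kappa> / \<omega>) * R powr n"
          using apos \<omega> R n by (simp add: \<rho>_def powr_mult powr_powr)
        finally show ?thesis using \<omega> by simp
      qed
      have \<rho>K: "\<rho> powr K = (2 / \<omega>) powr (1 + \<beta>) * a \<kappa> powr (1 + \<beta>) * R powr K"
      proof -
        have "\<rho> powr K = ((2 / \<omega>) * a \<kappa>) powr (K / n) * R powr K"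
          using apos \<omega> R by (simp add: \<rho>_def powr_mult powr_powr)
        also have "((2 / \<omega>) * a \<kappa>) powr (K / n) = (2 / \<omega>) powr (1 + \<beta>) * a \<kappa> powr (1 + \<beta>)"
          unfolding \<beta>(2) by (rule powr_mult)
        finally show ?thesis .
      qed
      have \<rho>R: "\<rho> \<le> R / 2"
      proof -
        have "2 * a \<kappa> / \<omega> \<le> (1 / 2) ^ DIM('a)"
          using le \<omega> by (simp add: \<epsilon>1_def power_divide field_simps)
        also have "\<dots> = (1 / 2) powr n" by (simp add: n_def powr_realpow)
        finally have "(2 * a \<kappa> / \<omega>) powr (1 / n) \<le> ((1 / 2) powr n) powr (1 / n)"
          using n apos \<omega> by (intro powr_mono2) auto
        also have "\<dots> = 1 / 2" using n by (simp add: powr_powr)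
        finally show ?thesis using R by (simp add: \<rho>_def)
      qed
      have "ennreal (d powr p * (a \<kappa> * R powr n) * (\<rho> powr - (real DIM('a) + s * p) / \<Lambda>)) * emeasure lborel (A \<kappa>')
        \<le> (\<integral>\<^sup>+w. indicator (E \<kappa> \<times> (ball z R - E \<kappa>)) w * ennreal (T \<kappa> w) \<partial>\<nu>)"
      proof (rule excess_integral_lower[where Q = "\<lambda>x. ball x \<rho> - E \<kappa>" and v = v])
        show "A \<kappa>' \<subseteq> E \<kappa>" using Emono[of \<kappa> \<kappa>'] \<kappa> by (auto simp: A_def)
        fix x assume x: "x \<in> A \<kappa>'"
        have "ball x \<rho> \<subseteq> ball z R"
        proof
          fix y assume "y \<in> ball x \<rho>"
          then have "dist x y < R / 2" "dist z x < R / 2"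
            using \<rho>R x by (auto simp: A_def dist_norm norm_minus_commute)
          then show "y \<in> ball z R" using dist_triangle[of z y x] by simp
        qed
        moreover have "ennreal (a \<kappa> * R powr n) \<le> emeasure lborel (ball x \<rho> - E \<kappa>)"
        proof -
          have "ennreal (2 * (a \<kappa> * R powr n)) = emeasure lborel (ball x \<rho>)"
            using \<rho> \<rho>n by (simp add: emeasure_ball \<omega>_def n_def)
          also have "\<dots> \<le> emeasure lborel ((ball x \<rho> - E \<kappa>) \<union> E \<kappa>)" by (intro emeasure_mono) auto
          also have "\<dots> \<le> emeasure lborel (ball x \<rho> - E \<kappa>) + emeasure lborel (E \<kappa>)"
            by (intro emeasure_subadditive) auto
          also have "emeasure lborel (E \<kappa>) = ennreal (a \<kappa> * R powr n)" using Efin aE by simp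
          finally have "ennreal (a \<kappa> * R powr n) + ennreal (a \<kappa> * R powr n)
              \<le> emeasure lborel (ball x \<rho> - E \<kappa>) + ennreal (a \<kappa> * R powr n)"
            using a_nn by (simp add: ennreal_plus[symmetric] del: ennreal_plus)
          then show ?thesis by (simp add: ennreal_add_left_cancel_le add.commute)
        qed
        ultimately show "ball x \<rho> - E \<kappa> \<in> sets borel \<and> ball x \<rho> - E \<kappa> \<subseteq> ball z R - E \<kappa> \<and>
            ennreal (a \<kappa> * R powr n) \<le> emeasure lborel (ball x \<rho> - E \<kappa>)"
          by auto
        fix y assume y: "y \<in> ball x \<rho> - E \<kappa>"
        then have "y \<in> ball z R - E \<kappa>" using \<open>ball x \<rho> \<subseteq> ball z R\<close> by auto
        then have vy: "0 \<le> level z R \<sigma> \<kappa> y - v y" using below by simp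
        have ex: "d \<le> excess v z R \<sigma> \<kappa> x" using exc[of x \<kappa>' \<kappa>] x by (simp add: A_def d_def)
        have "d powr p = d powr (p - 1) * d" using d by (simp add: powr_pm1_mult)
        also have "\<dots> \<le> T \<kappa> (x, y)"
          unfolding T_def using ex vy d p by (intro mult_mono powr_mono2) auto
        finally show "norm (x - y) \<le> \<rho> \<and> d powr p \<le> T \<kappa> (x, y)"
          using y by (simp add: dist_norm)
      qed (use \<rho> d a_nn in auto)
      also have "\<dots> \<le> ennreal (C1 * \<sigma> powr p * R powr - (s * p)) * emeasure lborel (E \<kappa>)"
        using \<kappa> by (intro main) auto
      finally have "ennreal (d powr p * (a \<kappa> * R powr n) * (\<rho> powr - K / \<Lambda>)) * ennreal (a \<kappa>' * R powr n)
        \<le> ennreal (C1 * \<sigma> powr p * R powr - (s * p)) * ennreal (a \<kappa> * R powr n)"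
        using EA[of \<kappa>'] Efin aE \<kappa> by (simp add: K_def n_def)
      then have "(d powr p * (a \<kappa> * R powr n) * (\<rho> powr - K / \<Lambda>)) * (a \<kappa>' * R powr n)
        \<le> (C1 * \<sigma> powr p * R powr - (s * p)) * (a \<kappa> * R powr n)"
        using C1 \<sigma> R \<Lambda> a_nn by (simp add: ennreal_mult[symmetric] ennreal_le_iff)
      then have "(d powr p * (\<rho> powr - K / \<Lambda>) * (a \<kappa>' * R powr n)) * (a \<kappa> * R powr n)
        \<le> (C1 * \<sigma> powr p * R powr - (s * p)) * (a \<kappa> * R powr n)"
        by (simp add: ac_simps)
      then have "d powr p * (\<rho> powr - K / \<Lambda>) * (a \<kappa>' * R powr n) \<le> C1 * \<sigma> powr p * R powr - (s * p)"
        by (rule mult_right_le_imp_le) (use apos R in simp)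
      then have "(d powr p * (\<rho> powr - K / \<Lambda>) * (a \<kappa>' * R powr n)) * (\<Lambda> * \<rho> powr K / d powr p)
        \<le> (C1 * \<sigma> powr p * R powr - (s * p)) * (\<Lambda> * \<rho> powr K / d powr p)"
        using \<Lambda> d \<rho> by (intro mult_right_mono) auto
      moreover have "(d powr p * (\<rho> powr - K / \<Lambda>) * (a \<kappa>' * R powr n)) * (\<Lambda> * \<rho> powr K / d powr p) = a \<kappa>' * R powr n"
      proof -
        have "\<rho> powr - K * \<rho> powr K = 1" using \<rho> by (simp add: powr_add[symmetric])
        then show ?thesis using d \<Lambda> by simp
      qed
      moreover have "(C1 * \<sigma> powr p * R powr - (s * p)) * (\<Lambda> * \<rho> powr K / d powr p)
        = (\<Lambda> * C1 * (2 / \<omega>) powr (1 + \<beta>) * (\<sigma> / d) powr p * a \<kappa> powr (1 + \<beta>)) * (R powr - (s * p) * R powr K)"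
        unfolding \<rho>K using \<sigma> d by (simp add: powr_divide)
      ultimately have "a \<kappa>' * R powr n \<le> (\<Lambda> * C1 * (2 / \<omega>) powr (1 + \<beta>) * (\<sigma> / d) powr p * a \<kappa> powr (1 + \<beta>)) * R powr n"
        unfolding R_cancel by simp
      then show ?thesis unfolding d_def by (rule mult_right_le_imp_le) (use R in simp)
    qed
    \<comment> \<open>The levels rise from \<open>M - \<sigma> / 2\<close> towards
      \<open>M - \<sigma> / 4\<close> in steps of \<open>\<sigma> / 8 / 2 ^ i\<close>. The quotient
      of \<open>\<sigma>\<close> and a step is \<open>8 * 2 ^ i\<close>, whence the growth factor
      \<open>2 powr p\<close> of the recursion.\<close>
    define lv where "lv i = M - \<sigma> / 4 - \<sigma> / 4 / 2 ^ i" for i :: nat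
    have lv: "M - \<sigma> \<le> lv i" "lv i < lv (Suc i)" "lv i \<le> M - \<sigma> / 4" "lv 0 = M - \<sigma> / 2" for i
    proof -
      have "\<sigma> / 4 / 2 ^ i \<le> \<sigma> / 4 / 1" using \<sigma> by (intro divide_left_mono) auto
      then show "M - \<sigma> \<le> lv i" using \<sigma> by (simp add: lv_def)
    qed (use \<sigma> in \<open>auto simp: lv_def field_simps\<close>)
    have "(\<lambda>i. a (lv i)) \<longlonglongrightarrow> 0"
    proof (rule \<epsilon>(3)[rule_format])
      show "0 \<le> a (lv i)" for i by (rule a_nn)
      show "a (lv 0) \<le> \<epsilon>" using small lv(4) by simp
      fix i assume "a (lv i) \<le> \<epsilon>1"
      then have "a (lv (Suc i)) \<le> \<Lambda> * C1 * (2 / \<omega>) powr (1 + \<beta>) * (\<sigma> / (lv (Suc i) - lv i)) powr p * a (lv i) powr (1 + \<beta>)"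
        using lv(1)[of i] lv(2)[of i] lv(3)[of "Suc i"] \<sigma> by (intro step) auto
      also have "\<sigma> / (lv (Suc i) - lv i) = 8 * 2 ^ i" using \<sigma> by (simp add: lv_def field_simps)
      also have "(8 * 2 ^ i) powr p = 8 powr p * (2 powr p) ^ i" by (simp add: powr_mult powr_two_power)
      finally show "a (lv (Suc i)) \<le> C * (2 powr p) ^ i * a (lv i) powr (1 + \<beta>)"
        by (simp add: C_def ac_simps)
    qed
    moreover have "a (M - \<sigma> / 4) \<le> a (lv i)" for i
    proof -
      have "measure lborel (E (M - \<sigma> / 4)) \<le> measure lborel (E (lv i))"
        using Emono[OF lv(3)[of i]] Efin by (intro measure_mono_fmeasurable) (auto simp: fmeasurable_def)
      then show ?thesis using R by (auto simp: a_def intro!: divide_right_mono)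
    qed
    ultimately have "a (M - \<sigma> / 4) \<le> 0"
      by (intro LIMSEQ_le_const[of "\<lambda>i. a (lv i)"]) auto
    then have "emeasure lborel (E (M - \<sigma> / 4)) = 0"
      using a_nn[of "M - \<sigma> / 4"] Efin aE by simp
    then have "AE x in lborel. x \<notin> E (M - \<sigma> / 4)"
      by (intro AE_not_in) auto
    then show "AE x in lborel. x \<in> ball z (R / 4) \<longrightarrow> v x \<le> M - \<sigma> / 4"
    proof eventually_elim
      fix x assume x: "x \<notin> E (M - \<sigma> / 4)"
      show "x \<in> ball z (R / 4) \<longrightarrow> v x \<le> M - \<sigma> / 4"
      proof
        assume "x \<in> ball z (R / 4)"
        then have "ramp z R x = 0" "x \<in> ball z R"
          using R by (auto intro!: ramp_eq_0 simp: dist_norm norm_minus_commute)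
        then show "v x \<le> M - \<sigma> / 4" using x by (auto simp: E_def superlevel_def level_def)
      qed
    qed
  qed
qed

end

section \<open>The obstacle problem\<close>

context nonlocal_kernel
begin

lemma tail_finite_bound:
  assumes [measurable]: "g \<in> borel_measurable borel" and g: "tail_finite g" and f: "\<And>y. \<bar>f y\<bar> \<le> \<bar>g y\<bar> + c" and c: "0 \<le> c"
  shows "tail_finite f"
proof -
  have "(\<integral>\<^sup>+y. ennreal (\<bar>f y\<bar> powr (p - 1) * weight y) \<partial>lborel)
    \<le> (\<integral>\<^sup>+y. ennreal (2 powr (p - 1)) * ennreal (\<bar>g y\<bar> powr (p - 1) * weight y)
         + ennreal (2 powr (p - 1) * c powr (p - 1)) * ennreal (weight y) \<partial>lborel)"
  proof (intro nn_integral_mono)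
    fix y
    have "\<bar>f y\<bar> powr (p - 1) \<le> (\<bar>g y\<bar> + c) powr (p - 1)" using p f by (intro powr_mono2) auto
    also have "\<dots> \<le> 2 powr (p - 1) * (\<bar>g y\<bar> powr (p - 1) + c powr (p - 1))" using p c by (intro powr_add_le) auto
    finally have "\<bar>f y\<bar> powr (p - 1) * weight y \<le> 2 powr (p - 1) * (\<bar>g y\<bar> powr (p - 1) + c powr (p - 1)) * weight y"
      using weight_pos[of y] by (intro mult_right_mono) auto
    then show "ennreal (\<bar>f y\<bar> powr (p - 1) * weight y) \<le> ennreal (2 powr (p - 1)) * ennreal (\<bar>g y\<bar> powr (p - 1) * weight y)
         + ennreal (2 powr (p - 1) * c powr (p - 1)) * ennreal (weight y)"
      using weight_pos[of y]
      by (simp add: ennreal_mult[symmetric] ennreal_plus[symmetric] less_imp_le algebra_simps ennreal_leI del: ennreal_plus)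
  qed
  also have "\<dots> = ennreal (2 powr (p - 1)) * (\<integral>\<^sup>+y. ennreal (\<bar>g y\<bar> powr (p - 1) * weight y) \<partial>lborel)
     + ennreal (2 powr (p - 1) * c powr (p - 1)) * (\<integral>\<^sup>+y. ennreal (weight y) \<partial>lborel)"
    by (simp add: nn_integral_add nn_integral_cmult)
  also have "\<dots> < \<infinity>" using g weight_finite by (simp add: tail_finite_def ennreal_mult_less_top)
  finally show ?thesis by (simp add: tail_finite_def)
qed

text \<open>The increments are compared only almost everywhere, because the truncations to which
  this is applied use essential bounds on \<open>v\<close>.\<close>

lemma energy_finite_bound:
  assumes [measurable]: "N \<in> sets borel" "v \<in> borel_measurable borel" and N: "bounded N" and v: "energy N v < \<infinity>" and L: "0 \<le> L"
    and h: "AE z in \<nu>. z \<in> N \<times> N \<longrightarrow> \<bar>h (fst z) - h (snd z)\<bar> \<le> \<bar>v (fst z) - v (snd z)\<bar> + L * norm (fst z - snd z)"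
  shows "energy N h < \<infinity>"
proof -
  have "energy N h \<le> (\<integral>\<^sup>+z. ennreal (2 powr p) * (indicator (N \<times> N) z * ennreal (\<bar>v (fst z) - v (snd z)\<bar> powr p)) +
     ennreal (2 powr p * L powr p) * (indicator (N \<times> N) z * ennreal (norm (fst z - snd z) powr p)) \<partial>\<nu>)"
    unfolding energy_def
  proof (rule nn_integral_mono_AE, use h in eventually_elim)
    fix z assume le: "z \<in> N \<times> N \<longrightarrow> \<bar>h (fst z) - h (snd z)\<bar> \<le> \<bar>v (fst z) - v (snd z)\<bar> + L * norm (fst z - snd z)"
    show "indicator (N \<times> N) z * ennreal (\<bar>h (fst z) - h (snd z)\<bar> powr p)
      \<le> ennreal (2 powr p) * (indicator (N \<times> N) z * ennreal (\<bar>v (fst z) - v (snd z)\<bar> powr p)) +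
     ennreal (2 powr p * L powr p) * (indicator (N \<times> N) z * ennreal (norm (fst z - snd z) powr p))"
    proof (cases "z \<in> N \<times> N")
      case True
      have "\<bar>h (fst z) - h (snd z)\<bar> powr p \<le> (\<bar>v (fst z) - v (snd z)\<bar> + L * norm (fst z - snd z)) powr p"
        using le True p by (intro powr_mono2) auto
      also have "\<dots> \<le> 2 powr p * (\<bar>v (fst z) - v (snd z)\<bar> powr p + (L * norm (fst z - snd z)) powr p)"
        using L p by (intro powr_add_le) auto
      also have "\<dots> = 2 powr p * \<bar>v (fst z) - v (snd z)\<bar> powr p + 2 powr p * L powr p * norm (fst z - snd z) powr p"
        using L by (simp add: powr_mult algebra_simps)
      finally show ?thesis using True
        by (simp add: ennreal_mult[symmetric] ennreal_plus[symmetric] ennreal_leI del: ennreal_plus)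
    qed simp
  qed
  also have "\<dots> = ennreal (2 powr p) * energy N v +
     ennreal (2 powr p * L powr p) * (\<integral>\<^sup>+z. indicator (N \<times> N) z * ennreal (norm (fst z - snd z) powr p) \<partial>\<nu>)"
    unfolding energy_def by (simp add: nn_integral_add nn_integral_cmult borel_measurable_\<nu>)
  also have "\<dots> < \<infinity>"
    using v near_integral_finite[of N] N by (simp add: ennreal_mult_less_top)
  finally show ?thesis .
qed

lemma energy_lipschitz:
  assumes "N \<in> sets borel" "bounded N" "0 \<le> L" "\<And>x y. x \<in> N \<Longrightarrow> y \<in> N \<Longrightarrow> \<bar>h x - h y\<bar> \<le> L * norm (x - y)"
  shows "energy N h < \<infinity>"
  by (rule energy_finite_bound[of N "\<lambda>_. 0" L]) (use assms in \<open>auto simp: energy_def\<close>)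

lemma separatedI:
  assumes "open N" "bounded N" "S \<in> sets borel" "closure S \<subseteq> N"
  shows "separated S N"
proof -
  have "compact (closure S)" using assms by (meson bounded_closure bounded_subset closure_subset compact_closure subset_trans)
  moreover have "closed (- N)" "closure S \<inter> - N = {}" using assms by auto
  ultimately obtain d where "0 < d" "\<forall>x\<in>closure S. \<forall>y\<in>- N. d \<le> dist x y"
    by (rule separate_compact_closed[THEN exE]) auto
  then show ?thesis using assms closure_subset[of S] by (auto simp: separated_def intro!: exI[of _ d])
qed

end

text \<open>Outside \<open>N\<close> the function \<open>g\<close> is the exterior datum: bounded
  above, but from below only of finite tail. On \<open>N\<close> the Lipschitz bound gives it finite
  energy, so that \<open>g\<close> is itself a competitor of finite \<open>J\<close>.\<close>

locale obstacle_problem = nonlocal_kernel s p \<Lambda> k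
  for s p \<Lambda> :: real and k :: "'a::euclidean_space \<times> 'a \<Rightarrow> real" +
  fixes N D :: "'a set" and g :: "'a \<Rightarrow> real" and M L :: real
  assumes N: "open N" "bounded N" and D: "open D" "closure D \<subseteq> N"
    and g_borel [measurable]: "g \<in> borel_measurable borel"
    and g_lip: "\<And>x y. x \<in> N \<Longrightarrow> y \<in> N \<Longrightarrow> \<bar>g x - g y\<bar> \<le> L * norm (x - y)" and L: "0 \<le> L"
    and g_bound: "\<And>x. x \<in> N \<Longrightarrow> \<bar>g x\<bar> \<le> M" and g_le: "\<And>x. g x \<le> M" and M: "0 \<le> M"
    and g_tail: "tail_finite g"
begin

text \<open>The ceiling \<open>M + 1\<close> bounds all competitors on \<open>D\<close> uniformly.
  The minimizer is later chosen below \<open>M\<close>, so the ceiling leaves room for upward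
  variations.\<close>

definition adm :: "('a \<Rightarrow> real) \<Rightarrow> bool"
  where "adm w \<longleftrightarrow> w \<in> borel_measurable borel \<and> (\<forall>x. x \<notin> D \<longrightarrow> w x = g x) \<and> (\<forall>x\<in>D. g x \<le> w x \<and> w x \<le> M + 1)"

text \<open>The constants come from \<open>abs_powr_diff_le\<close>: the factor \<open>p\<close>,
  the bound \<open>2 * M + 1\<close> for the difference of a competitor and \<open>g\<close> on
  \<open>D\<close>, and \<open>2 powr (p - 1)\<close> from splitting a sum.\<close>

definition comp :: "'a \<times> 'a \<Rightarrow> real"
  where "comp z = p * (2 * M + 1) * 2 powr (p - 1) * far D N (M + 1) g z"

text \<open>The energy of \<open>w\<close> relative to that of \<open>g\<close>, which may be infinite far away, plus an
  integrable function that makes the integrand nonnegative for all admissible \<open>w\<close>.\<close>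
definition density :: "('a \<Rightarrow> real) \<Rightarrow> 'a \<times> 'a \<Rightarrow> real"
  where "density w z = \<bar>w (fst z) - w (snd z)\<bar> powr p - \<bar>g (fst z) - g (snd z)\<bar> powr p
     + (indicator (N \<times> N) z * \<bar>g (fst z) - g (snd z)\<bar> powr p + comp z)"

definition J :: "('a \<Rightarrow> real) \<Rightarrow> ennreal"
  where "J w = (\<integral>\<^sup>+z. ennreal (density w z) \<partial>\<nu>)"

lemma DN: "D \<subseteq> N" using D closure_subset by blast

lemma ND_borel [measurable]: "N \<in> sets borel" "D \<in> sets borel" using N D by auto

lemma sep: "separated D N" by (rule separatedI) (use N D in auto)

lemma comp_borel [measurable]: "comp \<in> borel_measurable borel"
  unfolding comp_def by measurable

lemma comp_nonneg: "0 \<le> comp z"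
  unfolding comp_def using p M far_nonneg by (intro mult_nonneg_nonneg) auto

lemma comp_integrable: "integrable \<nu> comp"
  unfolding comp_def by (intro integrable_mult_right far_integrable sep g_borel g_tail)

lemma adm_borel: "adm w \<Longrightarrow> w \<in> borel_measurable borel" by (simp add: adm_def)

lemma density_borel [measurable]:
  assumes [measurable]: "w \<in> borel_measurable borel"
  shows "density w \<in> borel_measurable borel"
  unfolding density_def by measurable

lemma adm_bound: "adm w \<Longrightarrow> x \<in> N \<Longrightarrow> \<bar>w x\<bar> \<le> M + 1"
  using g_bound[of x] DN by (cases "x \<in> D") (force simp: adm_def)+

lemma adm_tail: "adm w \<Longrightarrow> tail_finite w"
proof (rule tail_finite_bound[OF g_borel g_tail])
  assume w: "adm w"
  fix y show "\<bar>w y\<bar> \<le> \<bar>g y\<bar> + (M + 1)"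
    using adm_bound[OF w, of y] w DN M by (cases "y \<in> D") (auto simp: adm_def)
qed (use M in simp)

text \<open>Far values of a competitor are those of \<open>g\<close>, so the two powers differ only
  through a bounded change in \<open>D\<close>; by the mean value estimate the far value enters with
  exponent \<open>p - 1\<close>.\<close>

lemma far_difference:
  assumes w: "adm w" and z: "z \<notin> N \<times> N"
  shows "\<bar>\<bar>w (fst z) - w (snd z)\<bar> powr p - \<bar>g (fst z) - g (snd z)\<bar> powr p\<bar> \<le> comp z"
proof -
  have *: "\<bar>\<bar>w x - g y\<bar> powr p - \<bar>g x - g y\<bar> powr p\<bar> \<le> p * (2 * M + 1) * 2 powr (p - 1) * ((M + 1) powr (p - 1) + \<bar>g y\<bar> powr (p - 1))"
    if "x \<in> D" for x y
  proof -
    have b: "\<bar>w x\<bar> \<le> M + 1" "\<bar>g x\<bar> \<le> M" using that DN adm_bound[OF w, of x] g_bound[of x] by auto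
    have "\<bar>\<bar>w x - g y\<bar> powr p - \<bar>g x - g y\<bar> powr p\<bar>
      \<le> p * (max \<bar>w x - g y\<bar> \<bar>g x - g y\<bar>) powr (p - 1) * \<bar>\<bar>w x - g y\<bar> - \<bar>g x - g y\<bar>\<bar>"
      by (rule abs_powr_diff_le[OF p])
    also have "\<dots> \<le> p * ((M + 1) + \<bar>g y\<bar>) powr (p - 1) * (2 * M + 1)"
    proof (intro mult_mono powr_mono2)
      show "\<bar>\<bar>w x - g y\<bar> - \<bar>g x - g y\<bar>\<bar> \<le> 2 * M + 1" using b by linarith
    qed (use b p M in auto)
    also have "\<dots> \<le> p * (2 powr (p - 1) * ((M + 1) powr (p - 1) + \<bar>g y\<bar> powr (p - 1))) * (2 * M + 1)"
      using p M by (intro mult_right_mono mult_left_mono powr_add_le) auto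
    finally show ?thesis by (simp add: ac_simps)
  qed
  obtain x y where xy: "z = (x, y)" by (cases z)
  consider "x \<in> D" "y \<notin> N" | "x \<notin> N" "y \<in> D" | "x \<notin> D" "y \<notin> D" using z DN xy by auto
  then show ?thesis
  proof cases
    case 1
    then have "w y = g y" using w DN by (auto simp: adm_def)
    then show ?thesis using *[OF 1(1), of y] 1 DN by (auto simp: xy comp_def far_def)
  next
    case 2
    then have "w x = g x" using w DN by (auto simp: adm_def)
    then show ?thesis using *[OF 2(2), of x] 2 DN by (auto simp: xy comp_def far_def abs_minus_commute)
  next
    case 3
    then have "w x = g x" "w y = g y" using w by (auto simp: adm_def)
    then show ?thesis using comp_nonneg by (simp add: xy)
  qed
qed

text \<open>On \<open>N \<times> N\<close> the terms with \<open>g\<close> cancel and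
  \<open>comp\<close> is nonnegative; elsewhere \<open>comp\<close> absorbs the difference.\<close>

lemma density_lower:
  assumes "adm w"
  shows "indicator (N \<times> N) z * \<bar>w (fst z) - w (snd z)\<bar> powr p \<le> density w z"
  using far_difference[OF assms, of z] comp_nonneg[of z] by (cases "z \<in> N \<times> N") (auto simp: density_def)

lemma density_nonneg: "adm w \<Longrightarrow> 0 \<le> density w z"
  using density_lower[of w z] by (smt (verit) indicator_pos_le mult_nonneg_nonneg powr_ge_zero)

lemma energy_g: "energy N g < \<infinity>"
  by (rule energy_lipschitz[OF _ N(2) L g_lip]) auto

lemma adm_g: "adm g"
proof -
  have "g x \<le> M + 1" for x using g_le[of x] by simp
  then show ?thesis by (auto simp: adm_def)
qed

lemma J_g: "J g < \<infinity>"
proof -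
  have "integrable \<nu> (\<lambda>z. indicator (N \<times> N) z * \<bar>g (fst z) - g (snd z)\<bar> powr p + comp z)"
    by (intro Bochner_Integration.integrable_add near_integrable comp_integrable energy_g) auto
  moreover have "density g = (\<lambda>z. indicator (N \<times> N) z * \<bar>g (fst z) - g (snd z)\<bar> powr p + comp z)"
    by (auto simp: density_def)
  ultimately show ?thesis unfolding J_def
    by (simp add: real_integrable_def less_top)
qed

lemma energy_le_J:
  assumes "adm w" shows "energy N w \<le> J w"
  unfolding energy_def J_def
proof (intro nn_integral_mono)
  fix z
  show "indicator (N \<times> N) z * ennreal (\<bar>w (fst z) - w (snd z)\<bar> powr p) \<le> ennreal (density w z)"
    using density_lower[OF assms, of z] by (cases "z \<in> N \<times> N") (auto intro: ennreal_leI)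
qed

lemma adm_lattice:
  assumes "adm a" "adm b"
  shows "adm (\<lambda>x. min (a x) (b x))" "adm (\<lambda>x. max (a x) (b x))"
  using assms by (auto simp: adm_def)

lemma J_lattice:
  assumes a: "adm a" and b: "adm b"
  shows "J (\<lambda>x. min (a x) (b x)) + J (\<lambda>x. max (a x) (b x)) \<le> J a + J b"
proof -
  note [measurable] = adm_borel[OF a] adm_borel[OF b]
  have "J (\<lambda>x. min (a x) (b x)) + J (\<lambda>x. max (a x) (b x))
    = (\<integral>\<^sup>+z. ennreal (density (\<lambda>x. min (a x) (b x)) z) + ennreal (density (\<lambda>x. max (a x) (b x)) z) \<partial>\<nu>)"
    unfolding J_def by (rule nn_integral_add[symmetric]) (auto simp: borel_measurable_\<nu>)
  also have "\<dots> \<le> (\<integral>\<^sup>+z. ennreal (density a z) + ennreal (density b z) \<partial>\<nu>)"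
  proof (intro nn_integral_mono)
    fix z
    have "density (\<lambda>x. min (a x) (b x)) z + density (\<lambda>x. max (a x) (b x)) z \<le> density a z + density b z"
      using abs_powr_submodular[OF p, of "a (fst z)" "b (fst z)" "a (snd z)" "b (snd z)"]
      unfolding density_def by linarith
    then show "ennreal (density (\<lambda>x. min (a x) (b x)) z) + ennreal (density (\<lambda>x. max (a x) (b x)) z)
        \<le> ennreal (density a z) + ennreal (density b z)"
      using density_nonneg adm_lattice[OF a b] a b
      by (simp add: ennreal_plus[symmetric] ennreal_leI del: ennreal_plus)
  qed
  also have "\<dots> = J a + J b"
    unfolding J_def by (rule nn_integral_add) (auto simp: borel_measurable_\<nu>)
  finally show ?thesis .
qed

lemma adm_limit:
  assumes W: "\<And>i::nat. adm (W i)" and lim: "\<And>x. (\<lambda>i. W i x) \<longlonglongrightarrow> w x"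
  shows "adm w" "J w \<le> liminf (\<lambda>i. J (W i))"
proof -
  note [measurable] = adm_borel[OF W]
  have [measurable]: "w \<in> borel_measurable borel"
    by (rule borel_measurable_LIMSEQ_real[OF lim]) measurable
  show "adm w"
    unfolding adm_def
  proof (intro conjI allI impI ballI)
    fix x assume "x \<notin> D"
    then have "(\<lambda>i. W i x) = (\<lambda>i. g x)" using W by (auto simp: adm_def)
    then show "w x = g x" using lim[of x] by (simp add: LIMSEQ_const_iff)
  next
    fix x assume "x \<in> D"
    then have "\<And>i. g x \<le> W i x \<and> W i x \<le> M + 1" using W by (auto simp: adm_def)
    then show "g x \<le> w x" "w x \<le> M + 1"
      using lim[of x] by (auto intro: LIMSEQ_le_const LIMSEQ_le_const2)
  qed simp
  have "J w = (\<integral>\<^sup>+z. liminf (\<lambda>i. ennreal (density (W i) z)) \<partial>\<nu>)"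
    unfolding J_def
  proof (intro nn_integral_cong lim_imp_Liminf[symmetric] tendsto_ennrealI)
    fix z show "(\<lambda>i. density (W i) z) \<longlonglongrightarrow> density w z"
      unfolding density_def using p
      by (intro tendsto_intros tendsto_powr' lim) auto
  qed simp
  also have "\<dots> \<le> liminf (\<lambda>i. J (W i))"
    unfolding J_def by (rule nn_integral_liminf) (auto simp: borel_measurable_\<nu>)
  finally show "J w \<le> liminf (\<lambda>i. J (W i))" .
qed

text \<open>No compactness is needed: by submodularity, the suprema of the tails of a fast minimizing
  sequence again form a minimizing sequence, and they decrease.\<close>
lemma minimizer_exists:
  obtains v where "adm v" "\<And>x. v x \<le> M" "\<And>w. adm w \<Longrightarrow> J v \<le> J w"
proof -
  define m where "m = (INF w\<in>{w. adm w}. J w)"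
  have m_le: "m \<le> J w" if "adm w" for w unfolding m_def using that by (intro INF_lower) auto
  have m_fin: "m < \<infinity>" using m_le[OF adm_g] J_g by (rule le_less_trans)
  have "\<exists>w. adm w \<and> J w \<le> m + ennreal ((1 / 2) ^ i)" for i :: nat
  proof -
    have "m < m + ennreal ((1 / 2) ^ i)"
      using m_fin by (cases m) (auto simp: ennreal_plus[symmetric] ennreal_less_iff simp del: ennreal_plus)
    then obtain w where "w \<in> {w. adm w}" "J w < m + ennreal ((1 / 2) ^ i)"
      unfolding m_def by (subst (asm) INF_less_iff) blast
    then show ?thesis by (auto intro: less_imp_le)
  qed
  then obtain w where w: "\<And>i. adm (w i)" "\<And>i. J (w i) \<le> m + ennreal ((1 / 2) ^ i)" by metis
  \<comment> \<open>\<open>W k j\<close> is the maximum of \<open>w k\<close>, ...,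
    \<open>w (k + j)\<close>. Its energy exceeds \<open>m\<close> by at most the sum of the errors
    \<open>(1 / 2) ^ i\<close> of its members, which is the expression in the claim about
    \<open>W\<close>.\<close>
  define W where "W k = rec_nat (w k) (\<lambda>j f x. max (f x) (w (k + Suc j) x))" for k
  have W0: "W k 0 = w k" and WS: "W k (Suc j) = (\<lambda>x. max (W k j x) (w (k + Suc j) x))" for k j
    by (simp_all add: W_def)
  have W: "adm (W k j) \<and> J (W k j) \<le> m + ennreal (2 * (1 / 2) ^ k - (1 / 2) ^ (k + j))" for k j
  proof (induction j)
    case 0
    have "2 * (1 / 2) ^ k - (1 / 2) ^ k = ((1 / 2) ^ k :: real)" by simp
    then show ?case using w by (simp add: W0)
  next
    case (Suc j)
    define e where "e = 2 * (1 / 2) ^ k - ((1 / 2) ^ (k + j) :: real)"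
    have e: "0 \<le> e"
    proof -
      have "(1 / 2) ^ (k + j) \<le> ((1 / 2) ^ k :: real)" by (intro power_decreasing) auto
      moreover have "0 \<le> ((1 / 2) ^ k :: real)" by simp
      ultimately show ?thesis unfolding e_def by linarith
    qed
    have adm: "adm (W k j)" using Suc by simp
    \<comment> \<open>The minimum of two competitors is again a competitor and has energy at least
      \<open>m\<close>; cancelling the finite \<open>m\<close> leaves the maximum with the two
      errors added.\<close>
    have "m + J (W k (Suc j)) \<le> J (\<lambda>x. min (W k j x) (w (k + Suc j) x)) + J (W k (Suc j))"
      by (intro add_right_mono m_le adm_lattice adm w)
    also have "\<dots> \<le> J (W k j) + J (w (k + Suc j))"
      unfolding WS by (intro J_lattice adm w)
    also have "\<dots> \<le> (m + ennreal e) + (m + ennreal ((1 / 2) ^ (k + Suc j)))"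
      unfolding e_def by (intro add_mono conjunct2[OF Suc] w(2))
    also have "\<dots> = m + (m + (ennreal e + ennreal ((1 / 2) ^ (k + Suc j))))" by (simp add: ac_simps)
    finally have "J (W k (Suc j)) \<le> m + (ennreal e + ennreal ((1 / 2) ^ (k + Suc j)))"
      using m_fin ennreal_add_left_cancel_le[of m] by (auto simp: less_top)
    also have "ennreal e + ennreal ((1 / 2) ^ (k + Suc j)) = ennreal (2 * (1 / 2) ^ k - (1 / 2) ^ (k + Suc j))"
      using e by (simp add: ennreal_plus[symmetric] e_def del: ennreal_plus)
    finally show ?case using adm_lattice(2)[OF adm w(1)] by (simp add: WS)
  qed
  have Wbd: "W k j x \<le> max (M + 1) (g x)" for k j x
    using W[of k j] by (cases "x \<in> D") (auto simp: adm_def)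
  have Wge: "g x \<le> W k j x" for k j x
    using W[of k j] by (cases "x \<in> D") (auto simp: adm_def)
  have Winc: "incseq (\<lambda>j. W k j x)" for k x by (rule incseq_SucI) (simp add: WS)
  define V where "V k x = (SUP j. W k j x)" for k x
  have bdd: "bdd_above (range (\<lambda>j. W k j x))" for k x by (rule bdd_aboveI2) (rule Wbd)
  have WV: "W k j x \<le> V k x" for k j x
    unfolding V_def by (rule cSUP_upper[OF UNIV_I bdd])
  have Vlim: "(\<lambda>j. W k j x) \<longlonglongrightarrow> V k x" for k x
    unfolding V_def by (rule LIMSEQ_incseq_SUP[OF bdd Winc])
  have V: "adm (V k)" "J (V k) \<le> liminf (\<lambda>j. J (W k j))" for k
    using adm_limit[OF conjunct1[OF W] Vlim] by auto
  have JV: "J (V k) \<le> m + ennreal (2 * (1 / 2) ^ k)" for k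
  proof -
    have "liminf (\<lambda>j. J (W k j)) \<le> liminf (\<lambda>j::nat. m + ennreal (2 * (1 / 2) ^ k))"
    proof (intro Liminf_mono always_eventually allI)
      fix j
      show "J (W k j) \<le> m + ennreal (2 * (1 / 2) ^ k)"
        using W[of k j] by (auto elim!: order_trans intro!: add_left_mono ennreal_leI)
    qed
    then show ?thesis using V(2)[of k] by (simp add: Liminf_const)
  qed
  have WW: "W (Suc k) j x \<le> W k (Suc j) x" for k j x
    by (induction j) (auto simp: W0 WS max_def)
  have Vdec: "V (Suc k) x \<le> V k x" for k x
    unfolding V_def[of "Suc k"]
  proof (rule cSUP_least)
    fix j show "W (Suc k) j x \<le> V k x"
      by (rule order_trans[OF WW WV])
  qed simp
  define u where "u x = (INF k. V k x)" for x
  have Vge: "g x \<le> V k x" for k x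
    by (rule order_trans[OF Wge WV])
  have ulim: "(\<lambda>k. V k x) \<longlonglongrightarrow> u x" for x
    unfolding u_def
  proof (rule LIMSEQ_decseq_INF)
    show "bdd_below (range (\<lambda>k. V k x))" by (rule bdd_belowI2) (rule Vge)
    show "decseq (\<lambda>k. V k x)" using Vdec by (intro decseq_SucI) auto
  qed
  have u: "adm u" "J u \<le> liminf (\<lambda>k. J (V k))"
    using adm_limit[OF V(1) ulim] by auto
  have "liminf (\<lambda>k. J (V k)) \<le> liminf (\<lambda>k. m + ennreal (2 * (1 / 2) ^ k))"
    by (intro Liminf_mono always_eventually allI JV)
  also have "\<dots> = m + ennreal (2 * 0)"
    by (intro lim_imp_Liminf tendsto_add tendsto_ennrealI tendsto_intros LIMSEQ_power_zero) auto
  finally have Ju: "J u \<le> m" using u by simp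
  \<comment> \<open>Cutting at \<open>M\<close> respects the constraints, since \<open>g\<close>
    stays below \<open>M\<close>, and enlarges no increment, so \<open>J\<close> does not grow. It
    gains the distance 1 from the ceiling.\<close>
  define v where "v x = min (u x) M" for x
  have [measurable]: "u \<in> borel_measurable borel" by (rule adm_borel[OF u(1)])
  have "v \<in> borel_measurable borel" unfolding v_def by measurable
  then have v: "adm v" using u(1) g_le by (auto simp: adm_def v_def min_absorb1)
  have "J v \<le> J u"
    unfolding J_def
  proof (intro nn_integral_mono ennreal_leI)
    fix z
    have "\<bar>v (fst z) - v (snd z)\<bar> powr p \<le> \<bar>u (fst z) - u (snd z)\<bar> powr p"
      using p by (intro powr_mono2) (auto simp: v_def min_def)
    then show "density v z \<le> density u z" by (simp add: density_def)
  qed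
  with Ju have Jv: "J v \<le> m" by simp
  show thesis
  proof (rule that[OF v])
    show "v x \<le> M" for x by (simp add: v_def)
    show "J v \<le> J w" if "adm w" for w using Jv m_le[OF that] by simp
  qed
qed

text \<open>One-sided differentiation of \<open>J\<close> in the direction \<open>h\<close> under
  the integral sign. The obstacle restricts the direction by \<open>g \<le> v + t * h\<close>; the
  ceiling is avoided by small steps. The bound on the increments of \<open>h\<close> gives it finite
  energy.\<close>

lemma variational_inequality:
  assumes v: "adm v" "\<And>x. v x \<le> M" and min: "\<And>w. adm w \<Longrightarrow> J v \<le> J w"
    and h [measurable]: "h \<in> borel_measurable borel" and hD: "\<And>x. x \<notin> D \<Longrightarrow> h x = 0" and hc: "\<And>x. \<bar>h x\<bar> \<le> c"
    and L': "0 \<le> L'" and hL: "AE z in \<nu>. z \<in> N \<times> N \<longrightarrow>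
        \<bar>h (fst z) - h (snd z)\<bar> \<le> \<bar>v (fst z) - v (snd z)\<bar> + L' * norm (fst z - snd z)"
    and t: "0 < t" "\<And>x. x \<in> D \<Longrightarrow> g x \<le> v x + t * h x"
  shows "integrable \<nu> (form v h) \<and> 0 \<le> (\<integral>z. form v h z \<partial>\<nu>)"
proof -
  note [measurable] = adm_borel[OF v(1)]
  have Jv: "J v < \<infinity>" using min[OF adm_g] J_g by simp
  then have en: "energy N v < \<infinity>" using energy_le_J[OF v(1)] by simp
  have enh: "energy N h < \<infinity>"
    by (rule energy_finite_bound[OF _ _ N(2) en L' hL]) auto
  have c: "0 \<le> c" using hc[of undefined] by linarith
  have int: "integrable \<nu> (form v h)"
    by (rule form_integrable[OF sep _ _ adm_tail[OF v(1)] hD hc adm_bound[OF v(1)] en enh]) auto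
  define a where "a z = v (fst z) - v (snd z)" for z
  define b where "b z = h (fst z) - h (snd z)" for z
  have [measurable]: "a \<in> borel_measurable borel" "b \<in> borel_measurable borel" unfolding a_def b_def by measurable
  \<comment> \<open>\<open>t0 * c \<le> 1\<close> respects the ceiling, \<open>t0 \<le> t\<close>
    the obstacle, and \<open>t0 \<le> 1\<close> keeps all difference quotients below one dominating
    function.\<close>
  define t0 where "t0 = min t (min 1 (1 / (c + 1)))"
  have t0: "0 < t0" "t0 \<le> t" "t0 \<le> 1" "t0 * c \<le> 1"
  proof -
    show "0 < t0" "t0 \<le> t" "t0 \<le> 1" using t c by (auto simp: t0_def min_le_iff_disj)
    have "t0 * c \<le> 1 / (c + 1) * (c + 1)" using c \<open>0 < t0\<close> by (intro mult_mono) (auto simp: t0_def)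
    then show "t0 * c \<le> 1" using c by simp
  qed
  define \<tau> where "\<tau> i = t0 / real (Suc i)" for i
  have \<tau>: "0 < \<tau> i" "\<tau> i \<le> t0" "\<tau> i \<le> 1" for i
    using t0 by (auto simp: \<tau>_def field_simps intro: order_trans[of _ t0])
  have admi: "adm (\<lambda>x. v x + \<tau> i * h x)" for i
    unfolding adm_def
  proof (intro conjI allI impI ballI)
    fix x assume "x \<notin> D" then show "v x + \<tau> i * h x = g x" using v(1) hD by (simp add: adm_def)
  next
    fix x assume x: "x \<in> D"
    have "\<tau> i * h x \<le> \<tau> i * \<bar>h x\<bar>" using \<tau>[of i] by (intro mult_left_mono) auto
    also have "\<dots> \<le> t0 * c" using \<tau>[of i] hc[of x] t0 by (intro mult_mono) auto
    finally show "v x + \<tau> i * h x \<le> M + 1" using v(2)[of x] t0(4) by linarith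
    have gv: "g x \<le> v x" using v(1) x by (auto simp: adm_def)
    show "g x \<le> v x + \<tau> i * h x"
    proof (cases "0 \<le> h x")
      case True then show ?thesis using gv \<tau>[of i] by (simp add: add_increasing2)
    next
      case False
      have "t * h x \<le> \<tau> i * h x" using False \<tau>[of i] t0 by (intro mult_right_mono_neg) auto
      then show ?thesis using t(2)[OF x] by linarith
    qed
  qed measurable
  define d where "d i z = (\<bar>a z + \<tau> i * b z\<bar> powr p - \<bar>a z\<bar> powr p) / \<tau> i" for i z
  have [measurable]: "d i \<in> borel_measurable borel" for i unfolding d_def by measurable
  \<comment> \<open>On pairs of a point of \<open>D\<close> and a point outside \<open>N\<close> the
    power \<open>\<bar>b z\<bar> powr p\<close> is at most \<open>c powr p\<close>, and
    \<open>far\<close> with parameter 1 is at least 1 there, whatever \<open>g\<close> is.\<close>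
  define dom where "dom z = p * 2 powr (p - 1) * (\<bar>form v h z\<bar> +
      (indicator (N \<times> N) z * \<bar>b z\<bar> powr p + c powr p * far D N 1 g z))" for z
  have dom_int: "integrable \<nu> dom"
    unfolding dom_def b_def
    by (intro integrable_mult_right Bochner_Integration.integrable_add integrable_abs int near_integrable far_integrable
        sep g_borel g_tail enh) auto
  have d_le: "\<bar>d i z\<bar> \<le> dom z" for i z
  proof -
    have "\<bar>\<bar>a z + \<tau> i * b z\<bar> powr p - \<bar>a z\<bar> powr p\<bar>
      \<le> p * (max \<bar>a z + \<tau> i * b z\<bar> \<bar>a z\<bar>) powr (p - 1) * \<bar>\<bar>a z + \<tau> i * b z\<bar> - \<bar>a z\<bar>\<bar>"
      by (rule abs_powr_diff_le[OF p])
    also have "\<dots> \<le> p * (\<bar>a z\<bar> + \<bar>b z\<bar>) powr (p - 1) * (\<tau> i * \<bar>b z\<bar>)"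
    proof (intro mult_mono powr_mono2)
      have "\<bar>\<tau> i * b z\<bar> \<le> 1 * \<bar>b z\<bar>" using \<tau>[of i] by (simp only: abs_mult) (intro mult_right_mono, auto)
      then show "max \<bar>a z + \<tau> i * b z\<bar> \<bar>a z\<bar> \<le> \<bar>a z\<bar> + \<bar>b z\<bar>" by auto
      have "\<bar>\<bar>a z + \<tau> i * b z\<bar> - \<bar>a z\<bar>\<bar> \<le> \<bar>\<tau> i * b z\<bar>" by linarith
      then show "\<bar>\<bar>a z + \<tau> i * b z\<bar> - \<bar>a z\<bar>\<bar> \<le> \<tau> i * \<bar>b z\<bar>" using \<tau>[of i] by (simp add: abs_mult)
    qed (use p in auto)
    finally have "\<bar>d i z\<bar> \<le> p * (\<bar>a z\<bar> + \<bar>b z\<bar>) powr (p - 1) * \<bar>b z\<bar>"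
      using \<tau>[of i] by (simp add: d_def abs_divide divide_le_eq ac_simps)
    also have "\<dots> \<le> p * (2 powr (p - 1) * (\<bar>a z\<bar> powr (p - 1) + \<bar>b z\<bar> powr (p - 1))) * \<bar>b z\<bar>"
      using p by (intro mult_right_mono mult_left_mono powr_add_le) auto
    also have "\<dots> = p * 2 powr (p - 1) * (\<bar>form v h z\<bar> + \<bar>b z\<bar> powr p)"
      by (simp add: form_def abs_mult abs_phi a_def[symmetric] b_def[symmetric] powr_pm1_mult distrib_right)
    also have "\<dots> \<le> dom z"
      unfolding dom_def
    proof (intro mult_left_mono add_left_mono)
      obtain x y where z: "z = (x, y)" by (cases z)
      have bc: "\<bar>h x\<bar> powr p \<le> c powr p" for x using hc p by (intro powr_mono2) auto
      have bf: "c powr p * X \<le> c powr p * (X * (1 + Y))" if "0 \<le> X" "0 \<le> Y" for X Y :: real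
        using that by (intro mult_left_mono) (simp_all add: distrib_left)
      consider "z \<in> N \<times> N" | "x \<in> D" "y \<notin> N" | "x \<notin> N" "y \<in> D" | "x \<notin> D" "y \<notin> D" using z DN by auto
      then show "\<bar>b z\<bar> powr p \<le> indicator (N \<times> N) z * \<bar>b z\<bar> powr p + c powr p * far D N 1 g z"
      proof cases
        case 1 then show ?thesis using far_nonneg by simp
      next
        case 2
        then have "h y = 0" using hD DN by auto
        then show ?thesis using 2 bc[of x] bf[of 1 "\<bar>g y\<bar> powr (p - 1)"] DN by (auto simp: z b_def far_def intro: order_trans)
      next
        case 3
        then have "h x = 0" using hD DN by auto
        then show ?thesis using 3 bc[of y] bf[of 1 "\<bar>g x\<bar> powr (p - 1)"] DN by (auto simp: z b_def far_def intro: order_trans)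
      next
        case 4
        then have "b z = 0" using hD by (simp add: z b_def)
        then show ?thesis using far_nonneg by simp
      qed
    qed (use p in auto)
    finally show ?thesis .
  qed
  have d_int: "integrable \<nu> (d i)" for i
    by (rule Bochner_Integration.integrable_bound[OF dom_int])
       (use d_le in \<open>auto simp: borel_measurable_\<nu> intro!: AE_I2 intro: order_trans[OF _ abs_ge_self]\<close>)
  have \<Phi>_int: "integrable \<nu> (density v)"
    using Jv density_nonneg[OF v(1)] by (intro integrableI_nonneg) (auto simp: borel_measurable_\<nu> J_def)
  have d_nn: "0 \<le> (\<integral>z. d i z \<partial>\<nu>)" for i
  proof -
    have eq: "density (\<lambda>x. v x + \<tau> i * h x) z = density v z + \<tau> i * d i z" for z
    proof -
      have "v (fst z) + \<tau> i * h (fst z) - (v (snd z) + \<tau> i * h (snd z)) = a z + \<tau> i * b z"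
        by (simp add: a_def b_def algebra_simps)
      then show ?thesis using \<tau>[of i] by (simp add: density_def d_def a_def[symmetric])
    qed
    have int2: "integrable \<nu> (\<lambda>z. density v z + \<tau> i * d i z)"
      by (intro Bochner_Integration.integrable_add integrable_mult_right \<Phi>_int d_int)
    have "ennreal (\<integral>z. density v z \<partial>\<nu>) = J v"
      unfolding J_def using density_nonneg[OF v(1)] by (intro nn_integral_eq_integral[symmetric] \<Phi>_int) auto
    also have "\<dots> \<le> J (\<lambda>x. v x + \<tau> i * h x)" by (rule min[OF admi])
    also have "\<dots> = ennreal (\<integral>z. density v z + \<tau> i * d i z \<partial>\<nu>)"
      unfolding J_def eq using density_nonneg[OF admi[of i]] int2
      by (intro nn_integral_eq_integral) (auto simp: eq)
    finally have "(\<integral>z. density v z \<partial>\<nu>) \<le> (\<integral>z. density v z + \<tau> i * d i z \<partial>\<nu>)"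
    proof (subst (asm) ennreal_le_iff)
      show "0 \<le> (\<integral>z. density v z + \<tau> i * d i z \<partial>\<nu>)"
        using density_nonneg[OF admi[of i]] by (intro Bochner_Integration.integral_nonneg) (simp add: eq)
    qed
    then have "0 \<le> \<tau> i * (\<integral>z. d i z \<partial>\<nu>)" using \<Phi>_int d_int by simp
    then show ?thesis using \<tau>[of i] by (simp add: zero_le_mult_iff)
  qed
  have lim: "(\<lambda>i. d i z) \<longlonglongrightarrow> p * form v h z" for z
  proof (cases "b z = 0")
    case True
    then show ?thesis by (simp add: d_def form_def b_def)
  next
    case False
    have \<tau>lim: "\<tau> \<longlonglongrightarrow> 0" unfolding \<tau>_def using LIMSEQ_inverse_real_of_nat tendsto_mult_right_zero[of _ sequentially t0]
      by (auto simp: divide_inverse)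
    have "((\<lambda>x. \<bar>x\<bar> powr p) has_real_derivative (p * phi p (a z))) (at (a z))"
      by (rule abs_powr_has_derivative[OF p])
    then have "(\<lambda>e. (\<bar>a z + e\<bar> powr p - \<bar>a z\<bar> powr p) / e) \<midarrow>0\<rightarrow> p * phi p (a z)" by (simp add: DERIV_def)
    moreover have "filterlim (\<lambda>i. \<tau> i * b z) (at 0) sequentially"
      unfolding filterlim_at using \<tau>lim False \<tau>
      by (auto intro!: tendsto_mult_left_zero always_eventually simp: less_imp_neq[symmetric])
    ultimately have "(\<lambda>i. (\<bar>a z + \<tau> i * b z\<bar> powr p - \<bar>a z\<bar> powr p) / (\<tau> i * b z)) \<longlonglongrightarrow> p * phi p (a z)"
      by (rule filterlim_compose)
    then have "(\<lambda>i. (\<bar>a z + \<tau> i * b z\<bar> powr p - \<bar>a z\<bar> powr p) / (\<tau> i * b z) * b z) \<longlonglongrightarrow> p * phi p (a z) * b z"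
      by (intro tendsto_mult tendsto_const)
    then show ?thesis using False by (simp add: d_def form_def a_def[symmetric] b_def[symmetric] mult.assoc)
  qed
  have "(\<lambda>i. \<integral>z. d i z \<partial>\<nu>) \<longlonglongrightarrow> (\<integral>z. p * form v h z \<partial>\<nu>)"
    by (rule integral_dominated_convergence[OF _ _ dom_int])
       (use lim d_le in \<open>auto simp: borel_measurable_\<nu>\<close>)
  then have "0 \<le> (\<integral>z. p * form v h z \<partial>\<nu>)" by (rule LIMSEQ_le_const) (use d_nn in auto)
  then show ?thesis using p int by (simp add: zero_le_mult_iff)
qed

end

section \<open>Continuity of minimizers\<close>

text \<open>Nonempty open sets are not null. This turns almost everywhere statements into statements
  at some point of a prescribed open set.\<close>

lemma AE_lborel_witness:
  fixes U :: "'a::euclidean_space set"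
  assumes "AE x in lborel. P x" "open U" "U \<noteq> {}"
  obtains x where "x \<in> U" "P x"
proof -
  have "\<exists>x\<in>U. P x"
  proof (rule ccontr)
    assume "\<not> (\<exists>x\<in>U. P x)"
    then have "AE x in lborel. x \<notin> U" using assms(1) by (auto elim!: eventually_mono)
    then have "emeasure lborel U = 0"
      using assms(2) AE_iff_measurable[of U lborel "\<lambda>x. x \<notin> U"] by auto
    then show False
      using assms(2,3) open_not_negligible[of U] negligible_iff_null_sets[of U]
      by (auto simp: null_sets_completion_iff null_sets_def intro: null_sets_completionI)
  qed
  then show thesis using that by blast
qed

text \<open>\<open>c z\<close> is the essential limit of \<open>v\<close> at \<open>z\<close>.
  Overlapping balls share a point where both approximations hold, which gives continuity; for the
  identity almost everywhere, a Lindelof subcover leaves only countably many exceptional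
  sets.\<close>

lemma continuous_representative:
  fixes v c :: "'a::euclidean_space \<Rightarrow> real"
  assumes S: "open S"
    and lim: "\<And>z \<epsilon>. z \<in> S \<Longrightarrow> 0 < \<epsilon> \<Longrightarrow> \<exists>r>0. AE x in lborel. x \<in> ball z r \<longrightarrow> \<bar>v x - c z\<bar> \<le> \<epsilon>"
  shows "continuous_on S c" "AE x in lborel. x \<in> S \<longrightarrow> v x = c x"
proof -
  have near: "\<exists>r>0. (AE x in lborel. x \<in> ball z r \<longrightarrow> \<bar>v x - c z\<bar> \<le> \<epsilon>) \<and> (\<forall>y\<in>S. y \<in> ball z r \<longrightarrow> \<bar>c y - c z\<bar> \<le> 2 * \<epsilon>)"
    if z: "z \<in> S" and e: "0 < \<epsilon>" for z \<epsilon>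
  proof -
    obtain r where r: "0 < r" "AE x in lborel. x \<in> ball z r \<longrightarrow> \<bar>v x - c z\<bar> \<le> \<epsilon>" using lim[OF z e] by blast
    have "\<bar>c y - c z\<bar> \<le> 2 * \<epsilon>" if y: "y \<in> S" "y \<in> ball z r" for y
    proof -
      obtain r' where r': "0 < r'" "AE x in lborel. x \<in> ball y r' \<longrightarrow> \<bar>v x - c y\<bar> \<le> \<epsilon>" using lim[OF y(1) e] by blast
      have "AE x in lborel. (x \<in> ball z r \<longrightarrow> \<bar>v x - c z\<bar> \<le> \<epsilon>) \<and> (x \<in> ball y r' \<longrightarrow> \<bar>v x - c y\<bar> \<le> \<epsilon>)"
        using r(2) r'(2) by eventually_elim blast
      then obtain x where "x \<in> ball z r \<inter> ball y r'" "\<bar>v x - c z\<bar> \<le> \<epsilon>" "\<bar>v x - c y\<bar> \<le> \<epsilon>"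
        by (rule AE_lborel_witness[of _ "ball z r \<inter> ball y r'"]) (use y r' in auto)
      then show ?thesis by linarith
    qed
    then show ?thesis using r by blast
  qed
  show "continuous_on S c"
    unfolding continuous_on_iff
  proof (intro ballI allI impI)
    fix z and e :: real assume z: "z \<in> S" and e: "0 < e"
    obtain r where r: "0 < r" "\<forall>y\<in>S. y \<in> ball z r \<longrightarrow> \<bar>c y - c z\<bar> \<le> 2 * (e / 3)" using near[OF z, of "e / 3"] e by auto
    then show "\<exists>d>0. \<forall>y\<in>S. dist y z < d \<longrightarrow> dist (c y) (c z) < e"
      using e by (intro exI[of _ r]) (force simp: dist_real_def dist_commute)
  qed
  have ae: "AE x in lborel. x \<in> S \<longrightarrow> \<bar>v x - c x\<bar> \<le> 3 * \<epsilon>" if e: "0 < \<epsilon>" for \<epsilon>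
  proof -
    obtain r where "\<forall>z\<in>S. 0 < r z \<and> (AE x in lborel. x \<in> ball z (r z) \<longrightarrow> \<bar>v x - c z\<bar> \<le> \<epsilon>)
        \<and> (\<forall>y\<in>S. y \<in> ball z (r z) \<longrightarrow> \<bar>c y - c z\<bar> \<le> 2 * \<epsilon>)"
      using bchoice[of S "\<lambda>z r. 0 < r \<and> (AE x in lborel. x \<in> ball z r \<longrightarrow> \<bar>v x - c z\<bar> \<le> \<epsilon>)
        \<and> (\<forall>y\<in>S. y \<in> ball z r \<longrightarrow> \<bar>c y - c z\<bar> \<le> 2 * \<epsilon>)"] near[OF _ e] by blast
    then have r: "\<And>z. z \<in> S \<Longrightarrow> 0 < r z"
        "\<And>z. z \<in> S \<Longrightarrow> AE x in lborel. x \<in> ball z (r z) \<longrightarrow> \<bar>v x - c z\<bar> \<le> \<epsilon>"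
        "\<And>z y. z \<in> S \<Longrightarrow> y \<in> S \<Longrightarrow> y \<in> ball z (r z) \<Longrightarrow> \<bar>c y - c z\<bar> \<le> 2 * \<epsilon>"
      by blast+
    obtain F' where F': "F' \<subseteq> (\<lambda>z. ball z (r z)) ` S" "countable F'" "\<Union>F' = \<Union>((\<lambda>z. ball z (r z)) ` S)"
      by (rule Lindelof[of "(\<lambda>z. ball z (r z)) ` S"]) auto
    have "AE x in lborel. \<forall>B\<in>F'. x \<in> B \<longrightarrow> x \<in> S \<longrightarrow> \<bar>v x - c x\<bar> \<le> 3 * \<epsilon>"
    proof (intro AE_ball_countable[THEN iffD2, OF F'(2)] ballI)
      fix B assume "B \<in> F'"
      then obtain z where z: "z \<in> S" "B = ball z (r z)" using F'(1) by auto
      show "AE x in lborel. x \<in> B \<longrightarrow> x \<in> S \<longrightarrow> \<bar>v x - c x\<bar> \<le> 3 * \<epsilon>"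
        using r(2)[OF z(1)]
      proof eventually_elim
        fix x assume le: "x \<in> ball z (r z) \<longrightarrow> \<bar>v x - c z\<bar> \<le> \<epsilon>"
        show "x \<in> B \<longrightarrow> x \<in> S \<longrightarrow> \<bar>v x - c x\<bar> \<le> 3 * \<epsilon>"
        proof (intro impI)
          assume "x \<in> B" "x \<in> S"
          then show "\<bar>v x - c x\<bar> \<le> 3 * \<epsilon>" using le r(3)[OF z(1), of x] z(2) by auto
        qed
      qed
    qed
    then show ?thesis
    proof eventually_elim
      fix x assume *: "\<forall>B\<in>F'. x \<in> B \<longrightarrow> x \<in> S \<longrightarrow> \<bar>v x - c x\<bar> \<le> 3 * \<epsilon>"
      show "x \<in> S \<longrightarrow> \<bar>v x - c x\<bar> \<le> 3 * \<epsilon>"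
      proof
        assume x: "x \<in> S"
        then have "x \<in> ball x (r x)" using r(1) by simp
        then have "x \<in> \<Union>F'" using F'(3) x by blast
        then show "\<bar>v x - c x\<bar> \<le> 3 * \<epsilon>" using * x by blast
      qed
    qed
  qed
  have "AE x in lborel. \<forall>n::nat. x \<in> S \<longrightarrow> \<bar>v x - c x\<bar> \<le> 3 * (1 / real (Suc n))"
    by (subst AE_all_countable) (intro allI ae, simp)
  then show "AE x in lborel. x \<in> S \<longrightarrow> v x = c x"
  proof eventually_elim
    fix x assume *: "\<forall>n::nat. x \<in> S \<longrightarrow> \<bar>v x - c x\<bar> \<le> 3 * (1 / real (Suc n))"
    show "x \<in> S \<longrightarrow> v x = c x"
    proof
      assume "x \<in> S"
      have "(\<lambda>n. 3 * (1 / real (Suc n))) \<longlonglongrightarrow> 3 * 0"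
        using LIMSEQ_inverse_real_of_nat by (intro tendsto_mult tendsto_const) (simp add: inverse_eq_divide)
      then have "\<bar>v x - c x\<bar> \<le> 3 * 0" by (rule LIMSEQ_le_const) (use * \<open>x \<in> S\<close> in auto)
      then show "v x = c x" by simp
    qed
  qed
qed

section \<open>Oscillation decrease at the scale of a single point\<close>

context nonlocal_kernel
begin

lemma tail_integral_finite:
  assumes [measurable]: "f \<in> borel_measurable borel" and tail: "tail_finite f" and r: "0 < r"
  shows "(\<integral>\<^sup>+y. indicator (- ball z r) y * ennreal ((max 0 (f y - m)) powr (p - 1) *
          norm (y - z) powr - (real DIM('a) + s * p)) \<partial>lborel) < \<infinity>"
proof -
  define K where "K = real DIM('a) + s * p"
  define A where "A = (1 + norm z) / r + 1"
  have A: "0 < A" using r by (auto simp: A_def intro!: add_nonneg_pos)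
  have "tail_finite (\<lambda>y. max 0 (f y - m))"
    by (rule tail_finite_bound[OF assms(1) tail, where c = "\<bar>m\<bar>"]) auto
  then have fin: "(\<integral>\<^sup>+y. ennreal ((max 0 (f y - m)) powr (p - 1) * weight y) \<partial>lborel) < \<infinity>"
    by (simp add: tail_finite_def)
  have "(\<integral>\<^sup>+y. indicator (- ball z r) y * ennreal ((max 0 (f y - m)) powr (p - 1) *
          norm (y - z) powr - (real DIM('a) + s * p)) \<partial>lborel)
     \<le> (\<integral>\<^sup>+y. ennreal (A powr K) * ennreal ((max 0 (f y - m)) powr (p - 1) * weight y) \<partial>lborel)"
  proof (intro nn_integral_mono)
    fix y
    show "indicator (- ball z r) y * ennreal ((max 0 (f y - m)) powr (p - 1) *
          norm (y - z) powr - (real DIM('a) + s * p))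
       \<le> ennreal (A powr K) * ennreal ((max 0 (f y - m)) powr (p - 1) * weight y)"
    proof (cases "y \<in> ball z r")
      case False
      then have yr: "r \<le> norm (y - z)" by (simp add: dist_norm norm_minus_commute)
      have "1 + norm y \<le> (1 + norm z) / r * r + norm (y - z)"
        using norm_triangle_ineq[of z "y - z"] r by simp
      also have "\<dots> \<le> (1 + norm z) / r * norm (y - z) + norm (y - z)"
        using yr r by (intro add_right_mono mult_left_mono) auto
      finally have le: "(1 + norm y) / A \<le> norm (y - z)" using A by (simp add: A_def field_simps)
      have pos: "0 < 1 + norm y" by (simp add: add_pos_nonneg)
      have "norm (y - z) powr - K \<le> ((1 + norm y) / A) powr - K"
        using le A pos sp_pos by (intro powr_mono2') (auto simp: K_def)
      also have "\<dots> = A powr K * weight y"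
      proof -
        have "((1 + norm y) / A) powr - q = A powr q * (1 + norm y) powr - q" for q
          using A pos by (simp add: powr_divide powr_minus field_simps)
        then show ?thesis by (simp only: weight_def K_def)
      qed
      finally have "(max 0 (f y - m)) powr (p - 1) * norm (y - z) powr - K
          \<le> (max 0 (f y - m)) powr (p - 1) * (A powr K * weight y)"
        by (intro mult_left_mono) auto
      then show ?thesis using False weight_pos[of y]
        by (simp add: ennreal_mult[symmetric] K_def less_imp_le ac_simps ennreal_leI)
    qed simp
  qed
  also have "\<dots> = ennreal (A powr K) * (\<integral>\<^sup>+y. ennreal ((max 0 (f y - m)) powr (p - 1) * weight y) \<partial>lborel)"
    by (rule nn_integral_cmult) measurable
  also have "\<dots> < \<infinity>" using fin by (simp add: ennreal_mult_less_top)
  finally show ?thesis .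
qed

text \<open>\<open>m0\<close> stands for the essential upper limit at \<open>z\<close>. From the
  bound \<open>m0 + \<sigma> / 8\<close> a decrease by \<open>\<sigma> / 4\<close> leads to
  \<open>m0 - \<sigma> / 8\<close>, strictly below the limit; a caller for whom \<open>m0\<close> is
  the exact limit gets a contradiction from the density hypothesis at one small radius.\<close>

lemma local_drop:
  assumes f [measurable]: "f \<in> borel_measurable borel" and tail: "tail_finite f"
    and sup: "\<And>\<epsilon>. 0 < \<epsilon> \<Longrightarrow> \<exists>r>0. AE x in lborel. x \<in> ball z r \<longrightarrow> f x \<le> m0 + \<epsilon>"
    and k0: "k0 < m0" and c0: "0 < c0" and r1: "0 < r1"
    and test: "\<And>R \<sigma> \<kappa>. \<lbrakk>0 < R; R < r1; 0 < \<sigma>; k0 \<le> \<kappa>; AE x in lborel. x \<in> ball z R \<longrightarrow> f x \<le> \<kappa> + \<sigma>\<rbrakk>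
        \<Longrightarrow> excess_test f z R \<sigma> \<kappa>"
  obtains \<delta> R1 where "0 < \<delta>" "0 < R1"
    "\<And>R. \<lbrakk>0 < R; R < R1; c0 * R ^ DIM('a) \<le> measure lborel {x \<in> ball z (R / 2). f x \<le> k0}\<rbrakk>
      \<Longrightarrow> AE x in lborel. x \<in> ball z (R / 4) \<longrightarrow> f x \<le> m0 - \<delta>"
proof -
  obtain H where H: "1 < H" and osc:
    "\<forall>v z R \<sigma> M. v \<in> borel_measurable borel \<longrightarrow> 0 < R \<longrightarrow> 0 < \<sigma> \<longrightarrow>
      (AE x in lborel. x \<in> ball z R \<longrightarrow> v x \<le> M) \<longrightarrow>
      (\<integral>\<^sup>+y. indicator (- ball z R) y * ennreal ((max 0 (v y - M)) powr (p - 1) *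
          norm (y - z) powr - (real DIM('a) + s * p)) \<partial>lborel) \<le> ennreal (R powr - (s * p) * \<sigma> powr (p - 1)) \<longrightarrow>
      c0 * R ^ DIM('a) \<le> measure lborel {x \<in> ball z (R / 2). v x \<le> M - H * \<sigma>} \<longrightarrow>
      (\<forall>\<kappa>\<in>{M - \<sigma>..M}. excess_test v z R \<sigma> \<kappa>) \<longrightarrow>
      (AE x in lborel. x \<in> ball z (R / 4) \<longrightarrow> v x \<le> M - \<sigma> / 4)"
    by (rule oscillation_decrease[OF c0]) (rule that; assumption)
  \<comment> \<open>With this \<open>\<sigma>\<close> the depth \<open>H * \<sigma>\<close> reaches
    from \<open>m0\<close> down to \<open>k0\<close>, and all levels in use lie above
    \<open>k0\<close>, where the tests are available.\<close>
  define \<sigma> where "\<sigma> = (m0 - k0) / H"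
  have \<sigma>: "0 < \<sigma>" "H * \<sigma> = m0 - k0" using H k0 by (auto simp: \<sigma>_def)
  have \<sigma>le: "\<sigma> \<le> m0 - k0" using \<sigma> H mult_right_mono[of 1 H \<sigma>] by simp
  define M where "M = m0 + \<sigma> / 8"
  obtain r0 where r0: "0 < r0" "AE x in lborel. x \<in> ball z r0 \<longrightarrow> f x \<le> M"
    using sup[of "\<sigma> / 8"] \<sigma> by (auto simp: M_def)
  define T where "T = (\<integral>\<^sup>+y. indicator (- ball z r0) y * ennreal ((max 0 (f y - M)) powr (p - 1) *
          norm (y - z) powr - (real DIM('a) + s * p)) \<partial>lborel)"
  have T: "T < \<infinity>" unfolding T_def by (rule tail_integral_finite[OF f tail r0(1)])
  define t where "t = enn2real T + 1"
  have t: "0 < t" "T \<le> ennreal t"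
  proof -
    show "0 < t" unfolding t_def by (simp add: add_nonneg_pos)
    have "T = ennreal (enn2real T)" using T by simp
    also have "\<dots> \<le> ennreal t" by (intro ennreal_leI) (simp add: t_def)
    finally show "T \<le> ennreal t" .
  qed
  \<comment> \<open>The tail beyond \<open>r0\<close> is a fixed number, while
    \<open>R powr - (s * p) * \<sigma> powr (p - 1)\<close> grows without bound as \<open>R\<close>
    shrinks. The annulus between \<open>R\<close> and \<open>r0\<close> adds nothing, since
    \<open>f \<le> M\<close> there almost everywhere.\<close>
  define R1 where "R1 = min (min r0 r1) ((\<sigma> powr (p - 1) / t) powr (1 / (s * p)))"
  show thesis
  proof (rule that[of "\<sigma> / 8" R1])
    show "0 < \<sigma> / 8" using \<sigma> by simp
    show "0 < R1" using r0 r1 \<sigma> t by (simp add: R1_def)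
    fix R assume R: "0 < R" "R < R1" and dens: "c0 * R ^ DIM('a) \<le> measure lborel {x \<in> ball z (R / 2). f x \<le> k0}"
    have Rr: "R < r0" "R < r1" "R \<le> (\<sigma> powr (p - 1) / t) powr (1 / (s * p))" using R by (auto simp: R1_def)
    have tR: "t \<le> R powr - (s * p) * \<sigma> powr (p - 1)"
    proof -
      have "R powr (s * p) \<le> ((\<sigma> powr (p - 1) / t) powr (1 / (s * p))) powr (s * p)"
        using Rr R sp_pos by (intro powr_mono2) auto
      also have "\<dots> = \<sigma> powr (p - 1) / t" using s p \<sigma> t by (simp add: powr_powr)
      finally have "t * R powr (s * p) \<le> \<sigma> powr (p - 1)" using t by (simp add: field_simps)
      then show ?thesis using R by (simp add: powr_minus field_simps)
    qed
    have fM: "AE x in lborel. x \<in> ball z R \<longrightarrow> f x \<le> M"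
      using r0(2) by eventually_elim (use Rr in auto)
    have tailR: "(\<integral>\<^sup>+y. indicator (- ball z R) y * ennreal ((max 0 (f y - M)) powr (p - 1) *
          norm (y - z) powr - (real DIM('a) + s * p)) \<partial>lborel) \<le> ennreal (R powr - (s * p) * \<sigma> powr (p - 1))"
    proof -
      have "(\<integral>\<^sup>+y. indicator (- ball z R) y * ennreal ((max 0 (f y - M)) powr (p - 1) *
          norm (y - z) powr - (real DIM('a) + s * p)) \<partial>lborel) \<le> T"
        unfolding T_def
      proof (rule nn_integral_mono_AE, use r0(2) in eventually_elim)
        fix y assume le: "y \<in> ball z r0 \<longrightarrow> f y \<le> M"
        then show "indicator (- ball z R) y * ennreal ((max 0 (f y - M)) powr (p - 1) * norm (y - z) powr - (real DIM('a) + s * p))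
          \<le> indicator (- ball z r0) y * ennreal ((max 0 (f y - M)) powr (p - 1) * norm (y - z) powr - (real DIM('a) + s * p))"
          using p Rr by (cases "y \<in> ball z r0") (auto simp: max_absorb1 indicator_def)
      qed
      also have "\<dots> \<le> ennreal t" by (rule t)
      also have "\<dots> \<le> ennreal (R powr - (s * p) * \<sigma> powr (p - 1))" using tR by (rule ennreal_leI)
      finally show ?thesis .
    qed
    have densH: "c0 * R ^ DIM('a) \<le> measure lborel {x \<in> ball z (R / 2). f x \<le> M - H * \<sigma>}"
    proof -
      have "measure lborel {x \<in> ball z (R / 2). f x \<le> k0} \<le> measure lborel {x \<in> ball z (R / 2). f x \<le> M - H * \<sigma>}"
      proof (rule measure_mono_fmeasurable)
        show "{x \<in> ball z (R / 2). f x \<le> k0} \<subseteq> {x \<in> ball z (R / 2). f x \<le> M - H * \<sigma>}"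
          using \<sigma> by (auto simp: M_def)
        have "bounded {x \<in> ball z (R / 2). f x \<le> M - H * \<sigma>}" by (rule bounded_subset[OF bounded_ball[of z "R / 2"]]) auto
        then show "{x \<in> ball z (R / 2). f x \<le> M - H * \<sigma>} \<in> fmeasurable lborel"
          using emeasure_bounded_finite by (auto simp: fmeasurable_def)
      qed auto
      then show ?thesis using dens by linarith
    qed
    have "AE x in lborel. x \<in> ball z (R / 4) \<longrightarrow> f x \<le> M - \<sigma> / 4"
    proof (rule osc[rule_format, OF f R(1) \<sigma>(1) _ tailR densH])
      show "AE x in lborel. x \<in> ball z R \<longrightarrow> f x \<le> M" by (rule fM)
      fix \<kappa> assume "\<kappa> \<in> {M - \<sigma>..M}"
      then have \<kappa>: "M \<le> \<kappa> + \<sigma>" "k0 \<le> \<kappa>" using \<sigma>le \<sigma> by (auto simp: M_def)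
      have "AE x in lborel. x \<in> ball z R \<longrightarrow> f x \<le> \<kappa> + \<sigma>"
        using fM by eventually_elim (use \<kappa> in auto)
      then show "excess_test f z R \<sigma> \<kappa>" by (intro test R Rr \<sigma> \<kappa>)
    qed
    then show "AE x in lborel. x \<in> ball z (R / 4) \<longrightarrow> f x \<le> m0 - \<sigma> / 8"
      by eventually_elim (simp add: M_def)
  qed
qed

text \<open>Cutting at the sphere creates no jump: where the ramp is 1 there is no excess, and a
  point of the half ball has distance at least \<open>R / 2\<close> from the outside, over which the
  slope \<open>4 * \<sigma> / R\<close> already exceeds the largest excess
  \<open>\<sigma>\<close>.\<close>

lemma excess_lipschitz:
  assumes R: "0 < R" and \<sigma>: "0 < \<sigma>" and f: "AE x in lborel. x \<in> ball z R \<longrightarrow> f x \<le> \<kappa> + \<sigma>"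
  shows "AE w in \<nu>. \<bar>excess f z R \<sigma> \<kappa> (fst w) - excess f z R \<sigma> \<kappa> (snd w)\<bar>
    \<le> \<bar>f (fst w) - f (snd w)\<bar> + 4 * \<sigma> / R * norm (fst w - snd w)"
  using AE_\<nu>_pair[OF f]
proof eventually_elim
  fix w :: "'a \<times> 'a"
  assume le: "(fst w \<in> ball z R \<longrightarrow> f (fst w) \<le> \<kappa> + \<sigma>) \<and> (snd w \<in> ball z R \<longrightarrow> f (snd w) \<le> \<kappa> + \<sigma>)"
  obtain x y where w: "w = (x, y)" by (cases w)
  have out: "excess f z R \<sigma> \<kappa> x \<le> 4 * \<sigma> / R * norm (x - y)"
    if x: "x \<in> ball z R" "f x \<le> \<kappa> + \<sigma>" and y: "y \<notin> ball z R" for x y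
  proof (cases "norm (x - z) < R / 2")
    case True
    have "norm (y - z) \<le> norm (x - y) + norm (x - z)"
      using norm_triangle_ineq4[of "x - z" "x - y"] by (simp add: add.commute)
    then have "R / 2 \<le> norm (x - y)" using True y by (simp add: dist_norm norm_minus_commute)
    then have "4 * \<sigma> / R * (R / 2) \<le> 4 * \<sigma> / R * norm (x - y)" using \<sigma> R by (intro mult_left_mono) auto
    moreover have "excess f z R \<sigma> \<kappa> x \<le> \<sigma>"
    proof -
      have "0 \<le> \<sigma> * ramp z R x" using \<sigma> ramp_bounds(1)[of z R x] by simp
      then show ?thesis using x \<sigma> by (simp add: excess_def level_def)
    qed
    ultimately show ?thesis using \<sigma> R by simp
  next
    case False
    then have "ramp z R x = 1" by (intro ramp_eq_1 R) simp
    then show ?thesis using x \<sigma> R by (simp add: excess_def level_def)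
  qed
  have nn: "0 \<le> 4 * \<sigma> / R * norm (x - y)" using \<sigma> R by simp
  consider "x \<in> ball z R" "y \<in> ball z R" | "x \<in> ball z R" "y \<notin> ball z R"
    | "x \<notin> ball z R" "y \<in> ball z R" | "x \<notin> ball z R" "y \<notin> ball z R" by blast
  then have "\<bar>excess f z R \<sigma> \<kappa> x - excess f z R \<sigma> \<kappa> y\<bar> \<le> \<bar>f x - f y\<bar> + 4 * \<sigma> / R * norm (x - y)"
  proof cases
    case 1
    have "\<bar>\<sigma> * ramp z R x - \<sigma> * ramp z R y\<bar> \<le> \<sigma> * (4 / R * norm (x - y))"
      using mult_left_mono[OF ramp_lipschitz[OF R, of z x y], of \<sigma>] \<sigma>
      by (simp add: right_diff_distrib[symmetric] abs_mult)
    then have "\<bar>\<sigma> * ramp z R x - \<sigma> * ramp z R y\<bar> \<le> 4 * \<sigma> / R * norm (x - y)" by (simp add: ac_simps)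
    moreover have "\<bar>excess f z R \<sigma> \<kappa> x - excess f z R \<sigma> \<kappa> y\<bar> \<le> \<bar>f x - f y\<bar> + \<bar>\<sigma> * ramp z R x - \<sigma> * ramp z R y\<bar>"
      using 1 by (auto simp: excess_def level_def max_def)
    ultimately show ?thesis by linarith
  next
    case 2
    then show ?thesis using out[of x y] le w excess_nonneg[of f z R \<sigma> \<kappa> x] by (auto simp: excess_def[of _ _ _ _ _ ] intro: order_trans)
  next
    case 3
    then show ?thesis using out[of y x] le w excess_nonneg[of f z R \<sigma> \<kappa> y]
      by (auto simp: excess_def[of _ _ _ _ _ ] norm_minus_commute intro: order_trans)
  next
    case 4
    then show ?thesis using nn by (simp add: excess_def)
  qed
  then show "\<bar>excess f z R \<sigma> \<kappa> (fst w) - excess f z R \<sigma> \<kappa> (snd w)\<bar>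
    \<le> \<bar>f (fst w) - f (snd w)\<bar> + 4 * \<sigma> / R * norm (fst w - snd w)" by (simp add: w)
qed

end

section \<open>Essential limits of the minimizer inside and at the boundary\<close>

context obstacle_problem
begin

lemma g_continuous: "continuous_on N g"
proof -
  have "L-lipschitz_on N g"
    using g_lip L by (intro lipschitz_onI) (auto simp: dist_norm)
  then show ?thesis by (rule lipschitz_on_continuous_on)
qed

lemma g_near:
  assumes "z \<in> N" "0 < \<epsilon>"
  obtains r where "0 < r" "ball z r \<subseteq> N" "\<And>x. x \<in> ball z r \<Longrightarrow> \<bar>g x - g z\<bar> \<le> \<epsilon>"
proof -
  obtain r where r: "0 < r" "ball z r \<subseteq> N" using N assms openE by blast
  obtain d where d: "0 < d" "\<And>x. x \<in> N \<Longrightarrow> dist x z < d \<Longrightarrow> dist (g x) (g z) < \<epsilon>"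
    using g_continuous assms unfolding continuous_on_iff by metis
  show thesis
    by (rule that[of "min r d"]) (use r d in \<open>force simp: dist_commute dist_real_def\<close>)+
qed

context
  fixes v
  assumes v: "adm v" and vM: "\<And>x. v x \<le> M" and min: "\<And>w. adm w \<Longrightarrow> J v \<le> J w"
begin

lemma v_ge: "g x \<le> v x"
  using v by (cases "x \<in> D") (auto simp: adm_def)

text \<open>Subtracting the excess lowers \<open>v\<close> at most to the level, which stays above
  the obstacle. Off \<open>D\<close> one has \<open>v = g\<close> and hence no excess, so the ball
  may reach across the frontier of \<open>D\<close>, as the boundary estimate requires.\<close>

lemma excess_test_upper:
  assumes z: "ball z r1 \<subseteq> N" "\<And>x. x \<in> ball z r1 \<Longrightarrow> g x \<le> k0"
    and R: "0 < R" "R < r1" and \<sigma>: "0 < \<sigma>" and \<kappa>: "k0 \<le> \<kappa>"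
    and le: "AE x in lborel. x \<in> ball z R \<longrightarrow> v x \<le> \<kappa> + \<sigma>"
  shows "excess_test v z R \<sigma> \<kappa>"
proof -
  note [measurable] = adm_borel[OF v]
  define h where "h x = - excess v z R \<sigma> \<kappa> x" for x
  have [measurable]: "h \<in> borel_measurable borel" unfolding h_def by measurable
  have lev: "\<kappa> \<le> level z R \<sigma> \<kappa> x" for x using \<sigma> ramp_bounds(1)[of z R x] by (simp add: level_def)
  have gk: "g x \<le> level z R \<sigma> \<kappa> x" if "x \<in> ball z R" for x
    using z(2)[of x] that R \<kappa> lev[of x] by auto
  have "integrable \<nu> (form v h) \<and> 0 \<le> (\<integral>w. form v h w \<partial>\<nu>)"
  proof (rule variational_inequality[OF v vM min, where c = "max 0 (M - \<kappa>)" and L' = "4 * \<sigma> / R" and t = 1 and h = h])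
    show "h x = 0" if "x \<notin> D" for x
      using that v gk[of x] by (auto simp: h_def excess_def adm_def)
    show "\<bar>h x\<bar> \<le> max 0 (M - \<kappa>)" for x
      using vM[of x] lev[of x] by (auto simp: h_def excess_def)
    show "AE w in \<nu>. w \<in> N \<times> N \<longrightarrow> \<bar>h (fst w) - h (snd w)\<bar> \<le> \<bar>v (fst w) - v (snd w)\<bar> + 4 * \<sigma> / R * norm (fst w - snd w)"
      using excess_lipschitz[OF R(1) \<sigma> le] by eventually_elim (auto simp: h_def)
    show "g x \<le> v x + 1 * h x" if "x \<in> D" for x
      using gk[of x] v_ge[of x] by (auto simp: h_def excess_def)
  qed (use R \<sigma> in auto)
  moreover have "form v h = (\<lambda>w. - form v (excess v z R \<sigma> \<kappa>) w)"
    by (auto simp: form_def h_def algebra_simps)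
  ultimately show ?thesis by (simp add: excess_test_def)
qed

text \<open>Adding the excess of \<open>- v\<close> raises \<open>v\<close>, which the obstacle
  always permits. But the test function must vanish off \<open>D\<close>, where \<open>- v\<close>
  may well exceed the level; hence the ball has to lie in \<open>D\<close>.\<close>

lemma excess_test_lower:
  assumes z: "ball z r1 \<subseteq> D" and R: "0 < R" "R < r1" and \<sigma>: "0 < \<sigma>"
    and le: "AE x in lborel. x \<in> ball z R \<longrightarrow> - v x \<le> \<kappa> + \<sigma>"
  shows "excess_test (\<lambda>x. - v x) z R \<sigma> \<kappa>"
proof -
  note [measurable] = adm_borel[OF v]
  define h where "h = excess (\<lambda>x. - v x) z R \<sigma> \<kappa>"
  have [measurable]: "h \<in> borel_measurable borel" unfolding h_def by measurable
  have lev: "\<kappa> \<le> level z R \<sigma> \<kappa> x" for x using \<sigma> ramp_bounds(1)[of z R x] by (simp add: level_def)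
  have int: "integrable \<nu> (form v h) \<and> 0 \<le> (\<integral>w. form v h w \<partial>\<nu>)"
  proof (rule variational_inequality[OF v vM min, where c = "max 0 (M + 1 - \<kappa>)" and L' = "4 * \<sigma> / R" and t = 1 and h = h])
    have sub: "ball z R \<subseteq> D" using z R by auto
    show "h x = 0" if "x \<notin> D" for x using that sub by (auto simp: h_def excess_def)
    show "\<bar>h x\<bar> \<le> max 0 (M + 1 - \<kappa>)" for x
    proof (cases "x \<in> ball z R")
      case True
      then have "\<bar>v x\<bar> \<le> M + 1" using sub DN by (intro adm_bound[OF v]) auto
      then show ?thesis using lev[of x] by (auto simp: h_def excess_def)
    qed (simp add: h_def excess_def)
    show "AE w in \<nu>. w \<in> N \<times> N \<longrightarrow> \<bar>h (fst w) - h (snd w)\<bar> \<le> \<bar>v (fst w) - v (snd w)\<bar> + 4 * \<sigma> / R * norm (fst w - snd w)"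
      using excess_lipschitz[OF R(1) \<sigma> le] by eventually_elim (auto simp: h_def)
    show "g x \<le> v x + 1 * h x" if "x \<in> D" for x
      using v_ge[of x] excess_nonneg[of "\<lambda>x. - v x" z R \<sigma> \<kappa> x] by (simp add: h_def)
  qed (use R \<sigma> in auto)
  have "form (\<lambda>x. - v x) h = (\<lambda>w. - form v h w)"
  proof
    fix w show "form (\<lambda>x. - v x) h w = - form v h w"
      using phi_minus[of p "v (fst w) - v (snd w)"] by (simp add: form_def)
  qed
  then show ?thesis using int unfolding excess_test_def h_def[symmetric] by simp
qed

lemma upper_limit_exists:
  assumes "z \<in> N"
  obtains m where "\<And>\<epsilon>. 0 < \<epsilon> \<Longrightarrow> \<exists>r>0. AE x in lborel. x \<in> ball z r \<longrightarrow> v x \<le> m + \<epsilon>"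
    "\<And>\<delta> r. 0 < \<delta> \<Longrightarrow> 0 < r \<Longrightarrow> \<not> (AE x in lborel. x \<in> ball z r \<longrightarrow> v x \<le> m - \<delta>)"
    "g z \<le> m"
proof -
  define S where "S = {m. \<exists>r>0. AE x in lborel. x \<in> ball z r \<longrightarrow> v x \<le> m}"
  have low: "g z - \<epsilon> \<le> m" if m: "m \<in> S" and e: "0 < \<epsilon>" for m \<epsilon>
  proof -
    obtain r where r: "0 < r" "AE x in lborel. x \<in> ball z r \<longrightarrow> v x \<le> m" using m by (auto simp: S_def)
    obtain r' where r': "0 < r'" "\<And>x. x \<in> ball z r' \<Longrightarrow> \<bar>g x - g z\<bar> \<le> \<epsilon>"
      using g_near[OF assms e] by metis
    obtain x where "x \<in> ball z (min r r')" "x \<in> ball z r \<longrightarrow> v x \<le> m"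
      by (rule AE_lborel_witness[OF r(2), of "ball z (min r r')"]) (use r r' in auto)
    then show ?thesis using r'(2)[of x] v_ge[of x] by (auto simp: abs_le_iff)
  qed
  have MS: "M \<in> S" unfolding S_def using vM by (auto intro!: exI[of _ 1])
  have bdd: "bdd_below S" using low[of _ 1] by (auto intro!: bdd_belowI[of _ "g z - 1"])
  show thesis
  proof (rule that[of "Inf S"])
    fix \<epsilon> :: real assume "0 < \<epsilon>"
    then obtain m where "m \<in> S" "m < Inf S + \<epsilon>" using cInf_lessD[of S "Inf S + \<epsilon>"] MS by auto
    then obtain r where "0 < r" "AE x in lborel. x \<in> ball z r \<longrightarrow> v x \<le> m" by (auto simp: S_def)
    then show "\<exists>r>0. AE x in lborel. x \<in> ball z r \<longrightarrow> v x \<le> Inf S + \<epsilon>"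
      using \<open>m < Inf S + \<epsilon>\<close> by (intro exI[of _ r]) (auto elim!: eventually_mono)
  next
    fix \<delta> r :: real assume d: "0 < \<delta>" "0 < r"
    show "\<not> (AE x in lborel. x \<in> ball z r \<longrightarrow> v x \<le> Inf S - \<delta>)"
    proof
      assume "AE x in lborel. x \<in> ball z r \<longrightarrow> v x \<le> Inf S - \<delta>"
      then have "Inf S - \<delta> \<in> S" using d by (auto simp: S_def)
      then have "Inf S \<le> Inf S - \<delta>" by (rule cInf_lower[OF _ bdd])
      then show False using d by simp
    qed
  next
    show "g z \<le> Inf S"
    proof (rule cInf_greatest)
      show "S \<noteq> {}" using MS by auto
      fix m assume "m \<in> S"
      then have "g z - \<epsilon> \<le> m" if "0 < \<epsilon>" for \<epsilon> using low that by blast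
      then show "g z \<le> m" by (meson diff_le_eq field_le_epsilon)
    qed
  qed
qed

lemma lower_limit_exists:
  assumes "z \<in> N"
  obtains m where "\<And>\<epsilon>. 0 < \<epsilon> \<Longrightarrow> \<exists>r>0. AE x in lborel. x \<in> ball z r \<longrightarrow> m - \<epsilon> \<le> v x"
    "\<And>\<delta> r. 0 < \<delta> \<Longrightarrow> 0 < r \<Longrightarrow> \<not> (AE x in lborel. x \<in> ball z r \<longrightarrow> m + \<delta> \<le> v x)"
    "g z \<le> m"
proof -
  define S where "S = {m. \<exists>r>0. AE x in lborel. x \<in> ball z r \<longrightarrow> m \<le> v x}"
  have up: "m \<le> M" if m: "m \<in> S" for m
  proof -
    obtain r where r: "0 < r" "AE x in lborel. x \<in> ball z r \<longrightarrow> m \<le> v x" using m by (auto simp: S_def)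
    obtain x where "x \<in> ball z r" "x \<in> ball z r \<longrightarrow> m \<le> v x"
      by (rule AE_lborel_witness[OF r(2), of "ball z r"]) (use r in auto)
    then show ?thesis using vM[of x] by auto
  qed
  have bdd: "bdd_above S" using up by (auto intro!: bdd_aboveI[of _ M])
  have gS: "g z - \<epsilon> \<in> S" if e: "0 < \<epsilon>" for \<epsilon>
  proof -
    obtain r where r: "0 < r" "\<And>x. x \<in> ball z r \<Longrightarrow> \<bar>g x - g z\<bar> \<le> \<epsilon>" using g_near[OF assms e] by metis
    have "x \<in> ball z r \<longrightarrow> g z - \<epsilon> \<le> v x" for x using r(2)[of x] v_ge[of x] by auto
    then show ?thesis using r(1) by (auto simp: S_def)
  qed
  show thesis
  proof (rule that[of "Sup S"])
    fix \<epsilon> :: real assume "0 < \<epsilon>"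
    then obtain m where "m \<in> S" "Sup S - \<epsilon> < m" using less_cSupD[of S "Sup S - \<epsilon>"] gS[of 1] by auto
    then obtain r where "0 < r" "AE x in lborel. x \<in> ball z r \<longrightarrow> m \<le> v x" by (auto simp: S_def)
    then show "\<exists>r>0. AE x in lborel. x \<in> ball z r \<longrightarrow> Sup S - \<epsilon> \<le> v x"
      using \<open>Sup S - \<epsilon> < m\<close> by (intro exI[of _ r]) (auto elim!: eventually_mono)
  next
    fix \<delta> r :: real assume d: "0 < \<delta>" "0 < r"
    show "\<not> (AE x in lborel. x \<in> ball z r \<longrightarrow> Sup S + \<delta> \<le> v x)"
    proof
      assume "AE x in lborel. x \<in> ball z r \<longrightarrow> Sup S + \<delta> \<le> v x"
      then have "Sup S + \<delta> \<in> S" using d by (auto simp: S_def)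
      then have "Sup S + \<delta> \<le> Sup S" by (rule cSup_upper[OF _ bdd])
      then show False using d by simp
    qed
  next
    have "g z - \<epsilon> \<le> Sup S" if "0 < \<epsilon>" for \<epsilon> by (rule cSup_upper[OF gS[OF that] bdd])
    then show "g z \<le> Sup S" by (meson diff_le_eq field_le_epsilon)
  qed
qed

text \<open>If the upper limit \<open>m\<close> exceeded the lower limit \<open>l\<close>, then at a
  small radius one of the sets below and above the middle level \<open>k0\<close> would fill half of
  the half ball, and one of the two drops would contradict the choice of \<open>m\<close> or
  \<open>l\<close>. Since \<open>l \<ge> g z\<close>, the obstacle stays below \<open>k0\<close>
  near \<open>z\<close>, as testing from above demands.\<close>

lemma interior_limit:
  assumes z: "z \<in> D"
  obtains a where "\<And>\<epsilon>. 0 < \<epsilon> \<Longrightarrow> \<exists>r>0. AE x in lborel. x \<in> ball z r \<longrightarrow> \<bar>v x - a\<bar> \<le> \<epsilon>"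
proof -
  note [measurable] = adm_borel[OF v]
  have zN: "z \<in> N" using z DN by blast
  obtain m where m: "\<And>\<epsilon>. 0 < \<epsilon> \<Longrightarrow> \<exists>r>0. AE x in lborel. x \<in> ball z r \<longrightarrow> v x \<le> m + \<epsilon>"
    "\<And>\<delta> r. 0 < \<delta> \<Longrightarrow> 0 < r \<Longrightarrow> \<not> (AE x in lborel. x \<in> ball z r \<longrightarrow> v x \<le> m - \<delta>)" "g z \<le> m"
    using upper_limit_exists[OF zN] by blast
  obtain l where l: "\<And>\<epsilon>. 0 < \<epsilon> \<Longrightarrow> \<exists>r>0. AE x in lborel. x \<in> ball z r \<longrightarrow> l - \<epsilon> \<le> v x"
    "\<And>\<delta> r. 0 < \<delta> \<Longrightarrow> 0 < r \<Longrightarrow> \<not> (AE x in lborel. x \<in> ball z r \<longrightarrow> l + \<delta> \<le> v x)" "g z \<le> l"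
    using lower_limit_exists[OF zN] by blast
  have "m \<le> l"
  proof (rule ccontr)
    assume "\<not> m \<le> l"
    define k0 where "k0 = (m + l) / 2"
    have k0: "l < k0" "k0 < m" using \<open>\<not> m \<le> l\<close> by (auto simp: k0_def)
    define \<omega> where "\<omega> = unit_ball_vol (real DIM('a))"
    \<comment> \<open>Small enough that \<open>2 * (c0 * R ^ DIM('a))\<close> is at most the measure
      of the half ball, since \<open>2 \<le> 2 ^ DIM('a)\<close>.\<close>
    define c0 where "c0 = \<omega> / 4 ^ DIM('a)"
    have c0: "0 < c0" by (simp add: c0_def \<omega>_def)
    obtain r where r: "0 < r" "ball z r \<subseteq> N" "\<And>x. x \<in> ball z r \<Longrightarrow> \<bar>g x - g z\<bar> \<le> k0 - l"
      using g_near[OF zN, of "k0 - l"] k0 by auto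
    obtain r' where r': "0 < r'" "ball z r' \<subseteq> D" using D z openE by blast
    obtain \<delta>1 R1 where 1: "0 < \<delta>1" "0 < R1"
      "\<And>R. \<lbrakk>0 < R; R < R1; c0 * R ^ DIM('a) \<le> measure lborel {x \<in> ball z (R / 2). v x \<le> k0}\<rbrakk>
      \<Longrightarrow> AE x in lborel. x \<in> ball z (R / 4) \<longrightarrow> v x \<le> m - \<delta>1"
    proof (rule local_drop[OF adm_borel[OF v] adm_tail[OF v] m(1) k0(2) c0 r(1)])
      fix R \<sigma> \<kappa> assume R: "0 < R" "R < r" "0 < \<sigma>" "k0 \<le> \<kappa>" "AE x in lborel. x \<in> ball z R \<longrightarrow> v x \<le> \<kappa> + \<sigma>"
      show "excess_test v z R \<sigma> \<kappa>"
        by (rule excess_test_upper[OF r(2) _ R]) (use r(3) l(3) in \<open>force simp: abs_le_iff\<close>)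
    qed blast+
    obtain \<delta>2 R2 where 2: "0 < \<delta>2" "0 < R2"
      "\<And>R. \<lbrakk>0 < R; R < R2; c0 * R ^ DIM('a) \<le> measure lborel {x \<in> ball z (R / 2). - v x \<le> - k0}\<rbrakk>
      \<Longrightarrow> AE x in lborel. x \<in> ball z (R / 4) \<longrightarrow> - v x \<le> - l - \<delta>2"
    proof (rule local_drop[of "\<lambda>x. - v x" z "- l" "- k0" c0 r'])
      show "\<exists>r>0. AE x in lborel. x \<in> ball z r \<longrightarrow> - v x \<le> - l + \<epsilon>" if "0 < \<epsilon>" for \<epsilon>
        using l(1)[OF that] by (auto simp: algebra_simps)
      show "tail_finite (\<lambda>x. - v x)" using adm_tail[OF v] by (simp add: tail_finite_def)
      show "excess_test (\<lambda>x. - v x) z R \<sigma> \<kappa>"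
        if "0 < R" "R < r'" "0 < \<sigma>" "- k0 \<le> \<kappa>" "AE x in lborel. x \<in> ball z R \<longrightarrow> - v x \<le> \<kappa> + \<sigma>" for R \<sigma> \<kappa>
        by (rule excess_test_lower[OF r'(2) that(1,2,3,5)])
    qed (use k0 c0 r' in auto)
    define R where "R = min R1 R2 / 2"
    have R: "0 < R" "R < R1" "R < R2" using 1 2 by (auto simp: R_def)
    define A where "A = {x \<in> ball z (R / 2). v x \<le> k0}"
    define B where "B = {x \<in> ball z (R / 2). - v x \<le> - k0}"
    have AB: "A \<in> fmeasurable lborel" "B \<in> fmeasurable lborel"
    proof -
      have "bounded A" "bounded B" unfolding A_def B_def by (rule bounded_subset[OF bounded_ball[of z "R / 2"]]; auto)+
      then show "A \<in> fmeasurable lborel" "B \<in> fmeasurable lborel"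
        using emeasure_bounded_finite by (auto simp: fmeasurable_def A_def B_def)
    qed
    have "2 * (c0 * R ^ DIM('a)) \<le> measure lborel (ball z (R / 2))"
    proof -
      have "2 * (c0 * R ^ DIM('a)) = (2 / 2 ^ DIM('a)) * (\<omega> * (R / 2) ^ DIM('a))"
      proof -
        have "(4::real) ^ DIM('a) = 2 ^ DIM('a) * 2 ^ DIM('a)"
          using power_mult_distrib[of "2::real" 2 "DIM('a)"] by simp
        then show ?thesis by (simp add: c0_def power_divide)
      qed
      also have "\<dots> \<le> 1 * (\<omega> * (R / 2) ^ DIM('a))"
        using R self_le_power[of 2 "DIM('a)"] by (intro mult_right_mono) (auto simp: \<omega>_def Suc_leI)
      also have "\<dots> = measure lborel (ball z (R / 2))"
        using R by (simp add: \<omega>_def measure_def emeasure_ball)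
      finally show ?thesis .
    qed
    also have "ball z (R / 2) = A \<union> B" by (auto simp: A_def B_def)
    also have "measure lborel (A \<union> B) \<le> measure lborel A + measure lborel B"
      using AB by (intro measure_Un_le) auto
    finally have "c0 * R ^ DIM('a) \<le> measure lborel A \<or> c0 * R ^ DIM('a) \<le> measure lborel B" by linarith
    then show False
    proof
      assume "c0 * R ^ DIM('a) \<le> measure lborel A"
      then have "AE x in lborel. x \<in> ball z (R / 4) \<longrightarrow> v x \<le> m - \<delta>1" using 1(3) R by (simp add: A_def)
      then show False using m(2)[OF 1(1), of "R / 4"] R by simp
    next
      assume "c0 * R ^ DIM('a) \<le> measure lborel B"
      then have "AE x in lborel. x \<in> ball z (R / 4) \<longrightarrow> - v x \<le> - l - \<delta>2" using 2(3) R by (simp add: B_def)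
      then have "AE x in lborel. x \<in> ball z (R / 4) \<longrightarrow> l + \<delta>2 \<le> v x" by eventually_elim auto
      then show False using l(2)[OF 2(1), of "R / 4"] R by simp
    qed
  qed
  show thesis
  proof (rule that[of m])
    fix \<epsilon> :: real assume e: "0 < \<epsilon>"
    obtain r where r: "0 < r" "AE x in lborel. x \<in> ball z r \<longrightarrow> v x \<le> m + \<epsilon>" using m(1)[OF e] by blast
    obtain r' where r': "0 < r'" "AE x in lborel. x \<in> ball z r' \<longrightarrow> l - \<epsilon> \<le> v x" using l(1)[OF e] by blast
    have "AE x in lborel. x \<in> ball z (min r r') \<longrightarrow> \<bar>v x - m\<bar> \<le> \<epsilon>"
      using r(2) r'(2) by eventually_elim (use \<open>m \<le> l\<close> in auto)
    then show "\<exists>r>0. AE x in lborel. x \<in> ball z r \<longrightarrow> \<bar>v x - m\<bar> \<le> \<epsilon>" using r r' by (intro exI[of _ "min r r'"]) auto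
  qed
qed

text \<open>The obstacle bounds \<open>v\<close> from below, so only the upper limit is in question.
  The exterior ball contains a ball of radius \<open>R / 4\<close> that lies in the half ball about
  \<open>z\<close>, and there \<open>v = g\<close> is below \<open>k0\<close>; this is the density
  hypothesis.\<close>

lemma boundary_limit:
  assumes z: "z \<in> frontier D" and e: "norm (z - e) = r0" "0 < r0" "ball e r0 \<inter> D = {}" and \<epsilon>: "0 < \<epsilon>"
  shows "\<exists>r>0. AE x in lborel. x \<in> ball z r \<longrightarrow> \<bar>v x - g z\<bar> \<le> \<epsilon>"
proof -
  note [measurable] = adm_borel[OF v]
  have zN: "z \<in> N" using z D by (auto simp: frontier_def)
  obtain m where m: "\<And>\<epsilon>. 0 < \<epsilon> \<Longrightarrow> \<exists>r>0. AE x in lborel. x \<in> ball z r \<longrightarrow> v x \<le> m + \<epsilon>"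
    "\<And>\<delta> r. 0 < \<delta> \<Longrightarrow> 0 < r \<Longrightarrow> \<not> (AE x in lborel. x \<in> ball z r \<longrightarrow> v x \<le> m - \<delta>)" "g z \<le> m"
    using upper_limit_exists[OF zN] by blast
  have "m \<le> g z"
  proof (rule ccontr)
    assume "\<not> m \<le> g z"
    define k0 where "k0 = (m + g z) / 2"
    have k0: "g z < k0" "k0 < m" using \<open>\<not> m \<le> g z\<close> by (auto simp: k0_def)
    define \<omega> where "\<omega> = unit_ball_vol (real DIM('a))"
    define c0 where "c0 = \<omega> / 4 ^ DIM('a)"
    have c0: "0 < c0" by (simp add: c0_def \<omega>_def)
    obtain r where r: "0 < r" "ball z r \<subseteq> N" "\<And>x. x \<in> ball z r \<Longrightarrow> \<bar>g x - g z\<bar> \<le> k0 - g z"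
      using g_near[OF zN, of "k0 - g z"] k0 by auto
    have gk: "g x \<le> k0" if "x \<in> ball z r" for x using r(3)[OF that] by (auto simp: abs_le_iff)
    obtain \<delta>1 R1 where 1: "0 < \<delta>1" "0 < R1"
      "\<And>R. \<lbrakk>0 < R; R < R1; c0 * R ^ DIM('a) \<le> measure lborel {x \<in> ball z (R / 2). v x \<le> k0}\<rbrakk>
      \<Longrightarrow> AE x in lborel. x \<in> ball z (R / 4) \<longrightarrow> v x \<le> m - \<delta>1"
    proof (rule local_drop[OF adm_borel[OF v] adm_tail[OF v] m(1) k0(2) c0 r(1)])
      fix R \<sigma> \<kappa> assume R: "0 < R" "R < r" "0 < \<sigma>" "k0 \<le> \<kappa>" "AE x in lborel. x \<in> ball z R \<longrightarrow> v x \<le> \<kappa> + \<sigma>"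
      show "excess_test v z R \<sigma> \<kappa>"
        by (rule excess_test_upper[OF r(2) gk R])
    qed blast+
    define R where "R = min (min R1 r) r0 / 2"
    have R: "0 < R" "R < R1" "R < r" "R < r0" using 1 r e by (auto simp: R_def)
    \<comment> \<open>The point at distance \<open>R / 4\<close> from \<open>z\<close> on the way to
      \<open>e\<close>; the ball of radius \<open>R / 4\<close> about it touches the sphere about
      \<open>e\<close> at \<open>z\<close> from inside.\<close>
    define c where "c = z + (R / 4 / r0) *\<^sub>R (e - z)"
    have cz: "norm (c - z) = R / 4" using e R by (simp add: c_def norm_minus_commute)
    have ce: "norm (c - e) = r0 - R / 4"
    proof -
      have "c - e = (1 - R / 4 / r0) *\<^sub>R (z - e)" by (simp add: c_def algebra_simps)
      then have "norm (c - e) = \<bar>1 - R / 4 / r0\<bar> * r0" using e(1) by simp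
      also have "\<bar>1 - R / 4 / r0\<bar> = 1 - R / 4 / r0" using R e(2) by (simp add: field_simps)
      also have "(1 - R / 4 / r0) * r0 = r0 - R / 4" using e(2) by (simp add: field_simps)
      finally show ?thesis .
    qed
    have sub: "ball c (R / 4) \<subseteq> {x \<in> ball z (R / 2). v x \<le> k0}"
    proof
      fix x assume x: "x \<in> ball c (R / 4)"
      then have xc: "norm (x - c) < R / 4" by (simp add: dist_norm norm_minus_commute)
      have "norm (x - z) < R / 2" using norm_triangle_ineq[of "x - c" "c - z"] xc cz by simp
      moreover have "norm (x - e) < r0" using norm_triangle_ineq[of "x - c" "c - e"] xc ce by simp
      ultimately have xz: "x \<in> ball z (R / 2)" "x \<notin> D" "x \<in> ball z r"
        using e(3) R by (auto simp: dist_norm norm_minus_commute)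
      then have "v x = g x" using v by (simp add: adm_def)
      then show "x \<in> {x \<in> ball z (R / 2). v x \<le> k0}" using xz gk[of x] by simp
    qed
    have "c0 * R ^ DIM('a) = measure lborel (ball c (R / 4))"
      using R by (simp add: c0_def \<omega>_def measure_def emeasure_ball power_divide)
    also have "\<dots> \<le> measure lborel {x \<in> ball z (R / 2). v x \<le> k0}"
    proof (rule measure_mono_fmeasurable[OF sub])
      have "bounded {x \<in> ball z (R / 2). v x \<le> k0}" by (rule bounded_subset[OF bounded_ball[of z "R / 2"]]) auto
      then show "{x \<in> ball z (R / 2). v x \<le> k0} \<in> fmeasurable lborel"
        using emeasure_bounded_finite by (auto simp: fmeasurable_def)
    qed auto
    finally have "AE x in lborel. x \<in> ball z (R / 4) \<longrightarrow> v x \<le> m - \<delta>1" using 1(3) R by simp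
    then show False using m(2)[OF 1(1), of "R / 4"] R by simp
  qed
  obtain r where r: "0 < r" "AE x in lborel. x \<in> ball z r \<longrightarrow> v x \<le> m + \<epsilon>" using m(1)[OF \<epsilon>] by blast
  obtain r' where r': "0 < r'" "\<And>x. x \<in> ball z r' \<Longrightarrow> \<bar>g x - g z\<bar> \<le> \<epsilon>" using g_near[OF zN \<epsilon>] by metis
  have "AE x in lborel. x \<in> ball z (min r r') \<longrightarrow> \<bar>v x - g z\<bar> \<le> \<epsilon>"
    using r(2)
  proof eventually_elim
    fix x assume "x \<in> ball z r \<longrightarrow> v x \<le> m + \<epsilon>"
    then show "x \<in> ball z (min r r') \<longrightarrow> \<bar>v x - g z\<bar> \<le> \<epsilon>"
      using r'(2)[of x] v_ge[of x] \<open>m \<le> g z\<close> by (auto simp: abs_le_iff)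
  qed
  then show ?thesis using r r' by (intro exI[of _ "min r r'"]) auto
qed

lemma minimizer_continuous:
  assumes ext: "\<And>z. z \<in> frontier D \<Longrightarrow> \<exists>e r0. 0 < r0 \<and> norm (z - e) = r0 \<and> ball e r0 \<inter> D = {}"
  obtains c where "continuous_on N c" "AE x in lborel. x \<in> N \<longrightarrow> v x = c x" "\<And>x. x \<in> N - D \<Longrightarrow> c x = g x"
proof -
  have "\<exists>a. (\<forall>\<epsilon>>0. \<exists>r>0. AE x in lborel. x \<in> ball z r \<longrightarrow> \<bar>v x - a\<bar> \<le> \<epsilon>) \<and> (z \<notin> D \<longrightarrow> a = g z)" if z: "z \<in> N" for z
  proof -
    consider "z \<in> D" | "z \<in> frontier D" | "z \<notin> closure D"
      using D(1) by (auto simp: frontier_def interior_open)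
    then show ?thesis
    proof cases
      case 1
      then obtain a where "\<And>\<epsilon>. 0 < \<epsilon> \<Longrightarrow> \<exists>r>0. AE x in lborel. x \<in> ball z r \<longrightarrow> \<bar>v x - a\<bar> \<le> \<epsilon>"
        using interior_limit by blast
      then show ?thesis using 1 by blast
    next
      case 2
      then obtain e r0 where "0 < r0" "norm (z - e) = r0" "ball e r0 \<inter> D = {}" using ext by blast
      then show ?thesis using boundary_limit[OF 2] by blast
    next
      case 3
      have "\<exists>r>0. AE x in lborel. x \<in> ball z r \<longrightarrow> \<bar>v x - g z\<bar> \<le> \<epsilon>" if "0 < \<epsilon>" for \<epsilon>
      proof -
        obtain r where r: "0 < r" "\<And>x. x \<in> ball z r \<Longrightarrow> \<bar>g x - g z\<bar> \<le> \<epsilon>" using g_near[OF z \<open>0 < \<epsilon>\<close>] by metis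
        obtain r' where r': "0 < r'" "ball z r' \<subseteq> - closure D"
          using 3 openE[of "- closure D" z] by auto
        have "x \<in> ball z (min r r') \<longrightarrow> \<bar>v x - g z\<bar> \<le> \<epsilon>" for x
        proof
          assume x: "x \<in> ball z (min r r')"
          then have "x \<notin> D" using r'(2) closure_subset[of D] by auto
          then have "v x = g x" using v by (simp add: adm_def)
          then show "\<bar>v x - g z\<bar> \<le> \<epsilon>" using r(2)[of x] x by simp
        qed
        then show ?thesis using r r' by (intro exI[of _ "min r r'"]) auto
      qed
      then show ?thesis by blast
    qed
  qed
  then obtain c where c: "\<And>z \<epsilon>. z \<in> N \<Longrightarrow> 0 < \<epsilon> \<Longrightarrow> \<exists>r>0. AE x in lborel. x \<in> ball z r \<longrightarrow> \<bar>v x - c z\<bar> \<le> \<epsilon>"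
    "\<And>z. z \<in> N \<Longrightarrow> z \<notin> D \<longrightarrow> c z = g z" by metis
  show thesis
    using continuous_representative[OF N(1) c(1)] c(2) by (intro that[of c]) auto
qed

end

end

section \<open>Reduction to Borel functions\<close>

lemma borel_measurable_lebesgue_AE:
  fixes f g :: "'a::euclidean_space \<Rightarrow> 'b::topological_space"
  assumes f: "f \<in> borel_measurable lebesgue" and eq: "AE x in lebesgue. f x = g x"
  shows "g \<in> borel_measurable lebesgue"
proof (rule measurableI)
  fix A :: "'b set" assume A: "A \<in> sets borel"
  show "g -` A \<inter> space lebesgue \<in> sets lebesgue"
  proof (rule completion.in_sets_AE)
    show "f -` A \<inter> space lebesgue \<in> sets lebesgue" using f A by (rule measurable_sets)
    show "AE x in lebesgue. x \<in> f -` A \<inter> space lebesgue \<longleftrightarrow> x \<in> g -` A \<inter> space lebesgue"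
      using eq by eventually_elim auto
  qed auto
qed simp

lemma lebesgue_borel_representative:
  fixes u :: "'a::euclidean_space \<Rightarrow> ereal"
  assumes u: "u \<in> borel_measurable lebesgue" and fin: "AE x in lborel. \<bar>u x\<bar> \<noteq> \<infinity>"
  obtains f where "f \<in> borel_measurable borel" "AE x in lborel. u x = ereal (f x)"
proof -
  have "(\<lambda>x. real_of_ereal (u x)) \<in> borel_measurable (completion lborel)" using u by measurable
  then obtain f where f: "f \<in> borel_measurable lborel" "AE x in lborel. real_of_ereal (u x) = f x"
    using completion_ex_borel_measurable_real by blast
  have "AE x in lborel. u x = ereal (f x)"
    using f(2) fin by eventually_elim (auto simp: ereal_real)
  then show thesis using f by (intro that[of f]) auto
qed

lemma AE_lborel_swap:
  fixes P :: "'a::euclidean_space \<times> 'a \<Rightarrow> bool"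
  assumes "AE z in lborel. P z"
  shows "AE z in lborel. P (snd z, fst z)"
proof -
  obtain A where A: "A \<in> null_sets lborel" "{x. \<not> P x} \<subseteq> A"
    using assms by (auto elim!: AE_E simp: null_sets_def)
  have [measurable]: "A \<in> sets borel" using A by auto
  have [measurable]: "(\<lambda>z::'a \<times> 'a. (snd z, fst z)) \<in> borel_measurable borel"
    by (intro borel_measurable_continuous_onI continuous_intros)
  have "(\<integral>\<^sup>+z. indicator A (snd z, fst z) \<partial>lborel) = (\<integral>\<^sup>+z. indicator A z \<partial>lborel)"
    by (rule nn_integral_lborel_swap) measurable
  also have "\<dots> = 0" using A by auto
  finally have "AE z in lborel. (snd z, fst z) \<notin> A"
    by (subst (asm) nn_integral_0_iff_AE) (auto simp: indicator_def)
  then show ?thesis by eventually_elim (use A in blast)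
qed

text \<open>Three corrections on null sets: a Borel version, its symmetrization, and the pure power
  \<open>w\<close> wherever the bounds fail. The condition for the last one is symmetric in the
  pair, so symmetry survives.\<close>

lemma borel_kernel:
  fixes K :: "'a::euclidean_space \<Rightarrow> 'a \<Rightarrow> real"
  assumes s: "0 < s" "s < 1" and p: "1 < p" and \<Lambda>: "1 \<le> \<Lambda>" and K: "admissible_kernel s p \<Lambda> K"
  obtains k where "nonlocal_kernel s p \<Lambda> k" "AE z in lborel. K (fst z) (snd z) = k z"
proof -
  define q where "q = real DIM('a) + s * p"
  have meas: "(\<lambda>z. K (fst z) (snd z)) \<in> borel_measurable (completion lborel)"
    using K by (simp add: admissible_kernel_def split_beta')
  obtain k0 where k0 [measurable]: "k0 \<in> borel_measurable borel" and k0_eq: "AE z in lborel. K (fst z) (snd z) = k0 z"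
    using completion_ex_borel_measurable_real[OF meas] by auto
  have [measurable]: "(\<lambda>z::'a \<times> 'a. (snd z, fst z)) \<in> borel_measurable borel"
    by (intro borel_measurable_continuous_onI continuous_intros)
  define k1 where "k1 z = (k0 z + k0 (snd z, fst z)) / 2" for z
  have [measurable]: "k1 \<in> borel_measurable borel" unfolding k1_def by measurable
  define w where "w z = norm (fst z - snd z) powr - q" for z :: "'a \<times> 'a"
  have [measurable]: "w \<in> borel_measurable borel" unfolding w_def by measurable
  define k where "k z = (if w z / \<Lambda> \<le> k1 z \<and> k1 z \<le> \<Lambda> * w z then k1 z else w z)" for z
  have [measurable]: "k \<in> borel_measurable borel" unfolding k_def by measurable
  have w_nn: "0 \<le> w z" for z by (simp add: w_def)
  have w1: "w z / \<Lambda> \<le> w z" "w z \<le> \<Lambda> * w z" for z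
  proof -
    have "w z * 1 \<le> w z * \<Lambda>" using w_nn \<Lambda> by (intro mult_left_mono) auto
    then show "w z \<le> \<Lambda> * w z" "w z / \<Lambda> \<le> w z" using \<Lambda> by (auto simp: field_simps)
  qed
  have nk: "nonlocal_kernel s p \<Lambda> k"
  proof (rule nonlocal_kernel.intro)
    show "k (x, y) = k (y, x)" for x y
      by (simp add: k_def k1_def w_def norm_minus_commute add.commute)
    show "norm (x - y) powr - (real DIM('a) + s * p) / \<Lambda> \<le> k (x, y)" for x y
      using w1(1)[of "(x, y)"] by (auto simp: k_def w_def q_def)
    show "k (x, y) \<le> \<Lambda> * norm (x - y) powr - (real DIM('a) + s * p)" for x y
      using w1(2)[of "(x, y)"] by (auto simp: k_def w_def q_def)
  qed (use s p \<Lambda> in auto)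
  have "AE z in completion lborel. 1 / \<Lambda> \<le> K (fst z) (snd z) * norm (fst z - snd z) powr q \<and>
        K (fst z) (snd z) * norm (fst z - snd z) powr q \<le> \<Lambda>"
    using K by (simp add: admissible_kernel_def split_beta' q_def)
  then have b: "AE z in lborel. 1 / \<Lambda> \<le> K (fst z) (snd z) * norm (fst z - snd z) powr q \<and>
        K (fst z) (snd z) * norm (fst z - snd z) powr q \<le> \<Lambda>"
    by (simp add: AE_completion_iff)
  have "AE z in lborel. K (fst z) (snd z) = k z"
    using k0_eq AE_lborel_swap[OF k0_eq] b
  proof eventually_elim
    fix z :: "'a \<times> 'a"
    assume 1: "K (fst z) (snd z) = k0 z" and 2: "K (fst (snd z, fst z)) (snd (snd z, fst z)) = k0 (snd z, fst z)"
      and 3: "1 / \<Lambda> \<le> K (fst z) (snd z) * norm (fst z - snd z) powr q \<and>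
        K (fst z) (snd z) * norm (fst z - snd z) powr q \<le> \<Lambda>"
    have "K (snd z) (fst z) = K (fst z) (snd z)" using K unfolding admissible_kernel_def by blast
    then have k1: "k1 z = K (fst z) (snd z)" using 1 2 by (simp add: k1_def)
    \<comment> \<open>On the diagonal the lower bound would read
      \<open>1 / \<Lambda> \<le> 0\<close>.\<close>
    have ne: "fst z \<noteq> snd z" using 3 \<Lambda> by auto
    then have pos: "0 < norm (fst z - snd z) powr q" by simp
    have "w z / \<Lambda> \<le> k1 z" "k1 z \<le> \<Lambda> * w z"
      using 3 pos \<Lambda> unfolding k1 w_def powr_minus by (auto simp: field_simps)
    then show "K (fst z) (snd z) = k z" by (simp add: k_def k1)
  qed
  then show thesis using nk that by blast
qed

section \<open>Test functions and compact neighbourhoods\<close>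

lemma C_k_continuous: "C_k n f \<Longrightarrow> continuous_on UNIV f"
  by (cases n) (auto intro!: differentiable_imp_continuous_on simp: differentiable_on_def differentiable_at_withinI)

lemma compact_support_bounded:
  fixes f :: "'a::euclidean_space \<Rightarrow> real"
  assumes "continuous_on UNIV f" "compact C" "\<And>x. x \<notin> C \<Longrightarrow> f x = 0"
  obtains B where "0 \<le> B" "\<And>x. \<bar>f x\<bar> \<le> B"
proof -
  have "bounded (f ` C)" using assms by (intro compact_imp_bounded compact_continuous_image) (auto intro: continuous_on_subset)
  then obtain B where B: "\<And>x. x \<in> C \<Longrightarrow> \<bar>f x\<bar> \<le> B" by (auto simp: bounded_iff)
  show thesis
  proof (rule that[of "max 0 B"])
    show "\<bar>f x\<bar> \<le> max 0 B" for x using B[of x] assms(3)[of x] by (cases "x \<in> C") auto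
  qed simp
qed

text \<open>Smoothness is given by iterated partial derivatives, so the operator norm of the
  derivative is bounded through the finitely many partial derivatives, each continuous with compact
  support. The mean value inequality does the rest.\<close>

lemma test_function_lipschitz:
  fixes \<eta> :: "'a::euclidean_space \<Rightarrow> real"
  assumes \<eta>: "\<eta> \<in> test_functions S"
  obtains L where "0 \<le> L" "\<And>x y. \<bar>\<eta> x - \<eta> y\<bar> \<le> L * norm (x - y)"
proof -
  define C where "C = closure {x. \<eta> x \<noteq> 0}"
  have C: "compact C" "\<And>x. x \<notin> C \<Longrightarrow> \<eta> x = 0"
    using \<eta> closure_subset[of "{x. \<eta> x \<noteq> 0}"] by (auto simp: test_functions_def compactly_contained_def C_def)
  have "C_k (Suc 0) \<eta>" using \<eta> unfolding test_functions_def by blast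
  then have d: "\<And>x. \<eta> differentiable (at x)" and c: "\<And>b. b \<in> Basis \<Longrightarrow> continuous_on UNIV (\<lambda>x. frechet_derivative \<eta> (at x) b)"
    by auto
  have der: "(\<eta> has_derivative frechet_derivative \<eta> (at x)) (at x)" for x
    using d frechet_derivative_works by blast
  have zero: "frechet_derivative \<eta> (at x) b = 0" if x: "x \<notin> C" for x b
  proof -
    have "((\<lambda>_. 0) has_derivative (\<lambda>_. 0)) (at x)" by simp
    then have "(\<eta> has_derivative (\<lambda>_. 0)) (at x)"
      by (rule has_derivative_transform_within_open[of _ _ _ _ "- C"]) (use x C in \<open>auto intro: compact_imp_closed\<close>)
    then show ?thesis using has_derivative_unique[OF der] by metis
  qed
  have "\<exists>B. \<forall>x. \<bar>frechet_derivative \<eta> (at x) b\<bar> \<le> B" if b: "b \<in> Basis" for b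
    using compact_support_bounded[OF c[OF b] C(1) zero] by metis
  then obtain B where B: "\<And>b x. b \<in> Basis \<Longrightarrow> \<bar>frechet_derivative \<eta> (at x) b\<bar> \<le> B b" by metis
  define L where "L = (\<Sum>b\<in>Basis. \<bar>B b\<bar>)"
  have L: "0 \<le> L" by (simp add: L_def sum_nonneg)
  have on: "onorm (frechet_derivative \<eta> (at x)) \<le> L" for x
  proof (rule onorm_le)
    fix h
    interpret bounded_linear "frechet_derivative \<eta> (at x)" using der by (rule has_derivative_bounded_linear)
    have "frechet_derivative \<eta> (at x) h = frechet_derivative \<eta> (at x) (\<Sum>b\<in>Basis. (h \<bullet> b) *\<^sub>R b)"
      by (simp add: euclidean_representation)
    also have "\<dots> = (\<Sum>b\<in>Basis. (h \<bullet> b) * frechet_derivative \<eta> (at x) b)" by (simp add: sum scaleR)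
    finally have "\<bar>frechet_derivative \<eta> (at x) h\<bar> \<le> (\<Sum>b\<in>Basis. \<bar>(h \<bullet> b) * frechet_derivative \<eta> (at x) b\<bar>)" by simp
    also have "\<dots> \<le> (\<Sum>b\<in>Basis. norm h * \<bar>B b\<bar>)"
    proof (rule sum_mono)
      fix b :: 'a assume "b \<in> Basis"
      then show "\<bar>(h \<bullet> b) * frechet_derivative \<eta> (at x) b\<bar> \<le> norm h * \<bar>B b\<bar>"
        using B[of b x] Basis_le_norm[of b h] unfolding abs_mult by (intro mult_mono) auto
    qed
    also have "\<dots> = L * norm h" by (simp add: L_def sum_distrib_left mult.commute)
    finally show "norm (frechet_derivative \<eta> (at x) h) \<le> L * norm h" by simp
  qed
  show thesis
  proof (rule that[OF L])
    fix x y
    show "\<bar>\<eta> x - \<eta> y\<bar> \<le> L * norm (x - y)"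
      using differentiable_bound[OF convex_UNIV, of \<eta> "\<lambda>x. frechet_derivative \<eta> (at x)" L x y] der on by simp
  qed
qed

lemma test_function_facts:
  fixes \<eta> :: "'a::euclidean_space \<Rightarrow> real"
  assumes \<eta>: "\<eta> \<in> test_functions S"
  obtains C B L where "compact C" "C \<subseteq> S" "\<And>x. x \<notin> C \<Longrightarrow> \<eta> x = 0" "\<And>x. \<bar>\<eta> x\<bar> \<le> B" "0 \<le> L"
    "\<And>x y. \<bar>\<eta> x - \<eta> y\<bar> \<le> L * norm (x - y)" "\<eta> \<in> borel_measurable borel"
proof -
  define C where "C = closure {x. \<eta> x \<noteq> 0}"
  have C: "compact C" "C \<subseteq> S" "\<And>x. x \<notin> C \<Longrightarrow> \<eta> x = 0"
    using \<eta> closure_subset[of "{x. \<eta> x \<noteq> 0}"] by (auto simp: test_functions_def compactly_contained_def C_def)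
  have cont: "continuous_on UNIV \<eta>" using \<eta> C_k_continuous unfolding test_functions_def by blast
  obtain B where B: "\<And>x. \<bar>\<eta> x\<bar> \<le> B" using compact_support_bounded[OF cont C(1,3)] by metis
  obtain L where L: "0 \<le> L" "\<And>x y. \<bar>\<eta> x - \<eta> y\<bar> \<le> L * norm (x - y)"
    using test_function_lipschitz[OF \<eta>] by blast
  show thesis by (rule that[OF C B L borel_measurable_continuous_onI[OF cont]])
qed

lemma compact_union_cball:
  fixes C :: "'a::euclidean_space set"
  assumes "compact C"
  shows "compact (\<Union>x\<in>C. cball x e)"
proof -
  have "(\<Union>x\<in>C. cball x e) = (\<lambda>z. fst z + snd z) ` (C \<times> cball 0 e)"
  proof (intro set_eqI iffI)
    fix y assume "y \<in> (\<Union>x\<in>C. cball x e)"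
    then obtain x where "x \<in> C" "dist x y \<le> e" by auto
    then show "y \<in> (\<lambda>z. fst z + snd z) ` (C \<times> cball 0 e)"
      by (intro image_eqI[of _ _ "(x, y - x)"]) (auto simp: dist_norm norm_minus_commute)
  next
    fix y assume "y \<in> (\<lambda>z. fst z + snd z) ` (C \<times> cball 0 e)"
    then obtain a b where ab: "a \<in> C" "norm b \<le> e" "y = a + b" by auto
    then have "y \<in> cball a e" by (simp add: dist_norm)
    then show "y \<in> (\<Union>x\<in>C. cball x e)" using ab(1) by blast
  qed
  then show ?thesis using assms
    by (simp only:) (intro compact_continuous_image continuous_intros compact_Times compact_cball)
qed

lemma open_between:
  fixes C S :: "'a::euclidean_space set"
  assumes "compact C" "open S" "C \<subseteq> S"
  obtains D where "open D" "C \<subseteq> D" "D \<Subset> S"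
proof -
  obtain e where e: "0 < e" "(\<Union>x\<in>C. cball x e) \<subseteq> S"
    using compact_subset_open_imp_cball_epsilon_subset[OF assms] by blast
  note comp = compact_union_cball[OF assms(1), of e]
  define D where "D = (\<Union>x\<in>C. ball x e)"
  have "closure D \<subseteq> (\<Union>x\<in>C. cball x e)"
    using comp by (intro closure_minimal compact_imp_closed) (auto simp: D_def)
  then have "D \<Subset> S"
    using e comp unfolding compactly_contained_def by (meson closed_closure compact_Int_closed closed_subset compact_closure bounded_subset compact_imp_bounded closure_subset subset_trans)
  then show thesis using e by (intro that[of D]) (auto simp: D_def)
qed

section \<open>The definitions in terms of a real Borel representative\<close>

context nonlocal_kernel
begin

text \<open>For \<open>f\<close> bounded on a bounded set the integrability of the power
  \<open>p\<close> is automatic, and the two seminorm integrands agree up to a factor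
  \<open>\<Lambda>\<close> in either direction; on the diagonal both vanish.\<close>

lemma frac_sobolev_iff:
  assumes u: "u \<in> borel_measurable lebesgue" and f [measurable]: "f \<in> borel_measurable borel"
    and eq: "AE x in lborel. u x = ereal (f x)" and D: "open D" "bounded D" and b: "\<And>x. x \<in> D \<Longrightarrow> \<bar>f x\<bar> \<le> b"
  shows "u \<in> frac_sobolev s p D \<longleftrightarrow> energy D f < \<infinity>"
proof -
  define q where "q = real DIM('a) + s * p"
  have [measurable]: "D \<in> sets borel" using D by auto
  have Dl: "D \<in> sets lebesgue" using D by auto
  have 1: "u \<in> borel_measurable (lebesgue_on D)" using u by (rule measurable_restrict_space1)
  have 2: "(\<integral>\<^sup>+x\<in>D. abs_pow (u x) p \<partial>lebesgue) < \<infinity>"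
  proof -
    have "(\<integral>\<^sup>+x\<in>D. abs_pow (u x) p \<partial>lebesgue) = (\<integral>\<^sup>+x. abs_pow (u x) p * indicator D x \<partial>lborel)"
      by (rule nn_integral_completion)
    also have "\<dots> \<le> (\<integral>\<^sup>+x. ennreal (\<bar>b\<bar> powr p) * indicator D x \<partial>lborel)"
    proof (rule nn_integral_mono_AE, use eq in eventually_elim)
      fix x assume "u x = ereal (f x)"
      then show "abs_pow (u x) p * indicator D x \<le> ennreal (\<bar>b\<bar> powr p) * indicator D x"
        using b[of x] p by (cases "x \<in> D") (auto simp: abs_pow_def intro!: ennreal_leI powr_mono2)
    qed
    also have "\<dots> = ennreal (\<bar>b\<bar> powr p) * emeasure lborel D" by (simp add: nn_integral_cmult_indicator)
    also have "\<dots> < \<infinity>" using emeasure_bounded_finite[OF D(2)] by (simp add: ennreal_mult_less_top)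
    finally show ?thesis .
  qed
  define I where "I = (\<integral>\<^sup>+z. indicator (D \<times> D) z * (ennreal (\<bar>f (fst z) - f (snd z)\<bar> powr p) / ennreal (norm (fst z - snd z) powr q)) \<partial>lborel)"
  have 3: "(\<integral>\<^sup>+(x, y)\<in>D \<times> D. abs_pow (u x - u y) p / ennreal (norm (x - y) powr (real DIM('a) + s * p)) \<partial>lebesgue) = I"
    unfolding nn_integral_completion I_def
  proof (rule nn_integral_cong_AE, use AE_lborel_fst_snd[OF eq] in eventually_elim)
    fix z :: "'a \<times> 'a" assume z: "u (fst z) = ereal (f (fst z)) \<and> u (snd z) = ereal (f (snd z))"
    obtain x y where xy: "z = (x, y)" by (cases z)
    show "(case z of (x, y) \<Rightarrow> abs_pow (u x - u y) p / ennreal (norm (x - y) powr (real DIM('a) + s * p))) * indicator (D \<times> D) z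
       = indicator (D \<times> D) z * (ennreal (\<bar>f (fst z) - f (snd z)\<bar> powr p) / ennreal (norm (fst z - snd z) powr q))"
      using z by (simp add: xy abs_pow_def q_def mult.commute)
  qed
  have e: "energy D f = (\<integral>\<^sup>+z. ennreal (k z) * (indicator (D \<times> D) z * ennreal (\<bar>f (fst z) - f (snd z)\<bar> powr p)) \<partial>lborel)"
    unfolding energy_def \<nu>_def by (subst nn_integral_density) auto
  have pt: "ennreal (k z) * (indicator (D \<times> D) z * ennreal (\<bar>f (fst z) - f (snd z)\<bar> powr p))
      \<le> ennreal \<Lambda> * (indicator (D \<times> D) z * (ennreal (\<bar>f (fst z) - f (snd z)\<bar> powr p) / ennreal (norm (fst z - snd z) powr q)))" (is "?a \<le> ?b")
    and pt2: "(indicator (D \<times> D) z * (ennreal (\<bar>f (fst z) - f (snd z)\<bar> powr p) / ennreal (norm (fst z - snd z) powr q)))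
      \<le> ennreal \<Lambda> * (ennreal (k z) * (indicator (D \<times> D) z * ennreal (\<bar>f (fst z) - f (snd z)\<bar> powr p)))" (is "?c \<le> ?d") for z
  proof -
    obtain x y where z: "z = (x, y)" by (cases z)
    have "?a \<le> ?b \<and> ?c \<le> ?d"
    proof (cases "x = y")
      case True then show ?thesis by (simp add: z)
    next
      case False
      define A where "A = \<bar>f x - f y\<bar> powr p"
      define n where "n = norm (x - y) powr q"
      have n: "0 < n" using False by (simp add: n_def)
      have A: "0 \<le> A" by (simp add: A_def)
      have inv: "norm (x - y) powr - q = 1 / n" by (simp add: n_def powr_minus divide_inverse)
      have k: "k z \<le> \<Lambda> * (1 / n)" "1 / n / \<Lambda> \<le> k z"
        using k_upper[of x y] k_lower[of x y] unfolding z q_def[symmetric] inv by auto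
      have "k z * A \<le> \<Lambda> * (A / n)" using mult_right_mono[OF k(1) A] by (simp add: ac_simps)
      moreover have "A / n \<le> \<Lambda> * (k z * A)"
      proof -
        have "A / n = \<Lambda> * (1 / n / \<Lambda> * A)" using \<Lambda> by simp
        also have "\<dots> \<le> \<Lambda> * (k z * A)"
          using mult_right_mono[OF k(2) A] \<Lambda> by (intro mult_left_mono) auto
        finally show ?thesis .
      qed
      ultimately have "ennreal (k z * A) \<le> ennreal (\<Lambda> * (A / n))" "ennreal (A / n) \<le> ennreal (\<Lambda> * (k z * A))"
        by (auto intro: ennreal_leI)
      moreover have "ennreal (k z * A) = ennreal (k z) * ennreal A" "ennreal (A / n) = ennreal A / ennreal n"
        "ennreal (\<Lambda> * (A / n)) = ennreal \<Lambda> * (ennreal A / ennreal n)"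
        "ennreal (\<Lambda> * (k z * A)) = ennreal \<Lambda> * (ennreal (k z) * ennreal A)"
      proof -
        show "ennreal (k z * A) = ennreal (k z) * ennreal A" using k_nonneg A by (intro ennreal_mult) auto
        show d: "ennreal (A / n) = ennreal A / ennreal n" using A n by (simp add: divide_ennreal)
        show "ennreal (\<Lambda> * (A / n)) = ennreal \<Lambda> * (ennreal A / ennreal n)"
          unfolding d[symmetric] using A n \<Lambda> by (intro ennreal_mult) auto
        show "ennreal (\<Lambda> * (k z * A)) = ennreal \<Lambda> * (ennreal (k z) * ennreal A)"
          using k_nonneg[of z] A \<Lambda> by (subst ennreal_mult[symmetric], auto)+
      qed
      ultimately show ?thesis by (simp add: z A_def[symmetric] n_def[symmetric] indicator_def)
    qed
    then show "?a \<le> ?b" "?c \<le> ?d" by auto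
  qed
  have "energy D f \<le> (\<integral>\<^sup>+z. ennreal \<Lambda> * (indicator (D \<times> D) z * (ennreal (\<bar>f (fst z) - f (snd z)\<bar> powr p) / ennreal (norm (fst z - snd z) powr q))) \<partial>lborel)"
    unfolding e by (intro nn_integral_mono pt)
  also have "\<dots> = ennreal \<Lambda> * I" unfolding I_def by (rule nn_integral_cmult) measurable
  finally have le1: "energy D f \<le> ennreal \<Lambda> * I" .
  have "I \<le> (\<integral>\<^sup>+z. ennreal \<Lambda> * (ennreal (k z) * (indicator (D \<times> D) z * ennreal (\<bar>f (fst z) - f (snd z)\<bar> powr p))) \<partial>lborel)"
    unfolding I_def by (intro nn_integral_mono pt2)
  also have "\<dots> = ennreal \<Lambda> * energy D f" unfolding e by (rule nn_integral_cmult) measurable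
  finally have le2: "I \<le> ennreal \<Lambda> * energy D f" .
  have "energy D f < \<infinity> \<longleftrightarrow> I < \<infinity>"
    using le1 le2 by (auto simp: ennreal_mult_less_top elim!: order.strict_trans1)
  then show ?thesis unfolding frac_sobolev_def using 1 2 3 by simp
qed

lemma neg_part_tail_space:
  assumes u: "u \<in> borel_measurable lebesgue" and f [measurable]: "f \<in> borel_measurable borel"
    and eq: "AE x in lborel. u x = ereal (f x)" and tail: "tail_finite f"
  shows "neg_part u \<in> tail_space s p"
proof -
  have np: "AE x in lborel. abs_pow (neg_part u x) (p - 1) \<le> ennreal (\<bar>f x\<bar> powr (p - 1))"
    using eq
  proof eventually_elim
    fix x assume "u x = ereal (f x)"
    then have "\<exists>m. neg_part u x = ereal m \<and> \<bar>m\<bar> \<le> \<bar>f x\<bar>"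
      by (cases "0 \<le> f x") (auto simp: neg_part_def max_def zero_ereal_def)
    then obtain m where "neg_part u x = ereal m" "\<bar>m\<bar> \<le> \<bar>f x\<bar>" by blast
    then show "abs_pow (neg_part u x) (p - 1) \<le> ennreal (\<bar>f x\<bar> powr (p - 1))"
      using p by (auto simp: abs_pow_def intro!: ennreal_leI powr_mono2)
  qed
  have m: "neg_part u \<in> borel_measurable lebesgue" unfolding neg_part_def using u by measurable
  have w: "(\<integral>\<^sup>+x. abs_pow (neg_part u x) (p - 1) * ennreal ((1 + norm x) powr (- real DIM('a) - s * p)) \<partial>lebesgue) < \<infinity>"
  proof -
    have "(\<integral>\<^sup>+x. abs_pow (neg_part u x) (p - 1) * ennreal ((1 + norm x) powr (- real DIM('a) - s * p)) \<partial>lborel)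
       \<le> (\<integral>\<^sup>+x. ennreal (\<bar>f x\<bar> powr (p - 1) * weight x) \<partial>lborel)"
    proof (rule nn_integral_mono_AE, use np in eventually_elim)
      fix x assume "abs_pow (neg_part u x) (p - 1) \<le> ennreal (\<bar>f x\<bar> powr (p - 1))"
      then have "abs_pow (neg_part u x) (p - 1) * ennreal (weight x) \<le> ennreal (\<bar>f x\<bar> powr (p - 1)) * ennreal (weight x)"
        by (rule mult_right_mono) simp
      then show "abs_pow (neg_part u x) (p - 1) * ennreal ((1 + norm x) powr (- real DIM('a) - s * p))
          \<le> ennreal (\<bar>f x\<bar> powr (p - 1) * weight x)"
        using weight_pos[of x] by (simp add: ennreal_mult weight_def)
    qed
    also have "\<dots> < \<infinity>" using tail by (simp add: tail_finite_def)
    finally show ?thesis by (simp add: nn_integral_completion)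
  qed
  have loc: "(\<integral>\<^sup>+x\<in>C. abs_pow (neg_part u x) (p - 1) \<partial>lebesgue) < \<infinity>" if C: "compact C" for C
  proof -
    obtain r where r: "0 \<le> r" "\<And>x. x \<in> C \<Longrightarrow> norm x \<le> r"
      using compact_imp_bounded[OF C] by (metis bounded_iff norm_ge_zero order_trans linear)
    define c where "c = (1 + r) powr - (real DIM('a) + s * p)"
    have c: "0 < c" using r by (simp add: c_def)
    have cw: "c \<le> weight x" if "x \<in> C" for x
      unfolding c_def weight_def using r that sp_pos by (intro powr_mono2') (auto intro: add_pos_nonneg)
    have "(\<integral>\<^sup>+x\<in>C. abs_pow (neg_part u x) (p - 1) \<partial>lborel)
       \<le> (\<integral>\<^sup>+x. ennreal (1 / c) * ennreal (\<bar>f x\<bar> powr (p - 1) * weight x) \<partial>lborel)"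
    proof (rule nn_integral_mono_AE, use np in eventually_elim)
      fix x assume le: "abs_pow (neg_part u x) (p - 1) \<le> ennreal (\<bar>f x\<bar> powr (p - 1))"
      show "abs_pow (neg_part u x) (p - 1) * indicator C x \<le> ennreal (1 / c) * ennreal (\<bar>f x\<bar> powr (p - 1) * weight x)"
      proof (cases "x \<in> C")
        case True
        have "\<bar>f x\<bar> powr (p - 1) * 1 \<le> \<bar>f x\<bar> powr (p - 1) * (1 / c * weight x)"
          using cw[OF True] c by (intro mult_left_mono) (auto simp: field_simps)
        then have "ennreal (\<bar>f x\<bar> powr (p - 1)) \<le> ennreal (1 / c) * ennreal (\<bar>f x\<bar> powr (p - 1) * weight x)"
          using c weight_pos[of x] by (simp add: ennreal_mult[symmetric] ennreal_leI ac_simps)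
        then show ?thesis using le True by simp
      qed simp
    qed
    also have "\<dots> = ennreal (1 / c) * (\<integral>\<^sup>+x. ennreal (\<bar>f x\<bar> powr (p - 1) * weight x) \<partial>lborel)"
      by (rule nn_integral_cmult) measurable
    also have "\<dots> < \<infinity>" using tail by (simp add: tail_finite_def ennreal_mult_less_top)
    finally show ?thesis by (simp add: nn_integral_completion)
  qed
  show ?thesis unfolding tail_space_def using m w loc by simp
qed

lemma test_form_integrable:
  assumes f [measurable]: "f \<in> borel_measurable borel" and tail: "tail_finite f" and S: "open S"
    and b: "\<And>D. open D \<Longrightarrow> D \<Subset> S \<Longrightarrow> \<exists>b. \<forall>x\<in>D. \<bar>f x\<bar> \<le> b"
    and en: "\<And>D. open D \<Longrightarrow> D \<Subset> S \<Longrightarrow> energy D f < \<infinity>" and \<eta>: "\<eta> \<in> test_functions S"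
  shows "integrable \<nu> (form f \<eta>)"
proof -
  obtain C B L where C: "compact C" "C \<subseteq> S" and \<eta>0: "\<And>x. x \<notin> C \<Longrightarrow> \<eta> x = 0" and \<eta>B: "\<And>x. \<bar>\<eta> x\<bar> \<le> B" and L: "0 \<le> L"
    "\<And>x y. \<bar>\<eta> x - \<eta> y\<bar> \<le> L * norm (x - y)" and [measurable]: "\<eta> \<in> borel_measurable borel"
    using test_function_facts[OF \<eta>] by blast
  obtain D where D: "open D" "C \<subseteq> D" "D \<Subset> S" using open_between[OF C(1) S C(2)] by blast
  have bd: "bounded D" using D(3) closure_subset[of D] unfolding compactly_contained_def
    by (meson bounded_subset compact_imp_bounded)
  obtain b where b: "\<And>x. x \<in> D \<Longrightarrow> \<bar>f x\<bar> \<le> b" using b[OF D(1,3)] by blast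
  have sep: "separated C D"
    using D bd C by (intro separatedI) (auto simp: compact_imp_closed closure_closed borel_compact)
  show ?thesis
  proof (rule form_integrable[OF sep f _ tail \<eta>0 \<eta>B b en[OF D(1,3)]])
    show "energy D \<eta> < \<infinity>" using D bd L by (intro energy_lipschitz[of D L]) auto
  qed auto
qed

text \<open>For an integrable \<open>g\<close> both parts have finite integrals, so the inequality
  between them is the sign of their difference.\<close>

lemma integral_\<nu>_nonneg_iff:
  assumes g [measurable]: "g \<in> borel_measurable borel" and int: "integrable \<nu> g"
    and eq: "AE z in lborel. F z = ereal (g z * k z)"
  shows "integral_nonneg lebesgue F \<longleftrightarrow> 0 \<le> (\<integral>z. g z \<partial>\<nu>)"
proof -
  have int': "integrable lborel (\<lambda>z. k z * g z)" and I: "(\<integral>z. g z \<partial>\<nu>) = (\<integral>z. k z * g z \<partial>lborel)"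
    using int integrable_density[of g lborel k] integral_density[of g lborel k] k_nonneg
    unfolding \<nu>_def by auto
  have meas: "F \<in> borel_measurable lebesgue"
  proof (rule borel_measurable_lebesgue_AE)
    show "(\<lambda>z. ereal (g z * k z)) \<in> borel_measurable lebesgue"
      by (rule measurable_completion) measurable
    show "AE z in lebesgue. ereal (g z * k z) = F z"
      using AE_completion[OF eq] by eventually_elim simp
  qed
  define P where "P = (\<integral>\<^sup>+z. ennreal (k z * g z) \<partial>lborel)"
  define M where "M = (\<integral>\<^sup>+z. ennreal (- (k z * g z)) \<partial>lborel)"
  have fin: "P < \<infinity>" "M < \<infinity>" using int' by (auto simp: real_integrable_def P_def M_def less_top)
  have 1: "(\<integral>\<^sup>+z. e2ennreal (- F z) \<partial>lebesgue) = M"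
    unfolding nn_integral_completion M_def
    by (rule nn_integral_cong_AE, use eq in eventually_elim) (simp add: mult.commute)
  have 2: "(\<integral>\<^sup>+z. e2ennreal (F z) \<partial>lebesgue) = P"
    unfolding nn_integral_completion P_def
    by (rule nn_integral_cong_AE, use eq in eventually_elim) (simp add: mult.commute)
  have "(\<integral>z. g z \<partial>\<nu>) = enn2real P - enn2real M"
    unfolding I P_def M_def by (rule real_lebesgue_integral_def[OF int'])
  moreover have "M \<le> P \<longleftrightarrow> enn2real M \<le> enn2real P"
    using fin by (cases M; cases P) auto
  ultimately show ?thesis unfolding integral_nonneg_def 1 2 using meas fin by simp
qed

text \<open>With a two-sided tail, local bounds and finite local energy the double integral
  converges absolutely for every test function, so the extended integral becomes an ordinary
  one.\<close>

lemma weak_supersolution_iff: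
  assumes KK: "AE z in lborel. K (fst z) (snd z) = k z"
    and u: "u \<in> borel_measurable lebesgue" and f [measurable]: "f \<in> borel_measurable borel"
    and eq: "AE x in lborel. u x = ereal (f x)" and tail: "tail_finite f" and S: "open S"
    and b: "\<And>D. open D \<Longrightarrow> D \<Subset> S \<Longrightarrow> \<exists>b. \<forall>x\<in>D. \<bar>f x\<bar> \<le> b"
  shows "weak_supersolution s p K S u \<longleftrightarrow>
     (\<forall>D. open D \<longrightarrow> D \<Subset> S \<longrightarrow> energy D f < \<infinity>) \<and>
     (\<forall>\<eta>\<in>test_functions S. (\<forall>x. 0 \<le> \<eta> x) \<longrightarrow> 0 \<le> (\<integral>z. form f \<eta> z \<partial>\<nu>))"
proof -
  have fs: "u \<in> frac_sobolev_loc s p S \<longleftrightarrow> (\<forall>D. open D \<longrightarrow> D \<Subset> S \<longrightarrow> energy D f < \<infinity>)"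
  proof -
    have "u \<in> frac_sobolev s p D \<longleftrightarrow> energy D f < \<infinity>" if D: "open D" "D \<Subset> S" for D
    proof -
      have bd: "bounded D" using D(2) closure_subset[of D] unfolding compactly_contained_def
        by (meson bounded_subset compact_imp_bounded)
      obtain b where "\<And>x. x \<in> D \<Longrightarrow> \<bar>f x\<bar> \<le> b" using b[OF D] by blast
      then show ?thesis by (rule frac_sobolev_iff[OF u f eq D(1) bd])
    qed
    then show ?thesis unfolding frac_sobolev_loc_def by auto
  qed
  have int: "integral_nonneg lebesgue (\<lambda>(x, y). signed_pow p (u x - u y) * ereal ((\<eta> x - \<eta> y) * K x y))
      \<longleftrightarrow> 0 \<le> (\<integral>z. form f \<eta> z \<partial>\<nu>)"
    if en: "\<forall>D. open D \<longrightarrow> D \<Subset> S \<longrightarrow> energy D f < \<infinity>" and \<eta>: "\<eta> \<in> test_functions S" for \<eta>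
  proof (rule integral_\<nu>_nonneg_iff)
    have [measurable]: "\<eta> \<in> borel_measurable borel" using test_function_facts[OF \<eta>] by metis
    show "form f \<eta> \<in> borel_measurable borel" by measurable
    show "integrable \<nu> (form f \<eta>)" using en b by (intro test_form_integrable[OF f tail S _ _ \<eta>]) auto
    show "AE z in lborel. (case z of (x, y) \<Rightarrow> signed_pow p (u x - u y) * ereal ((\<eta> x - \<eta> y) * K x y)) = ereal (form f \<eta> z * k z)"
      using AE_lborel_fst_snd[OF eq] KK
    proof eventually_elim
      fix z :: "'a \<times> 'a" assume 1: "u (fst z) = ereal (f (fst z)) \<and> u (snd z) = ereal (f (snd z))" and 2: "K (fst z) (snd z) = k z"
      then show "(case z of (x, y) \<Rightarrow> signed_pow p (u x - u y) * ereal ((\<eta> x - \<eta> y) * K x y)) = ereal (form f \<eta> z * k z)"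
        by (simp add: split_beta signed_pow_def form_def phi_def)
    qed
  qed
  show ?thesis
    unfolding weak_supersolution_def fs using u neg_part_tail_space[OF u f eq tail] int by auto
qed

lemma form_minus: "form (\<lambda>x. - f x) h = (\<lambda>z. - form f h z)"
proof
  fix z show "form (\<lambda>x. - f x) h z = - form f h z"
    using phi_minus[of p "f (fst z) - f (snd z)"] by (simp add: form_def)
qed

lemma energy_minus: "energy D (\<lambda>x. - f x) = energy D f"
proof -
  have "\<bar>- a - - b\<bar> = \<bar>a - b\<bar>" for a b :: real by simp
  then show ?thesis unfolding energy_def by presburger
qed

lemma weak_solution_iff:
  assumes KK: "AE z in lborel. K (fst z) (snd z) = k z"
    and u: "u \<in> borel_measurable lebesgue" and f [measurable]: "f \<in> borel_measurable borel"
    and eq: "AE x in lborel. u x = ereal (f x)" and tail: "tail_finite f" and S: "open S"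
    and b: "\<And>D. open D \<Longrightarrow> D \<Subset> S \<Longrightarrow> \<exists>b. \<forall>x\<in>D. \<bar>f x\<bar> \<le> b"
  shows "weak_solution s p K S u \<longleftrightarrow>
     (\<forall>D. open D \<longrightarrow> D \<Subset> S \<longrightarrow> energy D f < \<infinity>) \<and>
     (\<forall>\<eta>\<in>test_functions S. (\<forall>x. 0 \<le> \<eta> x) \<longrightarrow> (\<integral>z. form f \<eta> z \<partial>\<nu>) = 0)"
proof -
  have "weak_subsolution s p K S u \<longleftrightarrow>
     (\<forall>D. open D \<longrightarrow> D \<Subset> S \<longrightarrow> energy D (\<lambda>x. - f x) < \<infinity>) \<and>
     (\<forall>\<eta>\<in>test_functions S. (\<forall>x. 0 \<le> \<eta> x) \<longrightarrow> 0 \<le> (\<integral>z. form (\<lambda>x. - f x) \<eta> z \<partial>\<nu>))"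
    unfolding weak_subsolution_def
  proof (rule weak_supersolution_iff[OF KK _ _ _ _ S])
    show "AE x in lborel. - u x = ereal (- f x)" using eq by eventually_elim simp
    show "tail_finite (\<lambda>x. - f x)" using tail by (simp add: tail_finite_def)
  qed (use u b in auto)
  moreover have "(\<integral>z. form (\<lambda>x. - f x) \<eta> z \<partial>\<nu>) = - (\<integral>z. form f \<eta> z \<partial>\<nu>)" for \<eta>
    by (simp add: form_minus)
  moreover have "I = 0 \<longleftrightarrow> 0 \<le> I \<and> 0 \<le> - I" for I :: real by auto
  moreover have "weak_supersolution s p K S u \<longleftrightarrow>
     (\<forall>D. open D \<longrightarrow> D \<Subset> S \<longrightarrow> energy D f < \<infinity>) \<and>
     (\<forall>\<eta>\<in>test_functions S. (\<forall>x. 0 \<le> \<eta> x) \<longrightarrow> 0 \<le> (\<integral>z. form f \<eta> z \<partial>\<nu>))"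
    by (rule weak_supersolution_iff[OF KK u f eq tail S b])
  ultimately show ?thesis
    unfolding weak_solution_def energy_minus by (simp only:) blast
qed

text \<open>The tail conditions on \<open>u\<close> and \<open>- u\<close> together force finite
  values almost everywhere. In \<open>S\<close> the representative agrees with \<open>u\<close> at
  every point, because comparison and continuity are pointwise; only outside is a null set
  disregarded.\<close>

lemma real_representative:
  assumes u: "u \<in> borel_measurable lebesgue" and t: "neg_part u \<in> tail_space s p" "neg_part (\<lambda>x. - u x) \<in> tail_space s p"
    and S: "open S" and c: "finite_continuous_on S u"
  obtains f where "f \<in> borel_measurable borel" "AE x in lborel. u x = ereal (f x)" "\<And>x. x \<in> S \<Longrightarrow> u x = ereal (f x)"
    "tail_finite f" "continuous_on S f"
proof -
  have fin: "AE x in lborel. abs_pow (neg_part w x) (p - 1) < \<infinity>"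
    and tl: "(\<integral>\<^sup>+x. abs_pow (neg_part w x) (p - 1) * ennreal (weight x) \<partial>lborel) < \<infinity>"
    and me: "(\<lambda>x. abs_pow (neg_part w x) (p - 1) * ennreal (weight x)) \<in> borel_measurable lebesgue"
    if w: "w \<in> borel_measurable lebesgue" "neg_part w \<in> tail_space s p" for w
  proof -
    have [measurable]: "neg_part w \<in> borel_measurable lebesgue" using w by (simp add: tail_space_def)
    have wl: "weight \<in> borel_measurable lebesgue" by (rule measurable_completion) simp
    note [measurable] = wl
    show 1: "(\<lambda>x. abs_pow (neg_part w x) (p - 1) * ennreal (weight x)) \<in> borel_measurable lebesgue"
      unfolding abs_pow_def by measurable
    have "- real DIM('a) - s * p = - (real DIM('a) + s * p)" by simp
    then have 2: "(\<integral>\<^sup>+x. abs_pow (neg_part w x) (p - 1) * ennreal (weight x) \<partial>lebesgue) < \<infinity>"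
      using w by (simp add: tail_space_def weight_def)
    then show "(\<integral>\<^sup>+x. abs_pow (neg_part w x) (p - 1) * ennreal (weight x) \<partial>lborel) < \<infinity>"
      by (simp add: nn_integral_completion)
    have "AE x in lebesgue. abs_pow (neg_part w x) (p - 1) * ennreal (weight x) \<noteq> \<infinity>"
      using 2 by (intro nn_integral_PInf_AE[OF 1]) auto
    then have "AE x in lborel. abs_pow (neg_part w x) (p - 1) * ennreal (weight x) \<noteq> \<infinity>"
      by (simp add: AE_completion_iff)
    then show "AE x in lborel. abs_pow (neg_part w x) (p - 1) < \<infinity>"
    proof eventually_elim
      fix x assume "abs_pow (neg_part w x) (p - 1) * ennreal (weight x) \<noteq> \<infinity>"
      then show "abs_pow (neg_part w x) (p - 1) < \<infinity>"
        using weight_pos[of x] by (auto simp: ennreal_mult_eq_top_iff less_top)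
    qed
  qed
  have mu: "(\<lambda>x. - u x) \<in> borel_measurable lebesgue" using u by measurable
  have "AE x in lborel. \<bar>u x\<bar> \<noteq> \<infinity>"
    using fin[OF u t(1)] fin[OF mu t(2)]
  proof eventually_elim
    fix x assume "abs_pow (neg_part u x) (p - 1) < \<infinity>" "abs_pow (neg_part (\<lambda>x. - u x) x) (p - 1) < \<infinity>"
    then show "\<bar>u x\<bar> \<noteq> \<infinity>" by (cases "u x") (auto simp: abs_pow_def neg_part_def max_def)
  qed
  then obtain f0 where f0 [measurable]: "f0 \<in> borel_measurable borel" and f0_eq: "AE x in lborel. u x = ereal (f0 x)"
    using lebesgue_borel_representative[OF u] by blast
  have cont: "continuous_on S (\<lambda>x. real_of_ereal (u x))"
    using c unfolding finite_continuous_on_def 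
    by (intro continuous_on_compose2[OF continuous_on_real]) auto
  define f where "f x = indicator S x *\<^sub>R real_of_ereal (u x) + indicator (- S) x * f0 x" for x
  have [measurable]: "S \<in> sets borel" using S by auto
  have [measurable]: "(\<lambda>x. indicator S x *\<^sub>R real_of_ereal (u x)) \<in> borel_measurable borel"
    by (rule borel_measurable_continuous_on_indicator[OF _ cont]) simp
  have f [measurable]: "f \<in> borel_measurable borel" unfolding f_def by measurable
  have fS: "u x = ereal (f x)" if "x \<in> S" for x
    using that c by (auto simp: f_def finite_continuous_on_def ereal_real)
  have f_eq: "AE x in lborel. u x = ereal (f x)"
    using f0_eq
  proof eventually_elim
    fix x assume "u x = ereal (f0 x)"
    show "u x = ereal (f x)"
    proof (cases "x \<in> S")
      case False
      then have "f x = f0 x" by (simp add: f_def)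
      then show ?thesis using \<open>u x = ereal (f0 x)\<close> by simp
    qed (rule fS)
  qed
  have "tail_finite f"
  proof -
    have "(\<integral>\<^sup>+x. ennreal (\<bar>f x\<bar> powr (p - 1) * weight x) \<partial>lborel)
      \<le> (\<integral>\<^sup>+x. abs_pow (neg_part u x) (p - 1) * ennreal (weight x) + abs_pow (neg_part (\<lambda>x. - u x) x) (p - 1) * ennreal (weight x) \<partial>lborel)"
    proof (rule nn_integral_mono_AE, use f_eq in eventually_elim)
      fix x assume ux: "u x = ereal (f x)"
      have "neg_part u x = ereal (max (- f x) 0)" "neg_part (\<lambda>x. - u x) x = ereal (max (f x) 0)"
        by (auto simp: ux neg_part_def max_def)
      then have "ennreal (\<bar>f x\<bar> powr (p - 1)) \<le> abs_pow (neg_part u x) (p - 1) + abs_pow (neg_part (\<lambda>x. - u x) x) (p - 1)"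
        by (cases "0 \<le> f x") (auto simp: abs_pow_def)
      then have "ennreal (\<bar>f x\<bar> powr (p - 1)) * ennreal (weight x)
          \<le> (abs_pow (neg_part u x) (p - 1) + abs_pow (neg_part (\<lambda>x. - u x) x) (p - 1)) * ennreal (weight x)"
        by (rule mult_right_mono) simp
      then show "ennreal (\<bar>f x\<bar> powr (p - 1) * weight x) \<le> abs_pow (neg_part u x) (p - 1) * ennreal (weight x) + abs_pow (neg_part (\<lambda>x. - u x) x) (p - 1) * ennreal (weight x)"
        using weight_pos[of x] by (simp add: ennreal_mult distrib_right)
    qed
    also have "\<dots> = (\<integral>\<^sup>+x. abs_pow (neg_part u x) (p - 1) * ennreal (weight x) + abs_pow (neg_part (\<lambda>x. - u x) x) (p - 1) * ennreal (weight x) \<partial>lebesgue)"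
      by (simp add: nn_integral_completion)
    also have "\<dots> = (\<integral>\<^sup>+x. abs_pow (neg_part u x) (p - 1) * ennreal (weight x) \<partial>lebesgue)
       + (\<integral>\<^sup>+x. abs_pow (neg_part (\<lambda>x. - u x) x) (p - 1) * ennreal (weight x) \<partial>lebesgue)"
      by (rule nn_integral_add[OF me[OF u t(1)] me[OF mu t(2)]])
    also have "\<dots> < \<infinity>" using tl[OF u t(1)] tl[OF mu t(2)] by (simp add: nn_integral_completion)
    finally show ?thesis by (simp add: tail_finite_def)
  qed
  moreover have "continuous_on S f"
    using cont by (rule continuous_on_eq) (simp add: f_def)
  ultimately show thesis using f f_eq fS that by blast
qed

end

section \<open>Mollification\<close>

text \<open>The classical function that is smooth and flat at 0. The powers of \<open>t\<close> in
  the denominator close the family under differentiation, up to linear combinations.\<close>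

definition flat :: "nat \<Rightarrow> real \<Rightarrow> real"
  where "flat m t = (if 0 < t then exp (- (1 / t)) / t ^ m else 0)"

lemma power_le_fact_exp:
  fixes x :: real
  assumes "0 \<le> x"
  shows "x ^ n \<le> fact n * exp x"
proof -
  have "(\<Sum>i\<in>{n}. x ^ i /\<^sub>R fact i) \<le> (\<Sum>i. x ^ i /\<^sub>R fact i)"
    using assms by (intro sum_le_suminf summable_exp_generic) auto
  then show ?thesis by (simp add: exp_def field_simps)
qed

text \<open>A single term of the exponential series at \<open>1 / t\<close> beats the denominator
  and leaves two powers of \<open>t\<close>, one more than a vanishing derivative at 0
  takes.\<close>

lemma flat_bound: "\<bar>flat m t\<bar> \<le> fact (m + 2) * t\<^sup>2"
proof (cases "0 < t")
  case True
  have "(1 / t) ^ (m + 2) \<le> fact (m + 2) * exp (1 / t)" using True by (intro power_le_fact_exp) simp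
  then have "1 \<le> fact (m + 2) * exp (1 / t) * t ^ (m + 2)"
    using True by (simp add: power_one_over divide_le_eq)
  then have "exp (- (1 / t)) * 1 \<le> exp (- (1 / t)) * (fact (m + 2) * exp (1 / t) * t ^ (m + 2))"
    by (intro mult_left_mono) auto
  also have "\<dots> = fact (m + 2) * t ^ (m + 2)" by (simp add: exp_minus)
  finally have "exp (- (1 / t)) \<le> (fact (m + 2) * t\<^sup>2) * t ^ m" by (simp add: power_add power2_eq_square ac_simps)
  then show ?thesis using True by (simp add: flat_def divide_le_eq)
qed (simp add: flat_def)

lemma flat_has_derivative:
  "(flat m has_real_derivative (flat (m + 2) t - real m * flat (m + 1) t)) (at t)"
proof -
  consider "0 < t" | "t < 0" | "t = 0" by linarith
  then show ?thesis
  proof cases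
    case 1
    have "((\<lambda>t. exp (- (1 / t)) / t ^ m) has_real_derivative (flat (m + 2) t - real m * flat (m + 1) t)) (at t)"
    proof -
      have "((\<lambda>t. t ^ m) has_real_derivative (real m * t ^ m / t)) (at t)"
        using 1 DERIV_pow[of m t UNIV] by (cases m) simp_all
      moreover have "((\<lambda>t. exp (- (1 / t))) has_real_derivative (exp (- (1 / t)) / (t * t))) (at t)"
        using 1 by (auto intro!: derivative_eq_intros)
      ultimately have "((\<lambda>t. exp (- (1 / t)) / t ^ m) has_real_derivative
          ((exp (- (1 / t)) / (t * t) * t ^ m - exp (- (1 / t)) * (real m * t ^ m / t)) / (t ^ m * t ^ m))) (at t)"
        using 1 by (intro DERIV_divide) auto
      moreover have "(E / (t * t) * T - E * (real m * T / t)) / (T * T) = E / (t * t * T) - real m * (E / (t * T))"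
        if "T \<noteq> 0" for E T :: real
        using that 1 by (simp add: field_simps)
      from this[of "t ^ m" "exp (- (1 / t))"]
      have "(exp (- (1 / t)) / (t * t) * t ^ m - exp (- (1 / t)) * (real m * t ^ m / t)) / (t ^ m * t ^ m)
          = flat (m + 2) t - real m * flat (m + 1) t"
        using 1 by (simp add: flat_def mult.assoc)
      ultimately show ?thesis by (simp only:)
    qed
    then show ?thesis
      by (rule has_field_derivative_transform_within_open[of _ _ _ "{0<..}"]) (use 1 in \<open>auto simp: flat_def\<close>)
  next
    case 2
    have "((\<lambda>t. 0) has_real_derivative (flat (m + 2) t - real m * flat (m + 1) t)) (at t)"
      using 2 by (simp add: flat_def)
    then show ?thesis
      by (rule has_field_derivative_transform_within_open[of _ _ _ "{..<0}"]) (use 2 in \<open>auto simp: flat_def\<close>)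
  next
    case 3
    have "((\<lambda>h. fact (m + 2) * \<bar>h\<bar>) \<longlongrightarrow> 0) (at (0::real))" by (intro tendsto_eq_intros) auto
    moreover have "\<forall>\<^sub>F h in at 0. norm (flat m h / h) \<le> fact (m + 2) * \<bar>h\<bar>"
      unfolding eventually_at_filter
    proof (intro always_eventually allI impI)
      fix h :: real assume "h \<noteq> 0"
      have "\<bar>flat m h\<bar> \<le> (fact (m + 2) * \<bar>h\<bar>) * \<bar>h\<bar>"
        using flat_bound[of m h] by (simp only: power2_eq_square abs_mult_self_eq mult.assoc)
      then show "norm (flat m h / h) \<le> fact (m + 2) * \<bar>h\<bar>"
        using \<open>h \<noteq> 0\<close> by (simp only: real_norm_def abs_divide) (simp add: divide_le_eq)
    qed
    ultimately have "((\<lambda>h. flat m h / h) \<longlongrightarrow> 0) (at 0)" by (rule Lim_null_comparison[rotated])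
    then show ?thesis using 3 by (simp add: DERIV_def flat_def)
  qed
qed

text \<open>A class of functions that contains a radial bump and is closed under partial derivatives.\<close>
inductive bump_class :: "real \<Rightarrow> ('a::euclidean_space \<Rightarrow> real) \<Rightarrow> bool" for r
  where
    flat: "bump_class r (\<lambda>x. flat m (r - x \<bullet> x))"
  | add: "bump_class r f \<Longrightarrow> bump_class r g \<Longrightarrow> bump_class r (\<lambda>x. f x + g x)"
  | scale: "bump_class r f \<Longrightarrow> bump_class r (\<lambda>x. c * f x)"
  | coordinate: "bump_class r f \<Longrightarrow> bump_class r (\<lambda>x. (x \<bullet> a) * f x)"

lemma bump_class_derivative:
  assumes "bump_class r f"
  shows "\<exists>f'. (\<forall>x. (f has_derivative f' x) (at x)) \<and> (\<forall>b. bump_class r (\<lambda>x. f' x b))"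
  using assms
proof (induction rule: bump_class.induct)
  case (flat m)
  define d where "d x h = (flat (m + 2) (r - x \<bullet> x) - real m * flat (m + 1) (r - x \<bullet> x)) * (- 2 * (x \<bullet> h))" for x h :: 'a
  have "((\<lambda>x. flat m (r - x \<bullet> x)) has_derivative d x) (at x)" for x :: 'a
  proof -
    have "((\<lambda>x. r - x \<bullet> x) has_derivative (\<lambda>h. - 2 * (x \<bullet> h))) (at x)"
      by (auto intro!: derivative_eq_intros simp: inner_commute)
    then have "((\<lambda>x. flat m (r - x \<bullet> x)) has_derivative
       (\<lambda>h. (flat (m + 2) (r - x \<bullet> x) - real m * flat (m + 1) (r - x \<bullet> x)) * (- 2 * (x \<bullet> h)))) (at x)"
      by (rule has_derivative_compose) (use flat_has_derivative in \<open>simp add: has_field_derivative_def\<close>)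
    then show ?thesis by (simp add: d_def[abs_def])
  qed
  moreover have "bump_class r (\<lambda>x. d x b)" for b
  proof -
    have "bump_class r (\<lambda>x. (x \<bullet> b) * (-2 * (flat (m + 2) (r - x \<bullet> x) + (- real m) * flat (m + 1) (r - x \<bullet> x))))"
      by (intro bump_class.intros)
    moreover have "(\<lambda>x. (x \<bullet> b) * (-2 * (flat (m + 2) (r - x \<bullet> x) + (- real m) * flat (m + 1) (r - x \<bullet> x)))) = (\<lambda>x. d x b)"
      by (simp add: d_def fun_eq_iff algebra_simps)
    ultimately show ?thesis by simp
  qed
  ultimately show ?case by blast
next
  case (add f g)
  then obtain f' g' where "\<forall>x. (f has_derivative f' x) (at x)" "\<forall>b. bump_class r (\<lambda>x. f' x b)"
    "\<forall>x. (g has_derivative g' x) (at x)" "\<forall>b. bump_class r (\<lambda>x. g' x b)" by blast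
  then show ?case
    by (intro exI[of _ "\<lambda>x h. f' x h + g' x h"]) (auto intro: bump_class.add has_derivative_add)
next
  case (scale f c)
  then obtain f' where "\<forall>x. (f has_derivative f' x) (at x)" "\<forall>b. bump_class r (\<lambda>x. f' x b)" by blast
  then show ?case
    by (intro exI[of _ "\<lambda>x h. c * f' x h"]) (auto intro: bump_class.scale has_derivative_mult_right)
next
  case (coordinate f a)
  then obtain f' where f': "\<forall>x. (f has_derivative f' x) (at x)" "\<forall>b. bump_class r (\<lambda>x. f' x b)" by blast
  have "((\<lambda>x. (x \<bullet> a) * f x) has_derivative (\<lambda>h. (x \<bullet> a) * f' x h + (h \<bullet> a) * f x)) (at x)" for x
    using f'(1) by (auto intro!: derivative_eq_intros)
  moreover have "bump_class r (\<lambda>x. (x \<bullet> a) * f' x b + (b \<bullet> a) * f x)" for b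
    by (intro bump_class.add bump_class.coordinate bump_class.scale coordinate.hyps f'(2)[rule_format])
  ultimately show ?case by (intro exI[of _ "\<lambda>x h. (x \<bullet> a) * f' x h + (h \<bullet> a) * f x"]) simp
qed

lemma bump_class_continuous: "bump_class r f \<Longrightarrow> continuous_on A f"
  using bump_class_derivative[of r f] by (metis continuous_at_imp_continuous_on has_derivative_continuous)

text \<open>The derivative falls on the smooth factor, so continuity of \<open>w\<close> is enough.
  Integrating over a box gives access to differentiation under the integral; in the application
  \<open>w\<close> vanishes outside the box.\<close>

lemma convolution_has_derivative:
  fixes w :: "'a::euclidean_space \<Rightarrow> real"
  assumes w: "continuous_on UNIV w" and f: "bump_class r f"
  obtains f' where "\<And>b. bump_class r (\<lambda>x. f' x b)"
    "\<And>x. ((\<lambda>x. integral (cbox a c) (\<lambda>t. w t * f (x - t))) has_derivative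
        (\<lambda>b. integral (cbox a c) (\<lambda>t. w t * f' (x - t) b))) (at x)"
proof -
  obtain f' where f': "\<And>x. (f has_derivative f' x) (at x)" "\<And>b. bump_class r (\<lambda>x. f' x b)"
    using bump_class_derivative[OF f] by blast
  have bl: "bounded_linear (f' x)" for x using f'(1) by (rule has_derivative_bounded_linear)
  define F where "F x t = w t *\<^sub>R Blinfun (f' (x - t))" for x t
  have Fb: "blinfun_apply (F x t) b = w t * f' (x - t) b" for x t b
    by (simp add: F_def scaleR_blinfun.rep_eq bounded_linear_Blinfun_apply[OF bl])
  have cont: "continuous_on (UNIV \<times> cbox a c) (\<lambda>(x, t). F x t)"
  proof (rule continuous_on_blinfun_componentwise)
    fix b :: 'a
    have 1: "continuous_on (UNIV \<times> cbox a c) (\<lambda>z. w (snd z))"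
      by (rule continuous_on_compose2[OF w]) (auto intro: continuous_intros)
    have 2: "continuous_on UNIV (\<lambda>x. f' x b)" by (rule bump_class_continuous[OF f'(2)])
    have "continuous_on (UNIV \<times> cbox a c) (\<lambda>z. f' (fst z - snd z) b)"
      by (rule continuous_on_compose2[OF 2]) (auto intro!: continuous_intros)
    with 1 have "continuous_on (UNIV \<times> cbox a c) (\<lambda>z. w (snd z) * f' (fst z - snd z) b)"
      by (rule continuous_on_mult)
    then show "continuous_on (UNIV \<times> cbox a c) (\<lambda>x. blinfun_apply (case x of (x, t) \<Rightarrow> F x t) b)"
      by (simp add: split_beta' Fb)
  qed
  have "((\<lambda>x. integral (cbox a c) (\<lambda>t. w t * f (x - t))) has_derivative blinfun_apply (integral (cbox a c) (F x))) (at x)" for x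
  proof (rule leibniz_rule[where U = UNIV and fx = F])
    fix x t
    have "((\<lambda>x. f (x - t)) has_derivative f' (x - t)) (at x)"
    proof -
      have "((\<lambda>x. x - t) has_derivative (\<lambda>h. h)) (at x)" by (auto intro!: derivative_eq_intros)
      then show ?thesis using f'(1)[of "x - t"] by (rule has_derivative_compose)
    qed
    then have "((\<lambda>x. w t * f (x - t)) has_derivative (\<lambda>h. w t * f' (x - t) h)) (at x)"
      by (rule has_derivative_mult_right)
    then show "((\<lambda>x. w t * f (x - t)) has_derivative blinfun_apply (F x t)) (at x)"
      by (simp add: Fb[abs_def])
  next
    fix x
    show "(\<lambda>t. w t * f (x - t)) integrable_on cbox a c"
      by (intro integrable_continuous continuous_on_mult continuous_on_subset[OF w]
          continuous_on_compose2[OF bump_class_continuous[OF f, of UNIV]] continuous_intros) auto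
  qed (use cont in auto)
  moreover have "blinfun_apply (integral (cbox a c) (F x)) b = integral (cbox a c) (\<lambda>t. w t * f' (x - t) b)" for x b
  proof -
    have "continuous_on (cbox a c) (F x)"
    proof -
      have "continuous_on (cbox a c) (\<lambda>t. (\<lambda>(x, t). F x t) (x, t))"
        by (rule continuous_on_compose2[OF cont]) (auto intro!: continuous_intros)
      then show ?thesis by simp
    qed
    then have "F x integrable_on cbox a c" by (rule integrable_continuous)
    then show ?thesis by (subst blinfun_apply_integral) (simp_all add: Fb)
  qed
  ultimately have "((\<lambda>x. integral (cbox a c) (\<lambda>t. w t * f (x - t))) has_derivative
        (\<lambda>b. integral (cbox a c) (\<lambda>t. w t * f' (x - t) b))) (at x)" for x
    by (metis (no_types, lifting) ext)
  then show thesis using f'(2) that by blast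
qed

lemma convolution_C_k:
  fixes w :: "'a::euclidean_space \<Rightarrow> real"
  assumes w: "continuous_on UNIV w"
  shows "bump_class r f \<Longrightarrow> C_k n (\<lambda>x. integral (cbox a c) (\<lambda>t. w t * f (x - t)))"
proof (induction n arbitrary: f)
  case 0
  obtain f' where "\<And>x. ((\<lambda>x. integral (cbox a c) (\<lambda>t. w t * f (x - t))) has_derivative
        (\<lambda>b. integral (cbox a c) (\<lambda>t. w t * f' (x - t) b))) (at x)"
    using convolution_has_derivative[OF w 0] by blast
  then show ?case by (auto intro!: continuous_at_imp_continuous_on has_derivative_continuous)
next
  case (Suc n)
  obtain f' where f': "\<And>b. bump_class r (\<lambda>x. f' x b)"
    "\<And>x. ((\<lambda>x. integral (cbox a c) (\<lambda>t. w t * f (x - t))) has_derivative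
        (\<lambda>b. integral (cbox a c) (\<lambda>t. w t * f' (x - t) b))) (at x)"
    using convolution_has_derivative[OF w Suc.prems] by blast
  have "frechet_derivative (\<lambda>x. integral (cbox a c) (\<lambda>t. w t * f (x - t))) (at x)
     = (\<lambda>b. integral (cbox a c) (\<lambda>t. w t * f' (x - t) b))" for x
    using f'(2) by (rule frechet_derivative_at[symmetric])
  then show ?case using Suc.IH[OF f'(1)] f'(2) by (auto simp: differentiable_def)
qed

text \<open>The tangent at the mean \<open>a\<close> lies below the convex power; integrated against
  the probability density \<open>\<rho>\<close>, its linear term vanishes.\<close>

lemma powr_jensen:
  fixes \<rho> X :: "'a \<Rightarrow> real"
  assumes p: "1 < p" and \<rho>: "integrable M \<rho>" "\<And>z. 0 \<le> \<rho> z" "(\<integral>z. \<rho> z \<partial>M) = 1"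
    and X [measurable]: "X \<in> borel_measurable M" and B: "\<And>z. \<bar>X z\<bar> \<le> B"
  shows "ennreal (\<bar>\<integral>z. \<rho> z * X z \<partial>M\<bar> powr p) \<le> (\<integral>\<^sup>+z. ennreal (\<rho> z * \<bar>X z\<bar> powr p) \<partial>M)"
proof -
  have [measurable]: "\<rho> \<in> borel_measurable M" using \<rho> by auto
  define a where "a = (\<integral>z. \<rho> z * X z \<partial>M)"
  have dom: "norm (\<rho> z * X z) \<le> norm (B * \<rho> z)" for z
  proof -
    have "\<rho> z * \<bar>X z\<bar> \<le> \<rho> z * \<bar>B\<bar>" using \<rho>(2)[of z] B[of z] by (intro mult_left_mono) auto
    then show ?thesis using \<rho>(2)[of z] by (simp add: abs_mult mult.commute)
  qed
  have 1: "integrable M (\<lambda>z. \<rho> z * X z)"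
    by (rule Bochner_Integration.integrable_bound[of M "\<lambda>z. B * \<rho> z"])
       (use \<rho> dom in auto)
  have 2: "integrable M (\<lambda>z. \<rho> z * \<bar>X z\<bar> powr p)"
  proof (rule Bochner_Integration.integrable_bound[of M "\<lambda>z. \<bar>B\<bar> powr p * \<rho> z"])
    have "\<bar>X z\<bar> powr p \<le> \<bar>B\<bar> powr p" for z using B[of z] p by (intro powr_mono2) auto
    then have "\<rho> z * \<bar>X z\<bar> powr p \<le> \<rho> z * \<bar>B\<bar> powr p" for z using \<rho>(2)[of z] by (intro mult_left_mono) auto
    then show "AE z in M. norm (\<rho> z * \<bar>X z\<bar> powr p) \<le> norm (\<bar>B\<bar> powr p * \<rho> z)"
      using \<rho>(2) by (auto simp: abs_mult mult.commute)
  qed (use \<rho> in auto)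
  have tan: "p * phi p a * (x - a) \<le> \<bar>x\<bar> powr p - \<bar>a\<bar> powr p" for x
    by (rule convex_on_imp_above_tangent[OF convex_abs_powr[OF p]])
       (auto intro: abs_powr_has_derivative[OF p])
  have "\<bar>a\<bar> powr p = (\<integral>z. \<rho> z * \<bar>a\<bar> powr p + p * phi p a * (\<rho> z * X z - a * \<rho> z) \<partial>M)"
    using 1 \<rho> by (simp add: a_def[symmetric])
  also have "\<dots> \<le> (\<integral>z. \<rho> z * \<bar>X z\<bar> powr p \<partial>M)"
  proof (rule integral_mono)
    fix z
    have "\<rho> z * (\<bar>a\<bar> powr p + p * phi p a * (X z - a)) \<le> \<rho> z * \<bar>X z\<bar> powr p"
      using tan[of "X z"] \<rho>(2)[of z] by (intro mult_left_mono) auto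
    then show "\<rho> z * \<bar>a\<bar> powr p + p * phi p a * (\<rho> z * X z - a * \<rho> z) \<le> \<rho> z * \<bar>X z\<bar> powr p"
      by (simp add: algebra_simps)
  qed (use 1 2 \<rho> in auto)
  finally have "ennreal (\<bar>a\<bar> powr p) \<le> ennreal (\<integral>z. \<rho> z * \<bar>X z\<bar> powr p \<partial>M)" by (rule ennreal_leI)
  also have "\<dots> = (\<integral>\<^sup>+z. ennreal (\<rho> z * \<bar>X z\<bar> powr p) \<partial>M)"
    using 2 \<rho>(2) by (intro nn_integral_eq_integral[symmetric]) auto
  finally show ?thesis by (simp add: a_def)
qed

lemma nn_integral_lborel_translate:
  fixes f :: "'a::euclidean_space \<Rightarrow> ennreal"
  assumes [measurable]: "f \<in> borel_measurable borel"
  shows "(\<integral>\<^sup>+x. f (c + x) \<partial>lborel) = (\<integral>\<^sup>+x. f x \<partial>lborel)"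
proof -
  have "(\<integral>\<^sup>+x. f x \<partial>lborel) = (\<integral>\<^sup>+x. f x \<partial>(distr lborel borel ((+) c)))"
    by (simp add: lborel_distr_plus)
  also have "\<dots> = (\<integral>\<^sup>+x. f (c + x) \<partial>lborel)" by (subst nn_integral_distr) auto
  finally show ?thesis by simp
qed

lemma mollifier_exists:
  fixes \<epsilon> :: real
  assumes e: "0 < \<epsilon>"
  obtains \<rho> :: "'a::euclidean_space \<Rightarrow> real" and r where "bump_class r \<rho>" "\<And>x. 0 \<le> \<rho> x" "\<And>x. \<epsilon> \<le> norm x \<Longrightarrow> \<rho> x = 0"
    "\<And>x. \<rho> (- x) = \<rho> x" "integrable lborel \<rho>" "(\<integral>x. \<rho> x \<partial>lborel) = 1"
proof -
  define f where "f x = flat 0 (\<epsilon>\<^sup>2 - x \<bullet> x)" for x :: 'a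
  have f: "bump_class (\<epsilon>\<^sup>2) f" unfolding f_def[abs_def] by (rule bump_class.flat)
  have nn: "0 \<le> f x" for x by (simp add: f_def flat_def)
  have out: "f x = 0" if "\<epsilon> \<le> norm x" for x
  proof -
    have "\<epsilon>\<^sup>2 \<le> x \<bullet> x" using that e by (simp add: power2_norm_eq_inner[symmetric] power_mono)
    then show ?thesis by (simp add: f_def flat_def)
  qed
  have pos: "0 < f x" if "norm x < \<epsilon>" for x
  proof -
    have "x \<bullet> x < \<epsilon>\<^sup>2" using that by (simp add: power2_norm_eq_inner[symmetric] power_strict_mono)
    then show ?thesis by (simp add: f_def flat_def)
  qed
  have "integrable lborel (\<lambda>x. indicator (cball 0 \<epsilon>) x *\<^sub>R f x)"
    by (rule borel_integrable_compact[OF compact_cball bump_class_continuous[OF f]])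
  moreover have "(\<lambda>x. indicator (cball 0 \<epsilon>) x *\<^sub>R f x) = f"
    using out by (auto simp: indicator_def fun_eq_iff)
  ultimately have int: "integrable lborel f" by simp
  define c where "c = (\<integral>x. f x \<partial>lborel)"
  have "c \<noteq> 0"
  proof
    assume "c = 0"
    then have "AE x in lborel. f x = 0"
      using integral_nonneg_eq_0_iff_AE[OF int] nn by (simp add: c_def)
    then obtain x where "x \<in> ball 0 \<epsilon>" "f x = 0"
      by (rule AE_lborel_witness[of _ "ball 0 \<epsilon>"]) (use e in auto)
    then show False using pos[of x] by simp
  qed
  moreover have "0 \<le> c" unfolding c_def using nn by simp
  ultimately have c: "0 < c" by simp
  show thesis
  proof (rule that[of "\<epsilon>\<^sup>2" "\<lambda>x. (1 / c) * f x"])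
    show "bump_class (\<epsilon>\<^sup>2) (\<lambda>x. (1 / c) * f x)" by (rule bump_class.scale[OF f])
    show "(\<integral>x. (1 / c) * f x \<partial>lborel) = 1" using c int by (simp add: c_def[symmetric])
    show "1 / c * f (- x) = 1 / c * f x" for x by (simp add: f_def)
  qed (use c nn out int in auto)
qed

section \<open>Energies of mollified functions\<close>

context nonlocal_kernel
begin

lemma energy_sum_finite:
  assumes [measurable]: "N \<in> sets borel" "a \<in> borel_measurable borel" "b \<in> borel_measurable borel"
    and fin: "energy N a < \<infinity>" "energy N b < \<infinity>"
    and h: "\<And>x y. x \<in> N \<Longrightarrow> y \<in> N \<Longrightarrow> \<bar>h x - h y\<bar> \<le> \<bar>a x - a y\<bar> + \<bar>b x - b y\<bar>"
  shows "energy N h < \<infinity>"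
proof -
  have "energy N h \<le> (\<integral>\<^sup>+z. ennreal (2 powr p) * (indicator (N \<times> N) z * ennreal (\<bar>a (fst z) - a (snd z)\<bar> powr p)) +
     ennreal (2 powr p) * (indicator (N \<times> N) z * ennreal (\<bar>b (fst z) - b (snd z)\<bar> powr p)) \<partial>\<nu>)"
    unfolding energy_def
  proof (intro nn_integral_mono)
    fix z
    show "indicator (N \<times> N) z * ennreal (\<bar>h (fst z) - h (snd z)\<bar> powr p)
      \<le> ennreal (2 powr p) * (indicator (N \<times> N) z * ennreal (\<bar>a (fst z) - a (snd z)\<bar> powr p)) +
     ennreal (2 powr p) * (indicator (N \<times> N) z * ennreal (\<bar>b (fst z) - b (snd z)\<bar> powr p))"
    proof (cases "z \<in> N \<times> N")
      case True
      have "\<bar>h (fst z) - h (snd z)\<bar> powr p \<le> (\<bar>a (fst z) - a (snd z)\<bar> + \<bar>b (fst z) - b (snd z)\<bar>) powr p"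
        using h[of "fst z" "snd z"] True p by (intro powr_mono2) auto
      also have "\<dots> \<le> 2 powr p * (\<bar>a (fst z) - a (snd z)\<bar> powr p + \<bar>b (fst z) - b (snd z)\<bar> powr p)"
        using p by (intro powr_add_le) auto
      finally show ?thesis using True
        by (simp add: ennreal_mult[symmetric] ennreal_plus[symmetric] ennreal_leI distrib_left del: ennreal_plus)
    qed simp
  qed
  also have "\<dots> = ennreal (2 powr p) * energy N a + ennreal (2 powr p) * energy N b"
    unfolding energy_def by (simp add: nn_integral_add nn_integral_cmult borel_measurable_\<nu>)
  also have "\<dots> < \<infinity>" using fin by (simp add: ennreal_mult_less_top)
  finally show ?thesis .
qed

text \<open>Mollification mixes values across the boundary of any domain, so the energy over all of
  space is required. Pairs that leave \<open>D\<close> cost \<open>c powr p\<close> times a kernel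
  integral, expressed by \<open>far\<close> for the zero function.\<close>

lemma energy_UNIV_finite:
  assumes sep: "separated C D" and [measurable]: "w \<in> borel_measurable borel"
    and w0: "\<And>x. x \<notin> C \<Longrightarrow> w x = 0" and wb: "\<And>x. \<bar>w x\<bar> \<le> c" and en: "energy D w < \<infinity>"
  shows "energy UNIV w < \<infinity>"
proof -
  have [measurable]: "C \<in> sets borel" "D \<in> sets borel" and CD: "C \<subseteq> D" using sep by (auto simp: separated_def)
  have "tail_finite (\<lambda>x. 0)" by (simp add: tail_finite_def)
  then have int: "integrable \<nu> (\<lambda>z. indicator (D \<times> D) z * \<bar>w (fst z) - w (snd z)\<bar> powr p + c powr p * far C D 1 (\<lambda>x. 0) z)"
    by (intro Bochner_Integration.integrable_add near_integrable integrable_mult_right far_integrable sep en) auto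
  have wc: "\<bar>w x\<bar> powr p \<le> c powr p" for x using wb p by (intro powr_mono2) auto
  have "energy UNIV w \<le> (\<integral>\<^sup>+z. ennreal (indicator (D \<times> D) z * \<bar>w (fst z) - w (snd z)\<bar> powr p + c powr p * far C D 1 (\<lambda>x. 0) z) \<partial>\<nu>)"
    unfolding energy_def
  proof (intro nn_integral_mono)
    fix z :: "'a \<times> 'a"
    obtain x y where z: "z = (x, y)" by (cases z)
    have "\<bar>w x - w y\<bar> powr p \<le> indicator (D \<times> D) z * \<bar>w x - w y\<bar> powr p + c powr p * far C D 1 (\<lambda>x. 0) z"
    proof -
      have fn: "0 \<le> c powr p * far C D 1 (\<lambda>x. 0) z" using far_nonneg by simp
      consider "x \<in> D" "y \<in> D" | "x \<in> C" "y \<notin> D" | "x \<notin> D" "y \<in> C" | "x \<notin> C" "y \<notin> C" using CD by blast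
      then show ?thesis
      proof cases
        case 1 then show ?thesis using fn by (simp add: z)
      next
        case 2
        then have "w y = 0" using w0 CD by blast
        then show ?thesis using 2 wc[of x] CD by (auto simp: z far_def)
      next
        case 3
        then have "w x = 0" using w0 CD by blast
        then show ?thesis using 3 wc[of y] CD by (auto simp: z far_def)
      next
        case 4
        then have "w x = 0" "w y = 0" using w0 by auto
        then show ?thesis using fn by simp
      qed
    qed
    then show "indicator (UNIV \<times> UNIV) z * ennreal (\<bar>w (fst z) - w (snd z)\<bar> powr p)
      \<le> ennreal (indicator (D \<times> D) z * \<bar>w (fst z) - w (snd z)\<bar> powr p + c powr p * far C D 1 (\<lambda>x. 0) z)"
      by (simp add: z ennreal_leI)
  qed
  also have "\<dots> < \<infinity>" using int by (simp add: real_integrable_def less_top)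
  finally show ?thesis .
qed

text \<open>The kernel is not assumed translation invariant, but the pure power
  \<open>norm (x - y) powr - q\<close> is; passing to it and back costs \<open>\<Lambda>\<close>
  twice. In between, Jensen's inequality and Fubini's theorem reduce the average to translates of
  \<open>w\<close>, which all have the same energy.\<close>

lemma energy_mollify:
  fixes w \<rho> :: "'a \<Rightarrow> real"
  assumes w [measurable]: "w \<in> borel_measurable borel" and wb: "\<And>x. \<bar>w x\<bar> \<le> c"
    and \<rho>: "integrable lborel \<rho>" "\<And>z. 0 \<le> \<rho> z" "(\<integral>z. \<rho> z \<partial>lborel) = 1"
  shows "energy UNIV (\<lambda>x. \<integral>z. \<rho> z * w (x + z) \<partial>lborel) \<le> ennreal (\<Lambda> * \<Lambda>) * energy UNIV w"
proof -
  define q where "q = real DIM('a) + s * p"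
  have [measurable]: "\<rho> \<in> borel_measurable borel" using \<rho>(1) by auto
  define E where "E z = ennreal (norm (fst z - snd z) powr - q)" for z :: "'a \<times> 'a"
  have [measurable]: "E \<in> borel_measurable borel" unfolding E_def by measurable
  define I where "I = (\<integral>\<^sup>+z. E z * ennreal (\<bar>w (fst z) - w (snd z)\<bar> powr p) \<partial>lborel)"
  have [measurable]: "(\<lambda>x. \<integral>z. \<rho> z * w (x + z) \<partial>lborel) \<in> borel_measurable borel"
  proof -
    have "(\<lambda>x. \<integral>z. \<rho> z * w (x + z) \<partial>lborel) \<in> borel_measurable lborel"
      by (rule lborel.borel_measurable_lebesgue_integral) (simp add: split_beta' lborel_prod)
    then show ?thesis by simp
  qed
  have pt: "ennreal (\<bar>(\<integral>z. \<rho> z * w (x + z) \<partial>lborel) - (\<integral>z. \<rho> z * w (y + z) \<partial>lborel)\<bar> powr p)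
     \<le> (\<integral>\<^sup>+z. ennreal (\<rho> z * \<bar>w (x + z) - w (y + z)\<bar> powr p) \<partial>lborel)" for x y
  proof -
    have int: "integrable lborel (\<lambda>z. \<rho> z * w (x + z))" for x
    proof (rule Bochner_Integration.integrable_bound[of lborel "\<lambda>z. c * \<rho> z"])
      have "\<rho> z * \<bar>w (x + z)\<bar> \<le> \<rho> z * \<bar>c\<bar>" for z
        using \<rho>(2)[of z] wb[of "x + z"] by (intro mult_left_mono) auto
      then show "AE z in lborel. norm (\<rho> z * w (x + z)) \<le> norm (c * \<rho> z)"
        using \<rho>(2) by (auto simp: abs_mult mult.commute)
    qed (use \<rho> in auto)
    have "(\<integral>z. \<rho> z * w (x + z) \<partial>lborel) - (\<integral>z. \<rho> z * w (y + z) \<partial>lborel) = (\<integral>z. \<rho> z * (w (x + z) - w (y + z)) \<partial>lborel)"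
      using int[of x] int[of y] by (simp add: right_diff_distrib)
    moreover have "\<bar>w (x + z) - w (y + z)\<bar> \<le> 2 * c" for z using wb[of "x + z"] wb[of "y + z"] by linarith
    ultimately show ?thesis using powr_jensen[OF p \<rho>, of "\<lambda>z. w (x + z) - w (y + z)" "2 * c"] by simp
  qed
  have "energy UNIV (\<lambda>x. \<integral>z. \<rho> z * w (x + z) \<partial>lborel)
     = (\<integral>\<^sup>+u. ennreal (k u) * ennreal (\<bar>(\<integral>z. \<rho> z * w (fst u + z) \<partial>lborel) - (\<integral>z. \<rho> z * w (snd u + z) \<partial>lborel)\<bar> powr p) \<partial>lborel)"
    unfolding energy_def \<nu>_def by (subst nn_integral_density) auto
  also have "\<dots> \<le> (\<integral>\<^sup>+u. ennreal \<Lambda> * (\<integral>\<^sup>+z. E u * ennreal (\<rho> z * \<bar>w (fst u + z) - w (snd u + z)\<bar> powr p) \<partial>lborel) \<partial>lborel)"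
  proof (intro nn_integral_mono)
    fix u :: "'a \<times> 'a"
    have "ennreal (k u) \<le> ennreal \<Lambda> * E u"
      using k_upper[of "fst u" "snd u"] \<Lambda> by (simp add: E_def q_def ennreal_mult[symmetric] ennreal_leI)
    then have "ennreal (k u) * ennreal (\<bar>(\<integral>z. \<rho> z * w (fst u + z) \<partial>lborel) - (\<integral>z. \<rho> z * w (snd u + z) \<partial>lborel)\<bar> powr p)
      \<le> (ennreal \<Lambda> * E u) * (\<integral>\<^sup>+z. ennreal (\<rho> z * \<bar>w (fst u + z) - w (snd u + z)\<bar> powr p) \<partial>lborel)"
      by (intro mult_mono pt) auto
    also have "\<dots> = ennreal \<Lambda> * (\<integral>\<^sup>+z. E u * ennreal (\<rho> z * \<bar>w (fst u + z) - w (snd u + z)\<bar> powr p) \<partial>lborel)"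
      by (subst nn_integral_cmult) (auto simp: mult.assoc)
    finally show "ennreal (k u) * ennreal (\<bar>(\<integral>z. \<rho> z * w (fst u + z) \<partial>lborel) - (\<integral>z. \<rho> z * w (snd u + z) \<partial>lborel)\<bar> powr p)
      \<le> ennreal \<Lambda> * (\<integral>\<^sup>+z. E u * ennreal (\<rho> z * \<bar>w (fst u + z) - w (snd u + z)\<bar> powr p) \<partial>lborel)" .
  qed
  also have "\<dots> = ennreal \<Lambda> * (\<integral>\<^sup>+u. \<integral>\<^sup>+z. E u * ennreal (\<rho> z * \<bar>w (fst u + z) - w (snd u + z)\<bar> powr p) \<partial>lborel \<partial>lborel)"
    by (rule nn_integral_cmult) (auto intro!: lborel.borel_measurable_nn_integral simp: split_beta' lborel_prod)
  also have "(\<integral>\<^sup>+u. \<integral>\<^sup>+z. E u * ennreal (\<rho> z * \<bar>w (fst u + z) - w (snd u + z)\<bar> powr p) \<partial>lborel \<partial>lborel)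
     = (\<integral>\<^sup>+z. \<integral>\<^sup>+u. E u * ennreal (\<rho> z * \<bar>w (fst u + z) - w (snd u + z)\<bar> powr p) \<partial>lborel \<partial>lborel)"
    by (rule lborel_pair.Fubini') (simp add: split_beta' lborel_prod)
  also have "\<dots> = (\<integral>\<^sup>+z. ennreal (\<rho> z) * I \<partial>lborel)"
  proof (intro nn_integral_cong)
    \<comment> \<open>Moving both points of the pair by \<open>z\<close> is a translation of the
      product space, and it leaves \<open>E\<close> unchanged.\<close>
    fix z
    have "(\<integral>\<^sup>+u. E u * ennreal (\<rho> z * \<bar>w (fst u + z) - w (snd u + z)\<bar> powr p) \<partial>lborel)
       = (\<integral>\<^sup>+u. ennreal (\<rho> z) * (E ((z, z) + u) * ennreal (\<bar>w (fst ((z, z) + u)) - w (snd ((z, z) + u))\<bar> powr p)) \<partial>lborel)"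
      using \<rho>(2) by (intro nn_integral_cong) (simp add: E_def ennreal_mult ac_simps)
    also have "\<dots> = (\<integral>\<^sup>+u. ennreal (\<rho> z) * (E u * ennreal (\<bar>w (fst u) - w (snd u)\<bar> powr p)) \<partial>lborel)"
      by (rule nn_integral_lborel_translate[of "\<lambda>u. ennreal (\<rho> z) * (E u * ennreal (\<bar>w (fst u) - w (snd u)\<bar> powr p))"]) measurable
    also have "\<dots> = ennreal (\<rho> z) * I" unfolding I_def by (rule nn_integral_cmult) measurable
    finally show "(\<integral>\<^sup>+u. E u * ennreal (\<rho> z * \<bar>w (fst u + z) - w (snd u + z)\<bar> powr p) \<partial>lborel) = ennreal (\<rho> z) * I" .
  qed
  also have "\<dots> = I"
    using nn_integral_eq_integral[OF \<rho>(1)] \<rho>(2,3) by (subst nn_integral_multc) auto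
  also have "ennreal \<Lambda> * I \<le> ennreal \<Lambda> * (ennreal \<Lambda> * energy UNIV w)"
  proof (rule mult_left_mono)
    have "I \<le> (\<integral>\<^sup>+u. ennreal \<Lambda> * (ennreal (k u) * ennreal (\<bar>w (fst u) - w (snd u)\<bar> powr p)) \<partial>lborel)"
      unfolding I_def
    proof (intro nn_integral_mono)
      fix u :: "'a \<times> 'a"
      have "norm (fst u - snd u) powr - q \<le> \<Lambda> * k u"
        using k_lower[of "fst u" "snd u"] \<Lambda> by (simp add: q_def divide_le_eq mult.commute)
      then have "E u \<le> ennreal \<Lambda> * ennreal (k u)"
        using \<Lambda> k_nonneg by (simp add: E_def ennreal_mult[symmetric] ennreal_leI)
      then show "E u * ennreal (\<bar>w (fst u) - w (snd u)\<bar> powr p) \<le> ennreal \<Lambda> * (ennreal (k u) * ennreal (\<bar>w (fst u) - w (snd u)\<bar> powr p))"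
        unfolding mult.assoc[symmetric] by (rule mult_right_mono) simp
    qed
    also have "\<dots> = ennreal \<Lambda> * energy UNIV w"
      unfolding energy_def \<nu>_def by (subst nn_integral_cmult, measurable, subst nn_integral_density, auto)
    finally show "I \<le> ennreal \<Lambda> * energy UNIV w" .
  qed simp
  finally show ?thesis using \<Lambda> by (simp add: ennreal_mult mult.assoc)
qed

end

section \<open>Comparison principle\<close>

lemma compactly_contained_bounded: "D \<Subset> S \<Longrightarrow> bounded D"
  unfolding compactly_contained_def by (meson bounded_subset closure_subset compact_imp_bounded)

lemma compactly_contained_subset: "D \<Subset> S \<Longrightarrow> D \<subseteq> S"
  using closure_subset[of D] by (auto simp: compactly_contained_def)

lemma compactly_contained_mono: "D \<Subset> S \<Longrightarrow> S \<subseteq> T \<Longrightarrow> D \<Subset> T"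
  by (auto simp: compactly_contained_def)

lemma compactly_containedI:
  assumes "D \<subseteq> C" "compact C" "C \<subseteq> S" shows "D \<Subset> S"
proof -
  have "closure D \<subseteq> C" using assms by (intro closure_minimal compact_imp_closed)
  moreover from this have "compact (closure D)" using assms(2) by (meson closed_closure compact_imp_bounded bounded_subset compact_eq_bounded_closed)
  ultimately show ?thesis using assms(3) by (auto simp: compactly_contained_def)
qed

lemma test_functions_mono: "S \<subseteq> T \<Longrightarrow> test_functions S \<subseteq> test_functions T"
  unfolding test_functions_def using compactly_contained_mono by blast

lemma continuous_bounded_compactly_contained:
  fixes f :: "'a::euclidean_space \<Rightarrow> real"
  assumes "continuous_on S f" "D \<Subset> S"
  shows "\<exists>b. \<forall>x\<in>D. \<bar>f x\<bar> \<le> b"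
proof -
  have "compact (f ` closure D)"
    using assms by (auto simp: compactly_contained_def intro: compact_continuous_image continuous_on_subset)
  then have "bounded (f ` D)"
    using closure_subset[of D] by (meson bounded_subset compact_imp_bounded image_mono)
  then show ?thesis by (auto simp: bounded_iff)
qed

text \<open>By translation and evenness of \<open>\<rho>\<close> the average of \<open>w\<close>
  around \<open>x\<close> is the integral of \<open>w t * \<rho> (x - t)\<close>, which moves
  \<open>x\<close> into the smooth factor. The box only has to contain \<open>C\<close>.\<close>

lemma mollify_test_function:
  fixes w :: "'a::euclidean_space \<Rightarrow> real"
  assumes w: "continuous_on UNIV w" and C: "compact C" "\<And>x. x \<notin> C \<Longrightarrow> w x = 0"
    and \<rho>: "bump_class r \<rho>" "\<And>x. 0 \<le> \<rho> x" "\<And>x. e \<le> norm x \<Longrightarrow> \<rho> x = 0" "\<And>x. \<rho> (- x) = \<rho> x"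
    and S: "(\<Union>x\<in>C. cball x e) \<subseteq> S"
  shows "(\<lambda>x. \<integral>z. \<rho> z * w (x + z) \<partial>lborel) \<in> test_functions S"
    "\<And>x. x \<notin> (\<Union>x\<in>C. cball x e) \<Longrightarrow> (\<integral>z. \<rho> z * w (x + z) \<partial>lborel) = 0"
proof -
  obtain a c where ac: "C \<subseteq> cbox a c" using compact_imp_bounded[OF C(1)] bounded_subset_cbox_symmetric by blast
  have \<rho>c: "continuous_on UNIV \<rho>" by (rule bump_class_continuous[OF \<rho>(1)])
  have [measurable]: "\<rho> \<in> borel_measurable borel" "w \<in> borel_measurable borel"
    using \<rho>c w by (auto intro: borel_measurable_continuous_onI)
  have eq: "(\<integral>z. \<rho> z * w (x + z) \<partial>lborel) = integral (cbox a c) (\<lambda>t. w t * \<rho> (x - t))" for x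
  proof -
    have "(\<integral>t. w t * \<rho> (x - t) \<partial>lborel) = (\<integral>t. w t * \<rho> (x - t) \<partial>(distr lborel borel ((+) x)))"
      by (simp add: lborel_distr_plus)
    also have "\<dots> = (\<integral>z. w (x + z) * \<rho> (x - (x + z)) \<partial>lborel)" by (rule integral_distr) measurable
    also have "\<dots> = (\<integral>z. \<rho> z * w (x + z) \<partial>lborel)" by (simp add: \<rho>(4) mult.commute)
    finally have "(\<integral>z. \<rho> z * w (x + z) \<partial>lborel) = (\<integral>t. w t * \<rho> (x - t) \<partial>lborel)" by simp
    also have "\<dots> = (LINT t:cbox a c|lborel. w t * \<rho> (x - t))"
      unfolding set_lebesgue_integral_def using C(2) ac
      by (intro Bochner_Integration.integral_cong) (auto simp: indicator_def)
    also have "\<dots> = integral (cbox a c) (\<lambda>t. w t * \<rho> (x - t))"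
    proof (rule set_borel_integral_eq_integral(2))
      have "continuous_on (cbox a c) (\<lambda>t. w t * \<rho> (x - t))"
        by (intro continuous_on_mult continuous_on_subset[OF w] continuous_on_compose2[OF \<rho>c] continuous_intros) auto
      then show "set_integrable lborel (cbox a c) (\<lambda>t. w t * \<rho> (x - t))"
        unfolding set_integrable_def by (intro borel_integrable_compact compact_cbox)
    qed
    finally show ?thesis .
  qed
  show zero: "(\<integral>z. \<rho> z * w (x + z) \<partial>lborel) = 0" if "x \<notin> (\<Union>x\<in>C. cball x e)" for x
  proof -
    have nz: "\<rho> z * w (x + z) = 0" for z
    proof (cases "e \<le> norm z")
      case False
      then have "x + z \<notin> C" using that by (auto simp: dist_norm)
      then show ?thesis using C(2) by simp
    qed (simp add: \<rho>(3))
    show ?thesis by (simp only: nz) simp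
  qed
  have "{x. (\<integral>z. \<rho> z * w (x + z) \<partial>lborel) \<noteq> 0} \<Subset> S"
    by (rule compactly_containedI[OF _ compact_union_cball[OF C(1)] S]) (use zero in blast)
  then show "(\<lambda>x. \<integral>z. \<rho> z * w (x + z) \<partial>lborel) \<in> test_functions S"
    unfolding test_functions_def eq using convolution_C_k[OF w \<rho>(1)] by auto
qed

context nonlocal_kernel
begin

text \<open>Comparison tests with truncated differences of solutions, which are merely continuous
  with finite local energy. Their mollifications are test functions, converge pointwise and have
  energies bounded by \<open>energy_mollify\<close>, so \<open>limit_integral_nonneg\<close> carries
  the sign to the limit.\<close>

lemma form_nonneg_extend:
  assumes f [measurable]: "f \<in> borel_measurable borel" and tail: "tail_finite f" and S: "open S"
    and fb: "\<And>D. open D \<Longrightarrow> D \<Subset> S \<Longrightarrow> \<exists>b. \<forall>x\<in>D. \<bar>f x\<bar> \<le> b"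
    and en: "\<And>D. open D \<Longrightarrow> D \<Subset> S \<Longrightarrow> energy D f < \<infinity>"
    and sup: "\<And>\<eta>. \<eta> \<in> test_functions S \<Longrightarrow> (\<And>x. 0 \<le> \<eta> x) \<Longrightarrow> 0 \<le> (\<integral>z. form f \<eta> z \<partial>\<nu>)"
    and w: "continuous_on UNIV w" "\<And>x. 0 \<le> w x" and C: "compact C" "C \<subseteq> S" "\<And>x. x \<notin> C \<Longrightarrow> w x = 0"
    and enw: "\<And>D. open D \<Longrightarrow> D \<Subset> S \<Longrightarrow> energy D w < \<infinity>"
  shows "integrable \<nu> (form f w) \<and> 0 \<le> (\<integral>z. form f w z \<partial>\<nu>)"
proof -
  have wm [measurable]: "w \<in> borel_measurable borel" using w(1) by (rule borel_measurable_continuous_onI)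
  obtain D where D: "open D" "C \<subseteq> D" "D \<Subset> S" using open_between[OF C(1) S C(2)] by blast
  have bd: "bounded D" by (rule compactly_contained_bounded[OF D(3)])
  obtain b where b: "\<And>x. x \<in> D \<Longrightarrow> \<bar>f x\<bar> \<le> b" using fb[OF D(1,3)] by blast
  obtain e where e: "0 < e" "(\<Union>x\<in>C. cball x e) \<subseteq> D"
    using compact_subset_open_imp_cball_epsilon_subset[OF C(1) D(1,2)] by blast
  \<comment> \<open>Contains the supports of all mollifications at the radii
    \<open>e / real (Suc i)\<close>, so one far majorant serves for all of them.\<close>
  define C1 where "C1 = (\<Union>x\<in>C. cball x e)"
  have C1: "compact C1" "C1 \<subseteq> D" "C1 \<subseteq> S"
    using e compactly_contained_subset[OF D(3)] compact_union_cball[OF C(1)] by (auto simp: C1_def)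
  have sep1: "separated C1 D" and sep: "separated C D"
    using D bd C C1 by (auto intro!: separatedI simp: compact_imp_closed closure_closed borel_compact)
  obtain c where c: "0 \<le> c" "\<And>x. \<bar>w x\<bar> \<le> c" using compact_support_bounded[OF w(1) C(1,3)] by blast
  have "\<exists>(\<rho> :: 'a \<Rightarrow> real) r. bump_class r \<rho> \<and> (\<forall>x. 0 \<le> \<rho> x) \<and> (\<forall>x. e / real (Suc i) \<le> norm x \<longrightarrow> \<rho> x = 0) \<and> (\<forall>x. \<rho> (- x) = \<rho> x) \<and>
      integrable lborel \<rho> \<and> (\<integral>x. \<rho> x \<partial>lborel) = 1" for i
  proof -
    have "0 < e / real (Suc i)" using e by simp
    then obtain \<rho> :: "'a \<Rightarrow> real" and r where "bump_class r \<rho>" "\<And>x. 0 \<le> \<rho> x" "\<And>x. e / real (Suc i) \<le> norm x \<Longrightarrow> \<rho> x = 0"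
      "\<And>x. \<rho> (- x) = \<rho> x" "integrable lborel \<rho>" "(\<integral>x. \<rho> x \<partial>lborel) = 1"
      by (rule mollifier_exists) (rule that; assumption)
    then show ?thesis by (intro exI[of _ \<rho>] exI[of _ r]) simp
  qed
  then obtain \<rho> :: "nat \<Rightarrow> 'a \<Rightarrow> real" and r where \<rho>: "\<And>i. bump_class (r i) (\<rho> i)" "\<And>i x. 0 \<le> \<rho> i x"
    "\<And>i x. e / real (Suc i) \<le> norm x \<Longrightarrow> \<rho> i x = 0" "\<And>i x. \<rho> i (- x) = \<rho> i x"
    "\<And>i. integrable lborel (\<rho> i)" "\<And>i. (\<integral>x. \<rho> i x \<partial>lborel) = 1" by metis
  have [measurable]: "\<rho> i \<in> borel_measurable borel" for i using \<rho>(5)[of i] by auto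
  define W where "W i x = (\<integral>z. \<rho> i z * w (x + z) \<partial>lborel)" for i x
  have ei: "e / real (Suc i) \<le> e" for i using e by (simp add: divide_le_eq)
  have supp: "(\<Union>x\<in>C. cball x (e / real (Suc i))) \<subseteq> C1" for i
    unfolding C1_def using ei[of i] by (intro UN_mono subset_refl) (auto intro: order_trans)
  have Wtest: "W i \<in> test_functions S" and W0: "x \<notin> C1 \<Longrightarrow> W i x = 0" for i x
    using mollify_test_function[OF w(1) C(1,3) \<rho>(1)[of i] \<rho>(2) \<rho>(3)[of i] \<rho>(4), where S = S] supp[of i] C1(3)
    unfolding W_def by blast+
  have [measurable]: "W i \<in> borel_measurable borel" for i using test_function_facts[OF Wtest[of i]] by blast
  have int: "integrable lborel (\<lambda>z. \<rho> i z * h z)" if [measurable]: "h \<in> borel_measurable borel" and h: "\<And>z. \<bar>h z\<bar> \<le> B" for i h B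
  proof (rule Bochner_Integration.integrable_bound[of lborel "\<lambda>z. B * \<rho> i z"])
    have "\<rho> i z * \<bar>h z\<bar> \<le> \<rho> i z * \<bar>B\<bar>" for z
      using \<rho>(2)[of i z] h[of z] by (intro mult_left_mono) auto
    then show "AE z in lborel. norm (\<rho> i z * h z) \<le> norm (B * \<rho> i z)"
      using \<rho>(2) by (auto simp: abs_mult mult.commute)
  qed (use \<rho> in auto)
  have bound: "\<bar>\<integral>z. \<rho> i z * h z \<partial>lborel\<bar> \<le> B" if [measurable]: "h \<in> borel_measurable borel"
    and h: "\<And>z. \<bar>h z\<bar> \<le> B'" "\<And>z. norm z < e / real (Suc i) \<Longrightarrow> \<bar>h z\<bar> \<le> B" for i h B B'
  proof -
    have "\<bar>\<integral>z. \<rho> i z * h z \<partial>lborel\<bar> \<le> (\<integral>z. \<bar>\<rho> i z * h z\<bar> \<partial>lborel)" by (rule integral_abs_bound)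
    also have "\<dots> \<le> (\<integral>z. \<rho> i z * B \<partial>lborel)"
    proof (rule integral_mono)
      show "\<bar>\<rho> i z * h z\<bar> \<le> \<rho> i z * B" for z
      proof (cases "e / real (Suc i) \<le> norm z")
        case False
        then show ?thesis using h(2)[of z] \<rho>(2)[of i z] by (simp add: abs_mult mult_left_mono)
      qed (simp add: \<rho>(3))
    qed (use int[OF _ h(1)] \<rho>(5) in auto)
    also have "\<dots> = B" using \<rho>(6) by simp
    finally show ?thesis .
  qed
  have Wc: "\<bar>W i x\<bar> \<le> c" for i x
    unfolding W_def by (rule bound[where B' = c]) (use c in auto)
  have Wnn: "0 \<le> W i x" for i x
    unfolding W_def using \<rho>(2) w(2) by (intro Bochner_Integration.integral_nonneg) simp
  have Wlim: "(\<lambda>i. W i x) \<longlonglongrightarrow> w x" for x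
  proof (rule LIMSEQ_I)
    fix d :: real assume d: "0 < d"
    obtain r where r: "0 < r" "\<And>y. dist y x < r \<Longrightarrow> dist (w y) (w x) < d / 2"
      using w(1) d unfolding continuous_on_iff by (metis UNIV_I half_gt_zero)
    obtain i0 where i0: "e / r < real i0" using reals_Archimedean2 by blast
    show "\<exists>no. \<forall>n\<ge>no. norm (W n x - w x) < d"
    proof (intro exI[of _ i0] allI impI)
      fix n assume n: "i0 \<le> n"
      have "e / r < real (Suc n)" using i0 n by linarith
      then have small: "e / real (Suc n) < r" using r(1) e by (simp add: field_simps)
      have i1: "integrable lborel (\<lambda>z. \<rho> n z * w (x + z))" by (rule int[where B = c]) (use c in auto)
      have "W n x - w x = (\<integral>z. \<rho> n z * w (x + z) \<partial>lborel) - (\<integral>z. \<rho> n z * w x \<partial>lborel)"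
        using \<rho>(6) by (simp add: W_def)
      also have "\<dots> = (\<integral>z. \<rho> n z * (w (x + z) - w x) \<partial>lborel)"
        using i1 \<rho>(5) by (subst Bochner_Integration.integral_diff[symmetric]) (auto simp: right_diff_distrib)
      also have "\<bar>\<dots>\<bar> \<le> d / 2"
      proof (rule bound[where B' = "2 * c"])
        show "\<bar>w (x + z) - w x\<bar> \<le> 2 * c" for z using c(2)[of "x + z"] c(2)[of x] by linarith
        fix z :: 'a assume "norm z < e / real (Suc n)"
        then show "\<bar>w (x + z) - w x\<bar> \<le> d / 2"
          using r(2)[of "x + z"] small by (simp add: dist_norm)
      qed measurable
      finally show "norm (W n x - w x) < d" using d by simp
    qed
  qed
  have enU: "energy UNIV w < \<infinity>" by (rule energy_UNIV_finite[OF sep wm C(3) c(2) enw[OF D(1,3)]])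
  define m where "m = enn2real (ennreal (\<Lambda> * \<Lambda>) * energy UNIV w)"
  have m: "ennreal (\<Lambda> * \<Lambda>) * energy UNIV w = ennreal m"
    unfolding m_def using enU by (intro ennreal_enn2real[symmetric]) (simp add: ennreal_mult_less_top)
  have enW: "energy D (W i) \<le> ennreal m" for i
  proof -
    have "energy D (W i) \<le> energy UNIV (W i)"
      unfolding energy_def by (intro nn_integral_mono) (auto simp: indicator_def)
    also have "\<dots> \<le> ennreal m"
      using energy_mollify[OF wm c(2) \<rho>(5)[of i] \<rho>(2) \<rho>(6)[of i]] by (simp add: W_def[abs_def] m)
    finally show ?thesis .
  qed
  have m0: "0 \<le> m" by (simp add: m_def)
  have [measurable]: "D \<in> sets borel" using D(1) by auto
  define B where "B i z = indicator (D \<times> D) z * \<bar>W i (fst z) - W i (snd z)\<bar> powr p" for i z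
  have Bint: "integrable \<nu> (B i)" for i
    unfolding B_def using enW[of i] by (intro near_integrable) (auto intro: le_less_trans)
  have Bm: "(\<integral>z. B i z \<partial>\<nu>) \<le> m" for i
  proof -
    have "ennreal (\<integral>z. B i z \<partial>\<nu>) = (\<integral>\<^sup>+z. ennreal (B i z) \<partial>\<nu>)"
      by (intro nn_integral_eq_integral[symmetric] Bint) (simp add: B_def)
    also have "\<dots> = energy D (W i)"
      unfolding energy_def B_def by (intro nn_integral_cong) (auto simp: indicator_def)
    also have "\<dots> \<le> ennreal m" by (rule enW)
    finally show ?thesis using m0 by simp
  qed
  define G where "G \<epsilon> z = \<epsilon> powr (1 / (1 - p)) * (indicator (D \<times> D) z * \<bar>f (fst z) - f (snd z)\<bar> powr p)
      + 2 powr (p - 1) * c * far C1 D b f z" for \<epsilon> z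
  have intw: "integrable \<nu> (form f w)"
    by (rule form_integrable[OF sep f wm tail C(3) c(2) b en[OF D(1,3)] enw[OF D(1,3)]])
  have "0 \<le> (\<integral>z. form f w z \<partial>\<nu>)"
  proof (rule limit_integral_nonneg[where F = "\<lambda>i. form f (W i)" and B = B and W = m and G = G])
    show "integrable \<nu> (form f (W i))" for i by (rule test_form_integrable[OF f tail S fb en Wtest])
    show "0 \<le> (\<integral>z. form f (W i) z \<partial>\<nu>)" for i by (rule sup[OF Wtest Wnn])
    show "integrable \<nu> (form f w)" by (rule intw)
    show "AE z in \<nu>. (\<lambda>i. form f (W i) z) \<longlonglongrightarrow> form f w z"
      unfolding form_def by (intro AE_I2 tendsto_intros Wlim)
    show "integrable \<nu> (G \<epsilon>)" for \<epsilon>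
      unfolding G_def by (intro Bochner_Integration.integrable_add integrable_mult_right near_integrable
          far_integrable sep1 f tail en[OF D(1,3)]) auto
    fix \<epsilon> :: real and i assume \<epsilon>: "0 < \<epsilon>"
    \<comment> \<open>\<open>young_powr\<close> with \<open>\<delta>\<close> puts the small weight
      \<open>\<delta> powr (1 - p) = \<epsilon>\<close> on the varying energy of \<open>W i\<close>
      and the large weight \<open>\<delta>\<close> on the fixed energy of \<open>f\<close>.\<close>
    define \<delta> where "\<delta> = \<epsilon> powr (1 / (1 - p))"
    have \<delta>: "0 < \<delta>" "\<delta> powr (1 - p) = \<epsilon>" using \<epsilon> p by (auto simp: \<delta>_def powr_powr)
    show "AE z in \<nu>. form f (W i) z \<le> G \<epsilon> z + \<epsilon> * B i z"
    proof (intro AE_I2)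
      fix z
      have "\<bar>form f (W i) z\<bar> \<le> indicator (D \<times> D) z * (\<bar>f (fst z) - f (snd z)\<bar> powr (p - 1) * \<bar>W i (fst z) - W i (snd z)\<bar>)
        + 2 powr (p - 1) * c * far C1 D b f z"
        by (rule form_le_far[OF C1(2) W0 Wc b])
      moreover have "\<bar>f (fst z) - f (snd z)\<bar> powr (p - 1) * \<bar>W i (fst z) - W i (snd z)\<bar>
         \<le> \<delta> * \<bar>f (fst z) - f (snd z)\<bar> powr p + \<epsilon> * \<bar>W i (fst z) - W i (snd z)\<bar> powr p"
        using young_powr[of "\<bar>f (fst z) - f (snd z)\<bar>" "\<bar>W i (fst z) - W i (snd z)\<bar>" \<delta> p] \<delta> p by simp
      then have "indicator (D \<times> D) z * (\<bar>f (fst z) - f (snd z)\<bar> powr (p - 1) * \<bar>W i (fst z) - W i (snd z)\<bar>)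
         \<le> indicator (D \<times> D) z * (\<delta> * \<bar>f (fst z) - f (snd z)\<bar> powr p + \<epsilon> * \<bar>W i (fst z) - W i (snd z)\<bar> powr p)"
        by (intro mult_left_mono) auto
      moreover have "\<dots> = \<delta> * (indicator (D \<times> D) z * \<bar>f (fst z) - f (snd z)\<bar> powr p) + \<epsilon> * B i z"
        by (simp add: B_def algebra_simps)
      ultimately show "form f (W i) z \<le> G \<epsilon> z + \<epsilon> * B i z"
        unfolding G_def \<delta>_def[symmetric] by linarith
    qed
  qed (use Bint Bm in \<open>auto simp: B_def\<close>)
  then show ?thesis using intw by simp
qed

text \<open>Testing both inequalities with \<open>w\<close> and subtracting gives an integrand
  \<open>T\<close> that is nonnegative by monotonicity and has integral at most 0, so it vanishes
  almost everywhere. But it is positive at pairs of a point with \<open>w > 0\<close> and a point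
  outside the closure of \<open>D\<close>: the contradiction comes from the interaction with the
  exterior.\<close>

lemma comparison_principle:
  assumes f [measurable]: "f \<in> borel_measurable borel" and g [measurable]: "g \<in> borel_measurable borel"
    and tail: "tail_finite f" "tail_finite g" and D: "open D" "bounded D"
    and cont: "continuous_on D f" "continuous_on D g"
    and enf: "\<And>D'. open D' \<Longrightarrow> D' \<Subset> D \<Longrightarrow> energy D' f < \<infinity>"
    and eng: "\<And>D'. open D' \<Longrightarrow> D' \<Subset> D \<Longrightarrow> energy D' g < \<infinity>"
    and sup: "\<And>\<eta>. \<eta> \<in> test_functions D \<Longrightarrow> (\<And>x. 0 \<le> \<eta> x) \<Longrightarrow> 0 \<le> (\<integral>z. form f \<eta> z \<partial>\<nu>)"
    and sub: "\<And>\<eta>. \<eta> \<in> test_functions D \<Longrightarrow> (\<And>x. 0 \<le> \<eta> x) \<Longrightarrow> (\<integral>z. form g \<eta> z \<partial>\<nu>) \<le> 0"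
    and \<epsilon>: "0 < \<epsilon>" and C: "compact C" "C \<subseteq> D" "\<And>x. x \<in> D - C \<Longrightarrow> g x \<le> f x + \<epsilon>"
    and out: "AE x in lborel. x \<notin> D \<longrightarrow> g x \<le> f x" and x: "x \<in> D"
  shows "g x \<le> f x + \<epsilon>"
proof (rule ccontr)
  assume neg: "\<not> g x \<le> f x + \<epsilon>"
  define w where "w x = (if x \<in> D then max 0 (g x - f x - \<epsilon>) else 0)" for x
  have w0: "w x = 0" if "x \<notin> C" for x using C(3)[of x] that by (auto simp: w_def)
  have w_cont: "continuous_on UNIV w"
  proof -
    have "continuous_on D w"
      by (rule continuous_on_eq[of _ "\<lambda>x. max 0 (g x - f x - \<epsilon>)"]) (auto intro!: continuous_intros cont simp: w_def)
    moreover have "continuous_on (- C) w"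
      by (rule continuous_on_eq[of _ "\<lambda>x. 0"]) (auto simp: w0)
    ultimately have "continuous_on (D \<union> - C) w"
      using D(1) C(1) by (intro continuous_on_open_Un) (auto simp: compact_imp_closed)
    moreover have "D \<union> - C = UNIV" using C(2) by auto
    ultimately show ?thesis by simp
  qed
  have enw: "energy D' w < \<infinity>" if D': "open D'" "D' \<Subset> D" for D'
  proof (rule energy_sum_finite[OF _ g f eng[OF D'] enf[OF D']])
    have "D' \<subseteq> D" by (rule compactly_contained_subset[OF D'(2)])
    then show "\<bar>w x - w y\<bar> \<le> \<bar>g x - g y\<bar> + \<bar>f x - f y\<bar>" if "x \<in> D'" "y \<in> D'" for x y
      using that by (auto simp: w_def max_def subset_iff)
  qed (use D' in auto)
  have 1: "integrable \<nu> (form f w) \<and> 0 \<le> (\<integral>z. form f w z \<partial>\<nu>)"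
    by (rule form_nonneg_extend[OF f tail(1) D(1) _ enf sup w_cont _ C(1,2) w0 enw])
       (auto intro: continuous_bounded_compactly_contained[OF cont(1)] simp: w_def)
  have 2: "integrable \<nu> (form (\<lambda>x. - g x) w) \<and> 0 \<le> (\<integral>z. form (\<lambda>x. - g x) w z \<partial>\<nu>)"
  proof (rule form_nonneg_extend[OF _ _ D(1) _ _ _ w_cont _ C(1,2) w0 enw])
    show "tail_finite (\<lambda>x. - g x)" using tail(2) by (simp add: tail_finite_def)
    show "energy D' (\<lambda>x. - g x) < \<infinity>" if "open D'" "D' \<Subset> D" for D' using eng that by (simp add: energy_minus)
    show "\<exists>b. \<forall>x\<in>D'. \<bar>- g x\<bar> \<le> b" if "open D'" "D' \<Subset> D" for D'
      using continuous_bounded_compactly_contained[OF cont(2) that(2)] by simp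
    show "0 \<le> (\<integral>z. form (\<lambda>x. - g x) \<eta> z \<partial>\<nu>)" if "\<eta> \<in> test_functions D" "\<And>x. 0 \<le> \<eta> x" for \<eta>
      using sub[OF that] by (simp add: form_minus)
  qed (auto simp: w_def)
  define T where "T z = form g w z - form f w z" for z
  have intg: "integrable \<nu> (form g w)" "(\<integral>z. form g w z \<partial>\<nu>) \<le> 0"
    using 2 by (auto simp: form_minus)
  have T: "integrable \<nu> T" "(\<integral>z. T z \<partial>\<nu>) \<le> 0"
    unfolding T_def using 1 intg by auto
  \<comment> \<open>Outside \<open>D\<close> the ordering \<open>g \<le> f\<close> makes the
    truncation vanish by itself, so one formula covers almost all pairs and monotonicity applies
    across the boundary as well.\<close>
  have w_eq: "w y = max 0 (g y - f y - \<epsilon>)" if "y \<notin> D \<longrightarrow> g y \<le> f y" for y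
    using that \<epsilon> by (auto simp: w_def)
  have T_nn: "AE z in \<nu>. 0 \<le> T z"
    using AE_\<nu>_pair[OF out]
  proof eventually_elim
    fix z :: "'a \<times> 'a"
    assume o: "(fst z \<notin> D \<longrightarrow> g (fst z) \<le> f (fst z)) \<and> (snd z \<notin> D \<longrightarrow> g (snd z) \<le> f (snd z))"
    obtain a b where z: "z = (a, b)" by (cases z)
    have wa: "w a = max 0 (g a - f a - \<epsilon>)" and wb: "w b = max 0 (g b - f b - \<epsilon>)" using o w_eq z by auto
    have T: "T z = (phi p (g a - g b) - phi p (f a - f b)) * (w a - w b)"
      by (simp add: T_def form_def z left_diff_distrib)
    show "0 \<le> T z"
    proof (cases "w b \<le> w a")
      case True
      then have "w a = w b \<or> f a - f b \<le> g a - g b" unfolding wa wb by (auto simp: max_def split: if_splits)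
      then show ?thesis unfolding T using True phi_mono[OF p] by auto
    next
      case False
      then have "g a - g b \<le> f a - f b" unfolding wa wb by (auto simp: max_def split: if_splits)
      then have "phi p (g a - g b) - phi p (f a - f b) \<le> 0" using phi_mono[OF p] by auto
      then show ?thesis unfolding T using False by (auto intro: mult_nonpos_nonpos)
    qed
  qed
  have "0 \<le> (\<integral>z. T z \<partial>\<nu>)" using T_nn by (rule integral_nonneg_AE)
  then have "(\<integral>z. T z \<partial>\<nu>) = 0" using T(2) by simp
  then have "AE z in \<nu>. T z = 0" using integral_nonneg_eq_0_iff_AE[OF T(1) T_nn] by simp
  then have T0: "AE z in lborel. 0 < ennreal (k z) \<longrightarrow> T z = 0"
    unfolding \<nu>_def by (subst (asm) AE_density) auto
  define U where "U = {x. 0 < w x}"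
  have U: "open U" unfolding U_def using w_cont by (intro open_Collect_less) (auto intro: continuous_intros)
  have "x \<in> U" using neg x by (simp add: U_def w_def)
  \<comment> \<open>A bounded \<open>D\<close> leaves a nonempty open exterior, which supplies the
    second point of the contradictory pair.\<close>
  moreover have "- closure D \<noteq> {}" using D(2) by (metis bounded_closure Compl_empty_eq double_complement not_bounded_UNIV)
  then obtain y where "y \<in> - closure D" by blast
  ultimately have ne: "U \<times> (- closure D) \<noteq> {}" by auto
  have "AE z in lborel. (0 < ennreal (k z) \<longrightarrow> T z = 0) \<and>
      ((fst z \<notin> D \<longrightarrow> g (fst z) \<le> f (fst z)) \<and> (snd z \<notin> D \<longrightarrow> g (snd z) \<le> f (snd z)))"
    using T0 AE_lborel_fst_snd[OF out] by eventually_elim blast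
  then obtain z where z: "z \<in> U \<times> (- closure D)" "0 < ennreal (k z) \<longrightarrow> T z = 0"
      "(fst z \<notin> D \<longrightarrow> g (fst z) \<le> f (fst z)) \<and> (snd z \<notin> D \<longrightarrow> g (snd z) \<le> f (snd z))"
    by (rule AE_lborel_witness[of _ "U \<times> (- closure D)"]) (use ne open_Times[OF U open_Compl[OF closed_closure[of D]]] in auto)
  obtain a b where ab: "z = (a, b)" by (cases z)
  have a: "0 < w a" "a \<in> D" "f a + \<epsilon> < g a" using z(1) ab by (auto simp: U_def w_def split: if_splits)
  have b: "b \<notin> D" "g b \<le> f b" "w b = 0" using z(1,3) ab closure_subset[of D] by (auto simp: w_def)
  have "0 < k z" unfolding ab by (rule k_pos) (use a b in auto)
  then have "T z = 0" using z(2) by simp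
  moreover have "T z = (phi p (g a - g b) - phi p (f a - f b)) * w a"
    by (simp add: T_def form_def ab b left_diff_distrib)
  moreover have "phi p (f a - f b) < phi p (g a - g b)"
    using a b \<epsilon> by (intro phi_strict_mono p) auto
  ultimately show False using a(1) by simp
qed

lemma continuous_weak_solution_superharmonic:
  assumes KK: "AE z in lborel. K (fst z) (snd z) = k z" and S: "open S" and u: "continuous_weak_solution s p K S u"
  shows "superharmonic s p K S u"
proof -
  have um: "u \<in> borel_measurable lebesgue" and ut: "neg_part u \<in> tail_space s p" "neg_part (\<lambda>x. - u x) \<in> tail_space s p"
    and uc: "finite_continuous_on S u" and us: "weak_solution s p K S u"
    using u by (auto simp: continuous_weak_solution_def weak_solution_def weak_subsolution_def weak_supersolution_def)
  obtain f where f: "f \<in> borel_measurable borel" "AE x in lborel. u x = ereal (f x)" "\<And>x. x \<in> S \<Longrightarrow> u x = ereal (f x)"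
    "tail_finite f" "continuous_on S f"
    using real_representative[OF um ut S uc] by blast
  have fw: "(\<forall>D. open D \<longrightarrow> D \<Subset> S \<longrightarrow> energy D f < \<infinity>) \<and>
     (\<forall>\<eta>\<in>test_functions S. (\<forall>x. 0 \<le> \<eta> x) \<longrightarrow> (\<integral>z. form f \<eta> z \<partial>\<nu>) = 0)"
    using us weak_solution_iff[OF KK um f(1,2,4) S continuous_bounded_compactly_contained[OF f(5)]] by blast
  have lsc: "lower_semicontinuous_on S u"
    unfolding lower_semicontinuous_on_def
  proof
    fix x assume x: "x \<in> S"
    have "(u \<longlongrightarrow> u x) (at x within S)"
      using uc x by (auto simp: finite_continuous_on_def continuous_on_def)
    moreover have "at x within S \<noteq> bot" using at_within_open[OF x S] by simp
    ultimately show "u x \<le> Liminf (at x within S) u" by (simp add: lim_imp_Liminf)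
  qed
  have comp: "v x \<le> u x"
    if D: "open D" "D \<Subset> S" and vs: "weak_solution s p K D v" and vc: "finite_continuous_on (closure D) v"
      and fr: "\<forall>x\<in>frontier D. v x \<le> u x" and out: "AE x in lebesgue. x \<notin> D \<longrightarrow> v x \<le> u x" and x: "x \<in> D" for D v x
  proof -
    have vm: "v \<in> borel_measurable lebesgue" and vt: "neg_part v \<in> tail_space s p" "neg_part (\<lambda>x. - v x) \<in> tail_space s p"
      using vs by (auto simp: weak_solution_def weak_subsolution_def weak_supersolution_def)
    have vcD: "finite_continuous_on D v"
      using vc closure_subset[of D] unfolding finite_continuous_on_def by (meson continuous_on_subset subsetD)
    obtain h where h: "h \<in> borel_measurable borel" "AE x in lborel. v x = ereal (h x)" "\<And>x. x \<in> D \<Longrightarrow> v x = ereal (h x)"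
      "tail_finite h" "continuous_on D h"
      using real_representative[OF vm vt D(1) vcD] by blast
    have hw: "(\<forall>D'. open D' \<longrightarrow> D' \<Subset> D \<longrightarrow> energy D' h < \<infinity>) \<and>
     (\<forall>\<eta>\<in>test_functions D. (\<forall>x. 0 \<le> \<eta> x) \<longrightarrow> (\<integral>z. form h \<eta> z \<partial>\<nu>) = 0)"
      using vs weak_solution_iff[OF KK vm h(1,2,4) D(1) continuous_bounded_compactly_contained[OF h(5)]] by blast
    have DS: "D \<subseteq> S" "closure D \<subseteq> S" "compact (closure D)"
      using D(2) compactly_contained_subset by (auto simp: compactly_contained_def)
    \<comment> \<open>Formed with \<open>v\<close> and not with \<open>h\<close>: the two agree on
      \<open>D\<close>, but possibly not on the frontier, where the continuity of \<open>v\<close>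
      up to the boundary is used.\<close>
    define d where "d y = real_of_ereal (v y) - f y" for y
    have d_cont: "continuous_on (closure D) d"
      unfolding d_def using vc f(5) DS
      by (intro continuous_on_diff continuous_on_compose2[OF continuous_on_real, of _ v])
         (auto simp: finite_continuous_on_def intro: continuous_on_subset)
    have hf: "h x \<le> f x + \<epsilon>" if \<epsilon>: "0 < \<epsilon>" for \<epsilon>
    proof -
      \<comment> \<open>Compact as a closed subset of the closure, and inside \<open>D\<close>
        because \<open>v \<le> u\<close> on the frontier excludes a difference of
        \<open>\<epsilon>\<close> there. It confines the support of the truncation.\<close>
      define C where "C = {y \<in> closure D. \<epsilon> \<le> d y}"
      have C1: "compact C"
      proof -
        have "closedin (top_of_set (closure D)) (closure D \<inter> d -` {\<epsilon>..})"
          by (rule continuous_closedin_preimage[OF d_cont]) simp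
        then have "closed (closure D \<inter> d -` {\<epsilon>..})" by (rule closedin_closed_trans) simp
        moreover have "closure D \<inter> d -` {\<epsilon>..} = C" by (auto simp: C_def)
        ultimately show ?thesis using DS(3) by (metis C_def closed_Int_compact compact_Int_closed inf_le1 inf.absorb_iff2)
      qed
      have C2: "C \<subseteq> D"
      proof
        fix y assume y: "y \<in> C"
        show "y \<in> D"
        proof (rule ccontr)
          assume "y \<notin> D"
          then have "y \<in> frontier D" using y D(1) by (auto simp: C_def frontier_def interior_open)
          moreover have "y \<in> S" using y DS by (auto simp: C_def)
          ultimately have "v y \<le> ereal (f y)" using fr f(3)[of y] by metis
          moreover have "\<bar>v y\<bar> \<noteq> \<infinity>" using vc y by (auto simp: C_def finite_continuous_on_def)
          ultimately have "d y \<le> 0" by (cases "v y") (auto simp: d_def)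
          then show False using y \<epsilon> by (simp add: C_def)
        qed
      qed
      have C3: "h y \<le> f y + \<epsilon>" if "y \<in> D - C" for y
        using that h(3)[of y] closure_subset[of D] by (auto simp: C_def d_def)
      have c: "continuous_on D f" using f(5) DS(1) by (rule continuous_on_subset)
      have e1: "energy D' f < \<infinity>" if "open D'" "D' \<Subset> D" for D'
        using fw that compactly_contained_mono[OF _ DS(1)] by blast
      have s1: "0 \<le> (\<integral>z. form f \<eta> z \<partial>\<nu>)" if "\<eta> \<in> test_functions D" "\<And>x. 0 \<le> \<eta> x" for \<eta>
        using fw that test_functions_mono[OF DS(1)] by (simp add: subset_iff)
      have o: "AE x in lborel. x \<notin> D \<longrightarrow> h x \<le> f x"
        using out[unfolded AE_completion_iff] f(2) h(2) by eventually_elim auto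
      have e2: "energy D' h < \<infinity>" if "open D'" "D' \<Subset> D" for D' using hw that by blast
      have s2: "(\<integral>z. form h \<eta> z \<partial>\<nu>) \<le> 0" if "\<eta> \<in> test_functions D" "\<And>x. 0 \<le> \<eta> x" for \<eta>
        using hw that by simp
      show ?thesis
        by (rule comparison_principle[OF f(1) h(1) f(4) h(4) D(1) compactly_contained_bounded[OF D(2)] c h(5)
              e1 e2 s1 s2 \<epsilon> C1 C2 C3 o x])
    qed
    have "h x \<le> f x" using hf by (rule field_le_epsilon)
    then show "v x \<le> u x" using h(3)[OF x] f(3)[of x] x DS by auto
  qed
  have fin: "AE x in lebesgue. x \<in> S \<longrightarrow> u x < \<infinity>" "\<forall>x\<in>S. - \<infinity> < u x"
    using f(3) by (auto intro!: AE_I2)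
  show ?thesis
    unfolding superharmonic_def
  proof (intro conjI um fin lsc ut(1) allI impI)
    fix D v
    assume "open D" "D \<Subset> S" "weak_solution s p K D v" "finite_continuous_on (closure D) v"
      "\<forall>x\<in>frontier D. v x \<le> u x" "AE x in lebesgue. x \<notin> D \<longrightarrow> v x \<le> u x"
    then show "\<forall>x\<in>D. v x \<le> u x" using comp[of D v] by blast
  qed
qed

lemma continuous_weak_solution_minus:
  assumes "continuous_weak_solution s p K S u"
  shows "continuous_weak_solution s p K S (\<lambda>x. - u x)"
proof -
  have "continuous_on S (\<lambda>x. - u x)"
    using assms by (auto simp: continuous_weak_solution_def finite_continuous_on_def continuous_on_def intro: tendsto_uminus_ereal)
  then show ?thesis
    using assms by (auto simp: continuous_weak_solution_def weak_solution_def weak_subsolution_def finite_continuous_on_def)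
qed

end

section \<open>Approximation of superharmonic functions from below\<close>

text \<open>\<open>D\<close> consists of the points at distance more than \<open>r\<close> from
  \<open>E\<close>, the complement of a neighbourhood of \<open>C\<close>. A frontier point has
  distance exactly \<open>r\<close> from \<open>E\<close>, and the ball of radius \<open>r\<close>
  about its nearest point in \<open>E\<close> misses \<open>D\<close>.\<close>

lemma exterior_ball_domain:
  fixes C S :: "'a::euclidean_space set"
  assumes C: "compact C" and S: "open S" "C \<subseteq> S"
  obtains D N where "open D" "C \<subseteq> D" "D \<Subset> N" "open N" "N \<Subset> S"
    "\<And>z. z \<in> frontier D \<Longrightarrow> \<exists>e r. 0 < r \<and> norm (z - e) = r \<and> ball e r \<inter> D = {}"
proof -
  obtain e where e: "0 < e" "(\<Union>x\<in>C. cball x e) \<subseteq> S"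
    using compact_subset_open_imp_cball_epsilon_subset[OF C S] by blast
  \<comment> \<open>\<open>D\<close> lies in the closed neighbourhood of \<open>C\<close> of radius
    \<open>2 * r\<close> and \<open>N\<close> is the open one of radius \<open>3 * r\<close>; its
    closure must stay within distance \<open>e\<close> of \<open>C\<close>.\<close>
  define r where "r = e / 4"
  have r: "0 < r" using e by (simp add: r_def)
  define E where "E = {y. \<forall>x\<in>C. 2 * r \<le> dist x y}"
  have E: "closed E"
  proof -
    have "E = (\<Inter>x\<in>C. {y. 2 * r \<le> dist x y})" by (auto simp: E_def)
    then show ?thesis by (simp only:) (intro closed_INT ballI closed_Collect_le continuous_intros)
  qed
  \<comment> \<open>\<open>infdist\<close> to the empty set is 0 by convention and is not attained.
    A compact \<open>C\<close> has no bounded neighbourhood that fills the space, so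
    \<open>E\<close> is nonempty.\<close>
  have Ene: "E \<noteq> {}"
  proof
    assume "E = {}"
    have "UNIV \<subseteq> (\<Union>x\<in>C. cball x (2 * r))"
    proof
      fix y
      have "y \<notin> E" using \<open>E = {}\<close> by simp
      then show "y \<in> (\<Union>x\<in>C. cball x (2 * r))" by (force simp: E_def)
    qed
    then show False using compact_union_cball[OF C, of "2 * r"]
      by (meson bounded_subset compact_imp_bounded not_bounded_UNIV)
  qed
  define D where "D = {x. r < infdist x E}"
  define N where "N = (\<Union>x\<in>C. ball x (3 * r))"
  have infdist_eq: "\<exists>y\<in>E. infdist x E = dist x y" for x
  proof -
    obtain y where y: "y \<in> E" "\<And>z. z \<in> E \<Longrightarrow> dist x y \<le> dist x z" using distance_attains_inf[OF E Ene] by blast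
    have "dist x y \<le> infdist x E"
      unfolding infdist_notempty[OF Ene] by (intro cINF_greatest[OF Ene] y(2))
    then have "infdist x E = dist x y" using infdist_le[OF y(1), of x] by simp
    then show ?thesis using y by blast
  qed
  have D: "open D" unfolding D_def by (intro open_Collect_less continuous_intros)
  have CD: "C \<subseteq> D"
  proof
    fix x assume x: "x \<in> C"
    obtain y where "y \<in> E" "infdist x E = dist x y" using infdist_eq by blast
    then show "x \<in> D" using x r by (auto simp: D_def E_def)
  qed
  have D2: "D \<subseteq> (\<Union>x\<in>C. cball x (2 * r))"
  proof
    fix x assume "x \<in> D"
    then have "x \<notin> E" using r by (auto simp: D_def)
    then show "x \<in> (\<Union>x\<in>C. cball x (2 * r))" by (force simp: E_def)
  qed
  have N3: "N \<subseteq> (\<Union>x\<in>C. cball x (3 * r))" by (auto simp: N_def)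
  show thesis
  proof (rule that[OF D CD])
    show "D \<Subset> N"
      by (rule compactly_containedI[OF D2 compact_union_cball[OF C]]) (use r in \<open>force simp: N_def\<close>)
    show "open N" by (auto simp: N_def)
    show "N \<Subset> S"
    proof (rule compactly_containedI[OF N3 compact_union_cball[OF C]])
      have "(\<Union>x\<in>C. cball x (3 * r)) \<subseteq> (\<Union>x\<in>C. cball x e)"
        using r by (intro UN_mono subset_refl) (auto simp: r_def)
      then show "(\<Union>x\<in>C. cball x (3 * r)) \<subseteq> S" using e by blast
    qed
    fix z assume z: "z \<in> frontier D"
    have "closure D \<subseteq> {x. r \<le> infdist x E}"
      by (intro closure_minimal closed_Collect_le continuous_intros) (auto simp: D_def)
    then have "r \<le> infdist z E" using z by (auto simp: frontier_def)
    moreover have "z \<notin> D" using z D by (simp add: frontier_def interior_open)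
    ultimately have zr: "infdist z E = r" by (simp add: D_def)
    obtain y where y: "y \<in> E" "infdist z E = dist z y" using infdist_eq by blast
    have "x \<notin> D" if "x \<in> ball y r" for x
      using infdist_le[OF y(1), of x] that by (auto simp: D_def dist_commute)
    then show "\<exists>e r. 0 < r \<and> norm (z - e) = r \<and> ball e r \<inter> D = {}"
      using y zr r by (intro exI[of _ y] exI[of _ r]) (auto simp: dist_norm)
  qed
qed

text \<open>Polynomials are the Lipschitz approximations of continuous functions used for obstacles.
  The bound on \<open>B\<close> is carried along because the increment of a product involves the
  values of the factors.\<close>

lemma real_polynomial_function_lipschitz:
  fixes q :: "'a::real_normed_vector \<Rightarrow> real"
  assumes "real_polynomial_function q" "bounded B"
  shows "\<exists>L c. 0 \<le> L \<and> 0 \<le> c \<and> (\<forall>x\<in>B. \<bar>q x\<bar> \<le> c) \<and> (\<forall>x\<in>B. \<forall>y\<in>B. \<bar>q x - q y\<bar> \<le> L * norm (x - y))"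
  using assms(1)
proof induction
  case (linear f)
  interpret bounded_linear f by fact
  obtain K where K: "0 \<le> K" "\<And>x. norm (f x) \<le> norm x * K" using nonneg_bounded by blast
  obtain b where b: "\<And>x. x \<in> B \<Longrightarrow> norm x \<le> b" using assms(2) by (auto simp: bounded_iff)
  have "\<bar>f x\<bar> \<le> \<bar>b\<bar> * K" if "x \<in> B" for x
    using K(2)[of x] mult_right_mono[OF b[OF that] K(1)] mult_right_mono[OF abs_ge_self[of b] K(1)]
    unfolding real_norm_def by linarith
  moreover have "\<bar>f x - f y\<bar> \<le> K * norm (x - y)" for x y
    using K(2)[of "x - y"] by (simp add: diff mult.commute)
  ultimately show ?case using K(1) by (intro exI[of _ K] exI[of _ "\<bar>b\<bar> * K"]) auto
next
  case (const c)
  then show ?case by (intro exI[of _ 0] exI[of _ "\<bar>c\<bar>"]) auto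
next
  case (add f g)
  then obtain L1 c1 L2 c2 where h: "0 \<le> L1" "0 \<le> c1" "\<forall>x\<in>B. \<bar>f x\<bar> \<le> c1" "\<forall>x\<in>B. \<forall>y\<in>B. \<bar>f x - f y\<bar> \<le> L1 * norm (x - y)"
    "0 \<le> L2" "0 \<le> c2" "\<forall>x\<in>B. \<bar>g x\<bar> \<le> c2" "\<forall>x\<in>B. \<forall>y\<in>B. \<bar>g x - g y\<bar> \<le> L2 * norm (x - y)" by blast
  have "\<bar>f x + g x\<bar> \<le> c1 + c2" if "x \<in> B" for x using h(3,7) that by (auto intro: order_trans[OF abs_triangle_ineq] add_mono)
  moreover have "\<bar>f x + g x - (f y + g y)\<bar> \<le> (L1 + L2) * norm (x - y)" if "x \<in> B" "y \<in> B" for x y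
  proof -
    have "\<bar>f x - f y\<bar> \<le> L1 * norm (x - y)" "\<bar>g x - g y\<bar> \<le> L2 * norm (x - y)" using h(4,8) that by auto
    then show ?thesis unfolding distrib_right by linarith
  qed
  ultimately show ?case using h by (intro exI[of _ "L1 + L2"] exI[of _ "c1 + c2"]) auto
next
  case (mult f g)
  then obtain L1 c1 L2 c2 where h: "0 \<le> L1" "0 \<le> c1" "\<forall>x\<in>B. \<bar>f x\<bar> \<le> c1" "\<forall>x\<in>B. \<forall>y\<in>B. \<bar>f x - f y\<bar> \<le> L1 * norm (x - y)"
    "0 \<le> L2" "0 \<le> c2" "\<forall>x\<in>B. \<bar>g x\<bar> \<le> c2" "\<forall>x\<in>B. \<forall>y\<in>B. \<bar>g x - g y\<bar> \<le> L2 * norm (x - y)" by blast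
  have "\<bar>f x * g x\<bar> \<le> c1 * c2" if "x \<in> B" for x unfolding abs_mult using h that by (intro mult_mono) auto
  moreover have "\<bar>f x * g x - f y * g y\<bar> \<le> (L1 * c2 + c1 * L2) * norm (x - y)" if "x \<in> B" "y \<in> B" for x y
  proof -
    have "f x * g x - f y * g y = (f x - f y) * g x + f y * (g x - g y)" by (simp add: algebra_simps)
    then have "\<bar>f x * g x - f y * g y\<bar> \<le> \<bar>(f x - f y) * g x\<bar> + \<bar>f y * (g x - g y)\<bar>"
      by (simp only: abs_triangle_ineq)
    also have "\<dots> \<le> (L1 * norm (x - y)) * c2 + c1 * (L2 * norm (x - y))"
      unfolding abs_mult using h that by (intro add_mono mult_mono) auto
    finally show ?thesis by (simp add: algebra_simps)
  qed
  ultimately show ?case using h by (intro exI[of _ "L1 * c2 + c1 * L2"] exI[of _ "c1 * c2"]) auto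
qed

lemma lower_semicontinuous_on_both:
  assumes S: "open S" and l: "lower_semicontinuous_on S u" "lower_semicontinuous_on S (\<lambda>x. - u x)"
  shows "continuous_on S (u :: 'a::{perfect_space, t1_space} \<Rightarrow> ereal)"
  unfolding continuous_on_def
proof
  fix x assume x: "x \<in> S"
  have nb: "at x within S \<noteq> bot" using at_within_open[OF x S] by simp
  have 1: "u x \<le> Liminf (at x within S) u" using l(1) x unfolding lower_semicontinuous_on_def by blast
  have "- u x \<le> Liminf (at x within S) (\<lambda>y. - u y)" using l(2) x unfolding lower_semicontinuous_on_def by blast
  also have "\<dots> = - Limsup (at x within S) u" by (rule ereal_Liminf_uminus)
  finally have 2: "Limsup (at x within S) u \<le> u x" by (simp only: ereal_minus_le_minus)
  have 3: "Liminf (at x within S) u \<le> Limsup (at x within S) u" by (rule Liminf_le_Limsup[OF nb])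
  have "Liminf (at x within S) u = u x" by (rule antisym[OF order_trans[OF 3 2] 1])
  moreover have "Limsup (at x within S) u = u x" by (rule antisym[OF 2 order_trans[OF 1 3]])
  ultimately show "(u \<longlongrightarrow> u x) (at x within S)" using tendsto_iff_Liminf_eq_Limsup[OF nb, of u "u x"] by blast
qed

section \<open>The continuous minimizer and the set where it solves the equation\<close>

context obstacle_problem
begin

text \<open>Replacing the minimizer on \<open>N\<close> by its essential limits changes it on a null
  set, so \<open>J\<close> is the same. The pointwise constraints survive: a violation would fill a
  nonempty open set, which contains a point where both versions agree.\<close>

lemma continuous_minimizer:
  assumes ext: "\<And>z. z \<in> frontier D \<Longrightarrow> \<exists>e r. 0 < r \<and> norm (z - e) = r \<and> ball e r \<inter> D = {}"
  obtains V where "adm V" "\<And>x. V x \<le> M" "\<And>w. adm w \<Longrightarrow> J V \<le> J w" "continuous_on N V"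
proof -
  obtain v where v: "adm v" "\<And>x. v x \<le> M" "\<And>w. adm w \<Longrightarrow> J v \<le> J w" using minimizer_exists by blast
  obtain c where c: "continuous_on N c" "AE x in lborel. x \<in> N \<longrightarrow> v x = c x" "\<And>x. x \<in> N - D \<Longrightarrow> c x = g x"
    by (rule minimizer_continuous[OF v ext]) blast+
  define V where "V x = indicator N x *\<^sub>R c x + indicator (- N) x * g x" for x
  have V_out: "V x = g x" if "x \<notin> D" for x using that c(3)[of x] by (cases "x \<in> N") (auto simp: V_def)
  have V_N: "V x = c x" if "x \<in> N" for x using that by (simp add: V_def)
  have [measurable]: "V \<in> borel_measurable borel"
  proof -
    have [measurable]: "(\<lambda>x. indicator N x *\<^sub>R c x) \<in> borel_measurable borel"
      by (rule borel_measurable_continuous_on_indicator[OF _ c(1)]) simp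
    show ?thesis unfolding V_def by measurable
  qed
  have Vv: "AE x in lborel. v x = V x"
    using c(2)
  proof eventually_elim
    fix x assume "x \<in> N \<longrightarrow> v x = c x"
    then show "v x = V x" using V_out[of x] V_N[of x] v(1) DN by (cases "x \<in> D") (auto simp: adm_def)
  qed
  have cont: "continuous_on N V" using c(1) by (rule continuous_on_eq) (simp add: V_N)
  have contD: "continuous_on D V" "continuous_on D g"
    using cont g_continuous DN by (auto intro: continuous_on_subset)
  have ge: "g x \<le> V x" if x: "x \<in> D" for x
  proof (rule ccontr)
    assume neg: "\<not> g x \<le> V x"
    define U where "U = {y \<in> D. V y < g y}"
    have U: "open U" unfolding U_def
      using continuous_on_open_vimage[OF D(1), of "\<lambda>y. g y - V y", THEN iffD1, rule_format, of "{0<..}"] contD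
      by (auto intro!: continuous_intros simp: vimage_def Int_def conj_commute)
    obtain y where "y \<in> U" "v y = V y"
      by (rule AE_lborel_witness[OF Vv U]) (use neg x in \<open>auto simp: U_def\<close>)
    then show False using v(1) by (auto simp: U_def adm_def)
  qed
  have le: "V x \<le> M" for x
  proof (cases "x \<in> D")
    case False then show ?thesis using V_out g_le by simp
  next
    case True
    show ?thesis
    proof (rule ccontr)
      assume neg: "\<not> V x \<le> M"
      define U where "U = {y \<in> D. M < V y}"
      have U: "open U" unfolding U_def
        using continuous_on_open_vimage[OF D(1), of V, THEN iffD1, rule_format, of "{M<..}"] contD
        by (auto simp: vimage_def Int_def conj_commute)
      obtain y where "y \<in> U" "v y = V y"
        by (rule AE_lborel_witness[OF Vv U]) (use neg True in \<open>auto simp: U_def\<close>)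
      then show False using v(2)[of y] by (auto simp: U_def)
    qed
  qed
  have adm: "adm V" unfolding adm_def using V_out ge le by (auto intro: order_trans[OF le])
  have "J V = J v"
    unfolding J_def
  proof (rule nn_integral_cong_AE)
    show "AE z in \<nu>. ennreal (density V z) = ennreal (density v z)"
      using AE_\<nu>_pair[OF Vv] by eventually_elim (simp add: density_def)
  qed
  then show thesis using adm le v(3) cont by (intro that[of V]) auto
qed

lemma minimizer_test:
  assumes V: "adm V" "\<And>x. V x \<le> M" "\<And>w. adm w \<Longrightarrow> J V \<le> J w"
    and h [measurable]: "h \<in> borel_measurable borel" and h0: "\<And>x. x \<notin> D \<Longrightarrow> h x = 0" and hc: "\<And>x. \<bar>h x\<bar> \<le> c"
    and hn: "\<And>x. 0 \<le> h x"
    and L': "0 \<le> L'" and hL: "\<And>x y. x \<in> N \<Longrightarrow> y \<in> N \<Longrightarrow> \<bar>h x - h y\<bar> \<le> \<bar>V x - V y\<bar> + L' * norm (x - y)"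
  shows "integrable \<nu> (form V h) \<and> 0 \<le> (\<integral>z. form V h z \<partial>\<nu>)"
proof (rule variational_inequality[OF V h h0 hc L', where t = 1])
  show "AE z in \<nu>. z \<in> N \<times> N \<longrightarrow> \<bar>h (fst z) - h (snd z)\<bar> \<le> \<bar>V (fst z) - V (snd z)\<bar> + L' * norm (fst z - snd z)"
    using hL by (intro AE_I2) auto
  show "g x \<le> V x + 1 * h x" if "x \<in> D" for x using V(1) that hn[of x] by (auto simp: adm_def intro: add_increasing2)
qed auto

lemma energy_minimizer:
  assumes V: "adm V" "\<And>w. adm w \<Longrightarrow> J V \<le> J w"
  shows "energy N V < \<infinity>"
  using energy_le_J[OF V(1)] V(2)[OF adm_g] J_g by (meson le_less_trans order_trans)

text \<open>On the support of a test function inside \<open>{x \<in> D. g x < V x}\<close> the gap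
  to the obstacle has a positive minimum, so small downward variations are admissible too and the
  variational inequality becomes an equation.\<close>

lemma minimizer_weak_solution:
  assumes KK: "AE z in lborel. K (fst z) (snd z) = k z"
    and V: "adm V" "\<And>x. V x \<le> M" "\<And>w. adm w \<Longrightarrow> J V \<le> J w" "continuous_on N V"
  shows "open {x \<in> D. g x < V x}" "weak_solution s p K {x \<in> D. g x < V x} (\<lambda>x. ereal (V x))"
proof -
  define D' where "D' = {x \<in> D. g x < V x}"
  note [measurable] = adm_borel[OF V(1)]
  have contD: "continuous_on D V" "continuous_on D g"
    using V(4) g_continuous DN by (auto intro: continuous_on_subset)
  show op: "open {x \<in> D. g x < V x}"
    using continuous_on_open_vimage[OF D(1), of "\<lambda>y. V y - g y", THEN iffD1, rule_format, of "{0<..}"] contD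
    by (auto intro!: continuous_intros simp: vimage_def Int_def conj_commute)
  have D'N: "D' \<subseteq> N" using DN by (auto simp: D'_def)
  have en: "energy N V < \<infinity>" by (rule energy_minimizer[OF V(1,3)])
  show "weak_solution s p K {x \<in> D. g x < V x} (\<lambda>x. ereal (V x))"
    unfolding D'_def[symmetric]
  proof (rule weak_solution_iff[OF KK _ _ _ _ _ _, THEN iffD2])
    show "(\<lambda>x. ereal (V x)) \<in> borel_measurable lebesgue" by (rule measurable_completion) measurable
    show "V \<in> borel_measurable borel" by measurable
    show "tail_finite V" by (rule adm_tail[OF V(1)])
    show "open D'" using op by (simp add: D'_def)
    show "\<exists>b. \<forall>x\<in>B. \<bar>V x\<bar> \<le> b" if "open B" "B \<Subset> D'" for B
      using adm_bound[OF V(1)] compactly_contained_subset[OF that(2)] D'N by blast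
    show "(\<forall>B. open B \<longrightarrow> B \<Subset> D' \<longrightarrow> energy B V < \<infinity>) \<and>
     (\<forall>\<eta>\<in>test_functions D'. (\<forall>x. 0 \<le> \<eta> x) \<longrightarrow> (\<integral>z. form V \<eta> z \<partial>\<nu>) = 0)"
    proof (intro conjI allI impI ballI)
      fix B assume "open B" "B \<Subset> D'"
      then have "B \<subseteq> N" using compactly_contained_subset D'N by blast
      then have "energy B V \<le> energy N V"
        unfolding energy_def by (intro nn_integral_mono mult_right_mono) (auto simp: indicator_def)
      then show "energy B V < \<infinity>" using en by (rule le_less_trans)
    next
      fix \<eta> assume \<eta>: "\<eta> \<in> test_functions D'" and \<eta>n: "\<forall>x. 0 \<le> \<eta> x"
      obtain C B L' where C: "compact C" "C \<subseteq> D'" "\<And>x. x \<notin> C \<Longrightarrow> \<eta> x = 0" and B: "\<And>x. \<bar>\<eta> x\<bar> \<le> B" and L': "0 \<le> L'"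
        "\<And>x y. \<bar>\<eta> x - \<eta> y\<bar> \<le> L' * norm (x - y)" and [measurable]: "\<eta> \<in> borel_measurable borel"
        using test_function_facts[OF \<eta>] by blast
      have \<eta>0: "\<eta> x = 0" if "x \<notin> D" for x using that C by (auto simp: D'_def)
      have 1: "integrable \<nu> (form V \<eta>) \<and> 0 \<le> (\<integral>z. form V \<eta> z \<partial>\<nu>)"
      proof (rule minimizer_test[OF V(1-3) _ \<eta>0 B _ L'(1)])
        show "\<bar>\<eta> x - \<eta> y\<bar> \<le> \<bar>V x - V y\<bar> + L' * norm (x - y)" for x y using L'(2)[of x y] by simp
      qed (use \<eta>n in auto)
      obtain d where d: "0 < d" "\<And>x. x \<in> C \<Longrightarrow> g x + d \<le> V x"
      proof (cases "C = {}")
        case True then show ?thesis using that[of 1] by simp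
      next
        case False
        have "continuous_on C (\<lambda>x. V x - g x)"
          using contD C(2) by (intro continuous_intros) (auto intro: continuous_on_subset simp: D'_def)
        then obtain x0 where x0: "x0 \<in> C" "\<And>x. x \<in> C \<Longrightarrow> V x0 - g x0 \<le> V x - g x"
          using continuous_attains_inf[OF C(1) False] by blast
        then have "0 < V x0 - g x0" using C(2) by (auto simp: D'_def)
        then show ?thesis using x0(2) by (intro that[of "V x0 - g x0"]) (auto simp: algebra_simps)
      qed
      have B0: "0 \<le> B" using B[of undefined] by linarith
      \<comment> \<open>Keeps \<open>t * \<eta> x\<close> at most the gap \<open>d\<close>; the 1
        avoids a division by 0 when \<open>B = 0\<close>.\<close>
      define t where "t = d / (B + 1)"
      have t: "0 < t" using d B0 by (simp add: t_def)
      have 2: "integrable \<nu> (form V (\<lambda>x. - \<eta> x)) \<and> 0 \<le> (\<integral>z. form V (\<lambda>x. - \<eta> x) z \<partial>\<nu>)"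
      proof (rule variational_inequality[OF V(1-3), where c = B and L' = L' and t = t])
        show "AE z in \<nu>. z \<in> N \<times> N \<longrightarrow> \<bar>- \<eta> (fst z) - - \<eta> (snd z)\<bar> \<le> \<bar>V (fst z) - V (snd z)\<bar> + L' * norm (fst z - snd z)"
        proof (intro AE_I2 impI)
          fix z show "\<bar>- \<eta> (fst z) - - \<eta> (snd z)\<bar> \<le> \<bar>V (fst z) - V (snd z)\<bar> + L' * norm (fst z - snd z)"
            using L'(2)[of "fst z" "snd z"] by linarith
        qed
        fix x assume x: "x \<in> D"
        show "g x \<le> V x + t * - \<eta> x"
        proof (cases "x \<in> C")
          case True
          have "t * \<eta> x \<le> t * (B + 1)" using B[of x] t by (intro mult_left_mono) auto
          also have "\<dots> = d" using B0 by (simp add: t_def)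
          finally show ?thesis using d(2)[OF True] by simp
        next
          case False
          then show ?thesis using C(3) V(1) x by (auto simp: adm_def)
        qed
      qed (use \<eta>0 B L' t in auto)
      moreover have "form V (\<lambda>x. - \<eta> x) = (\<lambda>z. - form V \<eta> z)" by (auto simp: form_def algebra_simps)
      ultimately show "(\<integral>z. form V \<eta> z \<partial>\<nu>) = 0" using 1 by simp
    qed
  qed auto
qed

end

section \<open>From superharmonic functions to weak supersolutions\<close>

context nonlocal_kernel
begin

text \<open>The increments of a test function may be as large as those of \<open>V\<close>, which admits truncations
  of \<open>V\<close> itself.\<close>
definition supersolution_tested :: "'a set \<Rightarrow> 'a set \<Rightarrow> ('a \<Rightarrow> real) \<Rightarrow> bool"
  where "supersolution_tested D N V \<longleftrightarrow> (\<forall>h c L'. h \<in> borel_measurable borel \<longrightarrow> (\<forall>x. x \<notin> D \<longrightarrow> h x = 0) \<longrightarrow>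
    (\<forall>x. \<bar>h x\<bar> \<le> c) \<longrightarrow> (\<forall>x. 0 \<le> h x) \<longrightarrow> 0 \<le> L' \<longrightarrow>
    (\<forall>x\<in>N. \<forall>y\<in>N. \<bar>h x - h y\<bar> \<le> \<bar>V x - V y\<bar> + L' * norm (x - y)) \<longrightarrow>
    integrable \<nu> (form V h) \<and> 0 \<le> (\<integral>z. form V h z \<partial>\<nu>))"

text \<open>The minimizer is compared with \<open>u\<close> not on \<open>D\<close> but on the
  smaller set where it leaves the obstacle: only there is it known to be a solution, and on the
  frontier and outside it equals \<open>g\<close>, which is at most \<open>f\<close>.\<close>

lemma superharmonic_approximation:
  assumes KK: "AE z in lborel. K (fst z) (snd z) = k z" and u: "superharmonic s p K S u"
    and f [measurable]: "f \<in> borel_measurable borel" and eq: "AE x in lborel. u x = ereal (f x)" "\<And>x. x \<in> S \<Longrightarrow> u x = ereal (f x)"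
    and tail: "tail_finite f" and cont: "continuous_on S f"
    and D: "open D" "D \<Subset> N" "open N" "N \<Subset> S"
      "\<And>z. z \<in> frontier D \<Longrightarrow> \<exists>e r. 0 < r \<and> norm (z - e) = r \<and> ball e r \<inter> D = {}"
    and b: "0 \<le> b" "\<And>x. x \<in> N \<Longrightarrow> \<bar>f x\<bar> \<le> b" and \<delta>: "0 < \<delta>" "\<delta> \<le> 1" and m: "0 \<le> m"
  obtains V where "V \<in> borel_measurable borel" "\<And>x. V x \<le> f x" "\<And>x. x \<in> N \<Longrightarrow> f x - 2 * \<delta> \<le> V x"
    "\<And>x. x \<notin> N \<Longrightarrow> V x = min (f x) (b + 2 + m)" "energy N V < \<infinity>"
    "supersolution_tested D N V"
proof -
  have NS: "N \<subseteq> S" "compact (closure N)" "closure N \<subseteq> S" "bounded N" "closure D \<subseteq> N" "D \<subseteq> N"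
    using compactly_contained_subset[OF D(4)] compactly_contained_bounded[OF D(4)] compactly_contained_subset[OF D(2)] D(2,4)
    by (auto simp: compactly_contained_def)
  have [measurable]: "N \<in> sets borel" using D(3) by auto
  \<comment> \<open>Lowered by \<open>\<delta>\<close>, this polynomial is Lipschitz on
    \<open>N\<close> and lies between \<open>f - 2 * \<delta>\<close> and \<open>f\<close>.\<close>
  obtain q where q: "real_polynomial_function q" "\<And>x. x \<in> closure N \<Longrightarrow> \<bar>f x - q x\<bar> < \<delta>"
    using Stone_Weierstrass_real_polynomial_function[OF NS(2) continuous_on_subset[OF cont NS(3)] \<delta>(1)] by blast
  have qc: "continuous_on UNIV q" using continuous_on_polymonial_function q(1)
    by (simp add: real_polynomial_function_eq)
  have [measurable]: "q \<in> borel_measurable borel" using qc by (rule borel_measurable_continuous_onI)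
  obtain L c where L: "0 \<le> L" "\<forall>x\<in>N. \<forall>y\<in>N. \<bar>q x - q y\<bar> \<le> L * norm (x - y)"
    using real_polynomial_function_lipschitz[OF q(1) NS(4)] by blast
  \<comment> \<open>\<open>b + 2\<close> is at least \<open>b + 2 * \<delta>\<close> and so bounds
    \<open>g\<close> on \<open>N\<close>; the free part \<open>m\<close> lets the cut-off of
    \<open>f\<close> outside \<open>N\<close> tend to infinity.\<close>
  define M where "M = b + 2 + m"
  define g where "g x = (if x \<in> N then q x - \<delta> else min (f x) M)" for x
  have [measurable]: "g \<in> borel_measurable borel" unfolding g_def by measurable
  have gN: "f x - 2 * \<delta> \<le> g x \<and> g x \<le> f x" if "x \<in> N" for x
    using q(2)[of x] that closure_subset[of N] by (auto simp: g_def abs_less_iff)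
  have gle: "g x \<le> f x" for x using gN[of x] by (cases "x \<in> N") (auto simp: g_def)
  interpret ob: obstacle_problem s p \<Lambda> k N D g M L
  proof unfold_locales
    show "open N" "bounded N" "open D" "closure D \<subseteq> N" using D NS by auto
    show "g \<in> borel_measurable borel" by measurable
    show "\<bar>g x - g y\<bar> \<le> L * norm (x - y)" if "x \<in> N" "y \<in> N" for x y using L that by (simp add: g_def)
    show "0 \<le> L" by (rule L)
    show "\<bar>g x\<bar> \<le> M" if "x \<in> N" for x using gN[OF that] b(2)[OF that] \<delta> m by (auto simp: M_def abs_le_iff)
    show "g x \<le> M" for x using gN[of x] b(2)[of x] m by (cases "x \<in> N") (auto simp: M_def g_def abs_le_iff)
    show "0 \<le> M" using b m by (simp add: M_def)
    show "tail_finite g"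
    proof (rule tail_finite_bound[OF f tail])
      show "\<bar>g y\<bar> \<le> \<bar>f y\<bar> + M" for y
        using gN[of y] \<delta> b m by (cases "y \<in> N") (auto simp: g_def M_def abs_le_iff min_def)
      show "0 \<le> M" using b m by (simp add: M_def)
    qed
  qed
  obtain V where V: "ob.adm V" "\<And>x. V x \<le> M" "\<And>w. ob.adm w \<Longrightarrow> ob.J V \<le> ob.J w" "continuous_on N V"
    using ob.continuous_minimizer[OF D(5)] by blast
  note [measurable] = ob.adm_borel[OF V(1)]
  define D' where "D' = {x \<in> D. g x < V x}"
  have D': "open D'" "weak_solution s p K D' (\<lambda>x. ereal (V x))"
    using ob.minimizer_weak_solution[OF KK V] by (auto simp: D'_def)
  have V_out: "V x = g x" if "x \<notin> D'" for x
    using V(1) that by (cases "x \<in> D") (auto simp: ob.adm_def D'_def)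
  have D'N: "closure D' \<subseteq> N" using closure_mono[of D' D] NS by (auto simp: D'_def)
  have D'S: "D' \<Subset> S" by (rule compactly_containedI[of _ "closure N"]) (use NS closure_subset[of N] in \<open>auto simp: D'_def\<close>)
  have le: "V x \<le> f x" for x
  proof (cases "x \<in> D'")
    case True
    have "\<forall>x\<in>D'. ereal (V x) \<le> u x"
    proof -
      have "finite_continuous_on (closure D') (\<lambda>x. ereal (V x))"
        using continuous_on_subset[OF V(4) D'N] by (auto simp: finite_continuous_on_def intro: continuous_on_ereal)
      moreover have "\<exists>M::real. AE x in lebesgue. pos_part (\<lambda>x. ereal (V x)) x \<le> ereal M"
        using V(2) ob.M by (intro exI[of _ M] AE_I2) (auto simp: pos_part_def)
      moreover have "\<forall>x\<in>frontier D'. ereal (V x) \<le> u x"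
      proof
        fix x assume x: "x \<in> frontier D'"
        then have "x \<notin> D'" "x \<in> S" using D'(1) D'N NS by (auto simp: frontier_def interior_open)
        then show "ereal (V x) \<le> u x" using V_out[of x] gle[of x] eq(2)[of x] by simp
      qed
      moreover have "AE x in lebesgue. x \<notin> D' \<longrightarrow> ereal (V x) \<le> u x"
      proof -
        have "AE x in lborel. x \<notin> D' \<longrightarrow> ereal (V x) \<le> u x"
          using eq(1)
        proof eventually_elim
          fix x assume "u x = ereal (f x)"
          then show "x \<notin> D' \<longrightarrow> ereal (V x) \<le> u x" using V_out[of x] gle[of x] by simp
        qed
        then show ?thesis by (rule AE_completion)
      qed
      ultimately show ?thesis using u D' D'S unfolding superharmonic_def by blast
    qed
    then have "ereal (V x) \<le> u x" using True by blast
    moreover have "u x = ereal (f x)" using True compactly_contained_subset[OF D'S] by (intro eq(2)) auto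
    ultimately show ?thesis by simp
  next
    case False
    then show ?thesis using V_out gle by simp
  qed
  show thesis
  proof (rule that[of V])
    show "f x - 2 * \<delta> \<le> V x" if "x \<in> N" for x
      using gN[OF that] V(1) by (cases "x \<in> D") (auto simp: ob.adm_def)
    show "V x = min (f x) (b + 2 + m)" if "x \<notin> N" for x
    proof -
      have "x \<notin> D" using that NS by auto
      then have "V x = g x" using V(1) unfolding ob.adm_def by blast
      then show ?thesis using that by (simp add: g_def M_def)
    qed
    show "energy N V < \<infinity>" by (rule ob.energy_minimizer[OF V(1,3)])
    show "supersolution_tested D N V"
      unfolding supersolution_tested_def
    proof (intro allI impI)
      fix h c L'
      assume "h \<in> borel_measurable borel" "\<forall>x. x \<notin> D \<longrightarrow> h x = 0" "\<forall>x. \<bar>h x\<bar> \<le> c" "\<forall>x. 0 \<le> h x" "0 \<le> L'"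
        "\<forall>x\<in>N. \<forall>y\<in>N. \<bar>h x - h y\<bar> \<le> \<bar>V x - V y\<bar> + L' * norm (x - y)"
      then show "integrable \<nu> (form V h) \<and> 0 \<le> (\<integral>z. form V h z \<partial>\<nu>)"
        by (intro ob.minimizer_test[OF V(1-3), of h c L']) auto
    qed
  qed (use le in auto)
qed

text \<open>The Caccioppoli inequality for \<open>- V\<close>, with a level below \<open>- b\<close>
  on \<open>B\<close> and above \<open>b\<close> outside \<open>D\<close>. Then the excess vanishes
  off \<open>D\<close>, and on \<open>B\<close>, where the level is constant, it has the increments
  of \<open>- V\<close>. The left side thus contains the full energy on \<open>B\<close>, while the
  right side depends only on \<open>b\<close>, \<open>f\<close> and the sets.\<close>

lemma local_energy_bound:
  assumes f [measurable]: "f \<in> borel_measurable borel" and tail: "tail_finite f"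
    and D: "open D" "D \<Subset> N" "open N" "bounded N" and B: "B \<Subset> D"
  obtains E0 where "0 \<le> E0" "\<And>V. \<lbrakk>V \<in> borel_measurable borel; \<And>x. x \<in> N \<Longrightarrow> \<bar>V x\<bar> \<le> b; \<And>x. x \<notin> N \<Longrightarrow> \<bar>V x\<bar> \<le> \<bar>f x\<bar>;
      supersolution_tested D N V\<rbrakk> \<Longrightarrow> energy B V \<le> ennreal E0"
proof (cases "B = {} \<or> b < 0")
  case True
  have "energy B V \<le> ennreal 0" if "\<And>x. x \<in> N \<Longrightarrow> \<bar>V x\<bar> \<le> b" for V
  proof -
    have "B = {}"
    proof (rule ccontr)
      assume "B \<noteq> {}"
      then obtain x where "x \<in> N" using compactly_contained_subset[OF B] compactly_contained_subset[OF D(2)] by blast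
      then show False using that[of x] True \<open>B \<noteq> {}\<close> by auto
    qed
    then show ?thesis by (simp add: energy_def)
  qed
  then show thesis by (intro that[of 0]) auto
next
  case False
  then have b: "0 \<le> b" and Bne: "B \<noteq> {}" by auto
  have DN: "D \<subseteq> N" "closure D \<subseteq> N" and BD: "closure B \<subseteq> D" "compact (closure B)" "B \<subseteq> D"
    using D(2) B compactly_contained_subset[OF D(2)] compactly_contained_subset[OF B] by (auto simp: compactly_contained_def)
  have [measurable]: "N \<in> sets borel" "D \<in> sets borel" using D by auto
  have sep: "separated D N" by (rule separatedI) (use D DN in auto)
  obtain d where d: "0 < d" "\<And>x. infdist x (closure B) < d \<Longrightarrow> x \<in> D"
  proof -
    obtain d where d: "0 < d" "\<forall>x\<in>closure B. \<forall>y\<in>- D. d \<le> dist x y"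
      using separate_compact_closed[OF BD(2), of "- D"] D(1) BD(1) by auto
    have "x \<in> D" if x: "infdist x (closure B) < d" for x
    proof (rule ccontr)
      assume "x \<notin> D"
      then have "d \<le> dist x y" if "y \<in> closure B" for y using d(2) that by (auto simp: dist_commute)
      moreover have "closure B \<noteq> {}" using Bne by auto
      ultimately have "d \<le> infdist x (closure B)" by (simp add: infdist_notempty cINF_greatest)
      then show False using x by simp
    qed
    then show thesis using d(1) that by blast
  qed
  \<comment> \<open>The level has to rise from \<open>- (b + 1)\<close> on \<open>B\<close> to at
    least \<open>b + 1\<close> outside \<open>D\<close>, that is by \<open>2 * b + 2\<close> over
    the distance \<open>d\<close>.\<close>
  define L' where "L' = (2 * b + 2) / d"
  have L': "0 \<le> L'" using b d by (simp add: L'_def)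
  define l where "l x = L' * infdist x (closure B) - (b + 1)" for x
  have l_cont: "continuous_on UNIV l" unfolding l_def by (intro continuous_intros)
  have [measurable]: "l \<in> borel_measurable borel" using l_cont by (rule borel_measurable_continuous_onI)
  have l_lip: "\<bar>l x - l y\<bar> \<le> L' * norm (x - y)" for x y
  proof -
    have "\<bar>l x - l y\<bar> = L' * \<bar>infdist x (closure B) - infdist y (closure B)\<bar>"
      using L' by (simp add: l_def right_diff_distrib[symmetric] abs_mult)
    also have "\<dots> \<le> L' * norm (x - y)"
      using L' infdist_triangle_abs[of x "closure B" y] by (intro mult_left_mono) (auto simp: dist_norm)
    finally show ?thesis .
  qed
  have l_ge: "- (b + 1) \<le> l x" for x using L' infdist_nonneg[of x "closure B"] by (simp add: l_def)
  have l_out: "b + 1 \<le> l x" if "x \<notin> D" for x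
  proof -
    have "d \<le> infdist x (closure B)" using d(2)[of x] that by linarith
    then have "L' * d \<le> L' * infdist x (closure B)" using L' by (rule mult_left_mono)
    then show ?thesis using d by (simp add: l_def L'_def)
  qed
  have l_in: "l x = - (b + 1)" if "x \<in> B" for x using that closure_subset[of B] by (auto simp: l_def)
  define c1 where "c1 = enn2real (\<integral>\<^sup>+z. indicator (N \<times> N) z * ennreal (norm (fst z - snd z) powr p) \<partial>\<nu>)"
  define c2 where "c2 = (2 * b + 1) * 2 powr (p - 1) * (\<integral>z. far D N b f z \<partial>\<nu>)"
  have c1: "(\<integral>\<^sup>+z. indicator (N \<times> N) z * ennreal (norm (fst z - snd z) powr p) \<partial>\<nu>) = ennreal c1"
    unfolding c1_def using near_integral_finite[of N] D(4) by (intro ennreal_enn2real[symmetric]) auto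
  have c2: "0 \<le> c2" unfolding c2_def using b far_nonneg by simp
  define E0 where "E0 = 2 powr p * (4 * 3 powr p * L' powr p * c1 + c2)"
  have E0: "ennreal E0 = ennreal (2 powr p) * (ennreal (4 * 3 powr p * L' powr p) * ennreal c1 + ennreal c2)"
    unfolding E0_def using c2 by (simp add: ennreal_mult ennreal_plus c1_def)
  show thesis
  proof (rule that[of E0])
    show "0 \<le> E0" using c2 by (simp add: E0_def c1_def)
    fix V :: "'a \<Rightarrow> real"
    assume V [measurable]: "V \<in> borel_measurable borel" and Vb: "\<And>x. x \<in> N \<Longrightarrow> \<bar>V x\<bar> \<le> b" and Vf: "\<And>x. x \<notin> N \<Longrightarrow> \<bar>V x\<bar> \<le> \<bar>f x\<bar>"
      and test: "supersolution_tested D N V"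
    define v where "v x = - V x" for x
    have [measurable]: "v \<in> borel_measurable borel" unfolding v_def by measurable
    define h where "h = (\<lambda>x. if x \<in> N then max 0 (v x - l x) else 0)"
    define E where "E = {x \<in> N. l x < v x}"
    have [measurable]: "h \<in> borel_measurable borel" unfolding h_def by measurable
    have vb: "\<bar>v x\<bar> \<le> b" if "x \<in> N" for x using Vb[OF that] by (simp add: v_def)
    have ED: "E \<subseteq> D"
    proof
      fix x assume "x \<in> E"
      then have "l x < v x" "\<bar>v x\<bar> \<le> b" using vb by (auto simp: E_def)
      then show "x \<in> D" using l_out[of x] by (intro ccontr[of "x \<in> D"]) linarith
    qed
    have h0: "h x = 0" if "x \<notin> D" for x using that ED by (auto simp: h_def E_def max_def)
    have hb: "0 \<le> h x" "h x \<le> 2 * b + 1" for x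
      using vb[of x] l_ge[of x] b by (auto simp: h_def)
    have "integrable \<nu> (form V h) \<and> 0 \<le> (\<integral>z. form V h z \<partial>\<nu>)"
    proof (rule test[unfolded supersolution_tested_def, rule_format, OF _ h0 _ hb(1) L'])
      show "\<bar>h x\<bar> \<le> 2 * b + 1" for x using hb[of x] by simp
      show "\<bar>h x - h y\<bar> \<le> \<bar>V x - V y\<bar> + L' * norm (x - y)" if "x \<in> N" "y \<in> N" for x y
      proof -
        have "\<bar>h x - h y\<bar> \<le> \<bar>V x - V y\<bar> + \<bar>l x - l y\<bar>" using that by (auto simp: h_def v_def max_def)
        then show ?thesis using l_lip[of x y] by linarith
      qed
    qed measurable
    then have int: "integrable \<nu> (form v h)" "(\<integral>z. form v h z \<partial>\<nu>) \<le> 0"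
      unfolding v_def by (simp_all add: form_minus)
    have "(\<integral>\<^sup>+z. indicator (N \<times> N) z * ennreal (\<bar>(v (fst z) - l (fst z)) - (v (snd z) - l (snd z))\<bar> powr (p - 1)
            * \<bar>h (fst z) - h (snd z)\<bar>) \<partial>\<nu>)
      \<le> ennreal (2 powr p) * (ennreal (4 * 3 powr p * L' powr p) *
          (\<integral>\<^sup>+z. indicator (E \<times> N) z * ennreal (norm (fst z - snd z) powr p) \<partial>\<nu>)
        + (\<integral>\<^sup>+z. indicator (E \<times> - N) z * ennreal ((max 0 (v (snd z) - v (fst z))) powr (p - 1) * h (fst z)) \<partial>\<nu>))"
      by (rule caccioppoli[OF _ _ _ h_def E_def L' _ int]) (use l_lip in auto)
    also have "\<dots> \<le> ennreal E0"
      unfolding E0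
    proof (intro mult_left_mono add_mono)
      have "(\<integral>\<^sup>+z. indicator (E \<times> N) z * ennreal (norm (fst z - snd z) powr p) \<partial>\<nu>)
         \<le> (\<integral>\<^sup>+z. indicator (N \<times> N) z * ennreal (norm (fst z - snd z) powr p) \<partial>\<nu>)"
        by (intro nn_integral_mono mult_right_mono) (auto simp: indicator_def E_def)
      then show "(\<integral>\<^sup>+z. indicator (E \<times> N) z * ennreal (norm (fst z - snd z) powr p) \<partial>\<nu>) \<le> ennreal c1" by (simp add: c1)
      have "(\<integral>\<^sup>+z. indicator (E \<times> - N) z * ennreal ((max 0 (v (snd z) - v (fst z))) powr (p - 1) * h (fst z)) \<partial>\<nu>)
        \<le> (\<integral>\<^sup>+z. ennreal ((2 * b + 1) * 2 powr (p - 1) * far D N b f z) \<partial>\<nu>)"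
      proof (intro nn_integral_mono)
        fix z :: "'a \<times> 'a"
        obtain x y where z: "z = (x, y)" by (cases z)
        show "indicator (E \<times> - N) z * ennreal ((max 0 (v (snd z) - v (fst z))) powr (p - 1) * h (fst z))
          \<le> ennreal ((2 * b + 1) * 2 powr (p - 1) * far D N b f z)"
        proof (cases "x \<in> E \<and> y \<notin> N")
          case True
          then have x: "x \<in> N" "x \<in> D" using ED by (auto simp: E_def)
          have "max 0 (v y - v x) \<le> b + \<bar>f y\<bar>" using vb[OF x(1)] Vf[of y] True b by (auto simp: v_def)
          then have "(max 0 (v y - v x)) powr (p - 1) \<le> (b + \<bar>f y\<bar>) powr (p - 1)" using p by (intro powr_mono2) auto
          also have "\<dots> \<le> 2 powr (p - 1) * (b powr (p - 1) + \<bar>f y\<bar> powr (p - 1))" using p b by (intro powr_add_le) auto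
          finally have "(max 0 (v y - v x)) powr (p - 1) * h x
            \<le> (2 powr (p - 1) * (b powr (p - 1) + \<bar>f y\<bar> powr (p - 1))) * (2 * b + 1)"
            using hb[of x] b by (intro mult_mono) auto
          also have "\<dots> = (2 * b + 1) * 2 powr (p - 1) * far D N b f z"
            using True x by (simp add: far_def z)
          finally show ?thesis using True by (simp add: z ennreal_leI)
        qed (auto simp: z)
      qed
      also have "\<dots> = ennreal (\<integral>z. (2 * b + 1) * 2 powr (p - 1) * far D N b f z \<partial>\<nu>)"
        using b far_nonneg by (intro nn_integral_eq_integral integrable_mult_right far_integrable sep f tail) auto
      also have "\<dots> = ennreal c2" by (simp add: c2_def)
      finally show "(\<integral>\<^sup>+z. indicator (E \<times> - N) z * ennreal ((max 0 (v (snd z) - v (fst z))) powr (p - 1) * h (fst z)) \<partial>\<nu>)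
        \<le> ennreal c2" .
    qed auto
    finally have main: "(\<integral>\<^sup>+z. indicator (N \<times> N) z * ennreal (\<bar>(v (fst z) - l (fst z)) - (v (snd z) - l (snd z))\<bar> powr (p - 1)
            * \<bar>h (fst z) - h (snd z)\<bar>) \<partial>\<nu>) \<le> ennreal E0" .
    have "energy B V \<le> (\<integral>\<^sup>+z. indicator (N \<times> N) z * ennreal (\<bar>(v (fst z) - l (fst z)) - (v (snd z) - l (snd z))\<bar> powr (p - 1)
            * \<bar>h (fst z) - h (snd z)\<bar>) \<partial>\<nu>)"
      unfolding energy_def
    proof (intro nn_integral_mono)
      fix z :: "'a \<times> 'a"
      obtain x y where z: "z = (x, y)" by (cases z)
      show "indicator (B \<times> B) z * ennreal (\<bar>V (fst z) - V (snd z)\<bar> powr p)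
        \<le> indicator (N \<times> N) z * ennreal (\<bar>(v (fst z) - l (fst z)) - (v (snd z) - l (snd z))\<bar> powr (p - 1)
            * \<bar>h (fst z) - h (snd z)\<bar>)"
      proof (cases "x \<in> B \<and> y \<in> B")
        case True
        then have N: "x \<in> N" "y \<in> N" using BD DN by auto
        have "h x = v x - l x" "h y = v y - l y"
          using True N vb[of x] vb[of y] l_in[of x] l_in[of y] by (auto simp: h_def)
        then have "h x - h y = V y - V x" "(v x - l x) - (v y - l y) = V y - V x"
          using True l_in[of x] l_in[of y] by (auto simp: v_def)
        then show ?thesis using True N
          unfolding z fst_conv snd_conv by (simp only:) (simp add: powr_pm1_mult abs_minus_commute)
      qed (auto simp: z)
    qed
    with main show "energy B V \<le> ennreal E0" by (rule order_trans[rotated])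
  qed
qed

text \<open>The claim is local: each test function lives in some \<open>B\<close>, on which the
  approximations from below have uniformly bounded energies. Fatou's lemma gives \<open>f\<close>
  finite energy there, and \<open>limit_integral_nonneg\<close> passes the tested inequality to the
  limit.\<close>

lemma superharmonic_supersolution:
  assumes KK: "AE z in lborel. K (fst z) (snd z) = k z" and S: "open S" and u: "superharmonic s p K S u"
    and f [measurable]: "f \<in> borel_measurable borel" and eq: "AE x in lborel. u x = ereal (f x)" "\<And>x. x \<in> S \<Longrightarrow> u x = ereal (f x)"
    and tail: "tail_finite f" and cont: "continuous_on S f"
  shows "weak_supersolution s p K S u"
proof -
  have key: "energy B f < \<infinity> \<and> (\<forall>\<eta>\<in>test_functions B. (\<forall>x. 0 \<le> \<eta> x) \<longrightarrow> 0 \<le> (\<integral>z. form f \<eta> z \<partial>\<nu>))"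
    if B: "open B" "B \<Subset> S" for B
  proof -
    have Bc: "compact (closure B)" "closure B \<subseteq> S" using B by (auto simp: compactly_contained_def)
    obtain D N where D: "open D" "closure B \<subseteq> D" "D \<Subset> N" "open N" "N \<Subset> S"
      "\<And>z. z \<in> frontier D \<Longrightarrow> \<exists>e r. 0 < r \<and> norm (z - e) = r \<and> ball e r \<inter> D = {}"
      using exterior_ball_domain[OF Bc(1) S Bc(2)] by metis
    have BD: "B \<Subset> D" using D(2) Bc by (auto simp: compactly_contained_def)
    have BN: "B \<subseteq> D" "D \<subseteq> N" using compactly_contained_subset BD D(3) by auto
    have Bbd: "bounded B" by (rule compactly_contained_bounded[OF BD])
    have Nbd: "bounded N" by (rule compactly_contained_bounded[OF D(5)])
    have [measurable]: "B \<in> sets borel" using B by auto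
    obtain b0 where b0: "\<forall>x\<in>N. \<bar>f x\<bar> \<le> b0" using continuous_bounded_compactly_contained[OF cont D(5)] by blast
    define b where "b = max 0 b0"
    have b: "0 \<le> b" "\<And>x. x \<in> N \<Longrightarrow> \<bar>f x\<bar> \<le> b" using b0 by (auto simp: b_def max_def)
    \<comment> \<open>The index \<open>j\<close> governs both the accuracy
      \<open>1 / real (Suc j)\<close> on \<open>N\<close> and the cut-off level
      \<open>b + 2 + real j\<close> outside, so the approximations converge at every point.\<close>
    define good where "good j V \<longleftrightarrow> V \<in> borel_measurable borel \<and> (\<forall>x. V x \<le> f x) \<and> (\<forall>x\<in>N. f x - 2 * (1 / real (Suc j)) \<le> V x) \<and>
      (\<forall>x. x \<notin> N \<longrightarrow> V x = min (f x) (b + 2 + real j)) \<and> energy N V < \<infinity> \<and> supersolution_tested D N V" for j V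
    have "\<exists>V. good j V" for j
    proof -
      have \<delta>: "0 < 1 / real (Suc j)" "1 / real (Suc j) \<le> 1" by auto
      obtain V where "V \<in> borel_measurable borel" "\<And>x. V x \<le> f x" "\<And>x. x \<in> N \<Longrightarrow> f x - 2 * (1 / real (Suc j)) \<le> V x"
        "\<And>x. x \<notin> N \<Longrightarrow> V x = min (f x) (b + 2 + real j)" "energy N V < \<infinity>" "supersolution_tested D N V"
        using superharmonic_approximation[OF KK u f eq tail cont D(1,3,4,5,6) b \<delta> of_nat_0_le_iff[of j]] by blast
      then show ?thesis unfolding good_def by blast
    qed
    then obtain V where good: "\<And>j. good j (V j)" by metis
    then have V: "\<And>j. V j \<in> borel_measurable borel" "\<And>j x. V j x \<le> f x" "\<And>j x. x \<in> N \<Longrightarrow> f x - 2 * (1 / real (Suc j)) \<le> V j x"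
        "\<And>j x. x \<notin> N \<Longrightarrow> V j x = min (f x) (b + 2 + real j)" "\<And>j. energy N (V j) < \<infinity>"
      and test: "\<And>j. supersolution_tested D N (V j)"
      unfolding good_def by blast+
    note [measurable] = V(1)
    have Vb: "\<bar>V j x\<bar> \<le> b + 2" if x: "x \<in> N" for j x
    proof -
      have "1 / real (Suc j) \<le> 1" by simp
      then show ?thesis using V(2)[of j x] V(3)[OF x, of j] b(2)[OF x] b(1) unfolding abs_le_iff by linarith
    qed
    have Vf: "\<bar>V j x\<bar> \<le> \<bar>f x\<bar>" if x: "x \<notin> N" for j x using V(4)[OF x, of j] b(1) by (auto simp: min_def abs_le_iff)
    have Vlim: "(\<lambda>j. V j x) \<longlonglongrightarrow> f x" for x
    proof (cases "x \<in> N")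
      case True
      have l: "(\<lambda>j. f x - 2 * (1 / real (Suc j))) \<longlonglongrightarrow> f x - 2 * 0"
        using LIMSEQ_inverse_real_of_nat by (intro tendsto_intros) (simp add: inverse_eq_divide)
      show ?thesis
        by (rule tendsto_sandwich[OF _ _ l[simplified] tendsto_const]) (use V(2) V(3)[OF True] in auto)
    next
      case False
      obtain j0 where j0: "f x < real j0" using reals_Archimedean2 by blast
      have "\<forall>\<^sub>F j in sequentially. V j x = f x"
        unfolding eventually_sequentially
      proof (intro exI[of _ j0] allI impI)
        fix j assume "j0 \<le> j"
        then have "f x < b + 2 + real j" using j0 b(1) by linarith
        then show "V j x = f x" using V(4)[OF False, of j] by simp
      qed
      then show ?thesis by (rule tendsto_eventually)
    qed
    obtain E0 where E0: "0 \<le> E0" "\<And>V. \<lbrakk>V \<in> borel_measurable borel; \<And>x. x \<in> N \<Longrightarrow> \<bar>V x\<bar> \<le> b + 2; \<And>x. x \<notin> N \<Longrightarrow> \<bar>V x\<bar> \<le> \<bar>f x\<bar>;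
      supersolution_tested D N V\<rbrakk> \<Longrightarrow> energy B V \<le> ennreal E0"
      using local_energy_bound[OF f tail D(1,3,4) Nbd BD, of "b + 2"] by blast
    have enV: "energy B (V j) \<le> ennreal E0" for j by (rule E0(2)[OF V(1) Vb Vf test])
    have enf: "energy B f < \<infinity>"
    proof -
      have "energy B f = (\<integral>\<^sup>+z. liminf (\<lambda>j. indicator (B \<times> B) z * ennreal (\<bar>V j (fst z) - V j (snd z)\<bar> powr p)) \<partial>\<nu>)"
        unfolding energy_def
      proof (intro nn_integral_cong)
        fix z
        have "(\<lambda>j. ennreal (\<bar>V j (fst z) - V j (snd z)\<bar> powr p)) \<longlonglongrightarrow> ennreal (\<bar>f (fst z) - f (snd z)\<bar> powr p)"
          using p by (intro tendsto_ennrealI tendsto_powr' tendsto_intros Vlim) auto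
        then have "(\<lambda>j. indicator (B \<times> B) z * ennreal (\<bar>V j (fst z) - V j (snd z)\<bar> powr p))
          \<longlonglongrightarrow> indicator (B \<times> B) z * ennreal (\<bar>f (fst z) - f (snd z)\<bar> powr p)"
          by (cases "z \<in> B \<times> B") auto
        then show "indicator (B \<times> B) z * ennreal (\<bar>f (fst z) - f (snd z)\<bar> powr p)
          = liminf (\<lambda>j. indicator (B \<times> B) z * ennreal (\<bar>V j (fst z) - V j (snd z)\<bar> powr p))"
          by (intro lim_imp_Liminf[symmetric]) auto
      qed
      also have "\<dots> \<le> liminf (\<lambda>j. energy B (V j))"
        unfolding energy_def by (rule nn_integral_liminf) (simp add: borel_measurable_\<nu>)
      also have "\<dots> \<le> liminf (\<lambda>j::nat. ennreal E0)" by (intro Liminf_mono always_eventually allI enV)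
      also have "\<dots> < \<infinity>" by (simp add: Liminf_const)
      finally show ?thesis .
    qed
    have "0 \<le> (\<integral>z. form f \<eta> z \<partial>\<nu>)" if \<eta>: "\<eta> \<in> test_functions B" and \<eta>n: "\<And>x. 0 \<le> \<eta> x" for \<eta>
    proof -
      obtain C c L where C: "compact C" "C \<subseteq> B" "\<And>x. x \<notin> C \<Longrightarrow> \<eta> x = 0" and c: "\<And>x. \<bar>\<eta> x\<bar> \<le> c" and L: "0 \<le> L"
        "\<And>x y. \<bar>\<eta> x - \<eta> y\<bar> \<le> L * norm (x - y)" and \<eta>m [measurable]: "\<eta> \<in> borel_measurable borel"
        using test_function_facts[OF \<eta>] by blast
      have c0: "0 \<le> c" using c[of undefined] by linarith
      have sep: "separated C B"
        by (rule separatedI) (use B Bbd C in \<open>auto simp: compact_imp_closed closure_closed borel_compact\<close>)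
      have en\<eta>: "energy B \<eta> < \<infinity>" by (rule energy_lipschitz[OF _ Bbd L]) auto
      \<comment> \<open>One tail majorant for all \<open>V j\<close>, which makes the far part of
        the dominating function independent of \<open>j\<close>.\<close>
      define F0 where "F0 y = \<bar>f y\<bar> + (b + 2)" for y
      have [measurable]: "F0 \<in> borel_measurable borel" unfolding F0_def by measurable
      have F0: "tail_finite F0" by (rule tail_finite_bound[OF f tail, of _ "b + 2"]) (use b in \<open>auto simp: F0_def\<close>)
      have VF: "\<bar>V j y\<bar> \<le> \<bar>F0 y\<bar>" for j y using Vb[of y j] Vf[of y j] b(1) by (cases "y \<in> N") (auto simp: F0_def)
      have far_le: "far C B (b + 2) (V j) z \<le> far C B (b + 2) F0 z" for j z
        unfolding far_def using p VF b(1) by (intro add_mono mult_left_mono powr_mono2) auto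
      define Bj where "Bj j z = indicator (B \<times> B) z * \<bar>V j (fst z) - V j (snd z)\<bar> powr p" for j z
      \<comment> \<open>In contrast to mollification, here the test function is fixed and the
        bounded energies are those of \<open>V j\<close>; so Young's small weight goes to the factor
        with exponent \<open>p - 1\<close>, and the large one to the energy of
        \<open>\<eta>\<close>.\<close>
      define G where "G \<epsilon> z = \<epsilon> powr (1 - p) * (indicator (B \<times> B) z * \<bar>\<eta> (fst z) - \<eta> (snd z)\<bar> powr p)
         + 2 powr (p - 1) * c * far C B (b + 2) F0 z" for \<epsilon> z
      have tj: "integrable \<nu> (form (V j) \<eta>) \<and> 0 \<le> (\<integral>z. form (V j) \<eta> z \<partial>\<nu>)" for j
      proof (rule test[unfolded supersolution_tested_def, rule_format, OF \<eta>m _ c \<eta>n L(1)])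
        show "\<eta> x = 0" if "x \<notin> D" for x using that C BN by blast
        show "\<bar>\<eta> x - \<eta> y\<bar> \<le> \<bar>V j x - V j y\<bar> + L * norm (x - y)" for x y using L(2)[of x y] by simp
      qed
      have Bint: "integrable \<nu> (Bj j)" for j
        unfolding Bj_def using enV[of j] by (intro near_integrable) (auto intro: le_less_trans)
      have intf: "integrable \<nu> (form f \<eta>)"
        by (rule form_integrable[OF sep f \<eta>m tail C(3) c _ enf en\<eta>, of b]) (use b BN in auto)
      show ?thesis
      proof (rule limit_integral_nonneg[where F = "\<lambda>j. form (V j) \<eta>" and B = Bj and W = E0 and G = G])
        show "AE z in \<nu>. (\<lambda>j. form (V j) \<eta> z) \<longlonglongrightarrow> form f \<eta> z"
        proof (intro AE_I2)
          fix z
          have "isCont (phi p) t" for t using continuous_phi[OF p] by (simp add: continuous_on_eq_continuous_at)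
          then have "(\<lambda>j. phi p (V j (fst z) - V j (snd z))) \<longlonglongrightarrow> phi p (f (fst z) - f (snd z))"
            by (intro isCont_tendsto_compose[of _ "phi p"] tendsto_intros Vlim)
          then show "(\<lambda>j. form (V j) \<eta> z) \<longlonglongrightarrow> form f \<eta> z" unfolding form_def by (intro tendsto_intros)
        qed
        show "(\<integral>z. Bj j z \<partial>\<nu>) \<le> E0" for j
        proof -
          have "ennreal (\<integral>z. Bj j z \<partial>\<nu>) = (\<integral>\<^sup>+z. ennreal (Bj j z) \<partial>\<nu>)"
            by (intro nn_integral_eq_integral[symmetric] Bint) (simp add: Bj_def)
          also have "\<dots> = energy B (V j)"
            unfolding energy_def Bj_def by (intro nn_integral_cong) (auto simp: indicator_def)
          also have "\<dots> \<le> ennreal E0" by (rule enV)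
          finally show ?thesis using E0(1) by simp
        qed
        show "integrable \<nu> (G \<epsilon>)" for \<epsilon>
          unfolding G_def by (intro Bochner_Integration.integrable_add integrable_mult_right near_integrable
              far_integrable sep F0 en\<eta>) auto
        fix \<epsilon> :: real and j assume \<epsilon>: "0 < \<epsilon>"
        show "AE z in \<nu>. form (V j) \<eta> z \<le> G \<epsilon> z + \<epsilon> * Bj j z"
        proof (intro AE_I2)
          fix z
          have "\<bar>form (V j) \<eta> z\<bar> \<le> indicator (B \<times> B) z * (\<bar>V j (fst z) - V j (snd z)\<bar> powr (p - 1) * \<bar>\<eta> (fst z) - \<eta> (snd z)\<bar>)
            + 2 powr (p - 1) * c * far C B (b + 2) (V j) z"
            by (rule form_le_far[OF C(2,3) c]) (use Vb BN in auto)
          moreover have "2 powr (p - 1) * c * far C B (b + 2) (V j) z \<le> 2 powr (p - 1) * c * far C B (b + 2) F0 z"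
            using c0 by (intro mult_left_mono far_le) auto
          moreover have "\<bar>V j (fst z) - V j (snd z)\<bar> powr (p - 1) * \<bar>\<eta> (fst z) - \<eta> (snd z)\<bar>
             \<le> \<epsilon> * \<bar>V j (fst z) - V j (snd z)\<bar> powr p + \<epsilon> powr (1 - p) * \<bar>\<eta> (fst z) - \<eta> (snd z)\<bar> powr p"
            using \<epsilon> p by (intro young_powr) auto
          then have "indicator (B \<times> B) z * (\<bar>V j (fst z) - V j (snd z)\<bar> powr (p - 1) * \<bar>\<eta> (fst z) - \<eta> (snd z)\<bar>)
             \<le> indicator (B \<times> B) z * (\<epsilon> * \<bar>V j (fst z) - V j (snd z)\<bar> powr p + \<epsilon> powr (1 - p) * \<bar>\<eta> (fst z) - \<eta> (snd z)\<bar> powr p)"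
            by (intro mult_left_mono) auto
          moreover have "\<dots> = \<epsilon> * Bj j z + \<epsilon> powr (1 - p) * (indicator (B \<times> B) z * \<bar>\<eta> (fst z) - \<eta> (snd z)\<bar> powr p)"
            by (simp add: Bj_def algebra_simps)
          ultimately show "form (V j) \<eta> z \<le> G \<epsilon> z + \<epsilon> * Bj j z" unfolding G_def by linarith
        qed
      qed (use tj Bint intf in \<open>auto simp: Bj_def\<close>)
    qed
    then show ?thesis using enf by blast
  qed
  show ?thesis
  proof (rule weak_supersolution_iff[OF KK _ f eq(1) tail S, THEN iffD2])
    show "u \<in> borel_measurable lebesgue" using u by (simp add: superharmonic_def)
    show "\<exists>b. \<forall>x\<in>D. \<bar>f x\<bar> \<le> b" if "D \<Subset> S" for D by (rule continuous_bounded_compactly_contained[OF cont that])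
    show "(\<forall>D. open D \<longrightarrow> D \<Subset> S \<longrightarrow> energy D f < \<infinity>) \<and>
     (\<forall>\<eta>\<in>test_functions S. (\<forall>x. 0 \<le> \<eta> x) \<longrightarrow> 0 \<le> (\<integral>z. form f \<eta> z \<partial>\<nu>))"
    proof (intro conjI allI impI ballI)
      show "energy D f < \<infinity>" if "open D" "D \<Subset> S" for D using key[OF that] by blast
      fix \<eta> assume \<eta>: "\<eta> \<in> test_functions S" and n: "\<forall>x. 0 \<le> \<eta> x"
      have sup: "{x. \<eta> x \<noteq> 0} \<Subset> S" using \<eta> by (simp add: test_functions_def)
      obtain B where B: "open B" "closure {x. \<eta> x \<noteq> 0} \<subseteq> B" "B \<Subset> S"
        using open_between[of "closure {x. \<eta> x \<noteq> 0}" S] S sup by (auto simp: compactly_contained_def)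
      have "\<eta> \<in> test_functions B" using \<eta> B(2) by (auto simp: test_functions_def compactly_contained_def)
      then show "0 \<le> (\<integral>z. form f \<eta> z \<partial>\<nu>)" using key[OF B(1,3)] n by blast
    qed
  qed
qed

lemma harmonic_iff_continuous_weak_solution:
  assumes KK: "AE z in lborel. K (fst z) (snd z) = k z" and S: "open S"
  shows "harmonic s p K S u \<longleftrightarrow> continuous_weak_solution s p K S u"
proof
  assume "continuous_weak_solution s p K S u"
  then show "harmonic s p K S u"
    unfolding harmonic_def
    by (intro conjI continuous_weak_solution_superharmonic[OF KK S] continuous_weak_solution_minus)
next
  assume h: "harmonic s p K S u"
  then have u: "superharmonic s p K S u" "superharmonic s p K S (\<lambda>x. - u x)" by (auto simp: harmonic_def)
  have um: "u \<in> borel_measurable lebesgue" and t: "neg_part u \<in> tail_space s p" "neg_part (\<lambda>x. - u x) \<in> tail_space s p"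
    and l: "lower_semicontinuous_on S u" "lower_semicontinuous_on S (\<lambda>x. - u x)"
    and fin: "\<forall>x\<in>S. - \<infinity> < u x" "\<forall>x\<in>S. - \<infinity> < - u x"
    using u by (simp_all add: superharmonic_def)
  \<comment> \<open>Both \<open>u\<close> and \<open>- u\<close> are lower semicontinuous and never
    \<open>- \<infinity>\<close> in \<open>S\<close>, so continuity and finiteness of
    \<open>u\<close> are immediate; the work lies in the weak inequality alone.\<close>
  have c: "finite_continuous_on S u"
    unfolding finite_continuous_on_def
  proof (intro conjI ballI)
    show "continuous_on S u" by (rule lower_semicontinuous_on_both[OF S l])
    show "\<bar>u x\<bar> \<noteq> \<infinity>" if "x \<in> S" for x using fin that by (cases "u x") auto
  qed
  obtain f where f: "f \<in> borel_measurable borel" "AE x in lborel. u x = ereal (f x)" "\<And>x. x \<in> S \<Longrightarrow> u x = ereal (f x)"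
    "tail_finite f" "continuous_on S f"
    using real_representative[OF um t S c] by blast
  have 1: "weak_supersolution s p K S u"
    by (rule superharmonic_supersolution[OF KK S u(1) f])
  have 2: "weak_supersolution s p K S (\<lambda>x. - u x)"
  proof (rule superharmonic_supersolution[OF KK S u(2), where f = "\<lambda>x. - f x"])
    show "AE x in lborel. - u x = ereal (- f x)" using f(2) by eventually_elim simp
    show "tail_finite (\<lambda>x. - f x)" using f(4) by (simp add: tail_finite_def)
  qed (use f in \<open>auto intro: continuous_intros\<close>)
  show "continuous_weak_solution s p K S u"
    unfolding continuous_weak_solution_def weak_solution_def weak_subsolution_def using 1 2 c by simp
qed

end

theorem corollary7:
  fixes K :: "'a::euclidean_space \<Rightarrow> 'a \<Rightarrow> real"
    and s p \<Lambda> :: real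
    and \<Omega> :: "'a set"
    and u :: "'a \<Rightarrow> ereal"
  assumes "0 < s" "s < 1" "1 < p" "1 \<le> \<Lambda>"
    and "admissible_kernel s p \<Lambda> K"
    and "open \<Omega>"
  shows "harmonic s p K \<Omega> u \<longleftrightarrow> continuous_weak_solution s p K \<Omega> u"
proof -
  obtain k where k: "nonlocal_kernel s p \<Lambda> k" "AE z in lborel. K (fst z) (snd z) = k z"
    using borel_kernel[OF assms(1-5)] by blast
  show ?thesis
    by (rule nonlocal_kernel.harmonic_iff_continuous_weak_solution[OF k assms(6)])
qed

end
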